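(* Let $P_1,P_2,Q_1,Q_2$ be real polynomials in one variable without constant terms such that the coefficients of all of them together are algebraically independent over $\mathbb Q$, and put $A_i:=(P_i,Q_i):[0,1]\to\mathbb R^2$, $i=1,2$. Let $$S:=\{m\,A_1(1)+n\,A_2(1)\in\mathbb R^2 : (m,n)\in\mathbb Z^2\}.$$ For each pair $v_1,v_2\in S$ with $v_2-v_1=A_1(1)$ let $X_{v_1,v_2}:=\{v_1+A_1(t):t\in[0,1]\}$, and for each pair $w_1,w_2\in S$ with $w_2-w_1=A_2(1)$ let $Y_{w_1,w_2}:=\{w_1+A_2(t):t\in[0,1]\}$. Let $\mathcal L\subset\mathbb R^2$ be the union of all the curves $X_{v_1,v_2}$ and $Y_{w_1,w_2}$ (called the edges of $\mathcal L$). Assume that the maps $A_1,A_2:[0,1]\to\mathbb R^2$ are embeddings and that any two distinct edges of $\mathcal L$ are either disjoint or intersect only in a single point which is one of their endpoints (a point of $S$). Then each connected curve $\Gamma\subset\mathcal L$ that contains the origin and is composed of finitely many edges of $\mathcal L$ is universal.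
   Context: Fix $T>0$. A compact set $\Gamma\subset\mathbb R^2$ is a Lipschitz triangulable curve if there exist a finite subset $F\subset\Gamma$ and Lipschitz and locally bi-Lipschitz arcs $h_1,\dots,h_k:(0,1)\to\mathbb R^2$ such that $\Gamma\setminus F$ is the disjoint union of the sets $h_i((0,1))$, $1\le i\le k$. For real bounded Lebesgue measurable functions $a_1,a_2$ on $[0,T]$ consider the Abel equation $\frac{dv}{dt}=a_1v^2+a_2v^3$ on $[0,T]$ (solutions are absolutely continuous functions satisfying the equation almost everywhere), and the Lipschitz path $\tilde A:[0,T]\to\mathbb R^2$, $\tilde A(t)=\bigl(\int_0^t a_1(s)\,ds,\int_0^t a_2(s)\,ds\bigr)$, with image $\Gamma_{\tilde A}$. The equation has a center on $[0,T]$ if for all sufficiently small initial values $v_0$ the solution with $v(0)=v_0$ satisfies $v(T)=v_0$. The center is universal if all iterated integrals $I_{i_1,\dots,i_k}(a)=\int\cdots\int_{0\le s_1\le\cdots\le s_k\le T}a_{i_k}(s_k)\cdots a_{i_1}(s_1)\,ds_k\cdots ds_1$ ($k\ge1$, $i_1,\dots,i_k\in\{1,2\}$) vanish. A connected Lipschitz triangulable curve $\Gamma\subset\mathbb R^2$ containing the origin is universal if, whenever an Abel equation $\frac{dv}{dt}=a_1v^2+a_2v^3$ on $[0,T]$ with real bounded Lebesgue measurable coefficients $a_1,a_2$ and with $\Gamma_{\tilde A}\subset\Gamma$ has a center on $[0,T]$, this center is universal. *)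

theory Defs
  imports "HOL-Analysis.Analysis" "HOL-Computational_Algebra.Polynomial" "HOL-Library.Poly_Mapping"
begin

section \<open>Lipschitz triangulable curves\<close>

text \<open>An open arc is a topological embedding of the open interval; local bi-Lipschitz
  continuity refers to neighbourhoods in the parameter interval.\<close>

definition locally_bilipschitz_on :: "real set \<Rightarrow> (real \<Rightarrow> real \<times> real) \<Rightarrow> bool" where
  "locally_bilipschitz_on U h \<longleftrightarrow>
     (\<forall>t\<in>U. \<exists>\<epsilon>>0. \<exists>c>0. \<exists>C>0. \<forall>x\<in>U \<inter> ball t \<epsilon>. \<forall>y\<in>U \<inter> ball t \<epsilon>.
        c * dist x y \<le> dist (h x) (h y) \<and> dist (h x) (h y) \<le> C * dist x y)"

definition lipschitz_open_arc :: "(real \<Rightarrow> real \<times> real) \<Rightarrow> bool" where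
  "lipschitz_open_arc h \<longleftrightarrow>
     embedding_map (top_of_set {0<..<1}) euclidean h \<and>
     (\<exists>L. L-lipschitz_on {0<..<1} h) \<and>
     locally_bilipschitz_on {0<..<1} h"

definition lipschitz_triangulable :: "(real \<times> real) set \<Rightarrow> bool" where
  "lipschitz_triangulable \<Gamma> \<longleftrightarrow>
     compact \<Gamma> \<and>
     (\<exists>F (k::nat) h. finite F \<and> F \<subseteq> \<Gamma> \<and> 1 \<le> k \<and>
        (\<forall>i\<in>{1..k}. lipschitz_open_arc (h i)) \<and>
        disjoint_family_on (\<lambda>i. h i ` {0<..<1}) {1..k} \<and>
        \<Gamma> - F = (\<Union>i\<in>{1..k}. h i ` {0<..<1}))"


section \<open>Abel equations and centers\<close>

text \<open>The coefficients are a family \<open>a\<close> of which only \<open>a 1\<close> and \<open>a 2\<close> are used.\<close>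

definition bounded_lebesgue_measurable_on :: "real set \<Rightarrow> (real \<Rightarrow> real) \<Rightarrow> bool" where
  "bounded_lebesgue_measurable_on S f \<longleftrightarrow>
     f \<in> borel_measurable (lebesgue_on S) \<and> bounded (f ` S)"

text \<open>Absolute continuity of functions; the library constant
  \<open>absolutely_continuous\<close> is about measures.\<close>

definition absolutely_continuous_fun_on :: "real \<Rightarrow> real \<Rightarrow> (real \<Rightarrow> real) \<Rightarrow> bool" where
  "absolutely_continuous_fun_on a b f \<longleftrightarrow>
     (\<forall>\<epsilon>>0. \<exists>\<delta>>0. \<forall>I :: (real \<times> real) set.
        finite I \<longrightarrow> (\<forall>(x, y)\<in>I. a \<le> x \<and> x \<le> y \<and> y \<le> b) \<longrightarrow>
        disjoint_family_on (\<lambda>(x, y). {x<..<y}) I \<longrightarrow>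
        (\<Sum>(x, y)\<in>I. y - x) < \<delta> \<longrightarrow> (\<Sum>(x, y)\<in>I. \<bar>f y - f x\<bar>) < \<epsilon>)"

definition abel_solution :: "real \<Rightarrow> (nat \<Rightarrow> real \<Rightarrow> real) \<Rightarrow> (real \<Rightarrow> real) \<Rightarrow> bool" where
  "abel_solution T a v \<longleftrightarrow>
     absolutely_continuous_fun_on 0 T v \<and>
     (AE t in lebesgue_on {0..T}.
        (v has_real_derivative a 1 t * v t ^ 2 + a 2 t * v t ^ 3) (at t within {0..T}))"

text \<open>Existence of the solution on the whole of \<open>[0,T]\<close> for small initial values is part of
  speaking of ``the solution''.\<close>

definition has_center :: "real \<Rightarrow> (nat \<Rightarrow> real \<Rightarrow> real) \<Rightarrow> bool" where
  "has_center T a \<longleftrightarrow>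
     (\<exists>\<epsilon>>0. \<forall>v0. \<bar>v0\<bar> < \<epsilon> \<longrightarrow>
        (\<exists>v. abel_solution T a v \<and> v 0 = v0) \<and>
        (\<forall>v. abel_solution T a v \<and> v 0 = v0 \<longrightarrow> v T = v0))"

definition abel_path :: "(nat \<Rightarrow> real \<Rightarrow> real) \<Rightarrow> real \<Rightarrow> real \<times> real" where
  "abel_path a t = (LINT s|lebesgue_on {0..t}. a 1 s, LINT s|lebesgue_on {0..t}. a 2 s)"

text \<open>\<open>iterated_integral T a s [i\<^sub>1, \<dots>, i\<^sub>k]\<close> is the integral of
  \<open>a i\<^sub>k s\<^sub>k \<cdots> a i\<^sub>1 s\<^sub>1\<close> over \<open>s \<le> s\<^sub>1 \<le> \<cdots> \<le> s\<^sub>k \<le> T\<close>,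
  with \<open>s\<^sub>k\<close> as the innermost and \<open>s\<^sub>1\<close> as the outermost variable.\<close>

primrec iterated_integral ::
    "real \<Rightarrow> (nat \<Rightarrow> real \<Rightarrow> real) \<Rightarrow> real \<Rightarrow> nat list \<Rightarrow> real" where
  "iterated_integral T a s [] = 1"
| "iterated_integral T a s (i # is) =
     (LINT u|lebesgue_on {s..T}. iterated_integral T a u is * a i u)"

definition all_iterated_integrals_vanish :: "real \<Rightarrow> (nat \<Rightarrow> real \<Rightarrow> real) \<Rightarrow> bool" where
  "all_iterated_integrals_vanish T a \<longleftrightarrow>
     (\<forall>is. is \<noteq> [] \<and> set is \<subseteq> {1, 2} \<longrightarrow> iterated_integral T a 0 is = 0)"

definition universal_curve :: "real \<Rightarrow> (real \<times> real) set \<Rightarrow> bool" where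
  "universal_curve T \<Gamma> \<longleftrightarrow>
     lipschitz_triangulable \<Gamma> \<and> connected \<Gamma> \<and> (0, 0) \<in> \<Gamma> \<and>
     (\<forall>a. bounded_lebesgue_measurable_on {0..T} (a 1) \<longrightarrow>
          bounded_lebesgue_measurable_on {0..T} (a 2) \<longrightarrow>
          abel_path a ` {0..T} \<subseteq> \<Gamma> \<longrightarrow>
          has_center T a \<longrightarrow> all_iterated_integrals_vanish T a)"


section \<open>Algebraic independence over the rationals\<close>

text \<open>\<open>('i \<Rightarrow>\<^sub>0 nat) \<Rightarrow>\<^sub>0 rat\<close> is the type of polynomials over the rationals in indeterminates
  indexed by \<open>'i\<close>: finitely many monomials with their coefficients.\<close>

definition eval_rat_mpoly :: "(('i \<Rightarrow>\<^sub>0 nat) \<Rightarrow>\<^sub>0 rat) \<Rightarrow> ('i \<Rightarrow> real) \<Rightarrow> real" where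
  "eval_rat_mpoly p x =
     (\<Sum>m\<in>Poly_Mapping.keys p. of_rat (Poly_Mapping.lookup p m) *
        (\<Prod>i\<in>Poly_Mapping.keys m. x i ^ Poly_Mapping.lookup m i))"

definition algebraically_independent_rat :: "'i set \<Rightarrow> ('i \<Rightarrow> real) \<Rightarrow> bool" where
  "algebraically_independent_rat I x \<longleftrightarrow>
     (\<forall>p :: ('i \<Rightarrow>\<^sub>0 nat) \<Rightarrow>\<^sub>0 rat.
        (\<forall>m\<in>Poly_Mapping.keys p. Poly_Mapping.keys m \<subseteq> I) \<longrightarrow>
        eval_rat_mpoly p x = 0 \<longrightarrow> p = 0)"

text \<open>For polynomials without constant terms the relevant coefficients are those of
  \<open>t\<^sup>k\<close> with \<open>1 \<le> k \<le> degree\<close>; they are indexed by the position of the polynomial in the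
  list and by \<open>k\<close>. In particular intermediate coefficients cannot vanish, while the zero
  polynomial contributes no coefficient.\<close>

definition generic_coefficients :: "real poly list \<Rightarrow> bool" where
  "generic_coefficients ps \<longleftrightarrow>
     algebraically_independent_rat
       {(j, k). j < length ps \<and> 1 \<le> k \<and> k \<le> degree (ps ! j)}
       (\<lambda>(j, k). coeff (ps ! j) k)"


section \<open>The lattice spanned by two curves\<close>

definition poly_curve :: "real poly \<Rightarrow> real poly \<Rightarrow> real \<Rightarrow> real \<times> real" where
  "poly_curve P Q t = (poly P t, poly Q t)"

definition lattice_points ::
    "(real \<Rightarrow> real \<times> real) \<Rightarrow> (real \<Rightarrow> real \<times> real) \<Rightarrow> (real \<times> real) set" where
  "lattice_points A B = {of_int m *\<^sub>R A 1 + of_int n *\<^sub>R B 1 | m n :: int. True}"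

definition is_edge ::
    "(real \<Rightarrow> real \<times> real) \<Rightarrow> (real \<Rightarrow> real \<times> real) \<Rightarrow>
     (real \<times> real) set \<Rightarrow> real \<times> real \<Rightarrow> real \<times> real \<Rightarrow> bool" where
  "is_edge A B E v w \<longleftrightarrow>
     v \<in> lattice_points A B \<and> w \<in> lattice_points A B \<and>
     (w - v = A 1 \<and> E = {v + A t | t. t \<in> {0..1}} \<or>
      w - v = B 1 \<and> E = {v + B t | t. t \<in> {0..1}})"

definition edges ::
    "(real \<Rightarrow> real \<times> real) \<Rightarrow> (real \<Rightarrow> real \<times> real) \<Rightarrow> (real \<times> real) set set" where
  "edges A B = {E. \<exists>v w. is_edge A B E v w}"

text \<open>The common point is only required to be an endpoint of at least one of the two edges;
  a common endpoint is a special case.\<close>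

definition edges_meet_in_endpoints ::
    "(real \<Rightarrow> real \<times> real) \<Rightarrow> (real \<Rightarrow> real \<times> real) \<Rightarrow> bool" where
  "edges_meet_in_endpoints A B \<longleftrightarrow>
     (\<forall>E v w E' v' w'. is_edge A B E v w \<longrightarrow> is_edge A B E' v' w' \<longrightarrow> E \<noteq> E' \<longrightarrow>
        E \<inter> E' = {} \<or> (\<exists>p. E \<inter> E' = {p} \<and> p \<in> {v, w} \<union> {v', w'}))"

end

theory Submission
  imports Defs "HOL-Complex_Analysis.Complex_Analysis"
begin

text \<open>In the lattice graph a closed Lipschitz path with a center has as its signature (the series of
  its iterated integrals) a word in the signatures of the two edges \<open>A\<^sub>1\<close>, \<open>A\<^sub>2\<close> and their inverses.
  Comparing coefficients of the first return map, the center condition says that the vector fields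
  \<open>v\<^sup>2 d/dv\<close> and \<open>v\<^sup>3 d/dv\<close>, substituted for the letters, turn this word into the identity. Each such
  identity is a polynomial relation with rational coefficients between the coefficients of the
  edges; these being algebraically independent, it persists when the edges are replaced by a
  horizontal segment of length \<open>s\<close> and a vertical segment of length \<open>t\<close>. In the coordinate
  \<open>x = 1/v\<close> the latter have the return maps \<open>x \<mapsto> x - s\<close> and \<open>x \<mapsto> sqrt (x\<^sup>2 - 2t)\<close>, which for variable
  \<open>s, t\<close> satisfy no nontrivial relation. Hence the word is trivial in the free group on the two
  edges, so the signature is \<open>1\<close> and all iterated integrals vanish.\<close>

section \<open>Compositions of translations and square-root flows\<close>

text \<open>Two obstacles shape the development. A Lipschitz path may be at vertices for infinitely
  many times, even on a Cantor set of positive measure, so it need not be a finite concatenation of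
  edges. Only finitely many moves between different vertices occur; between visits of the same
  vertex an iterated integral changes at most quadratically in time, apart from excursions that
  contribute nothing, and quadratic increments sum to 0. The second obstacle is the freeness of
  translations and square roots, which is a matter of monodromy: an identity holds near infinity, is
  continued along a thin vertical strip across the real axis, and comes back as an identity with
  some of the translations reflected. Algebraic independence enters twice. Besides transferring
  relations to straight edges it supplies the geometry: edges without critical points, no vertex
  inside an edge, no common axis. Each time a coincidence would allow more coefficients to be solved
  for than new numbers are introduced. Products of series act like products of differential
  operators, so the return maps compose in reverse order.\<close>

text \<open>The branch of \<open>sqrt (u\<^sup>2 - t)\<close> close to \<open>u\<close>, meaningful for \<open>\<bar>t\<bar> < \<bar>u\<bar>\<^sup>2\<close>.\<close>

definition near_sqrt :: "complex \<Rightarrow> complex \<Rightarrow> complex" where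
  "near_sqrt u t = u * csqrt (1 - t / u\<^sup>2)"

lemma near_sqrt_squared: "u \<noteq> 0 \<Longrightarrow> (near_sqrt u t)\<^sup>2 = u\<^sup>2 - t"
  by (simp add: near_sqrt_def power_mult_distrib field_simps)

lemma near_sqrt_minus: "near_sqrt (- u) t = - near_sqrt u t"
  by (simp add: near_sqrt_def)

text \<open>With \<open>r\<close> the principal root, \<open>(r - 1) * (r + 1) = - t / u^2\<close>,
  and \<open>Re r \<ge> 0\<close> gives \<open>norm (r + 1) \<ge> 1\<close>. Every estimate of a
  root taken away from its branch points rests on this bound.\<close>

lemma norm_near_sqrt_diff:
  assumes "u \<noteq> 0"
  shows "norm (near_sqrt u t - u) \<le> norm t / norm u"
proof -
  define r where "r = csqrt (1 - t / u\<^sup>2)"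
  have "1 \<le> Re (r + 1)"
    using Re_csqrt[of "1 - t / u\<^sup>2"] by (simp add: r_def)
  also have "\<dots> \<le> norm (r + 1)"
    by (rule complex_Re_le_cmod)
  finally have r: "1 \<le> norm (r + 1)" .
  have "(r - 1) * (r + 1) = - (t / u\<^sup>2)"
    by (simp add: r_def algebra_simps flip: power2_eq_square)
  then have "norm (r - 1) * norm (r + 1) = norm t / norm u ^ 2"
    by (metis norm_divide norm_minus_cancel norm_mult norm_power)
  then have "norm (r - 1) \<le> norm t / norm u ^ 2"
    using r by (metis mult_left_mono mult.right_neutral norm_ge_zero)
  then have "norm u * norm (r - 1) \<le> norm u * (norm t / norm u ^ 2)"
    by (intro mult_left_mono) auto
  also have "\<dots> = norm t / norm u"
    using assms by (simp add: power2_eq_square)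
  finally show ?thesis
    by (simp add: near_sqrt_def r_def norm_mult[symmetric] algebra_simps)
qed

lemma holomorphic_on_near_sqrt [holomorphic_intros]:
  assumes "f holomorphic_on S" "g holomorphic_on S"
    and "\<And>z. z \<in> S \<Longrightarrow> f z \<noteq> 0 \<and> norm (g z) < norm (f z) ^ 2"
  shows "(\<lambda>z. near_sqrt (f z) (g z)) holomorphic_on S"
proof -
  have "1 - g z / (f z)\<^sup>2 \<notin> \<real>\<^sub>\<le>\<^sub>0" if "z \<in> S" for z
  proof -
    have "norm (g z / (f z)\<^sup>2) < 1"
      using assms(3)[OF that] by (simp add: norm_divide norm_power)
    then have "Re (g z / (f z)\<^sup>2) < 1"
      using complex_Re_le_cmod[of "g z / (f z)\<^sup>2"] by linarith
    then show ?thesis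
      by (auto simp: complex_nonpos_Reals_iff)
  qed
  then show ?thesis
    unfolding near_sqrt_def using assms by (intro holomorphic_intros) auto
qed

text \<open>One step is the pair of flows in the coordinate \<open>1/v\<close>: translation by
  \<open>- m j\<close>, then \<open>x\<close> to \<open>sqrt (x^2 - e * n j)\<close>. The factor
  \<open>e\<close> is a complex parameter so that identities known for small positive
  \<open>e\<close> extend to the unit disc, and in particular to \<open>- e\<close>.\<close>

primrec chain :: "(nat \<Rightarrow> real) \<Rightarrow> (nat \<Rightarrow> real) \<Rightarrow> complex \<Rightarrow> complex \<Rightarrow> nat \<Rightarrow> complex" where
  "chain m n e x 0 = x"
| "chain m n e x (Suc j) = near_sqrt (chain m n e x j - of_real (m j)) (e * of_real (n j))"

text \<open>The radius keeps all intermediate points away from the branch points of the square roots.\<close>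

definition identity_chain :: "nat \<Rightarrow> real \<Rightarrow> (nat \<Rightarrow> real) \<Rightarrow> (nat \<Rightarrow> real) \<Rightarrow> bool" where
  "identity_chain k B m n \<longleftrightarrow>
     (\<forall>e x. norm e < 1 \<longrightarrow> norm x > (2 * real k + 3) * B \<longrightarrow> chain m n e x k = x)"

text \<open>Each step costs at most \<open>2 * B\<close>: \<open>B\<close> for the translation and
  \<open>B\<close> for the root, by \<open>norm_near_sqrt_diff\<close> at a point of norm at least
  1. The extra \<open>3 * B\<close> in the radius survives all \<open>k\<close> steps.\<close>

lemma chain_bounds:
  assumes "B \<ge> 1" "\<forall>j<k. \<bar>m j\<bar> \<le> B" "\<forall>j<k. \<bar>n j\<bar> \<le> B"
    and "norm e < 1" "norm x > (2 * real k + 3) * B" "j \<le> k"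
  shows "norm (chain m n e x j) > (2 * real (k - j) + 3) * B"
  using assms(6)
proof (induction j)
  case 0
  then show ?case using assms by simp
next
  case (Suc j)
  define u where "u = chain m n e x j - of_real (m j)"
  have IH: "norm (chain m n e x j) > (2 * real (k - j) + 3) * B"
    using Suc by simp
  have kj: "real (k - j) = real (k - Suc j) + 1"
    using Suc.prems by (simp add: of_nat_diff)
  have "norm u \<ge> norm (chain m n e x j) - \<bar>m j\<bar>"
    unfolding u_def by (metis norm_of_real norm_triangle_ineq2)
  then have u: "norm u > (2 * real (k - Suc j) + 4) * B"
    using IH kj assms(2)[rule_format, of j] Suc.prems by (simp add: algebra_simps)
  have "0 \<le> real (k - Suc j) * B" using assms(1) by simp
  then have u1: "norm u \<ge> 1"
    using u assms(1) unfolding distrib_left distrib_right by linarith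
  then have "u \<noteq> 0" by auto
  have t: "norm (e * of_real (n j)) \<le> B"
    using mult_mono[of "norm e" 1 "\<bar>n j\<bar>" B] assms(1,3,4) Suc.prems by (simp add: norm_mult)
  have "norm (near_sqrt u (e * of_real (n j)) - u) \<le> norm (e * of_real (n j)) / norm u"
    by (rule norm_near_sqrt_diff) fact
  also have "\<dots> \<le> B / 1"
    using t u1 assms(1) by (intro frac_le) auto
  finally have "norm (near_sqrt u (e * of_real (n j))) \<ge> norm u - B"
    using norm_triangle_ineq2[of u "near_sqrt u (e * of_real (n j))"]
    by (simp add: norm_minus_commute)
  then show ?case
    using u by (simp add: u_def algebra_simps)
qed

lemma chain_step_bounds:
  assumes "B \<ge> 1" "\<forall>j<k. \<bar>m j\<bar> \<le> B" "\<forall>j<k. \<bar>n j\<bar> \<le> B"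
    and "norm e < 1" "norm x > (2 * real k + 3) * B" "j < k"
  shows "chain m n e x j - of_real (m j) \<noteq> 0 \<and>
    norm (e * of_real (n j)) < norm (chain m n e x j - of_real (m j)) ^ 2"
proof -
  define u where "u = chain m n e x j - of_real (m j)"
  have "norm (chain m n e x j) > (2 * real (k - j) + 3) * B"
    using chain_bounds[OF assms(1-5), of j] assms(6) by simp
  moreover have "norm u \<ge> norm (chain m n e x j) - \<bar>m j\<bar>"
    unfolding u_def by (metis norm_of_real norm_triangle_ineq2)
  moreover have "0 \<le> real (k - j) * B" using assms(1) by simp
  ultimately have u: "norm u > 2 * B"
    using assms(2)[rule_format, of j] assms(6) by (simp add: algebra_simps)
  have t: "norm (e * of_real (n j)) \<le> B"
    using mult_mono[of "norm e" 1 "\<bar>n j\<bar>" B] assms(1,3,4,6) by (simp add: norm_mult)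
  have "B \<le> 2 * B * 1" using assms by simp
  also have "\<dots> < norm u * norm u"
    using u assms(1) by (intro mult_strict_mono) auto
  finally have "B < norm u ^ 2" by (simp add: power2_eq_square)
  then show ?thesis
    using t u assms(1) unfolding u_def[symmetric] by auto
qed

lemma chain_holomorphic:
  assumes "B \<ge> 1" "\<forall>j<k. \<bar>m j\<bar> \<le> B" "\<forall>j<k. \<bar>n j\<bar> \<le> B"
    and "f holomorphic_on S" "g holomorphic_on S"
    and "\<And>z. z \<in> S \<Longrightarrow> norm (f z) < 1" "\<And>z. z \<in> S \<Longrightarrow> norm (g z) > (2 * real k + 3) * B"
    and "j \<le> k"
  shows "(\<lambda>z. chain m n (f z) (g z) j) holomorphic_on S"
  using assms(8)
proof (induction j)
  case 0
  then show ?case using assms by simp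
next
  case (Suc j)
  then show ?case
    using chain_step_bounds[OF assms(1-3) assms(6,7), of _ _ j] assms(4,5)
    by (auto intro!: holomorphic_intros)
qed

text \<open>Identity theorem in \<open>x\<close>: the exterior of a disc is connected and the
  composition is holomorphic on it.\<close>

lemma chain_eq_extend:
  assumes B: "B \<ge> 1" "\<forall>j<k. \<bar>m j\<bar> \<le> B" "\<forall>j<k. \<bar>n j\<bar> \<le> B"
    and "norm e < 1" "open U" "U \<noteq> {}" "U \<subseteq> {x. norm x > (2 * real k + 3) * B}"
    and "\<And>x. x \<in> U \<Longrightarrow> chain m n e x k = x" "norm x > (2 * real k + 3) * B"
  shows "chain m n e x k = x"
proof (rule analytic_continuation_open[where s = U and s' = "{x. norm x > (2 * real k + 3) * B}"
      and f = "\<lambda>x. chain m n e x k" and g = "\<lambda>x. x"])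
  show "open {x::complex. norm x > (2 * real k + 3) * B}"
    by (intro open_Collect_less continuous_intros)
  have eq: "{x::complex. norm x > (2 * real k + 3) * B} = - cball 0 ((2 * real k + 3) * B)"
    by auto
  show "connected {x::complex. norm x > (2 * real k + 3) * B}"
    unfolding eq by (intro connected_complement_bounded_convex) auto
  show "(\<lambda>x. chain m n e x k) holomorphic_on {x. (2 * real k + 3) * B < cmod x}"
    using assms(4) by (intro chain_holomorphic[OF B]) auto
qed (use assms in auto)

text \<open>Continuation in both variables: an open set of \<open>x\<close> for each small positive
  \<open>e\<close> gives all large \<open>x\<close>; then, for fixed \<open>x\<close>, these
  \<open>e\<close> accumulate at 0 inside the unit disc.\<close>

lemma identity_chainI:
  assumes B: "B \<ge> 1" "\<forall>j<k. \<bar>m j\<bar> \<le> B" "\<forall>j<k. \<bar>n j\<bar> \<le> B"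
    and "e0 > 0" and open_U: "\<And>e. 0 < e \<Longrightarrow> e < e0 \<Longrightarrow> e < 1 \<Longrightarrow>
      \<exists>U. open U \<and> U \<noteq> {} \<and> U \<subseteq> {x. norm x > (2 * real k + 3) * B} \<and>
          (\<forall>x\<in>U. chain m n (of_real e) x k = x)"
  shows "identity_chain k B m n"
  unfolding identity_chain_def
proof (intro allI impI)
  fix e x :: complex assume e: "norm e < 1" and x: "norm x > (2 * real k + 3) * B"
  define U where "U = of_real ` {0<..<min e0 1} \<inter> ball (0::complex) 1"
  have "chain m n e x k - x = 0"
  proof (rule analytic_continuation[where U = U and \<xi> = 0 and S = "ball 0 1" and
        f = "\<lambda>e. chain m n e x k - x"])
    show "(\<lambda>e. chain m n e x k - x) holomorphic_on ball 0 1"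
      using x by (intro holomorphic_intros chain_holomorphic[OF B]) auto
    show "0 islimpt U"
      unfolding islimpt_approachable
    proof (intro allI impI)
      fix d :: real assume "d > 0"
      define t where "t = min (min e0 1) d / 2"
      have "0 < t" "t < min e0 1" "t < d" using assms(4) \<open>d > 0\<close> by (auto simp: t_def min_def)
      then show "\<exists>x'\<in>U. x' \<noteq> 0 \<and> dist x' 0 < d"
        by (intro bexI[of _ "of_real t"]) (auto simp: U_def)
    qed
    show "chain m n z x k - x = 0" if z: "z \<in> U" for z
    proof -
      obtain t where t: "z = of_real t" "0 < t" "t < e0" "t < 1"
        using z by (auto simp: U_def)
      obtain V where V: "open V" "V \<noteq> {}" "V \<subseteq> {x. norm x > (2 * real k + 3) * B}"
          "\<forall>x\<in>V. chain m n z x k = x"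
        using open_U[OF t(2-4)] t(1) by blast
      show ?thesis
        using chain_eq_extend[OF B _ V(1-3) _ x, of z] V(4) t by simp
    qed
  qed (use e in \<open>auto simp: U_def\<close>)
  then show "chain m n e x k = x" by simp
qed

text \<open>Here \<open>y\<close> is the offset from \<open>M\<close>, \<open>N\<close> an
  accumulated sum and \<open>w\<close> the radicand at a visit of \<open>M\<close>. If
  \<open>w\<close> is real, then \<open>2 * Re y * Im y\<close> is at most the error, which forces
  \<open>Im y\<close> to be of order \<open>\<beta>^2\<close>. Then \<open>w\<close> agrees with
  \<open>(Re y)^2 - \<beta>^2 * N\<close> up to less than \<open>\<beta>^2 * \<delta>\<close>, and
  the bounds on \<open>Re y\<close> fix its sign.\<close>

lemma square_near_branch_point_not_nonpos:
  fixes w y :: complex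
  assumes c: "0 < c1" "c1 < c2" and \<beta>: "0 < \<beta>" "K * \<beta> \<le> c1" "K \<ge> 0"
    and y: "\<beta> * c1 < Re y" "Re y < \<beta> * c2"
    and w: "norm (w - (y\<^sup>2 - of_real (\<beta>\<^sup>2 * N))) \<le> K * \<beta>\<^sup>2 * (\<beta> + norm y)"
    and small: "\<beta> * (K * (1 + c2)\<^sup>2 / c1 + 2 * K * (1 + c2)) < \<delta>"
  shows "N + \<delta> \<le> c1\<^sup>2 \<Longrightarrow> w \<notin> \<real>\<^sub>\<le>\<^sub>0" "N - \<delta> \<ge> c2\<^sup>2 \<Longrightarrow> - w \<notin> \<real>\<^sub>\<le>\<^sub>0"
proof -
  define a b where "a = Re y" and "b = \<bar>Im y\<bar>"
  define err where "err = K * \<beta>\<^sup>2 * (\<beta> + norm y)"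
  have b0: "b \<ge> 0" by (simp add: b_def)
  have a: "\<beta> * c1 < a" "a < \<beta> * c2" "0 < a"
    using y c \<beta> by (auto simp: a_def intro: order.strict_trans[OF mult_pos_pos])
  have "norm y \<le> a + b"
    using cmod_le[of y] a by (simp add: a_def b_def)
  then have "err \<le> K * \<beta>\<^sup>2 * (\<beta> + (\<beta> * c2 + b))"
    unfolding err_def using \<beta> a by (intro mult_left_mono) auto
  also have "\<dots> = (K * \<beta>) * (\<beta> * (\<beta> * (1 + c2) + b))"
    by (simp add: algebra_simps power2_eq_square)
  finally have err1: "err \<le> (K * \<beta>) * (\<beta> * (\<beta> * (1 + c2) + b))" .
  have re: "\<bar>Re w - (a\<^sup>2 - b\<^sup>2 - \<beta>\<^sup>2 * N)\<bar> \<le> err"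
  proof -
    have "Re (w - (y\<^sup>2 - of_real (\<beta>\<^sup>2 * N))) = Re w - (a\<^sup>2 - b\<^sup>2 - \<beta>\<^sup>2 * N)"
      by (simp add: a_def b_def Re_power2)
    then show ?thesis using w abs_Re_le_cmod[of "w - (y\<^sup>2 - of_real (\<beta>\<^sup>2 * N))"]
      by (simp add: err_def)
  qed
  have im: "\<bar>Im w - 2 * a * Im y\<bar> \<le> err"
  proof -
    have "Im (w - (y\<^sup>2 - of_real (\<beta>\<^sup>2 * N))) = Im w - 2 * a * Im y"
      by (simp add: a_def Im_power2)
    then show ?thesis using w abs_Im_le_cmod[of "w - (y\<^sup>2 - of_real (\<beta>\<^sup>2 * N))"]
      by (simp add: err_def)
  qed
  \<comment> \<open>The smallness hypothesis says precisely that
    \<open>X < \<beta>\<^sup>2 * \<delta>\<close>.\<close>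
  define X where "X = \<beta>\<^sup>2 * (\<beta> * (K * (1 + c2)\<^sup>2 / c1 + 2 * K * (1 + c2)))"
  have key: "b\<^sup>2 + err \<le> X \<and> err \<le> X" if "Im w = 0"
  proof -
    have "2 * (\<beta> * c1) * b \<le> 2 * a * b"
      using a b0 by (intro mult_right_mono) auto
    also have "\<dots> = \<bar>2 * a * Im y\<bar>"
      using a by (simp add: b_def abs_mult)
    also have "\<dots> \<le> err" using im that by simp
    also note err1
    finally have "\<beta> * (2 * c1 * b) \<le> \<beta> * (K * \<beta> * (\<beta> * (1 + c2) + b))"
      by (simp add: algebra_simps)
    then have *: "2 * c1 * b \<le> K * \<beta> * (\<beta> * (1 + c2) + b)"
      using \<beta> by simp
    \<comment> \<open>The term with \<open>b\<close> on the right of the previous inequality is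
      absorbed into half of its left side.\<close>
    have "K * \<beta> * b \<le> c1 * b" using \<beta> b0 by (intro mult_right_mono)
    then have 1: "c1 * b \<le> K * \<beta> * (\<beta> * (1 + c2))"
      using * by (simp add: algebra_simps)
    also have "\<dots> \<le> c1 * (\<beta> * (1 + c2))"
      using \<beta> c by (intro mult_right_mono) auto
    finally have b1: "b \<le> \<beta> * (1 + c2)" using c by simp
    have b2: "b \<le> K * \<beta> * (\<beta> * (1 + c2)) / c1"
      using 1 c by (simp add: field_simps)
    have "b\<^sup>2 \<le> (\<beta> * (1 + c2)) * (K * \<beta> * (\<beta> * (1 + c2)) / c1)"
      unfolding power2_eq_square using b1 b2 b0 \<beta> c by (intro mult_mono) auto
    also have "\<dots> = \<beta>\<^sup>2 * (\<beta> * (K * (1 + c2)\<^sup>2 / c1))"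
      by (simp add: power2_eq_square field_simps)
    finally have b3: "b\<^sup>2 \<le> \<beta>\<^sup>2 * (\<beta> * (K * (1 + c2)\<^sup>2 / c1))" .
    have "err \<le> (K * \<beta>) * (\<beta> * (\<beta> * (1 + c2) + \<beta> * (1 + c2)))"
      using err1 b1 \<beta> by (smt (verit, best) mult_left_mono mult_nonneg_nonneg)
    also have "\<dots> = \<beta>\<^sup>2 * (\<beta> * (2 * K * (1 + c2)))"
      by (simp add: power2_eq_square algebra_simps)
    finally have e3: "err \<le> \<beta>\<^sup>2 * (\<beta> * (2 * K * (1 + c2)))" .
    have "0 \<le> b\<^sup>2" by simp
    then show ?thesis using b3 e3 unfolding X_def distrib_left[of \<beta> "_ / c1"] distrib_left[of "\<beta>\<^sup>2" "\<beta> * (_ / c1)"] by linarith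
  qed
  have sm: "X < \<beta>\<^sup>2 * \<delta>"
    unfolding X_def using small \<beta> by (intro mult_strict_left_mono) auto
  show "w \<notin> \<real>\<^sub>\<le>\<^sub>0" if N: "N + \<delta> \<le> c1\<^sup>2"
  proof
    assume "w \<in> \<real>\<^sub>\<le>\<^sub>0"
    then have w0: "Im w = 0" "Re w \<le> 0" by (auto simp: complex_nonpos_Reals_iff)
    have "a\<^sup>2 \<ge> (\<beta> * c1)\<^sup>2" using a \<beta> c by (intro power_mono) auto
    moreover have "\<beta>\<^sup>2 * (N + \<delta>) \<le> \<beta>\<^sup>2 * c1\<^sup>2" using N by (intro mult_left_mono) auto
    ultimately show False
      using re w0(2) key[OF w0(1)] sm unfolding abs_le_iff power_mult_distrib distrib_left by linarith
  qed
  show "- w \<notin> \<real>\<^sub>\<le>\<^sub>0" if N: "N - \<delta> \<ge> c2\<^sup>2"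
  proof
    assume "- w \<in> \<real>\<^sub>\<le>\<^sub>0"
    then have w0: "Im w = 0" "Re w \<ge> 0" by (auto simp: complex_nonpos_Reals_iff)
    have "a\<^sup>2 \<le> (\<beta> * c2)\<^sup>2" using a \<beta> c by (intro power_mono) auto
    moreover have "\<beta>\<^sup>2 * (N - \<delta>) \<ge> \<beta>\<^sup>2 * c2\<^sup>2" using N by (intro mult_left_mono) auto
    moreover have "0 \<le> b\<^sup>2" by simp
    ultimately show False
      using re w0(2) key[OF w0(1)] sm unfolding abs_le_iff power_mult_distrib right_diff_distrib by linarith
  qed
qed

section \<open>Monodromy of a composition at the maximum of its walk\<close>

text \<open>\<open>M\<close> is the maximal partial sum of the translations \<open>m j\<close>, and \<open>N j\<close> accumulates the \<open>n i\<close> over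
  the visits of the maximum. For \<open>e = \<beta>\<^sup>2\<close> with small \<open>\<beta>\<close>, the composition started at \<open>M + y\<close> with \<open>y\<close>
  of order \<open>\<beta>\<close> behaves at these visits like \<open>sqrt (y\<^sup>2 - \<beta>\<^sup>2 * N j)\<close>. The vertical strip between \<open>M + \<beta> c1\<close>
  and \<open>M + \<beta> c2\<close> passes left of the branch points with maximal \<open>N j = Nm\<close> and right of all others.
  Continuing along it from top to bottom therefore changes the sign of the square root exactly at
  the visits with \<open>N j = Nm\<close>.\<close>

locale chain_corner =
  fixes k :: nat and B M Nm c1 c2 \<rho> :: real and m n N :: "nat \<Rightarrow> real"
  assumes k: "1 \<le> k" and B: "1 \<le> B" "\<forall>j<k. \<bar>m j\<bar> \<le> B" "\<forall>j<k. \<bar>n j\<bar> \<le> B"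
    and \<rho>: "0 < \<rho>" "\<And>j. \<lbrakk>1 \<le> j; j \<le> k; sum m {..<j} \<noteq> M\<rbrakk> \<Longrightarrow> sum m {..<j} \<le> M - \<rho>"
    and N_0: "N 0 = 0"
    and N_Suc: "\<And>j. N (Suc j) = N j + (if sum m {..<Suc j} = M then n j else 0)"
    and c: "0 < c1" "c1 < c2"
    and N_small: "\<And>j. \<lbrakk>1 \<le> j; j \<le> k; sum m {..<j} = M; N j \<noteq> Nm\<rbrakk> \<Longrightarrow> N j < c1\<^sup>2"
    and N_large: "c2\<^sup>2 < Nm"
begin

definition \<sigma> where "\<sigma> j = sum m {..<j}"

lemma \<sigma>_0 [simp]: "\<sigma> 0 = 0" and \<sigma>_Suc: "\<sigma> (Suc j) = \<sigma> j + m j"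
  by (simp_all add: \<sigma>_def)

definition Q where "Q = (2 * real k + 3) * B"

lemma Q_ge: "Q \<ge> 3"
  unfolding Q_def using mult_mono[of 3 "2 * real k + 3" 1 B] B by simp

text \<open>A rectangle of width proportional to \<open>\<beta>\<close> whose two ends reach beyond
  \<open>\<bar>Im x\<bar> = Q\<close>, where \<open>identity_chain\<close> applies; its middle
  crosses the real axis next to the branch points.\<close>

definition D where "D \<beta> = {x. M + \<beta> * c1 < Re x \<and> Re x < M + \<beta> * c2 \<and> \<bar>Im x\<bar> < Q + 1}"

text \<open>The continuation of the composition over the whole rectangle. At a visit with
  \<open>N = Nm\<close> the radicand \<open>w\<close> stays off the nonnegative axis, so the root is
  taken as \<open>\<i> * csqrt (- w)\<close>, with its cut there; at the other visits
  \<open>w\<close> stays off the nonpositive axis and the principal root serves.\<close>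

primrec z :: "real \<Rightarrow> complex \<Rightarrow> nat \<Rightarrow> complex" where
  "z \<beta> x 0 = x"
| "z \<beta> x (Suc j) =
     (if \<sigma> (Suc j) \<noteq> M then near_sqrt (z \<beta> x j - of_real (m j)) (of_real (\<beta>\<^sup>2 * n j))
      else if N (Suc j) = Nm then \<i> * csqrt (of_real (\<beta>\<^sup>2 * n j) - (z \<beta> x j - of_real (m j))\<^sup>2)
      else csqrt ((z \<beta> x j - of_real (m j))\<^sup>2 - of_real (\<beta>\<^sup>2 * n j)))"

text \<open>The unperturbed walk takes \<open>x = M + y\<close> to
  \<open>M + y - \<sigma> j\<close>, so without roots this is the offset \<open>y\<close>. At a
  visit of \<open>M\<close> it is \<open>z\<close> itself.\<close>

definition dev where "dev \<beta> x j = z \<beta> x j - of_real (M - \<sigma> j)"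

lemma z_minus: "z \<beta> x j - of_real (m j) = dev \<beta> x j + of_real (M - \<sigma> (Suc j))"
  by (simp add: dev_def \<sigma>_Suc)

lemma z_J_squared:
  assumes "\<sigma> (Suc j) = M"
  shows "(dev \<beta> x (Suc j))\<^sup>2 = (dev \<beta> x j)\<^sup>2 - of_real (\<beta>\<^sup>2 * n j)" "dev \<beta> x (Suc j) = z \<beta> x (Suc j)"
  using assms unfolding dev_def by (auto simp: \<sigma>_Suc power_mult_distrib algebra_simps)

lemma D_facts:
  assumes "x \<in> D \<beta>" "0 < \<beta>" "\<beta> < 1"
  shows "norm (x - of_real M) \<le> c2 + Q + 1" "(Re (x - of_real M))\<^sup>2 \<le> \<beta>\<^sup>2 * c2\<^sup>2"
    "\<beta> * c1 < Re (x - of_real M)" "Re (x - of_real M) < \<beta> * c2"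
proof -
  show 1: "\<beta> * c1 < Re (x - of_real M)" "Re (x - of_real M) < \<beta> * c2"
    using assms by (auto simp: D_def)
  moreover have "0 < \<beta> * c1" "\<beta> * c2 \<le> c2"
    using assms c by (auto intro: mult_left_le_one_le)
  ultimately show "norm (x - of_real M) \<le> c2 + Q + 1"
    using cmod_le[of "x - of_real M"] assms by (auto simp: D_def)
  show "(Re (x - of_real M))\<^sup>2 \<le> \<beta>\<^sup>2 * c2\<^sup>2"
    unfolding power_mult_distrib[symmetric] using 1 \<open>0 < \<beta> * c1\<close>
    by (intro power_mono) auto
qed

lemma eventually_small:
  fixes K \<delta> :: real
  assumes "\<delta> > 0"
  shows "eventually (\<lambda>\<beta>. K * \<beta> < \<delta>) (at_right 0)"
proof -
  have "((\<lambda>\<beta>. K * \<beta>) \<longlongrightarrow> K * 0) (at_right 0)" by (intro tendsto_intros)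
  then show ?thesis using assms by (simp add: order_tendsto_iff)
qed

lemma eventually_unit: "eventually (\<lambda>\<beta>::real. 0 < \<beta> \<and> \<beta> < 1) (at_right 0)"
  by (auto simp: eventually_at_right_field intro: exI[of _ 1])

text \<open>Roots taken away from \<open>M\<close> move a point only by order
  \<open>\<beta>^2\<close>, whereas a visit subtracts exactly \<open>\<beta>^2 * n j\<close> from
  the square; hence the square of \<open>dev\<close> is \<open>y^2 - \<beta>^2 * N j\<close> up to
  higher order. The lower bound on the real part keeps a step with gap \<open>\<rho>\<close> at
  distance at least \<open>\<rho> / 2\<close> from 0.\<close>

lemma dev_estimates:
  assumes "j \<le> k"
  shows "\<exists>K\<ge>0. \<forall>\<^sub>F \<beta> in at_right 0. \<forall>x\<in>D \<beta>.
     norm ((dev \<beta> x j)\<^sup>2 - ((x - of_real M)\<^sup>2 - of_real (\<beta>\<^sup>2 * N j))) \<le> K * \<beta>\<^sup>2 * (\<beta> + norm (x - of_real M)) \<and>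
     norm (dev \<beta> x j) \<le> K * (\<beta> + norm (x - of_real M)) \<and> Re (dev \<beta> x j) \<ge> - K * \<beta>"
  using assms
proof (induction j)
  case 0
  show ?case
  proof (intro exI[of _ 1] conjI)
    show "\<forall>\<^sub>F \<beta> in at_right 0. \<forall>x\<in>D \<beta>.
       norm ((dev \<beta> x 0)\<^sup>2 - ((x - of_real M)\<^sup>2 - of_real (\<beta>\<^sup>2 * N 0))) \<le> 1 * \<beta>\<^sup>2 * (\<beta> + norm (x - of_real M)) \<and>
       norm (dev \<beta> x 0) \<le> 1 * (\<beta> + norm (x - of_real M)) \<and> Re (dev \<beta> x 0) \<ge> - 1 * \<beta>"
      using eventually_unit
    proof eventually_elim
      case (elim \<beta>)
      then have "0 < \<beta> * c1" using c by simp
      then show ?case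
        using elim by (auto simp: dev_def N_0 D_def)
    qed
  qed auto
next
  case (Suc j)
  then obtain K where K: "K \<ge> 0" and ev: "\<forall>\<^sub>F \<beta> in at_right 0. \<forall>x\<in>D \<beta>.
     norm ((dev \<beta> x j)\<^sup>2 - ((x - of_real M)\<^sup>2 - of_real (\<beta>\<^sup>2 * N j))) \<le> K * \<beta>\<^sup>2 * (\<beta> + norm (x - of_real M)) \<and>
     norm (dev \<beta> x j) \<le> K * (\<beta> + norm (x - of_real M)) \<and> Re (dev \<beta> x j) \<ge> - K * \<beta>"
    by auto
  have nB: "\<bar>n j\<bar> \<le> B" using B Suc.prems by auto
  show ?case
  proof (cases "\<sigma> (Suc j) = M")
    case False
    then have gap: "M - \<sigma> (Suc j) \<ge> \<rho>"
      using \<rho>(2)[of "Suc j"] Suc.prems by (simp add: \<sigma>_def)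
    \<comment> \<open>\<open>C * \<beta>\<^sup>2\<close> bounds the displacement by
      \<open>near_sqrt\<close> at a point of norm at least \<open>\<rho> / 2\<close>.\<close>
    define C where "C = 2 * B / \<rho>"
    have C: "C \<ge> 0" using B \<rho> by (simp add: C_def)
    define K' where "K' = K + C * (2 * K + C) + C"
    have K': "K' \<ge> 0" "K + C * (2 * K + C) \<le> K'" "K + C \<le> K'" using K C by (auto simp: K'_def)
    have "\<forall>\<^sub>F \<beta> in at_right 0. K * \<beta> < \<rho> / 2" using \<rho> by (intro eventually_small) auto
    with ev eventually_unit
    have "\<forall>\<^sub>F \<beta> in at_right 0. \<forall>x\<in>D \<beta>.
     norm ((dev \<beta> x (Suc j))\<^sup>2 - ((x - of_real M)\<^sup>2 - of_real (\<beta>\<^sup>2 * N (Suc j)))) \<le> K' * \<beta>\<^sup>2 * (\<beta> + norm (x - of_real M)) \<and>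
     norm (dev \<beta> x (Suc j)) \<le> K' * (\<beta> + norm (x - of_real M)) \<and> Re (dev \<beta> x (Suc j)) \<ge> - K' * \<beta>"
    proof eventually_elim
      case (elim \<beta>)
      show ?case
      proof
        fix x assume x: "x \<in> D \<beta>"
        define s where "s = \<beta> + norm (x - of_real M)"
        define b where "b = dev \<beta> x j"
        define u where "u = b + of_real (M - \<sigma> (Suc j))"
        define d where "d = near_sqrt u (of_real (\<beta>\<^sup>2 * n j)) - u"
        have IH: "norm (b\<^sup>2 - ((x - of_real M)\<^sup>2 - of_real (\<beta>\<^sup>2 * N j))) \<le> K * \<beta>\<^sup>2 * s"
          "norm b \<le> K * s" "Re b \<ge> - K * \<beta>"
          using elim(1) x by (auto simp: b_def s_def)
        have s: "\<beta> \<le> s" by (simp add: s_def)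
        have "Re u \<ge> \<rho> / 2" using IH(3) elim(3) gap by (simp add: u_def)
        then have u: "norm u \<ge> \<rho> / 2" using complex_Re_le_cmod[of u] by linarith
        then have u0: "u \<noteq> 0" using \<rho> by auto
        have "norm d \<le> norm (of_real (\<beta>\<^sup>2 * n j) :: complex) / norm u"
          unfolding d_def by (rule norm_near_sqrt_diff[OF u0])
        also have "\<dots> \<le> \<beta>\<^sup>2 * B / (\<rho> / 2)"
          using u nB \<rho> by (intro frac_le) (auto simp: norm_mult norm_power intro!: mult_left_mono)
        also have "\<dots> = C * \<beta>\<^sup>2" by (simp add: C_def)
        finally have d: "norm d \<le> C * \<beta>\<^sup>2" .
        have "\<beta>\<^sup>2 \<le> \<beta>" using elim(2) by (simp add: power2_eq_square mult_left_le_one_le)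
        then have "C * \<beta>\<^sup>2 \<le> C * \<beta>" using C by (intro mult_left_mono) auto
        then have d1: "norm d \<le> C * \<beta>" using d by linarith
        then have d2: "norm d \<le> C * s" using mult_left_mono[OF s C] by linarith
        have dev': "dev \<beta> x (Suc j) = b + d"
          using False by (simp add: dev_def d_def u_def b_def \<sigma>_Suc algebra_simps)
        have "norm (2 * b + d) \<le> (2 * K + C) * s"
          using norm_triangle_ineq[of "2 * b" d] IH(2) d2 by (simp add: norm_mult algebra_simps)
        then have "norm (d * (2 * b + d)) \<le> (C * \<beta>\<^sup>2) * ((2 * K + C) * s)"
          unfolding norm_mult using d C by (intro mult_mono) auto
        moreover have "(b + d)\<^sup>2 - ((x - of_real M)\<^sup>2 - of_real (\<beta>\<^sup>2 * N j)) =
            (b\<^sup>2 - ((x - of_real M)\<^sup>2 - of_real (\<beta>\<^sup>2 * N j))) + d * (2 * b + d)"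
          by (simp add: power2_eq_square algebra_simps)
        ultimately have "norm ((b + d)\<^sup>2 - ((x - of_real M)\<^sup>2 - of_real (\<beta>\<^sup>2 * N j))) \<le>
            K * \<beta>\<^sup>2 * s + (C * \<beta>\<^sup>2) * ((2 * K + C) * s)"
          using IH(1) norm_triangle_ineq by (smt (verit))
        also have "\<dots> = (K + C * (2 * K + C)) * (\<beta>\<^sup>2 * s)" by (simp add: algebra_simps)
        also have "\<dots> \<le> K' * (\<beta>\<^sup>2 * s)"
          using K' s elim(2) by (intro mult_right_mono) auto
        finally have 1: "norm ((b + d)\<^sup>2 - ((x - of_real M)\<^sup>2 - of_real (\<beta>\<^sup>2 * N j))) \<le> K' * \<beta>\<^sup>2 * s"
          by simp
        have "norm (b + d) \<le> (K + C) * s"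
          using norm_triangle_ineq[of b d] IH(2) d2 by (simp add: algebra_simps)
        also have "\<dots> \<le> K' * s" using K' s elim(2) by (intro mult_right_mono) auto
        finally have 2: "norm (b + d) \<le> K' * s" .
        have "(K + C) * \<beta> \<le> K' * \<beta>" using K' elim(2) by (intro mult_right_mono) auto
        then have 3: "Re (b + d) \<ge> - K' * \<beta>"
          using IH(3) d1 abs_Re_le_cmod[of d] by (simp add: algebra_simps)
        have "N (Suc j) = N j" using False by (simp add: N_Suc \<sigma>_def)
        with 1 2 3 show "norm ((dev \<beta> x (Suc j))\<^sup>2 - ((x - of_real M)\<^sup>2 - of_real (\<beta>\<^sup>2 * N (Suc j)))) \<le> K' * \<beta>\<^sup>2 * (\<beta> + norm (x - of_real M)) \<and>
     norm (dev \<beta> x (Suc j)) \<le> K' * (\<beta> + norm (x - of_real M)) \<and> Re (dev \<beta> x (Suc j)) \<ge> - K' * \<beta>"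
          by (simp add: dev' s_def)
      qed
    qed
    then show ?thesis using K' by blast
  next
    case True
    define L where "L = c2\<^sup>2 + \<bar>N (Suc j)\<bar> + K * (c2 + Q + 2)"
    have L: "L \<ge> 0" using K c Q_ge by (simp add: L_def)
    define K' where "K' = K + B + L + 1"
    have K': "K' \<ge> 0" "K \<le> K'" "K + B \<le> K'" "L + 1 \<le> K'" using K B L by (auto simp: K'_def)
    from ev eventually_unit
    have "\<forall>\<^sub>F \<beta> in at_right 0. \<forall>x\<in>D \<beta>.
     norm ((dev \<beta> x (Suc j))\<^sup>2 - ((x - of_real M)\<^sup>2 - of_real (\<beta>\<^sup>2 * N (Suc j)))) \<le> K' * \<beta>\<^sup>2 * (\<beta> + norm (x - of_real M)) \<and>
     norm (dev \<beta> x (Suc j)) \<le> K' * (\<beta> + norm (x - of_real M)) \<and> Re (dev \<beta> x (Suc j)) \<ge> - K' * \<beta>"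
    proof eventually_elim
      case (elim \<beta>)
      show ?case
      proof
        fix x assume x: "x \<in> D \<beta>"
        define y where "y = x - of_real M"
        define s where "s = \<beta> + norm y"
        define b where "b = dev \<beta> x j"
        define b' where "b' = dev \<beta> x (Suc j)"
        have sq: "b'\<^sup>2 = b\<^sup>2 - of_real (\<beta>\<^sup>2 * n j)" using z_J_squared[OF True] by (simp add: b_def b'_def)
        have IH: "norm (b\<^sup>2 - (y\<^sup>2 - of_real (\<beta>\<^sup>2 * N j))) \<le> K * \<beta>\<^sup>2 * s"
          "norm b \<le> K * s" "Re b \<ge> - K * \<beta>"
          using elim(1) x by (auto simp: b_def s_def y_def)
        have s: "\<beta> \<le> s" by (simp add: s_def)
        have N: "N (Suc j) = N j + n j" using True by (simp add: N_Suc \<sigma>_def)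
        have "b'\<^sup>2 - (y\<^sup>2 - of_real (\<beta>\<^sup>2 * N (Suc j))) = b\<^sup>2 - (y\<^sup>2 - of_real (\<beta>\<^sup>2 * N j))"
          by (simp add: sq N algebra_simps)
        with IH(1) have 0: "norm (b'\<^sup>2 - (y\<^sup>2 - of_real (\<beta>\<^sup>2 * N (Suc j)))) \<le> K * \<beta>\<^sup>2 * s"
          by (simp only:)
        also have "\<dots> \<le> K' * \<beta>\<^sup>2 * s" using K' s elim(2) by (intro mult_right_mono) auto
        finally have 1: "norm (b'\<^sup>2 - (y\<^sup>2 - of_real (\<beta>\<^sup>2 * N (Suc j)))) \<le> K' * \<beta>\<^sup>2 * s" .
        have "norm b' ^ 2 \<le> norm b ^ 2 + norm (of_real (\<beta>\<^sup>2 * n j) :: complex)"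
          using norm_triangle_ineq4[of "b\<^sup>2" "of_real (\<beta>\<^sup>2 * n j)"] by (simp add: sq flip: norm_power)
        also have "\<dots> \<le> (K * s)\<^sup>2 + s\<^sup>2 * B"
        proof (rule add_mono)
          show "norm b ^ 2 \<le> (K * s)\<^sup>2" using IH(2) by (intro power_mono) auto
          have "\<beta>\<^sup>2 \<le> s\<^sup>2" using s elim(2) by (intro power_mono) auto
          then show "norm (of_real (\<beta>\<^sup>2 * n j) :: complex) \<le> s\<^sup>2 * B"
            using nB by (auto simp: norm_mult norm_power intro!: mult_mono)
        qed
        also have "\<dots> = (K\<^sup>2 + B) * s\<^sup>2" by (simp add: power_mult_distrib algebra_simps)
        also have "\<dots> \<le> (K + B)\<^sup>2 * s\<^sup>2"
        proof (rule mult_right_mono)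
          have "B \<le> B * B" "0 \<le> B * K" "0 \<le> K * B" using B K by simp_all
          then show "K\<^sup>2 + B \<le> (K + B)\<^sup>2"
            unfolding power2_eq_square distrib_left distrib_right by linarith
        qed auto
        finally have "norm b' ^ 2 \<le> ((K + B) * s)\<^sup>2" by (simp add: power_mult_distrib)
        then have "norm b' \<le> (K + B) * s"
          by (rule power2_le_imp_le) (use K B s elim(2) in auto)
        also have "\<dots> \<le> K' * s" using K' s elim(2) by (intro mult_right_mono) auto
        finally have 2: "norm b' \<le> K' * s" .
        have "Re b' \<ge> - (L + 1) * \<beta>"
        proof -
          \<comment> \<open>At a visit only the square of \<open>b'\<close> is known. This identity
            recovers \<open>Re b'\<close> from it: the contribution of \<open>y\<^sup>2\<close> is
            \<open>2 * (Re y)\<^sup>2\<close>, of order \<open>\<beta>\<^sup>2\<close> however large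
            \<open>Im y\<close> is.\<close>
          have cm: "norm (w\<^sup>2) + Re (w\<^sup>2) = 2 * (Re w)\<^sup>2" for w :: complex
            by (simp add: norm_power cmod_power2 Re_power2)
          define v where "v = y\<^sup>2 - of_real (\<beta>\<^sup>2 * N (Suc j))"
          have "norm (b'\<^sup>2) + Re (b'\<^sup>2) \<le> norm v + Re v + 2 * (K * \<beta>\<^sup>2 * s)"
            using 0 norm_triangle_ineq3[of "b'\<^sup>2" v] abs_Re_le_cmod[of "b'\<^sup>2 - v"]
            unfolding v_def by (simp del: norm_power)
          moreover have "norm v + Re v \<le> norm (y\<^sup>2) + Re (y\<^sup>2) + 2 * (\<beta>\<^sup>2 * \<bar>N (Suc j)\<bar>)"
          proof -
            have "norm (of_real (\<beta>\<^sup>2 * N (Suc j)) :: complex) = \<beta>\<^sup>2 * \<bar>N (Suc j)\<bar>"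
              by (simp add: norm_mult norm_power)
            moreover have "- (\<beta>\<^sup>2 * N (Suc j)) \<le> \<beta>\<^sup>2 * \<bar>N (Suc j)\<bar>"
              by (metis abs_ge_minus_self abs_mult abs_power2)
            ultimately show ?thesis
              using norm_triangle_ineq4[of "y\<^sup>2" "of_real (\<beta>\<^sup>2 * N (Suc j))"]
              unfolding v_def minus_complex.sel Re_complex_of_real by linarith
          qed
          moreover have "K * \<beta>\<^sup>2 * s \<le> K * \<beta>\<^sup>2 * (c2 + Q + 2)"
            using D_facts(1)[OF x] elim(2) K by (intro mult_left_mono) (auto simp: s_def y_def)
          ultimately have "2 * (Re b')\<^sup>2 \<le> 2 * (Re y)\<^sup>2 + 2 * (\<beta>\<^sup>2 * \<bar>N (Suc j)\<bar>) + 2 * (K * \<beta>\<^sup>2 * (c2 + Q + 2))"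
            unfolding cm by linarith
          moreover have "(Re y)\<^sup>2 \<le> \<beta>\<^sup>2 * c2\<^sup>2"
            using D_facts(2)[OF x] elim(2) by (simp add: y_def)
          ultimately have "(Re b')\<^sup>2 \<le> L * \<beta>\<^sup>2" by (simp add: L_def algebra_simps)
          also have "\<dots> \<le> ((L + 1) * \<beta>)\<^sup>2"
            unfolding power_mult_distrib
            by (rule mult_right_mono) (use L in \<open>auto simp: power2_eq_square algebra_simps\<close>)
          finally have "\<bar>Re b'\<bar> \<le> (L + 1) * \<beta>"
            using L elim(2) by (intro abs_le_square_iff[THEN iffD2, THEN order_trans[OF _ eq_refl]]) auto
          then show ?thesis by (simp add: algebra_simps abs_le_iff)
        qed
        moreover have "(L + 1) * \<beta> \<le> K' * \<beta>" using K' elim(2) by (intro mult_right_mono) auto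
        ultimately have 3: "Re b' \<ge> - K' * \<beta>" by (simp add: algebra_simps)
        from 1 2 3 show "norm ((dev \<beta> x (Suc j))\<^sup>2 - ((x - of_real M)\<^sup>2 - of_real (\<beta>\<^sup>2 * N (Suc j)))) \<le> K' * \<beta>\<^sup>2 * (\<beta> + norm (x - of_real M)) \<and>
     norm (dev \<beta> x (Suc j)) \<le> K' * (\<beta> + norm (x - of_real M)) \<and> Re (dev \<beta> x (Suc j)) \<ge> - K' * \<beta>"
          by (simp add: s_def y_def b'_def)
      qed
    qed
    then show ?thesis using K' by blast
  qed
qed

text \<open>The branches in \<open>z\<close> are chosen so that no radicand meets a cut on the
  rectangle: \<open>square_near_branch_point_not_nonpos\<close> checks this at the visits, the lower
  bound on \<open>Re (dev \<beta> x j)\<close> elsewhere.\<close>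

lemma z_holomorphic:
  assumes "j \<le> k"
  shows "\<forall>\<^sub>F \<beta> in at_right 0. (\<lambda>x. z \<beta> x j) holomorphic_on D \<beta>"
  using assms
proof (induction j)
  case 0
  show ?case by simp
next
  case (Suc j)
  then have IH: "\<forall>\<^sub>F \<beta> in at_right 0. (\<lambda>x. z \<beta> x j) holomorphic_on D \<beta>" by simp
  have nB: "\<bar>n j\<bar> \<le> B" using B Suc.prems by auto
  show ?case
  proof (cases "\<sigma> (Suc j) = M")
    case False
    then have gap: "M - \<sigma> (Suc j) \<ge> \<rho>"
      using \<rho>(2)[of "Suc j"] Suc.prems by (simp add: \<sigma>_def)
    obtain K where K: "K \<ge> 0" and ev0: "\<forall>\<^sub>F \<beta> in at_right 0. \<forall>x\<in>D \<beta>.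
     norm ((dev \<beta> x j)\<^sup>2 - ((x - of_real M)\<^sup>2 - of_real (\<beta>\<^sup>2 * N j))) \<le> K * \<beta>\<^sup>2 * (\<beta> + norm (x - of_real M)) \<and>
     norm (dev \<beta> x j) \<le> K * (\<beta> + norm (x - of_real M)) \<and> Re (dev \<beta> x j) \<ge> - K * \<beta>"
      using dev_estimates[of j] Suc.prems by auto
    have ev: "\<forall>\<^sub>F \<beta> in at_right 0. \<forall>x\<in>D \<beta>. Re (dev \<beta> x j) \<ge> - K * \<beta>"
      using ev0 by (rule eventually_mono) auto
    have "\<forall>\<^sub>F \<beta> in at_right 0. K * \<beta> < \<rho> / 2" "\<forall>\<^sub>F \<beta> in at_right 0. B * \<beta> < (\<rho> / 2)\<^sup>2"
      using \<rho> by (intro eventually_small, auto)+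
    with ev IH eventually_unit show ?thesis
    proof eventually_elim
      case (elim \<beta>)
      have "z \<beta> x j - of_real (m j) \<noteq> 0 \<and>
          norm (of_real (\<beta>\<^sup>2 * n j) :: complex) < norm (z \<beta> x j - of_real (m j)) ^ 2" if x: "x \<in> D \<beta>" for x
      proof -
        define u where "u = z \<beta> x j - of_real (m j)"
        have "Re u \<ge> \<rho> / 2" using elim(1) x elim(4) gap by (fastforce simp: u_def z_minus)
        then have u: "norm u \<ge> \<rho> / 2" using complex_Re_le_cmod[of u] by linarith
        then have u0: "u \<noteq> 0" using \<rho> by auto
        have "norm (of_real (\<beta>\<^sup>2 * n j) :: complex) = \<beta>\<^sup>2 * \<bar>n j\<bar>" by (simp add: norm_mult norm_power)
        also have "\<dots> \<le> \<beta>\<^sup>2 * B" using nB by (intro mult_left_mono) auto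
        also have "\<dots> \<le> \<beta> * B"
          using elim(3) B by (intro mult_right_mono) (auto simp: power2_eq_square mult_left_le_one_le)
        also have "\<dots> < (\<rho> / 2)\<^sup>2" using elim(5) by (simp add: mult.commute)
        also have "\<dots> \<le> norm u ^ 2" using u \<rho> by (intro power_mono) auto
        finally show ?thesis using u0 by (simp add: u_def)
      qed
      then show ?case using False elim(2) by (auto intro!: holomorphic_intros)
    qed
  next
    case True
    obtain K where K: "K \<ge> 0" and ev0: "\<forall>\<^sub>F \<beta> in at_right 0. \<forall>x\<in>D \<beta>.
       norm ((dev \<beta> x (Suc j))\<^sup>2 - ((x - of_real M)\<^sup>2 - of_real (\<beta>\<^sup>2 * N (Suc j)))) \<le> K * \<beta>\<^sup>2 * (\<beta> + norm (x - of_real M)) \<and>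
       norm (dev \<beta> x (Suc j)) \<le> K * (\<beta> + norm (x - of_real M)) \<and> Re (dev \<beta> x (Suc j)) \<ge> - K * \<beta>"
      using dev_estimates[of "Suc j"] Suc.prems by blast
    have ev: "\<forall>\<^sub>F \<beta> in at_right 0. \<forall>x\<in>D \<beta>.
       norm ((dev \<beta> x (Suc j))\<^sup>2 - ((x - of_real M)\<^sup>2 - of_real (\<beta>\<^sup>2 * N (Suc j)))) \<le> K * \<beta>\<^sup>2 * (\<beta> + norm (x - of_real M))"
      using ev0 by (rule eventually_mono) blast
    \<comment> \<open>Margin, measured on squares, by which \<open>N (Suc j)\<close> clears the
      strip: beyond \<open>c2\<close> if it equals \<open>Nm\<close>, below \<open>c1\<close>
      otherwise.\<close>
    define \<delta> where "\<delta> = (if N (Suc j) = Nm then Nm - c2\<^sup>2 else c1\<^sup>2 - N (Suc j))"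
    have \<delta>: "\<delta> > 0"
      using N_large N_small[of "Suc j"] True Suc.prems by (auto simp: \<delta>_def \<sigma>_def)
    have ev2: "\<forall>\<^sub>F \<beta> in at_right 0. K * \<beta> < c1"
      "\<forall>\<^sub>F \<beta> in at_right 0. (K * (1 + c2)\<^sup>2 / c1 + 2 * K * (1 + c2)) * \<beta> < \<delta>"
      using c \<delta> by (intro eventually_small, auto)+
    with ev IH eventually_unit show ?thesis
    proof eventually_elim
      case (elim \<beta>)
      have nn: "(N (Suc j) \<noteq> Nm \<longrightarrow> (z \<beta> x j - of_real (m j))\<^sup>2 - of_real (\<beta>\<^sup>2 * n j) \<notin> \<real>\<^sub>\<le>\<^sub>0) \<and>
         (N (Suc j) = Nm \<longrightarrow> of_real (\<beta>\<^sup>2 * n j) - (z \<beta> x j - of_real (m j))\<^sup>2 \<notin> \<real>\<^sub>\<le>\<^sub>0)"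
        if x: "x \<in> D \<beta>" for x
      proof -
        define w where "w = (z \<beta> x j - of_real (m j))\<^sup>2 - of_real (\<beta>\<^sup>2 * n j)"
        have w: "w = (dev \<beta> x (Suc j))\<^sup>2"
          using z_J_squared[OF True] True by (simp add: w_def z_minus)
        have 1: "norm (w - ((x - of_real M)\<^sup>2 - of_real (\<beta>\<^sup>2 * N (Suc j)))) \<le> K * \<beta>\<^sup>2 * (\<beta> + norm (x - of_real M))"
          using elim(1) x w by auto
        have 2: "\<beta> * (K * (1 + c2)\<^sup>2 / c1 + 2 * K * (1 + c2)) < \<delta>"
          using elim(5) by (simp add: mult.commute)
        note near = square_near_branch_point_not_nonpos[OF c _ _ K _ _ 1 2]
        have "w \<notin> \<real>\<^sub>\<le>\<^sub>0" if "N (Suc j) \<noteq> Nm"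
          by (rule near(1)) (use elim D_facts(3,4)[OF x] that in \<open>auto simp: \<delta>_def\<close>)
        moreover have "- w \<notin> \<real>\<^sub>\<le>\<^sub>0" if "N (Suc j) = Nm"
          by (rule near(2)) (use elim D_facts(3,4)[OF x] that in \<open>auto simp: \<delta>_def\<close>)
        ultimately show ?thesis by (simp add: w_def)
      qed
      then show ?case using True elim(2) by (cases "N (Suc j) = Nm") (auto intro!: holomorphic_intros)
    qed
  qed
qed

text \<open>\<open>b\<close> selects the end of the strip, \<open>True\<close> being the bottom. The
  sign is set anew at each visit instead of being multiplied, because \<open>z\<close> picks its
  root by half-plane, whatever the sign with which the point arrives. \<open>\<i> * csqrt\<close>
  has values in the upper half-plane, hence is close to \<open>- y\<close> at the bottom.\<close>

primrec flip_sign :: "bool \<Rightarrow> nat \<Rightarrow> real" where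
  "flip_sign b 0 = 1"
| "flip_sign b (Suc j) =
     (if \<sigma> (Suc j) = M then (if N (Suc j) = Nm \<and> b then - 1 else 1) else flip_sign b j)"

lemma flip_sign_cases: "flip_sign b j = 1 \<or> flip_sign b j = - 1"
  by (induction j) auto

lemma flip_sign_False: "flip_sign False j = 1"
  by (induction j) auto

text \<open>\<open>near_sqrt\<close> is odd, so continuing with \<open>- z\<close> instead of
  \<open>z\<close> amounts to reflecting the following translations:
  \<open>s * (z - m) = s * z - s * m\<close>. Far from the real axis \<open>dev\<close> is so close
  to \<open>y\<close> or \<open>- y\<close> that its half-plane decides which root \<open>z\<close>
  has taken.\<close>

lemma ends_of_strip:
  assumes "j \<le> k"
  shows "\<exists>K\<ge>0. \<forall>\<^sub>F \<beta> in at_right 0. \<forall>x\<in>D \<beta>. \<forall>b. (if b then Im x < - Q else Im x > Q) \<longrightarrow>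
     norm (dev \<beta> x j - flip_sign b j * (x - of_real M)) \<le> K * \<beta>\<^sup>2 \<and>
     chain (\<lambda>i. flip_sign b i * m i) n (of_real (\<beta>\<^sup>2)) x j = flip_sign b j * z \<beta> x j"
  using assms
proof (induction j)
  case 0
  then show ?case by (intro exI[of _ 0]) (auto simp: dev_def)
next
  case (Suc j)
  then obtain K where K: "K \<ge> 0" and ev: "\<forall>\<^sub>F \<beta> in at_right 0. \<forall>x\<in>D \<beta>. \<forall>b. (if b then Im x < - Q else Im x > Q) \<longrightarrow>
     norm (dev \<beta> x j - flip_sign b j * (x - of_real M)) \<le> K * \<beta>\<^sup>2 \<and>
     chain (\<lambda>i. flip_sign b i * m i) n (of_real (\<beta>\<^sup>2)) x j = flip_sign b j * z \<beta> x j"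
    by auto
  have nB: "\<bar>n j\<bar> \<le> B" using B Suc.prems by auto
  have ev2: "\<forall>\<^sub>F \<beta> in at_right 0. K * \<beta> < 1" "\<forall>\<^sub>F \<beta> in at_right 0. (K + B) * \<beta> < c1"
    "\<forall>\<^sub>F \<beta> in at_right 0. (K + B) * \<beta> < 1"
    using c by (intro eventually_small, auto)+
  have gap: "M - \<sigma> (Suc j) \<ge> 0"
    using \<rho>(2)[of "Suc j"] \<rho>(1) Suc.prems by (fastforce simp: \<sigma>_def)
  from ev ev2 eventually_unit have "\<forall>\<^sub>F \<beta> in at_right 0. \<forall>x\<in>D \<beta>. \<forall>b. (if b then Im x < - Q else Im x > Q) \<longrightarrow>
     norm (dev \<beta> x (Suc j) - flip_sign b (Suc j) * (x - of_real M)) \<le> (K + B) * \<beta>\<^sup>2 \<and>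
     chain (\<lambda>i. flip_sign b i * m i) n (of_real (\<beta>\<^sup>2)) x (Suc j) = flip_sign b (Suc j) * z \<beta> x (Suc j)"
  proof eventually_elim
    case (elim \<beta>)
    show ?case
    proof (intro ballI allI impI)
      fix x b assume x: "x \<in> D \<beta>" and b: "if b then Im x < - Q else Im x > Q"
      define y where "y = x - of_real M"
      define s where "s = flip_sign b j"
      define t where "t = (of_real (\<beta>\<^sup>2 * n j) :: complex)"
      define u where "u = dev \<beta> x j + of_real (M - \<sigma> (Suc j))"
      have s: "s = 1 \<or> s = - 1" using flip_sign_cases by (simp add: s_def)
      have IH: "norm (dev \<beta> x j - s * y) \<le> K * \<beta>\<^sup>2"
        "chain (\<lambda>i. flip_sign b i * m i) n (of_real (\<beta>\<^sup>2)) x j = s * z \<beta> x j"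
        using elim(1) x b by (auto simp: s_def y_def)
      have \<beta>2: "\<beta>\<^sup>2 \<le> \<beta>" using elim(5) by (simp add: power2_eq_square mult_left_le_one_le)
      have "K * \<beta>\<^sup>2 \<le> K * \<beta>" using \<beta>2 K by (intro mult_left_mono) auto
      then have K1: "K * \<beta>\<^sup>2 < 1" using elim(2) by linarith
      have Imy: "if b then Im y < - 3 else Im y > 3" using b Q_ge by (auto simp: y_def split: if_splits)
      have "\<bar>Im (dev \<beta> x j - s * y)\<bar> < 1"
        using IH(1) K1 abs_Im_le_cmod[of "dev \<beta> x j - s * y"] by linarith
      then have "\<bar>Im u\<bar> \<ge> 1" using s Imy by (auto simp: u_def split: if_splits)
      then have u1: "norm u \<ge> 1" using abs_Im_le_cmod[of u] by linarith
      then have u0: "u \<noteq> 0" by auto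
      have "norm (near_sqrt u t - u) \<le> norm t / norm u" by (rule norm_near_sqrt_diff[OF u0])
      also have "\<dots> \<le> \<beta>\<^sup>2 * B / 1"
        using u1 nB B by (intro frac_le) (auto simp: t_def norm_mult norm_power intro!: mult_left_mono)
      finally have d: "norm (near_sqrt u t - u) \<le> B * \<beta>\<^sup>2" by (simp add: mult.commute)
      have zu: "z \<beta> x j - of_real (m j) = u" by (simp add: z_minus u_def)
      have "chain (\<lambda>i. flip_sign b i * m i) n (of_real (\<beta>\<^sup>2)) x (Suc j) = near_sqrt (s * u) t"
        using IH(2) by (simp add: zu[symmetric] t_def s_def algebra_simps)
      also have "\<dots> = s * near_sqrt u t" using s by (auto simp: near_sqrt_minus)
      finally have ch: "chain (\<lambda>i. flip_sign b i * m i) n (of_real (\<beta>\<^sup>2)) x (Suc j) = s * near_sqrt u t" .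
      show "norm (dev \<beta> x (Suc j) - flip_sign b (Suc j) * (x - of_real M)) \<le> (K + B) * \<beta>\<^sup>2 \<and>
        chain (\<lambda>i. flip_sign b i * m i) n (of_real (\<beta>\<^sup>2)) x (Suc j) = flip_sign b (Suc j) * z \<beta> x (Suc j)"
      proof (cases "\<sigma> (Suc j) = M")
        case False
        then have zn: "z \<beta> x (Suc j) = near_sqrt u t" by (simp add: zu t_def)
        then have eq: "dev \<beta> x (Suc j) - s * y = (dev \<beta> x j - s * y) + (near_sqrt u t - u)"
          unfolding dev_def[of \<beta> x "Suc j"] by (simp add: u_def)
        have "norm (dev \<beta> x (Suc j) - s * y) \<le> (K + B) * \<beta>\<^sup>2"
          unfolding eq distrib_right
          using IH(1) d norm_triangle_ineq[of "dev \<beta> x j - s * y" "near_sqrt u t - u"] by linarith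
        then show ?thesis
          using False ch zn by (simp add: s_def y_def)
      next
        case True
        \<comment> \<open>\<open>w\<close> is the value of the composition at this visit, close to
          \<open>y\<close>, and \<open>v\<close> is the root chosen by \<open>z\<close>. Their
          squares agree; real parts decide between \<open>w\<close> and \<open>- w\<close>, or
          imaginary parts if the sum is \<open>Nm\<close>.\<close>
        define w where "w = s * near_sqrt u t"
        define v where "v = z \<beta> x (Suc j)"
        have udev: "u = dev \<beta> x j" using True by (simp add: u_def)
        have "w - y = s * ((dev \<beta> x j - s * y) + (near_sqrt u t - u))"
          using s by (auto simp: w_def udev)
        then have "norm (w - y) \<le> norm (dev \<beta> x j - s * y) + norm (near_sqrt u t - u)"
          using s norm_triangle_ineq[of "dev \<beta> x j - s * y" "near_sqrt u t - u"] by (auto simp: norm_mult)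
        then have wy: "norm (w - y) \<le> (K + B) * \<beta>\<^sup>2" using IH(1) d by (simp add: algebra_simps)
        also have "\<dots> = ((K + B) * \<beta>) * \<beta>" by (simp add: power2_eq_square)
        finally have wy1: "norm (w - y) < c1 * \<beta>" "norm (w - y) < 1"
        proof -
          assume *: "norm (w - y) \<le> ((K + B) * \<beta>) * \<beta>"
          have "((K + B) * \<beta>) * \<beta> < c1 * \<beta>" using elim by (intro mult_strict_right_mono) auto
          with * show "norm (w - y) < c1 * \<beta>" by linarith
          have "((K + B) * \<beta>) * \<beta> \<le> (K + B) * \<beta>" using elim K B by (intro mult_right_le_one_le) auto
          with * show "norm (w - y) < 1" using elim by linarith
        qed
        have "w\<^sup>2 = u\<^sup>2 - t" using s near_sqrt_squared[OF u0, of t] by (auto simp: w_def power_mult_distrib)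
        also have "\<dots> = v\<^sup>2"
          using z_J_squared[OF True, of \<beta> x] by (simp add: udev t_def v_def)
        finally have wv: "v = w \<or> v = - w" by (metis power2_eq_iff)
        have dv: "dev \<beta> x (Suc j) = v" using z_J_squared(2)[OF True] by (simp add: v_def)
        show ?thesis
        proof (cases "N (Suc j) = Nm")
          case False
          have "v = csqrt (u\<^sup>2 - t)" using True False by (simp add: v_def zu t_def)
          then have "Re v \<ge> 0" by (simp only: Re_csqrt)
          moreover have "Re w > 0"
            using wy1(1) abs_Re_le_cmod[of "w - y"] D_facts(3)[OF x] elim(5)
            by (simp add: y_def mult.commute)
          ultimately have "v = w" using wv by auto
          then show ?thesis using True False wy ch dv by (simp add: v_def w_def y_def)
        next
          case Nm: True
          have "v = \<i> * csqrt (t - u\<^sup>2)" using True Nm by (simp add: v_def zu t_def)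
          then have "Im v = Re (csqrt (t - u\<^sup>2))" by simp
          then have Imv: "Im v \<ge> 0" by (simp only: Re_csqrt)
          have Imw: "\<bar>Im w - Im y\<bar> < 1" using wy1(2) abs_Im_le_cmod[of "w - y"] by simp
          show ?thesis
          proof (cases b)
            case True
            then have "v = - w" using wv Imv Imw Imy by auto
            moreover have "- w - (of_real M - x) = - (w - y)" by (simp add: y_def)
            then have "norm (- w - (of_real M - x)) = norm (w - y)" by (simp only: norm_minus_cancel)
            ultimately show ?thesis
              using True Nm \<open>\<sigma> (Suc j) = M\<close> wy ch[folded w_def] dv
              by (simp add: v_def[symmetric] del: z.simps chain.simps)
          next
            case False
            then have "v = w" using wv Imv Imw Imy by auto
            then show ?thesis using False \<open>\<sigma> (Suc j) = M\<close> wy ch dv by (simp add: v_def w_def y_def)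
          qed
        qed
      qed
    qed
  qed
  then show ?case using K B by (intro exI[of _ "K + B"]) auto
qed

text \<open>At the top \<open>z\<close> is the composition itself, so the identity gives
  \<open>z = x\<close> there and, by continuation, on the whole rectangle. Reading this at the
  bottom yields the reflected identity. The final sign is 1, since \<open>dev\<close> close to
  \<open>- y\<close> contradicts \<open>z = x\<close> where \<open>Im x\<close> is large and
  negative.\<close>

lemma flipped_chain:
  assumes ident: "identity_chain k B m n"
  shows "flip_sign True k = 1" "identity_chain k B (\<lambda>i. flip_sign True i * m i) n"
proof -
  obtain K where K: "K \<ge> 0" and ev: "\<forall>\<^sub>F \<beta> in at_right 0. \<forall>x\<in>D \<beta>. \<forall>b. (if b then Im x < - Q else Im x > Q) \<longrightarrow>
     norm (dev \<beta> x k - flip_sign b k * (x - of_real M)) \<le> K * \<beta>\<^sup>2 \<and>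
     chain (\<lambda>i. flip_sign b i * m i) n (of_real (\<beta>\<^sup>2)) x k = flip_sign b k * z \<beta> x k"
    using ends_of_strip[of k] by auto
  have ev2: "\<forall>\<^sub>F \<beta> in at_right 0. K * \<beta> < 1"
    by (intro eventually_small) auto
  define U where "U b \<beta> = D \<beta> \<inter> {x. if b then Im x < - Q else Im x > Q}" for b \<beta>
  have D_boxes: "D \<beta> = {x. M + \<beta> * c1 < Re x} \<inter> {x. Re x < M + \<beta> * c2} \<inter>
      {x. Im x < Q + 1} \<inter> {x. - (Q + 1) < Im x}" for \<beta>
    by (auto simp: D_def)
  have D_open: "open (D \<beta>)" for \<beta>
    unfolding D_boxes by (intro open_Int open_Collect_less continuous_intros)
  have D_conn: "connected (D \<beta>)" for \<beta>
    unfolding D_boxes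
    by (intro convex_connected convex_Int convex_halfspace_Re_gt convex_halfspace_Re_lt
        convex_halfspace_Im_gt convex_halfspace_Im_lt)
  have U_open: "open (U b \<beta>)" for b \<beta>
    unfolding U_def by (cases b) (auto intro!: open_Int D_open open_Collect_less continuous_intros)
  have U_ne: "U b \<beta> \<noteq> {}" if "\<beta> > 0" for b \<beta>
  proof -
    have "\<beta> * c1 < \<beta> * c2" using that c by simp
    then have "Complex (M + \<beta> * (c1 + c2) / 2) (if b then - (Q + 1/2) else Q + 1/2) \<in> U b \<beta>"
      using Q_ge by (auto simp: U_def D_def algebra_simps)
    then show ?thesis by blast
  qed
  have U_far: "U b \<beta> \<subseteq> {x. norm x > (2 * real k + 3) * B}" for b \<beta>
  proof
    fix x assume "x \<in> U b \<beta>"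
    then have "\<bar>Im x\<bar> > Q" using Q_ge by (auto simp: U_def split: if_splits)
    then show "x \<in> {x. norm x > (2 * real k + 3) * B}"
      using abs_Im_le_cmod[of x] by (simp add: Q_def)
  qed
  have "\<forall>\<^sub>F \<beta> in at_right 0. flip_sign True k = 1 \<and>
      (\<forall>x\<in>U True \<beta>. chain (\<lambda>i. flip_sign True i * m i) n (of_real (\<beta>\<^sup>2)) x k = x)"
    using ev ev2 z_holomorphic[OF order.refl] eventually_unit
  proof eventually_elim
    case (elim \<beta>)
    have \<beta>21: "\<beta>\<^sup>2 < 1" using elim(4) by (simp add: power_less_one_iff)
    have top: "z \<beta> x k = x" if "x \<in> U False \<beta>" for x
    proof -
      have "chain m n (of_real (\<beta>\<^sup>2)) x k = z \<beta> x k"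
        using elim(1)[rule_format, of x False] that by (simp add: U_def flip_sign_False)
      moreover have "chain m n (of_real (\<beta>\<^sup>2)) x k = x"
        using ident U_far[of False \<beta>] that \<beta>21 unfolding identity_chain_def
        by (metis (no_types, lifting) abs_of_nonneg mem_Collect_eq norm_of_real subsetD zero_le_power2)
      ultimately show ?thesis by simp
    qed
    have all: "z \<beta> x k = x" if "x \<in> D \<beta>" for x
      using analytic_continuation_open[OF U_open D_open U_ne D_conn, of \<beta> False \<beta> "\<lambda>x. z \<beta> x k" "\<lambda>x. x" x]
        top elim that by (auto simp: U_def)
    have one: "flip_sign True k = 1"
    proof (rule ccontr)
      assume "flip_sign True k \<noteq> 1"
      then have f: "flip_sign True k = - 1" using flip_sign_cases by blast
      obtain x where x: "x \<in> U True \<beta>" using U_ne elim(4) by blast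
      then have xD: "x \<in> D \<beta>" and Imx: "Im x < - Q" by (auto simp: U_def)
      have "norm (dev \<beta> x k + (x - of_real M)) \<le> K * \<beta>\<^sup>2"
        using elim(1)[rule_format, of x True] xD Imx f by (simp add: algebra_simps)
      then have "\<bar>Im (dev \<beta> x k + (x - of_real M))\<bar> \<le> K * \<beta>\<^sup>2"
        using abs_Im_le_cmod order_trans by blast
      moreover have "K * \<beta>\<^sup>2 \<le> K * \<beta>"
        using elim(4) K by (intro mult_left_mono) (auto simp: power2_eq_square mult_left_le_one_le)
      ultimately show False using elim(2) all[OF xD] Imx Q_ge by (simp add: dev_def)
    qed
    show ?case
    proof (intro conjI ballI one)
      fix x assume x: "x \<in> U True \<beta>"
      then have "chain (\<lambda>i. flip_sign True i * m i) n (of_real (\<beta>\<^sup>2)) x k = flip_sign True k * z \<beta> x k"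
        using elim(1)[rule_format, of x True] by (simp add: U_def)
      then show "chain (\<lambda>i. flip_sign True i * m i) n (of_real (\<beta>\<^sup>2)) x k = x"
        using one all x by (simp add: U_def)
    qed
  qed
  then obtain b0 where b0: "b0 > 0" and good: "\<And>\<beta>. 0 < \<beta> \<Longrightarrow> \<beta> < b0 \<Longrightarrow> flip_sign True k = 1 \<and>
      (\<forall>x\<in>U True \<beta>. chain (\<lambda>i. flip_sign True i * m i) n (of_real (\<beta>\<^sup>2)) x k = x)"
    by (auto simp: eventually_at_right_field)
  show "flip_sign True k = 1" using good[of "b0 / 2"] b0 by simp
  have absm: "\<forall>j<k. \<bar>flip_sign True j * m j\<bar> \<le> B"
  proof (intro allI impI)
    fix j assume "j < k"
    then show "\<bar>flip_sign True j * m j\<bar> \<le> B" using B(2) flip_sign_cases[of True j] by auto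
  qed
  show "identity_chain k B (\<lambda>i. flip_sign True i * m i) n"
  proof (rule identity_chainI[OF B(1) absm B(3)])
    show "0 < b0\<^sup>2" using b0 by simp
    fix e :: real assume e: "0 < e" "e < b0\<^sup>2" "e < 1"
    \<comment> \<open>The strip for the parameter \<open>e\<close> has the scale
      \<open>\<beta> = sqrt e\<close>.\<close>
    have "sqrt e < b0" using real_sqrt_less_mono[OF e(2)] b0 by simp
    then have "\<forall>x\<in>U True (sqrt e). chain (\<lambda>i. flip_sign True i * m i) n (of_real e) x k = x"
      using good[of "sqrt e"] e by simp
    then show "\<exists>U. open U \<and> U \<noteq> {} \<and> U \<subseteq> {x. norm x > (2 * real k + 3) * B} \<and>
        (\<forall>x\<in>U. chain (\<lambda>i. flip_sign True i * m i) n (of_real e) x k = x)"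
      using U_open U_ne[of "sqrt e" True] U_far[of True "sqrt e"] e by (intro exI[of _ "U True (sqrt e)"]) auto
  qed
qed

text \<open>Signs change only when the walk is at \<open>M\<close>, so the flipped walk is the
  original one with some excursions reflected in the level \<open>M\<close>.\<close>

lemma flipped_sums: "(\<Sum>i<j. flip_sign True i * m i) = M - flip_sign True j * (M - \<sigma> j)"
proof (induction j)
  case 0
  then show ?case by simp
next
  case (Suc j)
  have "(\<Sum>i<Suc j. flip_sign True i * m i) = M - flip_sign True j * (M - \<sigma> (Suc j))"
    using Suc by (simp add: \<sigma>_Suc algebra_simps)
  then show ?case by auto
qed

text \<open>The walk cannot end with the sign -1, so a step follows the visit \<open>j\<close>.
  Being nonzero it leads below \<open>M\<close>, and its reflection leads above.\<close>

lemma flipped_max: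
  assumes "identity_chain k B m n" "1 \<le> j" "j \<le> k" "\<sigma> j = M" "N j = Nm" "\<And>i. i < k \<Longrightarrow> m i \<noteq> 0"
  shows "\<exists>i. 1 \<le> i \<and> i \<le> k \<and> (\<Sum>i<i. flip_sign True i * m i) > M"
proof -
  have f: "flip_sign True j = - 1" using assms(2-5) by (cases j) auto
  then have "j < k" using flipped_chain(1)[OF assms(1)] assms(3) by (cases "j = k") auto
  then have "\<sigma> (Suc j) \<noteq> M" using assms(4,6) by (simp add: \<sigma>_Suc)
  moreover from this have "\<sigma> (Suc j) < M"
    using \<rho>(2)[of "Suc j"] \<open>j < k\<close> \<rho>(1) by (force simp: \<sigma>_def)
  moreover from \<open>\<sigma> (Suc j) \<noteq> M\<close> have "flip_sign True (Suc j) = - 1" using f by simp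
  ultimately show ?thesis
    using flipped_sums[of "Suc j"] \<open>j < k\<close> by (intro exI[of _ "Suc j"]) simp
qed

end

lemma chain_uminus: "chain m (\<lambda>j. - n j) e x j = chain m n (- e) x j"
  by (induction j) auto

lemma identity_chain_uminus:
  assumes "identity_chain k B m n"
  shows "identity_chain k B m (\<lambda>j. - n j)"
  using assms unfolding identity_chain_def chain_uminus by (metis norm_minus_cancel)

text \<open>After a sign change the composition continues from \<open>M\<close> with reflected translations, so the
  descent following the visit of \<open>M\<close> becomes an ascent above \<open>M\<close>. Sign changes thus produce
  identities with ever larger peak, while there are only finitely many sign patterns.\<close>

definition peak :: "nat \<Rightarrow> (nat \<Rightarrow> real) \<Rightarrow> real" where
  "peak k m = Max ((\<lambda>j. sum m {..<j}) ` {1..k})"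

lemma raise_peak:
  assumes k: "1 \<le> k" and B: "1 \<le> B" "\<forall>j<k. \<bar>m j\<bar> \<le> B" "\<forall>j<k. \<bar>n j\<bar> \<le> B"
    and nz: "\<And>j. j < k \<Longrightarrow> m j \<noteq> 0" "\<And>j. j < k \<Longrightarrow> n j \<noteq> 0"
    and ident: "identity_chain k B m n"
  shows "\<exists>s. (\<forall>j. s j = 1 \<or> s j = - 1) \<and> identity_chain k B (\<lambda>j. s j * m j) n \<and>
             peak k m < peak k (\<lambda>j. s j * m j)"
proof -
  define M where "M = peak k m"
  define J where "J = {j\<in>{1..k}. sum m {..<j} = M}"
  define N where "N n j = (\<Sum>i<j. if sum m {..<Suc i} = M then n i else 0)" for n :: "nat \<Rightarrow> real" and j
  have fin: "finite ((\<lambda>j. sum m {..<j}) ` {1..k})" "(\<lambda>j. sum m {..<j}) ` {1..k} \<noteq> {}" using k by auto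
  have M_ge: "sum m {..<j} \<le> M" if "1 \<le> j" "j \<le> k" for j
    unfolding M_def peak_def using that by (intro Max_ge) auto
  have "M \<in> (\<lambda>j. sum m {..<j}) ` {1..k}"
    unfolding M_def peak_def using fin by (rule Max_in)
  then have J: "finite J" "J \<noteq> {}" by (auto simp: J_def)
  define j1 where "j1 = Min J"
  have j1: "j1 \<in> J" "\<And>j. j \<in> J \<Longrightarrow> j1 \<le> j" using J by (auto simp: j1_def)
  then obtain i1 where i1: "j1 = Suc i1" "i1 < k" by (cases j1) (auto simp: J_def)
  \<comment> \<open>At the first visit the accumulated sum is a single nonzero \<open>n i1\<close>.
    Passing to \<open>- n\<close> if necessary makes it positive; then the largest accumulated sum
    \<open>Nm\<close> is positive and has its branch point to the right of \<open>M\<close>.\<close>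
  have N1: "N n j1 = n i1" for n
  proof -
    have "N n j1 = N n i1 + n i1" using j1(1) by (simp add: N_def i1 J_def)
    moreover have "N n i1 = 0"
      unfolding N_def
    proof (rule sum.neutral, rule ballI)
      fix i assume "i \<in> {..<i1}"
      then have "Suc i \<notin> J" using j1(2)[of "Suc i"] i1 by auto
      then show "(if sum m {..<Suc i} = M then n i else 0) = 0"
        using \<open>i \<in> _\<close> i1 by (auto simp: J_def)
    qed
    ultimately show ?thesis by simp
  qed
  have *: ?thesis if pos: "n' i1 > 0" and n'B: "\<forall>j<k. \<bar>n' j\<bar> \<le> B" and id': "identity_chain k B m n'"
    and bk: "\<And>m'. identity_chain k B m' n' \<Longrightarrow> identity_chain k B m' n" for n'
  proof -
    define Nm where "Nm = Max (N n' ` J)"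
    have Nm_ge: "\<And>j. j \<in> J \<Longrightarrow> N n' j \<le> Nm" using J by (auto simp: Nm_def)
    have Nm0: "Nm > 0" using Nm_ge[OF j1(1)] N1 pos by simp
    have "Nm \<in> N n' ` J" unfolding Nm_def using J by (intro Max_in) auto
    then obtain j0 where j0: "j0 \<in> J" "N n' j0 = Nm" by auto
    \<comment> \<open>The runner-up to \<open>Nm\<close>, raised to at least 0 so that it has a real
      root; the strip is placed between \<open>sqrt N2\<close> and \<open>sqrt Nm\<close>.\<close>
    define N2 where "N2 = Max (insert 0 {v \<in> N n' ` J. v < Nm})"
    have N2: "0 \<le> N2" "N2 < Nm" "\<And>j. j \<in> J \<Longrightarrow> N n' j \<noteq> Nm \<Longrightarrow> N n' j \<le> N2"
    proof -
      have fin: "finite (insert 0 {v \<in> N n' ` J. v < Nm})" using J by auto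
      show "0 \<le> N2" unfolding N2_def using fin by (intro Max_ge) auto
      have "N2 \<in> insert 0 {v \<in> N n' ` J. v < Nm}" unfolding N2_def using fin by (intro Max_in) auto
      then show "N2 < Nm" using Nm0 by auto
      show "N n' j \<le> N2" if "j \<in> J" "N n' j \<noteq> Nm" for j
        unfolding N2_def using fin that Nm_ge[OF that(1)] by (intro Max_ge) auto
    qed
    obtain c1 where c1: "sqrt N2 < c1" "c1 < sqrt Nm" using N2 dense[of "sqrt N2" "sqrt Nm"] by auto
    obtain c2 where c2: "c1 < c2" "c2 < sqrt Nm" using dense[OF c1(2)] by auto
    have c10: "0 < c1" using c1 N2(1) real_sqrt_ge_zero[of N2] by linarith
    have c1sq: "N2 < c1\<^sup>2" using c1(1) N2(1) c10 by (metis real_less_lsqrt real_sqrt_less_iff real_sqrt_pow2_iff not_less less_eq_real_def real_sqrt_unique)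
    have c2sq: "c2\<^sup>2 < Nm" using c2 c10 Nm0 by (metis less_eq_real_def order_less_trans power_strict_mono real_sqrt_pow2 zero_less_numeral)
    \<comment> \<open>The element 1 keeps the set nonempty when every partial sum equals
      \<open>M\<close>.\<close>
    define R where "R = insert 1 ((\<lambda>j. M - sum m {..<j}) ` ({1..k} - J))"
    have R: "finite R" "R \<noteq> {}" by (auto simp: R_def)
    define \<rho> where "\<rho> = Min R"
    have R_pos: "r > 0" if "r \<in> R" for r
      using that M_ge by (fastforce simp: R_def J_def less_le)
    have \<rho>: "0 < \<rho>" unfolding \<rho>_def using R R_pos by (simp add: Min_gr_iff)
    have \<rho>_le: "sum m {..<j} \<le> M - \<rho>" if "1 \<le> j" "j \<le> k" "sum m {..<j} \<noteq> M" for j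
    proof -
      have "M - sum m {..<j} \<in> R" using that by (auto simp: R_def J_def)
      then have "\<rho> \<le> M - sum m {..<j}" unfolding \<rho>_def using R by (intro Min_le)
      then show ?thesis by linarith
    qed
    interpret chain_corner k B M Nm c1 c2 \<rho> m n' "N n'"
    proof
      show "N n' j < c1\<^sup>2" if "1 \<le> j" "j \<le> k" "sum m {..<j} = M" "N n' j \<noteq> Nm" for j
        using N2(3)[of j] that c1sq by (force simp: J_def)
    qed (use k B(1,2) n'B \<rho> \<rho>_le c10 c2 c2sq in \<open>auto simp: N_def\<close>)
    define s where "s j = flip_sign True j" for j
    obtain i where i: "1 \<le> i" "i \<le> k" "(\<Sum>i<i. s i * m i) > M"
      using flipped_max[OF id', of j0] j0 nz(1) by (auto simp: J_def \<sigma>_def s_def)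
    have "(\<Sum>i<i. s i * m i) \<le> peak k (\<lambda>j. s j * m j)"
      unfolding peak_def using i by (intro Max_ge) auto
    then show ?thesis
      using i bk[OF flipped_chain(2)[OF id']] flip_sign_cases
      by (intro exI[of _ s]) (auto simp: s_def M_def)
  qed
  show ?thesis
  proof (cases "n i1 > 0")
    case True
    then show ?thesis using * B(3) ident by blast
  next
    case False
    then have "- n i1 > 0" using nz(2)[OF i1(2)] by auto
    then show ?thesis
      using *[of "\<lambda>j. - n j"] B(3) identity_chain_uminus[OF ident] identity_chain_uminus[of k B _ "\<lambda>j. - n j"]
      by simp
  qed
qed

theorem not_identity_chain:
  assumes k: "1 \<le> k" and B: "1 \<le> B" "\<forall>j<k. \<bar>m j\<bar> \<le> B" "\<forall>j<k. \<bar>n j\<bar> \<le> B"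
    and nz: "\<And>j. j < k \<Longrightarrow> m j \<noteq> 0" "\<And>j. j < k \<Longrightarrow> n j \<noteq> 0"
  shows "\<not> identity_chain k B m n"
proof
  assume ident: "identity_chain k B m n"
  have peak_cong: "peak k f = peak k g" if "\<And>j. j < k \<Longrightarrow> f j = g j" for f g
    unfolding peak_def using that by (intro arg_cong[of _ _ Max] image_cong sum.cong) auto
  have chain_cong: "chain f n e x j = chain g n e x j" if "\<And>i. i < k \<Longrightarrow> f i = g i" "j \<le> k" for f g e x j
    using that(2) by (induction j) (auto simp: that(1))
  \<comment> \<open>Restricting sign patterns to the first \<open>k\<close> indices makes their set
    finite. A pattern with maximal peak among those giving an identity is beaten by
    \<open>raise_peak\<close>.\<close>
  define S where "S = {s \<in> {..<k} \<rightarrow>\<^sub>E {1, - 1 :: real}. identity_chain k B (\<lambda>j. s j * m j) n}"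
  have restr: "restrict s {..<k} \<in> S \<and> peak k (\<lambda>j. restrict s {..<k} j * m j) = peak k (\<lambda>j. s j * m j)"
    if "\<forall>j. s j = 1 \<or> s j = - 1" "identity_chain k B (\<lambda>j. s j * m j) n" for s
    using that chain_cong[of "\<lambda>j. restrict s {..<k} j * m j" "\<lambda>j. s j * m j" k]
    by (auto simp: S_def identity_chain_def intro!: peak_cong)
  have "finite S" unfolding S_def by (rule finite_subset[of _ "{..<k} \<rightarrow>\<^sub>E {1, - 1}"]) (auto intro!: finite_PiE)
  moreover have "S \<noteq> {}" using restr[of "\<lambda>_. 1"] ident by auto
  ultimately have "Max ((\<lambda>s. peak k (\<lambda>j. s j * m j)) ` S) \<in> (\<lambda>s. peak k (\<lambda>j. s j * m j)) ` S"
    by (intro Max_in) auto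
  then obtain s where s: "s \<in> S" "Max ((\<lambda>s. peak k (\<lambda>j. s j * m j)) ` S) = peak k (\<lambda>j. s j * m j)"
    by blast
  have s_max: "peak k (\<lambda>j. s' j * m j) \<le> peak k (\<lambda>j. s j * m j)" if "s' \<in> S" for s'
    unfolding s(2)[symmetric] using \<open>finite S\<close> that by (intro Max_ge) auto
  have s_abs: "s j = 1 \<or> s j = - 1" if "j < k" for j using s(1) that by (auto simp: S_def PiE_def Pi_def)
  have "\<exists>t. (\<forall>j. t j = 1 \<or> t j = - 1) \<and> identity_chain k B (\<lambda>j. t j * (s j * m j)) n \<and>
             peak k (\<lambda>j. s j * m j) < peak k (\<lambda>j. t j * (s j * m j))"
  proof (rule raise_peak[OF k B(1) _ B(3)])
    show "\<forall>j<k. \<bar>s j * m j\<bar> \<le> B" using B(2) s_abs by (force simp: abs_mult)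
    show "s j * m j \<noteq> 0" if "j < k" for j using nz(1)[OF that] s_abs[OF that] by auto
  qed (use nz(2) s(1) in \<open>auto simp: S_def\<close>)
  then obtain t where t: "\<forall>j. t j = 1 \<or> t j = - 1" "identity_chain k B (\<lambda>j. t j * (s j * m j)) n"
     "peak k (\<lambda>j. s j * m j) < peak k (\<lambda>j. t j * (s j * m j))" by blast
  define r where "r j = (if j < k then t j * s j else 1)" for j
  have r: "\<forall>j. r j = 1 \<or> r j = - 1" using t(1) s_abs by (auto simp: r_def) (metis minus_mult_minus mult_1 mult_minus1)+
  have "identity_chain k B (\<lambda>j. r j * m j) n"
    using t(2) chain_cong[of "\<lambda>j. r j * m j" "\<lambda>j. t j * (s j * m j)" k] by (simp add: identity_chain_def r_def)
  moreover have "peak k (\<lambda>j. r j * m j) = peak k (\<lambda>j. t j * (s j * m j))"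
    by (intro peak_cong) (simp add: r_def)
  ultimately show False using restr[of r] r s_max[of "restrict r {..<k}"] t(3) by simp
qed

section \<open>Series in two noncommuting letters\<close>

typedef word_series = "UNIV :: (bool list \<Rightarrow> real) set"
  morphisms word_coeff Word_series ..

lemma word_coeff_Word_series [simp]: "word_coeff (Word_series f) = f"
  by (simp add: Word_series_inverse)

lemma word_series_eqI: "(\<And>w. word_coeff S w = word_coeff R w) \<Longrightarrow> S = R"
  by (metis ext word_coeff_inject)

text \<open>The concatenation product, a sum over all splittings of a word
  (\<open>conv_sum\<close>). Recursion on the first letter shifts \<open>f\<close>, so that
  associativity is an induction using only linearity in \<open>f\<close>.\<close>

primrec conv :: "(bool list \<Rightarrow> real) \<Rightarrow> (bool list \<Rightarrow> real) \<Rightarrow> bool list \<Rightarrow> real" where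
  "conv f g [] = f [] * g []"
| "conv f g (x # w) = f [] * g (x # w) + conv (\<lambda>v. f (x # v)) g w"

lemmas conv_Cons = conv.simps(2)
declare conv_Cons [simp del]

lemma conv_linear_left: "conv (\<lambda>v. c * f v + f' v) g w = c * conv f g w + conv f' g w"
  by (induction w arbitrary: f f') (auto simp: conv_Cons algebra_simps)

lemma conv_zero_left: "conv (\<lambda>v. 0) g w = 0"
  by (induction w) (auto simp: conv_Cons)

lemma conv_assoc: "conv (conv f g) h w = conv f (conv g h) w"
proof (induction w arbitrary: f g h)
  case (Cons x w)
  have "conv (conv f g) h (x # w) = f [] * g [] * h (x # w) +
      conv (\<lambda>v. f [] * g (x # v) + conv (\<lambda>v. f (x # v)) g v) h w"
    by (simp add: conv_Cons)
  also have "\<dots> = f [] * g [] * h (x # w) +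
      (f [] * conv (\<lambda>v. g (x # v)) h w + conv (\<lambda>v. f (x # v)) (conv g h) w)"
    by (simp only: conv_linear_left Cons.IH)
  finally show ?case by (simp add: conv_Cons algebra_simps)
qed simp

lemma conv_sum: "conv f g w = (\<Sum>i\<le>length w. f (take i w) * g (drop i w))"
  by (induction w arbitrary: f) (simp_all add: conv_Cons sum.atMost_Suc_shift del: sum.atMost_Suc)

definition unit_coeff :: "bool list \<Rightarrow> real" where
  "unit_coeff w = (if w = [] then 1 else 0)"

lemma conv_unit_left: "conv unit_coeff g w = g w"
  by (cases w) (auto simp: unit_coeff_def conv_Cons conv_zero_left)

lemma conv_unit_right: "conv f unit_coeff w = f w"
  by (induction w arbitrary: f) (auto simp: unit_coeff_def conv_Cons)

instantiation word_series :: monoid_mult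
begin

definition one_word_series :: word_series where "1 = Word_series unit_coeff"

definition times_word_series :: "word_series \<Rightarrow> word_series \<Rightarrow> word_series" where
  "S * R = Word_series (conv (word_coeff S) (word_coeff R))"

instance
  by standard
    (auto intro!: word_series_eqI
      simp: times_word_series_def one_word_series_def conv_assoc conv_unit_left conv_unit_right)

end

lemma word_coeff_one: "word_coeff 1 w = (if w = [] then 1 else 0)"
  by (simp add: one_word_series_def unit_coeff_def)

lemma word_coeff_mult: "word_coeff (S * R) w = conv (word_coeff S) (word_coeff R) w"
  by (simp add: times_word_series_def)

fun conv_inverse :: "(bool list \<Rightarrow> real) \<Rightarrow> bool list \<Rightarrow> real" where
  "conv_inverse f [] = 1"
| "conv_inverse f (x # w) = - (\<Sum>i\<le>length w. f (x # take i w) * conv_inverse f (drop i w))"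

definition series_inverse :: "word_series \<Rightarrow> word_series" where
  "series_inverse S = Word_series (conv_inverse (word_coeff S))"

lemma series_inverse_right:
  assumes "word_coeff S [] = 1"
  shows "S * series_inverse S = 1"
proof (rule word_series_eqI)
  fix w
  show "word_coeff (S * series_inverse S) w = word_coeff 1 w"
  proof (cases w)
    case (Cons x v)
    have "word_coeff (S * series_inverse S) w = word_coeff S [] * conv_inverse (word_coeff S) (x # v) +
        conv (\<lambda>v. word_coeff S (x # v)) (conv_inverse (word_coeff S)) v"
      by (simp add: word_coeff_mult series_inverse_def conv_Cons Cons)
    then show ?thesis using assms by (simp add: conv_sum word_coeff_one Cons)
  qed (use assms in \<open>simp add: word_coeff_mult word_coeff_one series_inverse_def\<close>)
qed

text \<open>The right inverse again has constant coefficient 1, hence a right inverse of its own; as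
  in a group, this makes it two-sided.\<close>

lemma series_inverse_left:
  assumes "word_coeff S [] = 1"
  shows "series_inverse S * S = 1"
proof -
  define R where "R = series_inverse S"
  have "word_coeff R [] = 1" by (simp add: R_def series_inverse_def)
  then have R: "R * series_inverse R = 1" by (rule series_inverse_right)
  have "S = S * (R * series_inverse R)" by (simp add: R)
  also have "\<dots> = series_inverse R"
    using series_inverse_right[OF assms] by (simp add: R_def flip: mult.assoc)
  finally show ?thesis using R by (simp add: R_def)
qed

section \<open>Action of series on the powers of \<open>v\<close> through the two vector
  fields\<close>

definition letter_weight :: "bool \<Rightarrow> nat" where
  "letter_weight b = (if b then 2 else 1)"

text \<open>The total amount by which the operator of the word raises a power of \<open>v\<close>:
  \<open>False\<close> is the field \<open>v^2 d/dv\<close>, \<open>True\<close> the field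
  \<open>v^3 d/dv\<close>. The letter weights are also the indices of the coefficients
  \<open>a 1\<close> and \<open>a 2\<close>.\<close>

definition weight :: "bool list \<Rightarrow> nat" where
  "weight w = sum_list (map letter_weight w)"

lemma weight_simps [simp]:
  "weight [] = 0" "weight (b # w) = letter_weight b + weight w" "weight (u @ w) = weight u + weight w"
  by (simp_all add: weight_def)

lemma letter_weight_pos [simp]: "letter_weight b > 0"
  by (simp add: letter_weight_def)

lemma length_le_weight: "length w \<le> weight w"
  by (induction w) (auto simp: letter_weight_def)

lemma finite_weight_le: "finite {w. weight w \<le> d}"
proof (rule finite_subset)
  show "{w. weight w \<le> d} \<subseteq> {w. set w \<subseteq> UNIV \<and> length w \<le> d}"
    using length_le_weight order_trans by fastforce
qed (intro finite_lists_length_le finite)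

lemma finite_weight_eq: "finite {w. weight w = d}"
  by (rule finite_subset[OF _ finite_weight_le[of d]]) auto

text \<open>The vector fields \<open>D\<^sub>1 = v\<^sup>2 d/dv\<close> and \<open>D\<^sub>2 = v\<^sup>3 d/dv\<close> act on monomials by
  \<open>D\<^sub>w v\<^sup>k = field_coeff k w * v\<^bsup>k + weight w\<^esup>\<close>.\<close>

primrec field_coeff :: "nat \<Rightarrow> bool list \<Rightarrow> real" where
  "field_coeff k [] = 1"
| "field_coeff k (b # w) = field_coeff k w * real (k + weight w)"

lemma field_coeff_append: "field_coeff k (u @ w) = field_coeff k w * field_coeff (k + weight w) u"
  by (induction u) (auto simp: algebra_simps)

text \<open>The coefficient of \<open>v^(k + d)\<close> in the result of applying the series to
  \<open>v^k\<close>; only the finitely many words of weight \<open>d\<close> contribute.\<close>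

definition transport :: "word_series \<Rightarrow> nat \<Rightarrow> nat \<Rightarrow> real" where
  "transport S k d = (\<Sum>w | weight w = d. word_coeff S w * field_coeff k w)"

lemma transport_one: "transport 1 k d = (if d = 0 then 1 else 0)"
proof -
  have "transport 1 k d = (\<Sum>w | weight w = d. if w = [] then 1 else 0)"
    unfolding transport_def by (intro sum.cong) (auto simp: word_coeff_one)
  also have "\<dots> = (if d = 0 then 1 else 0)"
    using sum.delta[OF finite_weight_eq[of d], of "[]" "\<lambda>_. 1::real"] by simp
  finally show ?thesis .
qed

text \<open>In \<open>u @ w\<close> the word \<open>w\<close> acts first, so the right factor
  \<open>R\<close> raises the exponent from \<open>k\<close> to \<open>k + e\<close> before
  \<open>S\<close> acts.\<close>

lemma transport_mult:
  "transport (S * R) k d = (\<Sum>e\<le>d. transport R k e * transport S (k + e) (d - e))"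
proof -
  define h where "h u v = word_coeff S u * word_coeff R v * (field_coeff k v * field_coeff (k + weight v) u)" for u v
  have "transport (S * R) k d = (\<Sum>w | weight w = d. \<Sum>i\<le>length w. h (take i w) (drop i w))"
  proof -
    have "field_coeff k w = field_coeff k (drop i w) * field_coeff (k + weight (drop i w)) (take i w)" for w i
      by (metis append_take_drop_id field_coeff_append)
    then show ?thesis
      unfolding transport_def h_def word_coeff_mult conv_sum
      by (auto simp: sum_distrib_right intro!: sum.cong)
  qed
  also have "\<dots> = (\<Sum>(w, i)\<in>(SIGMA w:{w. weight w = d}. {..length w}). h (take i w) (drop i w))"
    by (rule sum.Sigma) (auto simp: finite_weight_eq)
  \<comment> \<open>Cutting the words of weight \<open>d\<close> in two enumerates all pairs of
    words of weights \<open>e\<close> and \<open>d - e\<close>.\<close>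
  also have "\<dots> = (\<Sum>(e, v, u)\<in>(SIGMA e:{..d}. {v. weight v = e} \<times> {u. weight u = d - e}). h u v)"
  proof (rule sum.reindex_bij_witness[where i = "\<lambda>(e, v, u). (u @ v, length u)"
        and j = "\<lambda>(w, i). (weight (drop i w), drop i w, take i w)"])
    fix a assume "a \<in> (SIGMA w:{w. weight w = d}. {..length w})"
    then obtain w i where a: "a = (w, i)" "weight w = d" "i \<le> length w" by auto
    have "weight (take i w) + weight (drop i w) = d"
      using a(2) by (metis append_take_drop_id weight_simps(3))
    then show "(case a of (w, i) \<Rightarrow> (weight (drop i w), drop i w, take i w))
         \<in> (SIGMA e:{..d}. {v. weight v = e} \<times> {u. weight u = d - e})"
      "(case case a of (w, i) \<Rightarrow> (weight (drop i w), drop i w, take i w) of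
          (e, v, u) \<Rightarrow> (u @ v, length u)) = a"
      "(case case a of (w, i) \<Rightarrow> (weight (drop i w), drop i w, take i w) of (e, v, u) \<Rightarrow> h u v) =
         (case a of (w, i) \<Rightarrow> h (take i w) (drop i w))"
      using a by auto
  qed auto
  also have "\<dots> = (\<Sum>e\<le>d. \<Sum>(v, u)\<in>{v. weight v = e} \<times> {u. weight u = d - e}. h u v)"
    by (rule sum.Sigma[symmetric]) (auto simp: finite_weight_eq)
  also have "\<dots> = (\<Sum>e\<le>d. transport R k e * transport S (k + e) (d - e))"
  proof (rule sum.cong[OF refl])
    fix e
    have "(\<Sum>(v, u)\<in>{v. weight v = e} \<times> {u. weight u = d - e}. h u v)
       = (\<Sum>v | weight v = e. \<Sum>u | weight u = d - e. h u v)"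
      by (rule sum.cartesian_product[symmetric])
    also have "\<dots> = transport R k e * transport S (k + e) (d - e)"
      unfolding transport_def sum_product h_def by (intro sum.cong refl) auto
    finally show "(\<Sum>(v, u)\<in>{v. weight v = e} \<times> {u. weight u = d - e}. h u v)
       = transport R k e * transport S (k + e) (d - e)" .
  qed
  finally show ?thesis .
qed

text \<open>\<open>S\<close> acts as the identity on every power of \<open>v\<close>. For arbitrary
  series this is weaker than \<open>S = 1\<close>, as the operators of different words satisfy
  linear relations; for words in the two edges it will turn out to be equivalent.\<close>

definition inert :: "word_series \<Rightarrow> bool" where
  "inert S \<longleftrightarrow> transport S = transport 1"

lemma transport_mult_cong:
  "transport S = transport S' \<Longrightarrow> transport R = transport R' \<Longrightarrow> transport (S * R) = transport (S' * R')"
  by (intro ext) (simp add: transport_mult)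

lemma inert_conjugate:
  assumes "inert S" "R * R' = 1"
  shows "inert (R * S * R')"
proof -
  have "transport (R * S * R') = transport (R * 1 * R')"
    using assms(1) by (intro transport_mult_cong) (auto simp: inert_def)
  then show ?thesis using assms(2) by (simp add: inert_def)
qed

section \<open>Words in two group elements and their cyclic reduction\<close>

definition zpower :: "word_series \<Rightarrow> int \<Rightarrow> word_series" where
  "zpower x e = (if e \<ge> 0 then x ^ nat e else series_inverse x ^ nat (- e))"

lemma zpower_simps [simp]: "zpower x 0 = 1" "zpower x 1 = x"
  by (simp_all add: zpower_def)

lemma zpower_add_one:
  assumes "word_coeff x [] = 1"
  shows "zpower x (e + 1) = zpower x e * x"
proof (cases "e \<ge> 0")
  case True
  then show ?thesis by (simp add: zpower_def nat_add_distrib power_commutes)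
next
  case False
  define n where "n = nat (- e - 1)"
  have e: "e = - int n - 1" using False by (simp add: n_def)
  have "zpower x e = series_inverse x ^ n * series_inverse x"
    using False e by (simp add: zpower_def nat_add_distrib power_commutes)
  then have "zpower x e * x = series_inverse x ^ n"
    by (simp add: mult.assoc series_inverse_left[OF assms])
  also have "\<dots> = zpower x (e + 1)" by (cases "n = 0") (auto simp: zpower_def e)
  finally show ?thesis by simp
qed

lemma zpower_add:
  assumes "word_coeff x [] = 1"
  shows "zpower x (d + e) = zpower x d * zpower x e"
proof (induction e rule: int_induct[where k = 0])
  case base
  then show ?case by simp
next
  case (step1 i)
  then show ?case
    using zpower_add_one[OF assms, of "d + i"] zpower_add_one[OF assms, of i]
    by (simp add: mult.assoc add.assoc)
next
  case (step2 i)
  have "zpower x (d + (i - 1)) * x = zpower x d * zpower x (i - 1) * x"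
    using zpower_add_one[OF assms, of "d + (i - 1)"] zpower_add_one[OF assms, of "i - 1"] step2
    by (simp add: mult.assoc)
  then have "zpower x (d + (i - 1)) * (x * series_inverse x) = zpower x d * zpower x (i - 1) * (x * series_inverse x)"
    by (simp flip: mult.assoc)
  then show ?case by (simp add: series_inverse_right[OF assms])
qed

definition word_value :: "(bool \<Rightarrow> word_series) \<Rightarrow> (bool \<times> int) list \<Rightarrow> word_series" where
  "word_value E L = prod_list (map (\<lambda>(b, e). zpower (E b) e) L)"

lemma word_value_simps [simp]:
  "word_value E [] = 1" "word_value E ((b, e) # L) = zpower (E b) e * word_value E L"
  "word_value E (L @ L') = word_value E L * word_value E L'"
  by (simp_all add: word_value_def)

definition interleave :: "bool \<Rightarrow> (int \<times> int) list \<Rightarrow> (bool \<times> int) list" where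
  "interleave b ps = concat (map (\<lambda>(m, n). [(b, m), (\<not> b, n)]) ps)"

lemma interleave_simps [simp]:
  "interleave b [] = []" "interleave b ((m, n) # ps) = (b, m) # (\<not> b, n) # interleave b ps"
  by (simp_all add: interleave_def)

lemma last_interleave:
  "ps \<noteq> [] \<Longrightarrow> interleave b ps \<noteq> [] \<and> last (interleave b ps) = (\<not> b, snd (last ps))"
  by (induction ps) (auto simp: interleave_def split: prod.splits)

lemma alternating_even:
  assumes "successively (\<lambda>p q. fst p \<noteq> fst q) L" "\<forall>p\<in>set L. snd p \<noteq> 0" "even (length L)"
    and "L = [] \<or> fst (hd L) = b"
  shows "\<exists>ps. L = interleave b ps \<and> (\<forall>(m, n)\<in>set ps. m \<noteq> 0 \<and> n \<noteq> 0)"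
  using assms
proof (induction L rule: length_induct)
  case (1 L)
  show ?case
  proof (cases L)
    case Nil
    then show ?thesis by (intro exI[of _ "[]"]) simp
  next
    case (Cons p L')
    then obtain q L'' where L: "L = p # q # L''" using 1(4) by (cases L') auto
    have "L'' = [] \<or> fst (hd L'') = b"
      using 1(2,5) by (cases L'') (auto simp: L)
    moreover have "successively (\<lambda>p q. fst p \<noteq> fst q) L''"
      using 1(2) by (cases L'') (auto simp: L)
    ultimately obtain ps where ps: "L'' = interleave b ps" "\<forall>(m, n)\<in>set ps. m \<noteq> 0 \<and> n \<noteq> 0"
      using 1(1)[rule_format, of L''] 1(3,4) by (auto simp: L)
    obtain m n where "p = (b, m)" "q = (\<not> b, n)"
      using 1(2,5) L by (cases p; cases q) auto
    then show ?thesis using ps 1(3) L by (intro exI[of _ "(m, n) # ps"]) auto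
  qed
qed

text \<open>A nontrivial reduced word is cyclically reduced by conjugations to a power of one letter
  or to an alternating word of even length; conjugation does not affect inertness.\<close>

lemma inert_word_trivial:
  assumes E: "\<And>b. word_coeff (E b) [] = 1"
    and single: "\<And>b e. e \<noteq> 0 \<Longrightarrow> \<not> inert (zpower (E b) e)"
    and alternating: "\<And>ps. ps \<noteq> [] \<Longrightarrow> \<forall>(m, n)\<in>set ps. m \<noteq> 0 \<and> n \<noteq> 0 \<Longrightarrow>
           \<not> inert (word_value E (interleave b0 ps))"
    and "inert (word_value E L)"
  shows "word_value E L = 1"
  using assms(4)
proof (induction L rule: length_induct)
  case (1 L)
  note IH = 1(1)[rule_format] and L_inert = 1(2)
  have inv: "zpower (E b) e * zpower (E b) (- e) = 1" "zpower (E b) (- e) * zpower (E b) e = 1" for b e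
    using zpower_add[OF E, of b e "- e"] zpower_add[OF E, of b "- e" e] by simp_all
  have shorter: ?case if "word_value E L = word_value E L'" "length L' < length L" for L'
    using IH[of L'] that L_inert by simp
  show ?case
  proof (cases "\<forall>p\<in>set L. snd p \<noteq> 0")
    case False
    then obtain b A C where "L = A @ (b, 0) # C"
      by (metis split_list surj_pair snd_conv)
    then show ?thesis by (intro shorter[of "A @ C"]) auto
  next
    case nz: True
    show ?thesis
    proof (cases "successively (\<lambda>p q. fst p \<noteq> fst q) L")
      case False
      then obtain i where i: "Suc i < length L" "fst (L ! i) = fst (L ! Suc i)"
        unfolding successively_conv_nth by blast
      define A C where "A = take i L" and "C = drop (Suc (Suc i)) L"
      obtain b d e where bde: "L ! i = (b, d)" "L ! Suc i = (b, e)"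
        using i(2) by (cases "L ! i"; cases "L ! Suc i") auto
      have L: "L = A @ (b, d) # (b, e) # C"
      proof -
        have "L = take i L @ L ! i # drop (Suc i) L" using i(1) by (intro id_take_nth_drop) simp
        also have "drop (Suc i) L = L ! Suc i # drop (Suc (Suc i)) L"
          by (rule Cons_nth_drop_Suc[OF i(1), symmetric])
        finally show ?thesis by (simp only: bde A_def C_def)
      qed
      show ?thesis
        by (intro shorter[of "A @ (b, d + e) # C"]) (auto simp: L zpower_add[OF E] mult.assoc)
    next
      case alt: True
      consider "L = []" | p where "L = [p]" | "even (length L)" "L \<noteq> []" | "odd (length L)" "length L \<ge> 3"
      proof -
        have "length L = 0 \<or> length L = Suc 0 \<or> (even (length L) \<and> length L \<noteq> 0) \<or>
            (odd (length L) \<and> length L \<ge> 3)" by presburger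
        then show thesis using that by (auto simp: length_Suc_conv)
      qed
      then show ?thesis
      proof cases
        case 1
        then show ?thesis by simp
      next
        case (2 p)
        then show ?thesis using single[of "snd p" "fst p"] nz L_inert by (cases p) auto
      next
        case 3
        show ?thesis
        proof (cases "fst (hd L) = b0")
          case True
          then obtain ps where "L = interleave b0 ps" "\<forall>(m, n)\<in>set ps. m \<noteq> 0 \<and> n \<noteq> 0"
            using alternating_even[OF alt nz 3(1), of b0] by auto
          then show ?thesis using alternating[of ps] 3 L_inert by force
        next
          \<comment> \<open>The word begins with the wrong letter. Having even length, it ends with
            \<open>b0\<close>; moving its first syllable to the end, which is a conjugation, gives
            an alternating word that begins with \<open>b0\<close>.\<close>
          case False
          obtain b e R where L: "L = (b, e) # R" using 3(2) by (cases L) auto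
          have last_R: "fst (last L) = b0 \<and> R \<noteq> []"
          proof -
            obtain ps where ps: "L = interleave (\<not> b0) ps"
              using alternating_even[OF alt nz 3(1), of "\<not> b0"] False by auto
            have "ps \<noteq> []" using ps L by auto
            then have "last (interleave (\<not> b0) ps) = (b0, snd (last ps))"
              using last_interleave by simp
            then have "fst (last L) = b0" unfolding ps by simp
            moreover have "R \<noteq> []" using 3(1) L by auto
            ultimately show ?thesis by simp
          qed
          have b: "b = (\<not> b0)" using False L by auto
          define L' where "L' = R @ [(b, e)]"
          have "successively (\<lambda>p q. fst p \<noteq> fst q) L'"
            using alt last_R b unfolding L'_def by (auto simp: successively_append_iff L successively_Cons)
          moreover have "fst (hd L') = b0"
            using alt last_R b by (cases R) (auto simp: L'_def L)
          ultimately obtain ps where ps: "L' = interleave b0 ps" "\<forall>(m, n)\<in>set ps. m \<noteq> 0 \<and> n \<noteq> 0"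
            using alternating_even[of L' b0] nz 3 by (auto simp: L'_def L)
          have "word_value E L' = zpower (E b) (- e) * word_value E L * zpower (E b) e"
            by (simp add: L'_def L inv flip: mult.assoc)
          then have "inert (word_value E L')"
            using inert_conjugate[OF L_inert inv(2)] by simp
          then show ?thesis using alternating[of ps] ps by (force simp: L'_def)
        qed
      next
        \<comment> \<open>The first and last syllables of an odd alternating word carry the same
          letter. Conjugation merges them into a shorter word, to which the induction hypothesis
          applies, and its value 1 is conjugated back.\<close>
        case 4
        obtain b e R where L: "L = (b, e) # R" using 4 by (cases L) auto
        have "R \<noteq> []" using 4(2) L by auto
        then obtain M c where R: "R = M @ [c]" by (metis append_butlast_last_id)
        have "fst c = b"
        proof -
          have "successively (\<lambda>p q. fst p \<noteq> fst q) ((b, e) # M)"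
            using alt by (auto simp: L R successively_append_iff successively_Cons)
          then obtain ps where ps: "(b, e) # M = interleave b ps"
            using alternating_even[of "(b, e) # M" b] nz 4(1) by (auto simp: L R)
          then have "ps \<noteq> []" by auto
          then have "last (interleave b ps) = (\<not> b, snd (last ps))"
            using last_interleave by simp
          then have "fst (last ((b, e) # M)) = (\<not> b)" using ps by simp
          moreover have "fst (last ((b, e) # M)) \<noteq> fst c"
            using alt by (cases M rule: rev_cases) (auto simp: L R successively_append_iff successively_Cons)
          ultimately show ?thesis by auto
        qed
        then obtain e' where c: "c = (b, e')" by (cases c) auto
        define L' where "L' = M @ [(b, e' + e)]"
        have eq: "word_value E L' = zpower (E b) (- e) * word_value E L * zpower (E b) e"
          by (simp add: L'_def L R c inv zpower_add[OF E] flip: mult.assoc)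
        then have "inert (word_value E L')"
          using inert_conjugate[OF L_inert inv(2)] by simp
        then have "word_value E L' = 1" by (intro IH) (auto simp: L'_def L R)
        then have "zpower (E b) e * (zpower (E b) (- e) * word_value E L * zpower (E b) e) * zpower (E b) (- e) = 1"
          using eq inv by simp
        moreover have "zpower (E b) e * (zpower (E b) (- e) * word_value E L * zpower (E b) e) * zpower (E b) (- e)
            = (zpower (E b) e * zpower (E b) (- e)) * word_value E L * (zpower (E b) e * zpower (E b) (- e))"
          by (simp only: mult.assoc)
        ultimately show ?thesis by (simp add: inv)
      qed
    qed
  qed
qed

section \<open>Freeness of the straight flows\<close>

text \<open>The signature of a straight segment of signed length \<open>t\<close> parallel to an
  axis.\<close>

definition exp_series :: "bool \<Rightarrow> real \<Rightarrow> word_series" where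
  "exp_series b t = Word_series (\<lambda>w. if set w \<subseteq> {b} then t ^ length w / fact (length w) else 0)"

lemma word_coeff_exp_series:
  "word_coeff (exp_series b t) w = (if set w \<subseteq> {b} then t ^ length w / fact (length w) else 0)"
  by (simp add: exp_series_def)

lemma exp_series_add: "exp_series b s * exp_series b t = exp_series b (s + t)"
proof (rule word_series_eqI)
  fix w
  show "word_coeff (exp_series b s * exp_series b t) w = word_coeff (exp_series b (s + t)) w"
  proof (cases "set w \<subseteq> {b}")
    case True
    have "word_coeff (exp_series b s * exp_series b t) w =
        (\<Sum>i\<le>length w. s ^ i / fact i * (t ^ (length w - i) / fact (length w - i)))"
      unfolding word_coeff_mult conv_sum
    proof (rule sum.cong[OF refl])
      fix i assume "i \<in> {..length w}"
      moreover have "set (take i w) \<subseteq> {b}" "set (drop i w) \<subseteq> {b}"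
        using True set_take_subset[of i w] set_drop_subset[of i w] by auto
      ultimately show "word_coeff (exp_series b s) (take i w) * word_coeff (exp_series b t) (drop i w) =
          s ^ i / fact i * (t ^ (length w - i) / fact (length w - i))"
        by (simp add: word_coeff_exp_series)
    qed
    also have "\<dots> = (\<Sum>i\<le>length w. of_nat (length w choose i) * s ^ i * t ^ (length w - i) / fact (length w))"
      by (intro sum.cong) (auto simp: binomial_fact field_simps)
    also have "\<dots> = (s + t) ^ length w / fact (length w)"
      by (simp add: binomial_ring sum_divide_distrib)
    finally show ?thesis using True by (simp add: word_coeff_exp_series)
  next
    case False
    have "word_coeff (exp_series b s) (take i w) * word_coeff (exp_series b t) (drop i w) = 0" for i
    proof -
      have "\<not> (set (take i w) \<subseteq> {b} \<and> set (drop i w) \<subseteq> {b})"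
        using False by (metis append_take_drop_id le_sup_iff set_append)
      then show ?thesis by (auto simp: word_coeff_exp_series)
    qed
    then have "word_coeff (exp_series b s * exp_series b t) w = 0"
      unfolding word_coeff_mult conv_sum by (intro sum.neutral ballI)
    then show ?thesis using False by (simp add: word_coeff_exp_series)
  qed
qed

lemma exp_series_0: "exp_series b 0 = 1"
  by (rule word_series_eqI) (auto simp: word_coeff_exp_series word_coeff_one power_0_left)

lemma exp_series_zpower: "zpower (exp_series b t) e = exp_series b (of_int e * t)"
proof -
  have E: "word_coeff (exp_series b t) [] = 1" by (simp add: word_coeff_exp_series)
  show ?thesis
  proof (induction e rule: int_induct[where k = 0])
    case base
    then show ?case by (simp add: exp_series_0)
  next
    case (step1 i)
    then show ?case by (simp add: zpower_add_one[OF E] exp_series_add) (simp add: algebra_simps)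
  next
    case (step2 i)
    have "zpower (exp_series b t) (i - 1) * (exp_series b t * exp_series b (- t)) =
        zpower (exp_series b t) i * exp_series b (- t)"
      using zpower_add_one[OF E, of "i - 1"] by (simp flip: mult.assoc)
    then show ?case by (simp add: step2 exp_series_add exp_series_0 algebra_simps)
  qed
qed

text \<open>The product of \<open>k + i * q\<close> over \<open>i < n\<close>, with \<open>q\<close>
  the weight of the letter; the rising factorial in \<open>k / q\<close> is the form in which it
  meets the binomial series.\<close>

lemma field_coeff_replicate:
  "field_coeff k (replicate n b) =
     real (letter_weight b) ^ n * pochhammer (real k / real (letter_weight b)) n"
  by (induction n)
    (auto simp: pochhammer_Suc weight_def sum_list_replicate field_simps)

lemma transport_exp_series:
  "transport (exp_series b t) k d =
     (if letter_weight b dvd d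
      then (real (letter_weight b) * t) ^ (d div letter_weight b) / fact (d div letter_weight b) *
        pochhammer (real k / real (letter_weight b)) (d div letter_weight b)
      else 0)"
proof -
  let ?q = "letter_weight b"
  have rep: "w = replicate (length w) b" if "set w \<subseteq> {b}" for w
    using that by (intro replicate_length_same[symmetric]) auto
  have wr: "weight (replicate n b) = n * ?q" for n
    by (simp add: weight_def sum_list_replicate)
  have "transport (exp_series b t) k d =
     (\<Sum>w\<in>(if ?q dvd d then {replicate (d div ?q) b} else {}). word_coeff (exp_series b t) w * field_coeff k w)"
    unfolding transport_def
  proof (rule sum.mono_neutral_right)
    show "finite {w. weight w = d}" by (rule finite_weight_eq)
    show "(if ?q dvd d then {replicate (d div ?q) b} else {}) \<subseteq> {w. weight w = d}"
      by (auto simp: wr)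
    show "\<forall>w\<in>{w. weight w = d} - (if ?q dvd d then {replicate (d div ?q) b} else {}).
        word_coeff (exp_series b t) w * field_coeff k w = 0"
    proof
      fix w assume w: "w \<in> {w. weight w = d} - (if ?q dvd d then {replicate (d div ?q) b} else {})"
      have "\<not> set w \<subseteq> {b}"
      proof
        assume "set w \<subseteq> {b}"
        then have w': "w = replicate (length w) b" using rep by blast
        then have "d = length w * ?q" using w wr by (metis (mono_tags, lifting) DiffE mem_Collect_eq)
        then have "?q dvd d" "d div ?q = length w" by simp_all
        then show False using w w' by auto
      qed
      then show "word_coeff (exp_series b t) w * field_coeff k w = 0"
        by (simp add: word_coeff_exp_series)
    qed
  qed
  then show ?thesis
    by (auto simp: word_coeff_exp_series field_coeff_replicate power_mult_distrib)
qed

text \<open>The operator of \<open>S\<close> is substitution of \<open>F\<close>: it takes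
  \<open>v^k\<close> to \<open>F^k\<close>. Having this for all \<open>k\<close> at once is what
  makes composition work in \<open>represents_mult\<close>.\<close>

definition represents :: "word_series \<Rightarrow> complex fps \<Rightarrow> bool" where
  "represents S F \<longleftrightarrow> fps_nth F 0 = 0 \<and>
     (\<forall>k d. fps_nth (F ^ k) (k + d) = of_real (transport S k d))"

text \<open>\<open>S * R\<close> lets \<open>R\<close> act first, which turns \<open>v^k\<close>
  into \<open>G^k\<close>; then \<open>S\<close> replaces \<open>v\<close> by
  \<open>F\<close>.\<close>

lemma represents_mult:
  assumes "represents S F" "represents R G"
  shows "represents (S * R) (G oo F)"
  unfolding represents_def
proof (intro conjI allI)
  show "fps_nth (G oo F) 0 = 0" using assms by (simp add: represents_def)
  fix k d
  have F0: "fps_nth F 0 = 0" and G0: "fps_nth G 0 = 0" using assms by (auto simp: represents_def)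
  have "fps_nth ((G oo F) ^ k) (k + d) = (\<Sum>i=0..k+d. fps_nth (G ^ k) i * fps_nth (F ^ i) (k + d))"
    by (simp add: fps_compose_power[OF F0] fps_compose_nth)
  also have "\<dots> = (\<Sum>i\<in>{k..k+d}. fps_nth (G ^ k) i * fps_nth (F ^ i) (k + d))"
    using startsby_zero_power_prefix[OF G0, of k] by (intro sum.mono_neutral_right) auto
  also have "\<dots> = (\<Sum>e\<le>d. fps_nth (G ^ k) (k + e) * fps_nth (F ^ (k + e)) ((k + e) + (d - e)))"
    by (rule sum.reindex_bij_witness[where i = "\<lambda>e. k + e" and j = "\<lambda>i. i - k"]) (auto simp: add.commute)
  also have "\<dots> = of_real (transport (S * R) k d)"
  proof -
    have "fps_nth (G ^ k) (k + e) = of_real (transport R k e)"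
      "fps_nth (F ^ i) (i + e) = of_real (transport S i e)" for k i e
      using assms by (simp_all add: represents_def)
    then show ?thesis by (simp only: transport_mult of_real_sum of_real_mult)
  qed
  finally show "fps_nth ((G oo F) ^ k) (k + d) = of_real (transport (S * R) k d)" .
qed

text \<open>The solution of \<open>v' = v^(q + 1)\<close> at time \<open>t\<close>, where
  \<open>q\<close> is the weight of the letter:
  \<open>v * (1 - q * t * v^q)^(- 1/q)\<close>.\<close>

definition flow_fps :: "bool \<Rightarrow> real \<Rightarrow> complex fps" where
  "flow_fps b t = fps_X * (fps_binomial (- 1 / of_nat (letter_weight b)) oo
      (fps_const (- of_real (real (letter_weight b) * t)) * fps_X ^ letter_weight b))"

definition flow :: "bool \<Rightarrow> real \<Rightarrow> complex \<Rightarrow> complex" where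
  "flow b t v = v * (1 + (- of_real (real (letter_weight b) * t)) * v ^ letter_weight b) powr
      (- 1 / of_nat (letter_weight b))"

lemma flow_has_fps_expansion: "flow b t has_fps_expansion flow_fps b t"
proof -
  have "(\<lambda>v. v * ((\<lambda>x. (1 + x) powr (- 1 / of_nat (letter_weight b))) \<circ>
      (\<lambda>v. (- of_real (real (letter_weight b) * t)) * v ^ letter_weight b)) v) has_fps_expansion flow_fps b t"
    unfolding flow_fps_def by (intro fps_expansion_intros) auto
  then show ?thesis by (simp add: flow_def[abs_def])
qed

lemma represents_exp_series: "represents (exp_series b t) (flow_fps b t)"
  unfolding represents_def
proof (intro conjI allI)
  let ?q = "letter_weight b"
  show "fps_nth (flow_fps b t) 0 = 0" by (simp add: flow_fps_def)
  fix k d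
  define a where "a = (- of_real (real ?q * t) :: complex)"
  define c where "c = (- 1 / of_nat ?q :: complex)"
  have a0: "fps_nth (fps_const a * fps_X ^ ?q) 0 = 0" by (simp add: letter_weight_def)
  have "flow_fps b t ^ k = fps_X ^ k * (fps_binomial (of_nat k * c) oo (fps_const a * fps_X ^ ?q))"
    unfolding flow_fps_def a_def[symmetric] c_def[symmetric]
    by (simp add: power_mult_distrib fps_compose_power[OF a0] fps_binomial_power del: fps_const_neg)
  moreover have "fps_binomial (of_nat k * c) oo (fps_const a * fps_X ^ ?q) =
      (fps_binomial (of_nat k * c) oo (fps_const a * fps_X)) oo fps_X ^ ?q"
    by (subst fps_compose_assoc[symmetric]) (auto simp: fps_compose_mult_distrib)
  ultimately have "fps_nth (flow_fps b t ^ k) (k + d) =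
      (if ?q dvd d then a ^ (d div ?q) * ((of_nat k * c) gchoose (d div ?q)) else 0)"
    by (simp add: fps_X_power_mult_nth fps_nth_compose_X_power fps_compose_linear)
  also have "\<dots> = of_real (transport (exp_series b t) k d)"
  proof (cases "?q dvd d")
    case True
    define n where "n = d div ?q"
    have "a ^ n * ((of_nat k * c) gchoose n) = (- a) ^ n * (pochhammer (of_nat k / of_nat ?q) n / fact n)"
      unfolding gbinomial_pochhammer by (simp add: c_def flip: power_mult_distrib)
    also have "\<dots> = of_real ((real ?q * t) ^ n / fact n * pochhammer (real k / real ?q) n)"
      by (simp add: a_def pochhammer_of_real[symmetric])
    finally show ?thesis using True by (simp add: transport_exp_series n_def)
  qed (simp add: transport_exp_series)
  finally show "fps_nth (flow_fps b t ^ k) (k + d) = of_real (transport (exp_series b t) k d)" .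
qed

lemma flow_at_0:
  "\<forall>\<^sub>F v in at 0. flow b t v \<noteq> 0 \<and>
     inverse (flow b t v) = (if b then near_sqrt (inverse v) (of_real (2 * t)) else inverse v - of_real t)"
proof -
  define g where "g v = 1 + (- of_real (real (letter_weight b) * t)) * v ^ letter_weight b" for v :: complex
  have "(g \<longlongrightarrow> g 0) (at 0)" unfolding g_def by (intro tendsto_intros)
  moreover have "g 0 = 1" by (simp add: g_def)
  ultimately have "\<forall>\<^sub>F v in at 0. g v \<noteq> 0" using tendsto_imp_eventually_ne[of g 1 "at 0" 0] by simp
  moreover have "\<forall>\<^sub>F v in at 0. v \<noteq> (0::complex)" by (simp add: eventually_at_filter)
  ultimately show ?thesis
  proof eventually_elim
    case (elim v)
    have f: "flow b t v = v * g v powr (- 1 / of_nat (letter_weight b))" by (simp add: flow_def g_def)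
    then have "flow b t v \<noteq> 0" using elim by simp
    moreover have "inverse (flow b t v) = (if b then near_sqrt (inverse v) (of_real (2 * t)) else inverse v - of_real t)"
    proof (cases b)
      case True
      have "inverse (flow b t v) = inverse v * g v powr (1 / 2)"
        unfolding f using elim by (simp add: letter_weight_def True powr_minus)
      also have "\<dots> = near_sqrt (inverse v) (of_real (2 * t))"
        unfolding near_sqrt_def csqrt_conv_powr g_def using elim
        by (simp add: letter_weight_def True field_simps)
      finally show ?thesis using True by simp
    next
      case False
      have "inverse (flow b t v) = inverse v * g v"
        unfolding f using elim by (simp add: letter_weight_def False powr_minus)
      then show ?thesis using False elim by (simp add: g_def letter_weight_def field_simps)
    qed
    ultimately show ?case by simp
  qed
qed

text \<open>In the coordinate \<open>x = 1/v\<close> the two flows are translation and \<open>x \<mapsto> sqrt (x\<^sup>2 - 2t)\<close>.\<close>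

theorem free_flows:
  assumes ps: "ps \<noteq> []" "\<forall>(m, n)\<in>set ps. m \<noteq> 0 \<and> n \<noteq> 0"
    and inert: "\<And>s t. inert (word_value (\<lambda>b. if b = b0 then exp_series False s else exp_series True t) (interleave b0 ps))"
  shows False
proof -
  define k where "k = length ps"
  define m n where "m j = real_of_int (fst (ps ! j))" and "n j = real_of_int (snd (ps ! j))" for j
  define B where "B = 1 + (\<Sum>j<k. \<bar>m j\<bar> + \<bar>n j\<bar>)"
  have k: "1 \<le> k" using ps by (simp add: k_def Suc_le_eq)
  have "B \<ge> 1" unfolding B_def by (simp add: sum_nonneg)
  have bound: "\<bar>m j\<bar> \<le> B \<and> \<bar>n j\<bar> \<le> B" if "j < k" for j
  proof -
    have "\<bar>m j\<bar> + \<bar>n j\<bar> \<le> (\<Sum>j<k. \<bar>m j\<bar> + \<bar>n j\<bar>)"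
      using that by (intro member_le_sum[of j]) auto
    then show ?thesis
      unfolding B_def using abs_ge_zero[of "m j"] abs_ge_zero[of "n j"] by linarith
  qed
  have nz: "m j \<noteq> 0" "n j \<noteq> 0" if "j < k" for j
    using ps(2) that nth_mem[of j ps] by (cases "ps ! j"; force simp: m_def n_def k_def)+
  have "identity_chain k B m n"
  proof (rule identity_chainI[OF \<open>B \<ge> 1\<close>])
    show "0 < (1::real)" by simp
    fix e :: real assume "0 < e" "e < 1" "e < 1"
    \<comment> \<open>The time of the second flow is \<open>e / 2\<close> because in
      \<open>1/v\<close> it is \<open>sqrt (x\<^sup>2 - 2 * t)\<close>, while \<open>chain\<close>
      has \<open>e * n j\<close> under the root.\<close>
    define E where "E b = (if b = b0 then exp_series False 1 else exp_series True (e / 2))" for b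
    \<comment> \<open>Each prefix of the word is followed in three guises: as a series, as the power
      series \<open>F\<close> representing it, and as a function \<open>\<phi>\<close> near 0 with
      that expansion, which in \<open>1/v\<close> is \<open>chain\<close>.\<close>
    have "\<exists>F \<phi>. represents (word_value E (interleave b0 (take j ps))) F \<and> \<phi> has_fps_expansion F \<and>
        (\<forall>\<^sub>F v in at 0. \<phi> v \<noteq> 0 \<and> inverse (\<phi> v) = chain m n (of_real e) (inverse v) j)"
      if "j \<le> k" for j
      using that
    proof (induction j)
      case 0
      have "\<forall>\<^sub>F v in at 0. v \<noteq> (0::complex)" by (simp add: eventually_at_filter)
      moreover have "represents 1 fps_X"
        unfolding represents_def transport_one by (auto simp: fps_X_power_nth)
      ultimately show ?case
        by (intro exI[of _ fps_X] exI[of _ "\<lambda>v. v"]) (auto intro: fps_expansion_intros)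
    next
      case (Suc j)
      then obtain F \<phi> where F: "represents (word_value E (interleave b0 (take j ps))) F"
        and \<phi>: "\<phi> has_fps_expansion F"
        and ev: "\<forall>\<^sub>F v in at 0. \<phi> v \<noteq> 0 \<and> inverse (\<phi> v) = chain m n (of_real e) (inverse v) j"
        by auto
      define G H where "G = flow_fps False (m j)" and "H = flow_fps True (n j * (e / 2))"
      define \<gamma> where "\<gamma> = flow False (m j)"
      define \<eta> where "\<eta> = flow True (n j * (e / 2))"
      have j: "j < length ps" using Suc.prems by (simp add: k_def)
      have take_Suc: "interleave b0 (take (Suc j) ps) =
          interleave b0 (take j ps) @ [(b0, fst (ps ! j)), (\<not> b0, snd (ps ! j))]"
        using j by (cases "ps ! j") (simp add: take_Suc_conv_app_nth interleave_def)
      have zE: "zpower (E b0) (fst (ps ! j)) = exp_series False (m j)"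
        "zpower (E (\<not> b0)) (snd (ps ! j)) = exp_series True (n j * (e / 2))"
        by (simp_all add: E_def exp_series_zpower m_def n_def)
      have wv: "word_value E (interleave b0 (take (Suc j) ps)) =
          word_value E (interleave b0 (take j ps)) * exp_series False (m j) * exp_series True (n j * (e / 2))"
        by (simp add: take_Suc zE mult.assoc)
      have rep: "represents (word_value E (interleave b0 (take (Suc j) ps))) (H oo (G oo F))"
        unfolding wv G_def H_def by (intro represents_mult F represents_exp_series)
      have F0: "fps_nth F 0 = 0" using F by (simp add: represents_def)
      have G0: "fps_nth (G oo F) 0 = 0" by (simp add: G_def flow_fps_def)
      have ex1: "(\<gamma> \<circ> \<phi>) has_fps_expansion (G oo F)"
        unfolding \<gamma>_def G_def by (intro has_fps_expansion_compose flow_has_fps_expansion \<phi> F0)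
      have ex2: "(\<eta> \<circ> (\<gamma> \<circ> \<phi>)) has_fps_expansion (H oo (G oo F))"
        unfolding \<eta>_def H_def by (intro has_fps_expansion_compose flow_has_fps_expansion ex1 G0)
      have lim: "filterlim f (at 0) (at 0)"
        if "f has_fps_expansion K" "fps_nth K 0 = 0" "\<forall>\<^sub>F v in at 0. f v \<noteq> 0" for f :: "complex \<Rightarrow> complex" and K
      proof -
        have "isCont f 0" using has_fps_expansion_imp_continuous[OF that(1)] by simp
        moreover have "f 0 = 0" using has_fps_expansion_imp_0_eq_fps_nth_0[OF that(1)] that(2) by simp
        ultimately have "(f \<longlongrightarrow> 0) (at 0)" by (simp add: isCont_def)
        then show ?thesis using that(3) by (simp add: filterlim_at eventually_conj_iff)
      qed
      have lim1: "filterlim \<phi> (at 0) (at 0)"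
        by (rule lim[OF \<phi> F0], rule eventually_mono[OF ev]) simp
      have ev1: "\<forall>\<^sub>F v in at 0. \<gamma> (\<phi> v) \<noteq> 0 \<and> inverse (\<gamma> (\<phi> v)) = inverse (\<phi> v) - of_real (m j)"
        using filterlim_iff[THEN iffD1, OF lim1, rule_format, OF flow_at_0[of False "m j"]]
        by (simp add: \<gamma>_def)
      have lim2: "filterlim (\<gamma> \<circ> \<phi>) (at 0) (at 0)"
        by (rule lim[OF ex1 G0], rule eventually_mono[OF ev1]) simp
      have ev2: "\<forall>\<^sub>F v in at 0. \<eta> (\<gamma> (\<phi> v)) \<noteq> 0 \<and>
          inverse (\<eta> (\<gamma> (\<phi> v))) = near_sqrt (inverse (\<gamma> (\<phi> v))) (of_real (n j * e))"
        using filterlim_iff[THEN iffD1, OF lim2, rule_format, OF flow_at_0[of True "n j * (e / 2)"]]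
        by (simp add: \<eta>_def)
      have "\<forall>\<^sub>F v in at 0. (\<eta> \<circ> (\<gamma> \<circ> \<phi>)) v \<noteq> 0 \<and>
          inverse ((\<eta> \<circ> (\<gamma> \<circ> \<phi>)) v) = chain m n (of_real e) (inverse v) (Suc j)"
        using ev ev1 ev2 by eventually_elim (simp add: mult.commute)
      then show ?case using rep ex2 by blast
    qed
    from this[of k] obtain F \<phi> where F: "represents (word_value E (interleave b0 ps)) F"
      and \<phi>: "\<phi> has_fps_expansion F"
      and ev: "\<forall>\<^sub>F v in at 0. \<phi> v \<noteq> 0 \<and> inverse (\<phi> v) = chain m n (of_real e) (inverse v) k"
      by (auto simp: k_def)
    have "transport (word_value E (interleave b0 ps)) = transport 1"
      using inert[of 1 "e / 2"] by (simp add: inert_def E_def[abs_def])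
    then have F1: "fps_nth F (1 + d) = (if d = 0 then 1 else 0)" for d
    proof -
      have "fps_nth (F ^ 1) (1 + d) = of_real (transport 1 1 d)"
        using F unfolding represents_def \<open>transport _ = transport 1\<close> by blast
      then show ?thesis by (simp add: transport_one)
    qed
    have "F = fps_X"
    proof (rule fps_ext)
      fix i
      show "fps_nth F i = fps_nth fps_X i"
        using F F1[of "i - 1"] by (cases i) (auto simp: represents_def)
    qed
    then have "\<forall>\<^sub>F v in nhds 0. \<phi> v = v"
      using \<phi> by (auto simp: has_fps_expansion_def elim: eventually_mono)
    then have "\<forall>\<^sub>F v in at 0. \<phi> v = v" by (simp add: eventually_at_filter eventually_mono)
    with ev have "\<forall>\<^sub>F v in at 0. inverse v = chain m n (of_real e) (inverse v) k"
      by eventually_elim simp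
    then obtain r where r: "r > 0" "\<And>v. v \<noteq> 0 \<Longrightarrow> norm v < r \<Longrightarrow> inverse v = chain m n (of_real e) (inverse v) k"
      by (auto simp: eventually_at)
    \<comment> \<open>Large \<open>x\<close> correspond to \<open>v = 1/x\<close> with
      \<open>norm v < r\<close>, where the identity of functions holds.\<close>
    define R where "R = max ((2 * real k + 3) * B) (inverse r)"
    have Rpos: "R > 0" using r by (simp add: R_def less_max_iff_disj)
    show "\<exists>U. open U \<and> U \<noteq> {} \<and> U \<subseteq> {x. norm x > (2 * real k + 3) * B} \<and>
          (\<forall>x\<in>U. chain m n (of_real e) x k = x)"
    proof (intro exI conjI ballI)
      show "open {x::complex. norm x > R}" by (intro open_Collect_less continuous_intros)
      have "norm (of_real (R + 1) :: complex) = R + 1"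
        using Rpos unfolding norm_of_real by simp
      then have "of_real (R + 1) \<in> {x::complex. norm x > R}"
        unfolding mem_Collect_eq by linarith
      then show "{x::complex. norm x > R} \<noteq> {}" by blast
      show "{x. norm x > R} \<subseteq> {x::complex. norm x > (2 * real k + 3) * B}" by (auto simp: R_def)
      fix x :: complex assume "x \<in> {x. norm x > R}"
      then have x: "norm x > R" "norm x > inverse r" by (auto simp: R_def)
      then have "x \<noteq> 0" using Rpos by auto
      moreover have "norm (inverse x) < r"
        using less_imp_inverse_less[OF x(2)] r(1) by (simp add: norm_inverse)
      ultimately show "chain m n (of_real e) x k = x" using r(2)[of "inverse x"] by simp
    qed
  qed (use bound in auto)
  then show False
    using not_identity_chain[OF k \<open>B \<ge> 1\<close>, of m n] bound nz by auto
qed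

section \<open>Absolutely continuous functions\<close>

lemma negligible_outer_open:
  fixes N :: "real set"
  assumes "negligible N" "\<delta> > 0"
  obtains U where "open U" "N \<subseteq> U" "U \<in> lmeasurable" "measure lebesgue U < \<delta>"
proof -
  have Ns: "N \<in> null_sets lebesgue" using assms by (simp add: negligible_iff_null_sets)
  obtain U where U: "open U" "N \<subseteq> U" "U - N \<in> lmeasurable" "emeasure lebesgue (U - N) < \<delta>"
    using sets_lebesgue_outer_open[of N \<delta>] assms negligible_imp_sets by metis
  have "(U - N) \<union> N \<in> lmeasurable"
    using U(3) negligible_imp_measurable[OF assms(1)] by (rule fmeasurable.Un)
  moreover have "(U - N) \<union> N = U" using U(2) by auto
  ultimately have "U \<in> lmeasurable" by simp
  moreover have "measure lebesgue (U - N) < \<delta>"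
    using U(3,4) assms by (simp add: emeasure_eq_measure2 ennreal_less_iff)
  then have "measure lebesgue U < \<delta>"
    using \<open>U \<in> lmeasurable\<close> Ns by (simp add: fmeasurableD measure_Diff_null_set)
  ultimately show thesis using U that by blast
qed

text \<open>Proved with gauge integrals. Intervals tagged outside \<open>N\<close> are controlled by
  differentiability at the tag; those tagged in \<open>N\<close> lie in an open set of measure below
  \<open>\<delta>\<close>, so absolute continuity bounds the total increment of \<open>f\<close>
  over them.\<close>

lemma fundamental_theorem_absolutely_continuous:
  fixes f g :: "real \<Rightarrow> real"
  assumes ab: "a \<le> b" and ac: "absolutely_continuous_fun_on a b f" and N: "negligible N"
    and deriv: "\<And>x. x \<in> {a..b} - N \<Longrightarrow> (f has_real_derivative g x) (at x within {a..b})"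
  shows "(g has_integral f b - f a) {a..b}"
proof (cases "a = b")
  case True
  then show ?thesis using has_integral_refl(1)[of g b] by simp
next
  case False
  then have L: "b - a > 0" using ab by simp
  \<comment> \<open>The value 0 on \<open>N\<close> removes the Riemann terms at exceptional tags;
    at the end it is undone as a change on a negligible set.\<close>
  define g0 where "g0 x = (if x \<in> N then 0 else g x)" for x
  have "(g0 has_integral f b - f a) {a..b}"
    unfolding has_integral_factor_content_real
  proof (intro allI impI)
    fix e :: real assume "e > 0"
    obtain \<delta> where \<delta>: "\<delta> > 0" and ac\<delta>: "\<And>I. finite I \<Longrightarrow> (\<forall>(x, y)\<in>I. a \<le> x \<and> x \<le> y \<and> y \<le> b) \<Longrightarrow>
        disjoint_family_on (\<lambda>(x, y). {x<..<y}) I \<Longrightarrow> (\<Sum>(x, y)\<in>I. y - x) < \<delta> \<Longrightarrow>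
        (\<Sum>(x, y)\<in>I. \<bar>f y - f x\<bar>) < e / 2 * (b - a)"
      using ac[unfolded absolutely_continuous_fun_on_def, rule_format, of "e / 2 * (b - a)"] \<open>e > 0\<close> L
      by (metis (no_types, lifting) divide_pos_pos mult_pos_pos zero_less_numeral)
    obtain U where U: "open U" "N \<subseteq> U" "U \<in> lmeasurable" "measure lebesgue U < \<delta>"
      using negligible_outer_open[OF N \<delta>] .
    have "\<exists>d>0. x \<in> {a..b} - N \<longrightarrow>
        (\<forall>y\<in>{a..b}. norm (y - x) < d \<longrightarrow> norm (f y - f x - g x * (y - x)) \<le> e / 2 * norm (y - x))" for x
    proof (cases "x \<in> {a..b} - N")
      case True
      then have "(f has_derivative (*) (g x)) (at x within {a..b})"
        using deriv by (simp add: has_field_derivative_def)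
      then show ?thesis
        using \<open>e > 0\<close> unfolding has_derivative_within_alt by (metis half_gt_zero)
    qed (auto intro: exI[of _ 1])
    then obtain r where r: "\<And>x. 0 < r x" "\<And>x y. x \<in> {a..b} - N \<Longrightarrow> y \<in> {a..b} \<Longrightarrow> norm (y - x) < r x \<Longrightarrow>
        norm (f y - f x - g x * (y - x)) \<le> e / 2 * norm (y - x)"
      by metis
    define d where "d x = (if x \<in> N then U else ball x (r x))" for x
    have gauge: "gauge d" using U r by (auto simp: gauge_def d_def)
    show "\<exists>d. gauge d \<and> (\<forall>p. p tagged_division_of {a..b} \<and> d fine p \<longrightarrow>
        norm ((\<Sum>(x, k)\<in>p. measure lborel k *\<^sub>R g0 x) - (f b - f a)) \<le> e * measure lborel {a..b})"
    proof (intro exI[of _ d] conjI gauge allI impI, elim conjE)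
      fix p assume p: "p tagged_division_of {a..b}" and fine: "d fine p"
      have fin: "finite p" using p by (rule tagged_division_of_finite)
      have intv: "\<exists>u v. k = {u..v} \<and> u \<le> v \<and> u \<le> x \<and> x \<le> v \<and> a \<le> u \<and> v \<le> b \<and> k \<subseteq> d x"
        if xk: "(x, k) \<in> p" for x k
      proof -
        have "x \<in> k" "k \<subseteq> {a..b}" using tagged_division_ofD(2,3)[OF p that] .
        moreover obtain u v where "k = {u..v}" using tagged_division_ofD(4)[OF p xk] unfolding box_real by blast
        moreover have "k \<subseteq> d x" using fine that unfolding fine_def by blast
        ultimately show ?thesis by auto
      qed
      define D where "D = (\<lambda>(x, k). measure lborel k * g0 x - (f (Sup k) - f (Inf k)) :: real)"
      define q where "q = {z \<in> p. fst z \<in> N}"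
      have "norm (sum D (p - q)) \<le> (\<Sum>z\<in>p - q. e / 2 * measure lborel (snd z))"
      proof (rule sum_norm_le)
        fix z assume "z \<in> p - q"
        then obtain x k where z: "z = (x, k)" "(x, k) \<in> p" "x \<notin> N" by (cases z) (auto simp: q_def)
        obtain u v where k: "k = {u..v}" "u \<le> x" "x \<le> v" "a \<le> u" "v \<le> b" "k \<subseteq> ball x (r x)"
          using intv[OF z(2)] z(3) by (auto simp: d_def)
        have x: "x \<in> {a..b} - N" using k z by auto
        have "norm (f u - f x - g x * (u - x)) \<le> e / 2 * (x - u)"
          "norm (f v - f x - g x * (v - x)) \<le> e / 2 * (v - x)"
        proof -
          have "u \<in> k" "v \<in> k" using k by auto
          then have "dist x u < r x" "dist x v < r x" using k(6) by auto
          then show "norm (f u - f x - g x * (u - x)) \<le> e / 2 * (x - u)"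
            "norm (f v - f x - g x * (v - x)) \<le> e / 2 * (v - x)"
            using r(2)[OF x, of u] r(2)[OF x, of v] k by (auto simp: dist_real_def)
        qed
        moreover have "(v - u) * g x - (f v - f u) =
            (f u - f x - g x * (u - x)) - (f v - f x - g x * (v - x))"
          by (simp add: algebra_simps)
        moreover have "e / 2 * (v - u) = e / 2 * (x - u) + e / 2 * (v - x)"
          by (simp only: distrib_left[symmetric]) simp
        ultimately have "\<bar>(v - u) * g x - (f v - f u)\<bar> \<le> e / 2 * (v - u)"
          unfolding real_norm_def by linarith
        then show "norm (D z) \<le> e / 2 * measure lborel (snd z)"
          using k z by (simp add: D_def g0_def content_real)
      qed
      also have "\<dots> \<le> (\<Sum>z\<in>p. e / 2 * measure lborel (snd z))"
        using fin \<open>e > 0\<close> by (intro sum_mono2) auto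
      also have "\<dots> = e / 2 * (b - a)"
        using additive_content_tagged_division[of p a b] p ab
        unfolding sum_distrib_left[symmetric] by (simp add: split_def content_real)
      finally have 1: "norm (sum D (p - q)) \<le> e / 2 * (b - a)" .
      \<comment> \<open>Degenerate intervals carry no increment. Without them the endpoint map
        \<open>\<iota>\<close> is injective, so the intervals can be treated as a set of
        pairs.\<close>
      define q' where "q' = {z \<in> q. Inf (snd z) < Sup (snd z)}"
      define \<iota> where "\<iota> z = (Inf (snd z), Sup (snd z))" for z :: "real \<times> real set"
      have q': "finite q'" "q' \<subseteq> p" using fin by (auto simp: q'_def q_def)
      have q'_intv: "snd z = {Inf (snd z)..Sup (snd z)} \<and> a \<le> Inf (snd z) \<and> Inf (snd z) < Sup (snd z) \<and>
          Sup (snd z) \<le> b \<and> snd z \<subseteq> U" if "z \<in> q'" for z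
        using that intv[of "fst z" "snd z"] by (auto simp: q'_def q_def d_def)
      have disj: "{Inf (snd z)<..<Sup (snd z)} \<inter> {Inf (snd z')<..<Sup (snd z')} = {}"
        if "z \<in> q'" "z' \<in> q'" "z \<noteq> z'" for z z'
      proof -
        have "interior (snd z) \<inter> interior (snd z') = {}"
          using tagged_division_ofD(5)[OF p, of "fst z" "snd z" "fst z'" "snd z'"] that q'(2) by auto
        then show ?thesis using q'_intv[OF that(1)] q'_intv[OF that(2)] by (metis interior_atLeastAtMost_real)
      qed
      have inj: "inj_on \<iota> q'"
      proof (rule inj_onI, rule ccontr)
        fix z z' assume z: "z \<in> q'" "z' \<in> q'" "\<iota> z = \<iota> z'" "z \<noteq> z'"
        then have "{Inf (snd z)<..<Sup (snd z)} = {}" using disj[OF z(1,2,4)] by (auto simp: \<iota>_def)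
        then show False using q'_intv[OF z(1)] by auto
      qed
      have "norm (sum D q) \<le> (\<Sum>z\<in>q. \<bar>f (Sup (snd z)) - f (Inf (snd z))\<bar>)"
        by (rule sum_norm_le) (auto simp: D_def g0_def q_def split: prod.splits)
      also have "\<dots> = (\<Sum>z\<in>q'. \<bar>f (Sup (snd z)) - f (Inf (snd z))\<bar>)"
      proof (rule sum.mono_neutral_right)
        show "\<forall>z\<in>q - q'. \<bar>f (Sup (snd z)) - f (Inf (snd z))\<bar> = 0"
        proof
          fix z assume z: "z \<in> q - q'"
          then obtain u v where "snd z = {u..v}" "u \<le> v" using intv[of "fst z" "snd z"] by (auto simp: q_def)
          then show "\<bar>f (Sup (snd z)) - f (Inf (snd z))\<bar> = 0" using z by (auto simp: q'_def)
        qed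
      qed (use fin in \<open>auto simp: q_def q'_def\<close>)
      also have "\<dots> = (\<Sum>(x, y)\<in>\<iota> ` q'. \<bar>f y - f x\<bar>)"
        unfolding sum.reindex[OF inj] by (simp add: \<iota>_def)
      also have "\<dots> < e / 2 * (b - a)"
      proof (rule ac\<delta>)
        show "finite (\<iota> ` q')" using q' by simp
        show "\<forall>(x, y)\<in>\<iota> ` q'. a \<le> x \<and> x \<le> y \<and> y \<le> b"
          using q'_intv by (force simp: \<iota>_def)
        show "disjoint_family_on (\<lambda>(x, y). {x<..<y}) (\<iota> ` q')"
          unfolding disjoint_family_on_def using disj by (fastforce simp: \<iota>_def)
        have "(\<Sum>(x, y)\<in>\<iota> ` q'. y - x) = (\<Sum>z\<in>q'. measure lebesgue {Inf (snd z)<..<Sup (snd z)})"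
          unfolding sum.reindex[OF inj] using q'_intv
          by (auto simp: \<iota>_def less_imp_le intro!: sum.cong)
        also have "\<dots> = measure lebesgue (\<Union>z\<in>q'. {Inf (snd z)<..<Sup (snd z)})"
          by (rule measure_negligible_finite_Union_image[symmetric])
            (use q' disj in \<open>auto simp: pairwise_def\<close>)
        also have "\<dots> \<le> measure lebesgue U"
        proof (rule measure_mono_fmeasurable)
          show "(\<Union>z\<in>q'. {Inf (snd z)<..<Sup (snd z)}) \<subseteq> U"
          proof
            fix x assume "x \<in> (\<Union>z\<in>q'. {Inf (snd z)<..<Sup (snd z)})"
            then obtain z where "z \<in> q'" "x \<in> {Inf (snd z)..Sup (snd z)}" by force
            then show "x \<in> U" using q'_intv[of z] by auto
          qed
        qed (use U q' in \<open>auto intro!: sets.finite_UN\<close>)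
        finally show "(\<Sum>(x, y)\<in>\<iota> ` q'. y - x) < \<delta>" using U by simp
      qed
      finally have 2: "norm (sum D q) \<le> e / 2 * (b - a)" by simp
      have "(\<Sum>(x, k)\<in>p. measure lborel k *\<^sub>R g0 x) - (f b - f a) = sum D p"
        unfolding additive_tagged_division_1[OF ab p, of f, symmetric] D_def
        by (simp add: sum_subtractf split_def)
      also have "\<dots> = sum D (p - q) + sum D q"
        using fin by (intro sum.subset_diff) (auto simp: q_def)
      finally show "norm ((\<Sum>(x, k)\<in>p. measure lborel k *\<^sub>R g0 x) - (f b - f a)) \<le> e * measure lborel {a..b}"
        using 1 2 norm_triangle_ineq[of "sum D (p - q)" "sum D q"] ab by (simp add: content_real)
    qed
  qed
  then show ?thesis
    by (rule has_integral_spike[OF N, rotated]) (auto simp: g0_def)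
qed

section \<open>Increments along a Lipschitz path\<close>

text \<open>\<open>driven p q \<gamma> f G\<close> expresses \<open>df = G\<^sub>1 d\<gamma>\<^sub>1 + G\<^sub>2 d\<gamma>\<^sub>2\<close> on \<open>[p, q]\<close> through increments up to
  a quadratic error, which avoids differentiating measurable integrals almost everywhere.\<close>

definition driven :: "real \<Rightarrow> real \<Rightarrow> (bool \<Rightarrow> real \<Rightarrow> real) \<Rightarrow> (real \<Rightarrow> real) \<Rightarrow> (bool \<Rightarrow> real \<Rightarrow> real) \<Rightarrow> bool" where
  "driven p q \<gamma> f G \<longleftrightarrow>
     (\<exists>B. \<forall>t. p \<le> t \<longrightarrow> t \<le> q \<longrightarrow> \<bar>f t\<bar> \<le> B \<and> (\<forall>b. \<bar>G b t\<bar> \<le> B)) \<and>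
     (\<exists>K. \<forall>s t. p \<le> s \<longrightarrow> s \<le> t \<longrightarrow> t \<le> q \<longrightarrow>
        \<bar>f t - f s - (\<Sum>b\<in>UNIV. G b t * (\<gamma> b t - \<gamma> b s))\<bar> \<le> K * (t - s)\<^sup>2)"

text \<open>Over \<open>N\<close> equal pieces the quadratic terms add up to at most
  \<open>\<bar>K\<bar> * L\<^sup>2 / N\<close>, which tends to 0, and the linear ones to
  \<open>R * L\<close>. With \<open>R = 0\<close> this replaces the argument that a function with
  zero derivative is constant.\<close>

lemma increments_small:
  fixes f :: "real \<Rightarrow> real"
  assumes pq: "p \<le> q" and inc: "\<And>s t. p \<le> s \<Longrightarrow> s \<le> t \<Longrightarrow> t \<le> q \<Longrightarrow> \<bar>f t - f s\<bar> \<le> K * (t - s)\<^sup>2 + R * (t - s)"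
  shows "\<bar>f q - f p\<bar> \<le> R * (q - p)"
proof (rule field_le_epsilon)
  fix e :: real assume "e > 0"
  define L where "L = q - p"
  have L: "L \<ge> 0" using pq by (simp add: L_def)
  obtain N :: nat where N: "\<bar>K\<bar> * L\<^sup>2 / e < N" using reals_Archimedean2 by blast
  have "0 \<le> \<bar>K\<bar> * L\<^sup>2 / e" using \<open>e > 0\<close> by simp
  then have N0: "N > 0" using N by (metis gr0I not_less of_nat_0)
  define x where "x i = p + real i * (L / N)" for i
  have dx: "x (Suc i) - x i = L / N" for i by (simp add: x_def distrib_right add_divide_distrib)
  have LN: "0 \<le> L / N" using L by simp
  have x: "p \<le> x i" "x i \<le> x (Suc i)" for i
    using dx[of i] LN mult_nonneg_nonneg[of "real i" "L / N"] by (auto simp: x_def)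
  have xq: "x i \<le> q" if "i \<le> N" for i
  proof -
    have "real i * (L / N) \<le> real N * (L / N)" using that L by (intro mult_right_mono) auto
    then show ?thesis using N0 by (simp add: x_def L_def)
  qed
  have "f q - f p = f (x N) - f (x 0)" using N0 by (simp add: x_def L_def)
  also have "\<dots> = (\<Sum>i<N. f (x (Suc i)) - f (x i))" by (rule sum_lessThan_telescope[symmetric])
  also have "\<bar>\<dots>\<bar> \<le> (\<Sum>i<N. \<bar>f (x (Suc i)) - f (x i)\<bar>)" by (rule sum_abs)
  also have "\<dots> \<le> (\<Sum>i<N. \<bar>K\<bar> * (L / N)\<^sup>2 + R * (L / N))"
  proof (rule sum_mono)
    fix i assume "i \<in> {..<N}"
    then have "\<bar>f (x (Suc i)) - f (x i)\<bar> \<le> K * (x (Suc i) - x i)\<^sup>2 + R * (x (Suc i) - x i)"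
      using x xq[of "Suc i"] by (intro inc) auto
    also have "\<dots> \<le> \<bar>K\<bar> * (L / N)\<^sup>2 + R * (L / N)" unfolding dx by (simp add: mult_right_mono)
    finally show "\<bar>f (x (Suc i)) - f (x i)\<bar> \<le> \<bar>K\<bar> * (L / N)\<^sup>2 + R * (L / N)" .
  qed
  also have "\<dots> = \<bar>K\<bar> * L\<^sup>2 / N + R * L"
    using N0 by (simp add: field_simps power2_eq_square)
  also have "\<bar>K\<bar> * L\<^sup>2 / N \<le> e" using N N0 \<open>e > 0\<close> by (simp add: field_simps)
  finally show "\<bar>f q - f p\<bar> \<le> R * (q - p) + e" by (simp add: L_def)
qed

locale lipschitz_path =
  fixes p q C :: real and \<gamma> :: "bool \<Rightarrow> real \<Rightarrow> real"
  assumes pq: "p \<le> q" and C: "0 \<le> C"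
    and lip: "\<And>b s t. p \<le> s \<Longrightarrow> s \<le> t \<Longrightarrow> t \<le> q \<Longrightarrow> \<bar>\<gamma> b t - \<gamma> b s\<bar> \<le> C * (t - s)"
begin

text \<open>Besides the defining bounds this extracts a Lipschitz bound for \<open>f\<close>: on a
  bounded interval the quadratic error is linear, and the two letters contribute
  \<open>2 * (B * C)\<close>.\<close>

lemma drivenD:
  assumes "driven p q \<gamma> f G"
  obtains B K where "B \<ge> 0" "K \<ge> 0" "\<And>t. p \<le> t \<Longrightarrow> t \<le> q \<Longrightarrow> \<bar>f t\<bar> \<le> B"
    "\<And>t b. p \<le> t \<Longrightarrow> t \<le> q \<Longrightarrow> \<bar>G b t\<bar> \<le> B"
    "\<And>s t. p \<le> s \<Longrightarrow> s \<le> t \<Longrightarrow> t \<le> q \<Longrightarrow> \<bar>f t - f s - (\<Sum>b\<in>UNIV. G b t * (\<gamma> b t - \<gamma> b s))\<bar> \<le> K * (t - s)\<^sup>2"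
    "\<And>s t. p \<le> s \<Longrightarrow> s \<le> t \<Longrightarrow> t \<le> q \<Longrightarrow> \<bar>f t - f s\<bar> \<le> K * (t - s)"
proof -
  obtain B K where BK: "\<And>t. p \<le> t \<Longrightarrow> t \<le> q \<Longrightarrow> \<bar>f t\<bar> \<le> B \<and> (\<forall>b. \<bar>G b t\<bar> \<le> B)"
    "\<And>s t. p \<le> s \<Longrightarrow> s \<le> t \<Longrightarrow> t \<le> q \<Longrightarrow> \<bar>f t - f s - (\<Sum>b\<in>UNIV. G b t * (\<gamma> b t - \<gamma> b s))\<bar> \<le> K * (t - s)\<^sup>2"
    using assms unfolding driven_def by blast
  have B: "B \<ge> 0" using BK(1)[of p] pq by force
  define K' where "K' = \<bar>K\<bar> + \<bar>K\<bar> * (q - p) + 2 * (B * C)"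
  have K'0: "K' \<ge> 0" using B C pq by (simp add: K'_def)
  have lip': "\<bar>f t - f s\<bar> \<le> K' * (t - s)" if "p \<le> s" "s \<le> t" "t \<le> q" for s t
  proof -
    have "\<bar>\<Sum>b\<in>UNIV. G b t * (\<gamma> b t - \<gamma> b s)\<bar> \<le> (\<Sum>b\<in>(UNIV :: bool set). B * (C * (t - s)))"
    proof (rule order.trans[OF sum_abs], rule sum_mono)
      fix b
      show "\<bar>G b t * (\<gamma> b t - \<gamma> b s)\<bar> \<le> B * (C * (t - s))"
        unfolding abs_mult using BK(1)[of t] lip[of s t b] that B C by (intro mult_mono) auto
    qed
    then have 1: "\<bar>\<Sum>b\<in>UNIV. G b t * (\<gamma> b t - \<gamma> b s)\<bar> \<le> 2 * (B * C) * (t - s)" by (simp add: UNIV_bool)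
    have "K * (t - s)\<^sup>2 \<le> \<bar>K\<bar> * ((q - p) * (t - s))"
      unfolding power2_eq_square using that by (intro mult_mono mult_right_mono) auto
    then have "K * (t - s)\<^sup>2 \<le> \<bar>K\<bar> * (q - p) * (t - s)" by (simp only: mult.assoc)
    moreover have "0 \<le> \<bar>K\<bar> * (t - s)" using that by simp
    ultimately show ?thesis using BK(2)[OF that] 1 unfolding K'_def distrib_right by linarith
  qed
  have quad: "\<bar>f t - f s - (\<Sum>b\<in>UNIV. G b t * (\<gamma> b t - \<gamma> b s))\<bar> \<le> K' * (t - s)\<^sup>2"
    if "p \<le> s" "s \<le> t" "t \<le> q" for s t
  proof -
    have "K \<le> K'" using B C pq abs_ge_self[of K] unfolding K'_def
      by (smt (verit) mult_nonneg_nonneg)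
    then have "K * (t - s)\<^sup>2 \<le> K' * (t - s)\<^sup>2" by (intro mult_right_mono) auto
    then show ?thesis using BK(2)[OF that] by linarith
  qed
  show thesis using that[OF B K'0 _ _ quad lip'] BK(1) by blast
qed

lemma drivenI:
  assumes "\<And>t. p \<le> t \<Longrightarrow> t \<le> q \<Longrightarrow> \<bar>f t\<bar> \<le> B" "\<And>t b. p \<le> t \<Longrightarrow> t \<le> q \<Longrightarrow> \<bar>G b t\<bar> \<le> B'"
    and "\<And>s t. p \<le> s \<Longrightarrow> s \<le> t \<Longrightarrow> t \<le> q \<Longrightarrow>
      \<bar>f t - f s - (\<Sum>b\<in>UNIV. G b t * (\<gamma> b t - \<gamma> b s))\<bar> \<le> K * (t - s)\<^sup>2"
  shows "driven p q \<gamma> f G"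
  unfolding driven_def
proof
  show "\<exists>B. \<forall>t. p \<le> t \<longrightarrow> t \<le> q \<longrightarrow> \<bar>f t\<bar> \<le> B \<and> (\<forall>b. \<bar>G b t\<bar> \<le> B)"
    using assms(1,2) by (intro exI[of _ "max B B'"]) (auto simp: le_max_iff_disj)
qed (use assms(3) in blast)

lemma driven_const [intro]: "driven p q \<gamma> (\<lambda>_. c) (\<lambda>_ _. 0)"
  by (rule drivenI[of _ "\<bar>c\<bar>" _ 0 0]) auto

lemma driven_add:
  assumes "driven p q \<gamma> f G" "driven p q \<gamma> g H"
  shows "driven p q \<gamma> (\<lambda>t. f t + g t) (\<lambda>b t. G b t + H b t)"
proof -
  obtain B K where f: "B \<ge> 0" "K \<ge> 0" "\<And>t. p \<le> t \<Longrightarrow> t \<le> q \<Longrightarrow> \<bar>f t\<bar> \<le> B"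
    "\<And>t b. p \<le> t \<Longrightarrow> t \<le> q \<Longrightarrow> \<bar>G b t\<bar> \<le> B"
    "\<And>s t. p \<le> s \<Longrightarrow> s \<le> t \<Longrightarrow> t \<le> q \<Longrightarrow> \<bar>f t - f s - (\<Sum>b\<in>UNIV. G b t * (\<gamma> b t - \<gamma> b s))\<bar> \<le> K * (t - s)\<^sup>2"
    "\<And>s t. p \<le> s \<Longrightarrow> s \<le> t \<Longrightarrow> t \<le> q \<Longrightarrow> \<bar>f t - f s\<bar> \<le> K * (t - s)"
    using drivenD[OF assms(1)] by blast
  obtain B' K' where g: "B' \<ge> 0" "K' \<ge> 0" "\<And>t. p \<le> t \<Longrightarrow> t \<le> q \<Longrightarrow> \<bar>g t\<bar> \<le> B'"
    "\<And>t b. p \<le> t \<Longrightarrow> t \<le> q \<Longrightarrow> \<bar>H b t\<bar> \<le> B'"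
    "\<And>s t. p \<le> s \<Longrightarrow> s \<le> t \<Longrightarrow> t \<le> q \<Longrightarrow> \<bar>g t - g s - (\<Sum>b\<in>UNIV. H b t * (\<gamma> b t - \<gamma> b s))\<bar> \<le> K' * (t - s)\<^sup>2"
    "\<And>s t. p \<le> s \<Longrightarrow> s \<le> t \<Longrightarrow> t \<le> q \<Longrightarrow> \<bar>g t - g s\<bar> \<le> K' * (t - s)"
    using drivenD[OF assms(2)] by blast
  show ?thesis
  proof (rule drivenI[of _ "B + B'" _ "B + B'" "K + K'"])
    show "\<bar>f t + g t\<bar> \<le> B + B'" "\<bar>G b t + H b t\<bar> \<le> B + B'" if "p \<le> t" "t \<le> q" for b t
      using f(3)[OF that] g(3)[OF that] f(4)[OF that, of b] g(4)[OF that, of b] by linarith+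
    show "\<bar>f t + g t - (f s + g s) - (\<Sum>b\<in>UNIV. (G b t + H b t) * (\<gamma> b t - \<gamma> b s))\<bar> \<le> (K + K') * (t - s)\<^sup>2"
      if "p \<le> s" "s \<le> t" "t \<le> q" for s t
      using f(5)[OF that] g(5)[OF that] unfolding distrib_right sum.distrib by linarith
  qed
qed

text \<open>With coefficients taken at the right endpoint, the product rule leaves the extra term
  \<open>(f t - f s) * (g t - g s)\<close>, which is quadratic by the Lipschitz bounds.\<close>

lemma driven_mult:
  assumes "driven p q \<gamma> f G" "driven p q \<gamma> g H"
  shows "driven p q \<gamma> (\<lambda>t. f t * g t) (\<lambda>b t. G b t * g t + f t * H b t)"
proof -
  obtain B K where f: "B \<ge> 0" "K \<ge> 0" "\<And>t. p \<le> t \<Longrightarrow> t \<le> q \<Longrightarrow> \<bar>f t\<bar> \<le> B"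
    "\<And>t b. p \<le> t \<Longrightarrow> t \<le> q \<Longrightarrow> \<bar>G b t\<bar> \<le> B"
    "\<And>s t. p \<le> s \<Longrightarrow> s \<le> t \<Longrightarrow> t \<le> q \<Longrightarrow> \<bar>f t - f s - (\<Sum>b\<in>UNIV. G b t * (\<gamma> b t - \<gamma> b s))\<bar> \<le> K * (t - s)\<^sup>2"
    "\<And>s t. p \<le> s \<Longrightarrow> s \<le> t \<Longrightarrow> t \<le> q \<Longrightarrow> \<bar>f t - f s\<bar> \<le> K * (t - s)"
    using drivenD[OF assms(1)] by blast
  obtain B' K' where g: "B' \<ge> 0" "K' \<ge> 0" "\<And>t. p \<le> t \<Longrightarrow> t \<le> q \<Longrightarrow> \<bar>g t\<bar> \<le> B'"
    "\<And>t b. p \<le> t \<Longrightarrow> t \<le> q \<Longrightarrow> \<bar>H b t\<bar> \<le> B'"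
    "\<And>s t. p \<le> s \<Longrightarrow> s \<le> t \<Longrightarrow> t \<le> q \<Longrightarrow> \<bar>g t - g s - (\<Sum>b\<in>UNIV. H b t * (\<gamma> b t - \<gamma> b s))\<bar> \<le> K' * (t - s)\<^sup>2"
    "\<And>s t. p \<le> s \<Longrightarrow> s \<le> t \<Longrightarrow> t \<le> q \<Longrightarrow> \<bar>g t - g s\<bar> \<le> K' * (t - s)"
    using drivenD[OF assms(2)] by blast
  show ?thesis
  proof (rule drivenI[of _ "B * B'" _ "2 * (B * B')" "K * B' + B * K' + K * K'"])
    show "\<bar>f t * g t\<bar> \<le> B * B'" if "p \<le> t" "t \<le> q" for t
      unfolding abs_mult using f(1,3) g(1,3) that by (intro mult_mono) auto
    show "\<bar>G b t * g t + f t * H b t\<bar> \<le> 2 * (B * B')" if "p \<le> t" "t \<le> q" for b t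
    proof -
      have "\<bar>G b t * g t\<bar> \<le> B * B'" "\<bar>f t * H b t\<bar> \<le> B * B'"
        unfolding abs_mult using f(1,3,4) g(1,3,4) that by (intro mult_mono; auto)+
      then show ?thesis by linarith
    qed
    show "\<bar>f t * g t - f s * g s - (\<Sum>b\<in>UNIV. (G b t * g t + f t * H b t) * (\<gamma> b t - \<gamma> b s))\<bar>
        \<le> (K * B' + B * K' + K * K') * (t - s)\<^sup>2" if st: "p \<le> s" "s \<le> t" "t \<le> q" for s t
    proof -
      define X where "X = f t - f s - (\<Sum>b\<in>UNIV. G b t * (\<gamma> b t - \<gamma> b s))"
      define Y where "Y = g t - g s - (\<Sum>b\<in>UNIV. H b t * (\<gamma> b t - \<gamma> b s))"
      have "f t * g t - f s * g s - (\<Sum>b\<in>UNIV. (G b t * g t + f t * H b t) * (\<gamma> b t - \<gamma> b s)) =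
          X * g t + f t * Y - (f t - f s) * (g t - g s)"
        by (simp add: X_def Y_def UNIV_bool algebra_simps)
      moreover have "\<bar>X * g t\<bar> \<le> K * (t - s)\<^sup>2 * B'"
        unfolding abs_mult X_def using f(2) f(5)[OF st] g(3)[of t] st by (intro mult_mono) auto
      moreover have "\<bar>f t * Y\<bar> \<le> B * (K' * (t - s)\<^sup>2)"
        unfolding abs_mult Y_def using f(1) f(3)[of t] g(5)[OF st] st by (intro mult_mono) auto
      moreover have "\<bar>(f t - f s) * (g t - g s)\<bar> \<le> (K * (t - s)) * (K' * (t - s))"
        unfolding abs_mult using f(2) f(6)[OF st] g(6)[OF st] st by (intro mult_mono) auto
      moreover have "K * (t - s)\<^sup>2 * B' + B * (K' * (t - s)\<^sup>2) + (K * (t - s)) * (K' * (t - s))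
          = (K * B' + B * K' + K * K') * (t - s)\<^sup>2"
        by (simp add: power2_eq_square algebra_simps)
      ultimately show ?thesis by linarith
    qed
  qed
qed

lemma driven_sum:
  assumes "finite A" "\<And>i. i \<in> A \<Longrightarrow> driven p q \<gamma> (f i) (G i)"
  shows "driven p q \<gamma> (\<lambda>t. \<Sum>i\<in>A. f i t) (\<lambda>b t. \<Sum>i\<in>A. G i b t)"
  using assms by (induction A rule: finite_induct) (auto intro!: driven_add)

lemma driven_power:
  assumes "driven p q \<gamma> f G"
  shows "driven p q \<gamma> (\<lambda>t. f t ^ k) (\<lambda>b t. real k * f t ^ (k - 1) * G b t)"
proof (induction k)
  case 0
  show ?case using driven_const[of 1] by simp
next
  case (Suc k)
  have "G b t * f t ^ k + f t * (real k * f t ^ (k - 1) * G b t) = real (Suc k) * f t ^ (Suc k - 1) * G b t" for b t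
    by (cases k) (auto simp: algebra_simps)
  then show ?case using driven_mult[OF assms Suc] by simp
qed

text \<open>Plays the role of estimating the integral of \<open>G\<close> along the path; the factor
  2 counts the letters.\<close>

lemma driven_increment:
  assumes "driven p q \<gamma> f G" "\<And>t b. p \<le> t \<Longrightarrow> t \<le> q \<Longrightarrow> \<bar>G b t\<bar> \<le> R"
  shows "\<bar>f q - f p\<bar> \<le> 2 * R * C * (q - p)"
proof -
  obtain B K where f: "B \<ge> 0" "K \<ge> 0" "\<And>t. p \<le> t \<Longrightarrow> t \<le> q \<Longrightarrow> \<bar>f t\<bar> \<le> B"
    "\<And>t b. p \<le> t \<Longrightarrow> t \<le> q \<Longrightarrow> \<bar>G b t\<bar> \<le> B"
    "\<And>s t. p \<le> s \<Longrightarrow> s \<le> t \<Longrightarrow> t \<le> q \<Longrightarrow> \<bar>f t - f s - (\<Sum>b\<in>UNIV. G b t * (\<gamma> b t - \<gamma> b s))\<bar> \<le> K * (t - s)\<^sup>2"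
    "\<And>s t. p \<le> s \<Longrightarrow> s \<le> t \<Longrightarrow> t \<le> q \<Longrightarrow> \<bar>f t - f s\<bar> \<le> K * (t - s)"
    using drivenD[OF assms(1)] by blast
  have R: "R \<ge> 0" using assms(2)[of p] pq by force
  show ?thesis
  proof (rule increments_small[OF pq])
    fix s t assume st: "p \<le> s" "s \<le> t" "t \<le> q"
    have "\<bar>\<Sum>b\<in>UNIV. G b t * (\<gamma> b t - \<gamma> b s)\<bar> \<le> (\<Sum>b\<in>(UNIV :: bool set). R * (C * (t - s)))"
    proof (rule order.trans[OF sum_abs], rule sum_mono)
      fix b
      show "\<bar>G b t * (\<gamma> b t - \<gamma> b s)\<bar> \<le> R * (C * (t - s))"
        unfolding abs_mult using assms(2)[of t b] lip[of s t b] st R C by (intro mult_mono) auto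
    qed
    then show "\<bar>f t - f s\<bar> \<le> K * (t - s)\<^sup>2 + 2 * R * C * (t - s)"
      using f(5)[OF st] by (simp add: UNIV_bool algebra_simps)
  qed
qed

lemma driven_zero_constant:
  assumes "driven p q \<gamma> f (\<lambda>_ _. 0)"
  shows "f q = f p"
  using driven_increment[OF assms, of 0] by simp

end

lemma driven_subinterval:
  assumes "driven p q \<gamma> f G" "p \<le> p'" "q' \<le> q"
  shows "driven p' q' \<gamma> f G"
  using assms unfolding driven_def by (meson order_trans)

section \<open>Abel equations\<close>

lemma bounded_measurable_integrable:
  fixes f :: "real \<Rightarrow> real"
  assumes f: "f \<in> borel_measurable (lebesgue_on {p..q})" and B: "\<And>t. p \<le> t \<Longrightarrow> t \<le> q \<Longrightarrow> \<bar>f t\<bar> \<le> B"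
    and st: "p \<le> s" "t \<le> q"
  shows "f integrable_on {s..t}" "(LINT u|lebesgue_on {s..t}. f u) = integral {s..t} f"
proof -
  have "f \<in> borel_measurable (lebesgue_on {s..t})"
    using f st by (intro measurable_restrict_mono[OF f]) auto
  moreover have "finite_measure (lebesgue_on {s..t})"
    by (rule finite_measure_lebesgue_on) (simp add: lmeasurable_interval)
  moreover have "AE x in lebesgue_on {s..t}. norm (f x) \<le> B"
    using B st by (intro AE_I2) auto
  ultimately have "integrable (lebesgue_on {s..t}) f"
    by (intro finite_measure.integrable_const_bound)
  then show "f integrable_on {s..t}" "(LINT u|lebesgue_on {s..t}. f u) = integral {s..t} f"
    by (auto intro: integrable_on_lebesgue_on lebesgue_integral_eq_integral)
qed

lemma integral_split:
  fixes f :: "real \<Rightarrow> real"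
  assumes "f integrable_on {p..q}" "p \<le> s" "s \<le> q"
  shows "integral {p..q} f = integral {p..s} f + integral {s..q} f"
  using Henstock_Kurzweil_Integration.integral_combine[of p s q f] assms by simp

lemma abs_integral_le:
  fixes f :: "real \<Rightarrow> real"
  assumes "f integrable_on {s..t}" "s \<le> t" "\<And>u. s \<le> u \<Longrightarrow> u \<le> t \<Longrightarrow> \<bar>f u\<bar> \<le> B"
  shows "\<bar>integral {s..t} f\<bar> \<le> B * (t - s)"
proof -
  have "B \<ge> 0" using assms(2) assms(3)[of s] by force
  then show ?thesis
    using has_integral_bound_real[of B "{}" f "integral {s..t} f" s t] integrable_integral[OF assms(1)] assms(2,3)
    by (auto simp: content_real)
qed

locale abel_equation =
  fixes T :: real and a :: "nat \<Rightarrow> real \<Rightarrow> real"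
  assumes T: "T > 0"
    and meas: "bounded_lebesgue_measurable_on {0..T} (a 1)" "bounded_lebesgue_measurable_on {0..T} (a 2)"
begin

definition \<alpha> where "\<alpha> b = a (letter_weight b)"

definition \<gamma> where "\<gamma> b t = integral {0..t} (\<alpha> b)"

text \<open>The lower limit is the variable: the recursion of \<open>iterated_integral\<close> moves
  it, so \<open>J\<close> satisfies a differential equation in \<open>s\<close> with final value at
  \<open>T\<close>.\<close>

definition J where "J s w = iterated_integral T a s (map letter_weight w)"

lemma \<alpha>_measurable: "\<alpha> b \<in> borel_measurable (lebesgue_on {0..T})"
  using meas by (cases b) (auto simp: \<alpha>_def letter_weight_def bounded_lebesgue_measurable_on_def)

lemma \<alpha>_bound_ex: "\<exists>C\<ge>1. \<forall>b t. 0 \<le> t \<longrightarrow> t \<le> T \<longrightarrow> \<bar>\<alpha> b t\<bar> \<le> C"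
proof -
  obtain B1 B2 where "\<forall>x\<in>a 1 ` {0..T}. norm x \<le> B1" "\<forall>x\<in>a 2 ` {0..T}. norm x \<le> B2"
    using meas unfolding bounded_lebesgue_measurable_on_def bounded_iff by blast
  then have "\<bar>\<alpha> b t\<bar> \<le> max 1 (max B1 B2)" if "0 \<le> t" "t \<le> T" for b t
    using that by (cases b) (force simp: \<alpha>_def letter_weight_def le_max_iff_disj)+
  then show ?thesis by (intro exI[of _ "max 1 (max B1 B2)"]) auto
qed

definition C where "C = (SOME c. c \<ge> 1 \<and> (\<forall>b t. 0 \<le> t \<longrightarrow> t \<le> T \<longrightarrow> \<bar>\<alpha> b t\<bar> \<le> c))"

lemma C_ge: "C \<ge> 1" and \<alpha>_bound: "0 \<le> t \<Longrightarrow> t \<le> T \<Longrightarrow> \<bar>\<alpha> b t\<bar> \<le> C"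
  using someI_ex[OF \<alpha>_bound_ex] unfolding C_def by blast+

lemma \<alpha>_integrable: "0 \<le> s \<Longrightarrow> t \<le> T \<Longrightarrow> \<alpha> b integrable_on {s..t}"
  using bounded_measurable_integrable(1)[OF \<alpha>_measurable, where B = C] \<alpha>_bound by blast

lemma \<gamma>_diff:
  assumes "0 \<le> s" "s \<le> t" "t \<le> T"
  shows "\<gamma> b t - \<gamma> b s = integral {s..t} (\<alpha> b)"
  using integral_split[OF \<alpha>_integrable[of 0 t b] assms(1,2)] assms by (simp add: \<gamma>_def)

lemma \<gamma>_lip:
  assumes "0 \<le> s" "s \<le> t" "t \<le> T"
  shows "\<bar>\<gamma> b t - \<gamma> b s\<bar> \<le> C * (t - s)"
  unfolding \<gamma>_diff[OF assms] using assms \<alpha>_bound by (intro abs_integral_le \<alpha>_integrable) auto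

sublocale lipschitz_path 0 T C \<gamma>
  using T C_ge \<gamma>_lip by unfold_locales auto

lemma \<gamma>_0 [simp]: "\<gamma> b 0 = 0"
  by (simp add: \<gamma>_def)

lemma abel_path_eq:
  assumes "0 \<le> t" "t \<le> T"
  shows "abel_path a t = (\<gamma> False t, \<gamma> True t)"
proof -
  have "(LINT u|lebesgue_on {0..t}. \<alpha> b u) = \<gamma> b t" for b
    using bounded_measurable_integrable(2)[OF \<alpha>_measurable \<alpha>_bound, of 0 t b] assms by (simp add: \<gamma>_def)
  from this[of False] this[of True] show ?thesis
    by (simp add: abel_path_def \<alpha>_def letter_weight_def)
qed

lemma J_Nil [simp]: "J s [] = 1"
  by (simp add: J_def)

text \<open>On \<open>[s, t]\<close> the factor \<open>f\<close> differs from its value at an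
  endpoint by at most \<open>\<bar>K\<bar> * (t - s)\<close>, so freezing it there costs a quadratic
  error. This is how integrals against \<open>\<alpha>\<close> become driven by
  \<open>\<gamma>\<close>.\<close>

lemma increment_of_product_integral:
  assumes f: "\<forall>s t. 0 \<le> s \<longrightarrow> s \<le> t \<longrightarrow> t \<le> T \<longrightarrow> \<bar>f t - f s\<bar> \<le> K * (t - s)"
    and st: "0 \<le> s" "s \<le> t" "t \<le> T"
  shows "(\<lambda>u. f u * \<alpha> b u) integrable_on {s..t}"
    "(LINT u|lebesgue_on {s..t}. f u * \<alpha> b u) = integral {s..t} (\<lambda>u. f u * \<alpha> b u)"
    "\<bar>integral {s..t} (\<lambda>u. f u * \<alpha> b u) - f t * (\<gamma> b t - \<gamma> b s)\<bar> \<le> \<bar>K\<bar> * C * (t - s)\<^sup>2"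
    "\<bar>integral {s..t} (\<lambda>u. f u * \<alpha> b u) - f s * (\<gamma> b t - \<gamma> b s)\<bar> \<le> \<bar>K\<bar> * C * (t - s)\<^sup>2"
proof -
  have lipK: "\<bar>f u - f v\<bar> \<le> \<bar>K\<bar> * \<bar>u - v\<bar>" if "0 \<le> u" "0 \<le> v" "u \<le> T" "v \<le> T" for u v
  proof (cases "u \<le> v")
    case True
    then have "\<bar>f v - f u\<bar> \<le> K * (v - u)" using f that by blast
    also have "\<dots> \<le> \<bar>K\<bar> * (v - u)" using True by (intro mult_right_mono) auto
    finally show ?thesis using True by (simp add: abs_minus_commute)
  next
    case False
    then have "\<bar>f u - f v\<bar> \<le> K * (u - v)" using f that False by (auto simp: not_le)
    also have "\<dots> \<le> \<bar>K\<bar> * (u - v)" using False by (intro mult_right_mono) auto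
    finally show ?thesis using False by simp
  qed
  have "\<bar>K\<bar>-lipschitz_on {0..T} f"
    by (intro lipschitz_onI) (use lipK in \<open>auto simp: dist_real_def\<close>)
  then have cont: "continuous_on {0..T} f" by (rule lipschitz_on_continuous_on)
  then have fm: "f \<in> borel_measurable (lebesgue_on {0..T})"
    by (intro continuous_imp_measurable_on_sets_lebesgue) auto
  then have m: "(\<lambda>u. f u * \<alpha> b u) \<in> borel_measurable (lebesgue_on {0..T})"
    using \<alpha>_measurable by (intro borel_measurable_times)
  have bd: "\<bar>f u * \<alpha> b u\<bar> \<le> (\<bar>f 0\<bar> + \<bar>K\<bar> * T) * C" if "0 \<le> u" "u \<le> T" for u
  proof -
    have "\<bar>K\<bar> * u \<le> \<bar>K\<bar> * T" using that by (intro mult_left_mono) auto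
    then have "\<bar>f u\<bar> \<le> \<bar>f 0\<bar> + \<bar>K\<bar> * T" using lipK[of u 0] that by simp
    then show ?thesis unfolding abs_mult using \<alpha>_bound[of u b] that T by (intro mult_mono) auto
  qed
  note int = bounded_measurable_integrable[OF m bd]
  show i: "(\<lambda>u. f u * \<alpha> b u) integrable_on {s..t}"
    "(LINT u|lebesgue_on {s..t}. f u * \<alpha> b u) = integral {s..t} (\<lambda>u. f u * \<alpha> b u)"
    using int[of s t] st by auto
  have *: "\<bar>integral {s..t} (\<lambda>u. f u * \<alpha> b u) - f v * (\<gamma> b t - \<gamma> b s)\<bar> \<le> \<bar>K\<bar> * C * (t - s)\<^sup>2"
    if v: "s \<le> v" "v \<le> t" for v
  proof -
    have "integral {s..t} (\<lambda>u. f u * \<alpha> b u) - f v * (\<gamma> b t - \<gamma> b s) =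
        integral {s..t} (\<lambda>u. f u * \<alpha> b u - f v * \<alpha> b u)"
      unfolding \<gamma>_diff[OF st]
      using i(1) \<alpha>_integrable[OF st(1,3), of b]
      by (subst Henstock_Kurzweil_Integration.integral_diff) (auto intro: integrable_on_mult_right)
    also have "\<bar>\<dots>\<bar> \<le> (\<bar>K\<bar> * (t - s) * C) * (t - s)"
    proof (rule abs_integral_le)
      show "(\<lambda>u. f u * \<alpha> b u - f v * \<alpha> b u) integrable_on {s..t}"
        using i(1) \<alpha>_integrable[OF st(1,3), of b]
        by (intro integrable_diff) (auto intro: integrable_on_mult_right)
      fix u assume u: "s \<le> u" "u \<le> t"
      have "\<bar>u - v\<bar> \<le> t - s" using u v by (simp add: abs_le_iff)
      then have "\<bar>f u - f v\<bar> \<le> \<bar>K\<bar> * (t - s)"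
        using lipK[of u v] mult_left_mono[of "\<bar>u - v\<bar>" "t - s" "\<bar>K\<bar>"] u v st by linarith
      then have "\<bar>f u - f v\<bar> * \<bar>\<alpha> b u\<bar> \<le> \<bar>K\<bar> * (t - s) * C"
        using \<alpha>_bound[of u b] u st by (intro mult_mono) auto
      then show "\<bar>f u * \<alpha> b u - f v * \<alpha> b u\<bar> \<le> \<bar>K\<bar> * (t - s) * C"
        by (simp add: abs_mult[symmetric] left_diff_distrib)
    qed (use st in auto)
    also have "\<dots> = \<bar>K\<bar> * C * (t - s)\<^sup>2" by (simp add: power2_eq_square algebra_simps)
    finally show ?thesis .
  qed
  show "\<bar>integral {s..t} (\<lambda>u. f u * \<alpha> b u) - f t * (\<gamma> b t - \<gamma> b s)\<bar> \<le> \<bar>K\<bar> * C * (t - s)\<^sup>2"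
    "\<bar>integral {s..t} (\<lambda>u. f u * \<alpha> b u) - f s * (\<gamma> b t - \<gamma> b s)\<bar> \<le> \<bar>K\<bar> * C * (t - s)\<^sup>2"
    using *[of t] *[of s] st by auto
qed

text \<open>Differentiation in the lower limit gives minus the integrand, which strips the first
  letter.\<close>

definition J_coeff where
  "J_coeff w b t = (case w of [] \<Rightarrow> 0 | c # v \<Rightarrow> if b = c then - J t v else 0)"

lemma driven_J: "driven 0 T \<gamma> (\<lambda>s. J s w) (J_coeff w)"
proof (induction w)
  case Nil
  show ?case using driven_const[of 1] by (simp add: J_coeff_def[abs_def])
next
  case (Cons b w)
  obtain B K where J: "B \<ge> 0" "K \<ge> 0" "\<And>t. 0 \<le> t \<Longrightarrow> t \<le> T \<Longrightarrow> \<bar>J t w\<bar> \<le> B"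
    "\<And>t c. 0 \<le> t \<Longrightarrow> t \<le> T \<Longrightarrow> \<bar>J_coeff w c t\<bar> \<le> B"
    "\<And>s t. 0 \<le> s \<Longrightarrow> s \<le> t \<Longrightarrow> t \<le> T \<Longrightarrow> \<bar>J t w - J s w - (\<Sum>c\<in>UNIV. J_coeff w c t * (\<gamma> c t - \<gamma> c s))\<bar> \<le> K * (t - s)\<^sup>2"
    "\<And>s t. 0 \<le> s \<Longrightarrow> s \<le> t \<Longrightarrow> t \<le> T \<Longrightarrow> \<bar>J t w - J s w\<bar> \<le> K * (t - s)"
    using drivenD[OF Cons] by blast
  have "\<forall>s t. 0 \<le> s \<longrightarrow> s \<le> t \<longrightarrow> t \<le> T \<longrightarrow> \<bar>J t w - J s w\<bar> \<le> K * (t - s)"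
    using J(6) by blast
  note int = increment_of_product_integral[of "\<lambda>u. J u w", OF this]
  have JT: "J s (b # w) = integral {s..T} (\<lambda>u. J u w * \<alpha> b u)" if "0 \<le> s" "s \<le> T" for s
    using int(2)[of s T b] that by (simp add: J_def \<alpha>_def)
  have diff: "J t (b # w) - J s (b # w) = - integral {s..t} (\<lambda>u. J u w * \<alpha> b u)"
    if "0 \<le> s" "s \<le> t" "t \<le> T" for s t
    using integral_split[OF int(1)[of s T b], of t] JT that by simp
  show ?case
  proof (rule drivenI[of _ "B * C * T" _ B "\<bar>K\<bar> * C"])
    fix t assume t: "0 \<le> t" "t \<le> T"
    have "\<bar>J t (b # w)\<bar> \<le> (B * C) * (T - t)"
      unfolding JT[OF t]
    proof (rule abs_integral_le)
      show "(\<lambda>u. J u w * \<alpha> b u) integrable_on {t..T}" using int(1)[of t T b] t by auto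
      show "\<bar>J u w * \<alpha> b u\<bar> \<le> B * C" if "t \<le> u" "u \<le> T" for u
        unfolding abs_mult using J(1) J(3)[of u] \<alpha>_bound[of u b] t that by (intro mult_mono) auto
    qed (use t in auto)
    also have "\<dots> \<le> (B * C) * T" using J(1) C_ge t by (intro mult_left_mono) auto
    finally show "\<bar>J t (b # w)\<bar> \<le> B * C * T" .
    show "\<bar>J_coeff (b # w) c t\<bar> \<le> B" for c using J(1) J(3)[OF t] by (simp add: J_coeff_def)
  next
    fix s t assume st: "0 \<le> s" "s \<le> t" "t \<le> T"
    have "(\<Sum>c\<in>UNIV. J_coeff (b # w) c t * (\<gamma> c t - \<gamma> c s)) = - J t w * (\<gamma> b t - \<gamma> b s)"
      by (cases b) (simp_all add: UNIV_bool J_coeff_def)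
    then show "\<bar>J t (b # w) - J s (b # w) - (\<Sum>c\<in>UNIV. J_coeff (b # w) c t * (\<gamma> c t - \<gamma> c s))\<bar>
        \<le> \<bar>K\<bar> * C * (t - s)\<^sup>2"
      using int(3)[OF st, of b] unfolding diff[OF st] by (simp add: abs_minus_commute)
  qed
qed

lemma J_at_end: "J T w = (if w = [] then 1 else 0)"
proof (cases w)
  case (Cons b v)
  obtain B K where K: "B \<ge> 0" "K \<ge> 0" "\<And>t. 0 \<le> t \<Longrightarrow> t \<le> T \<Longrightarrow> \<bar>J t v\<bar> \<le> B"
    "\<And>t c. 0 \<le> t \<Longrightarrow> t \<le> T \<Longrightarrow> \<bar>J_coeff v c t\<bar> \<le> B"
    "\<And>s t. 0 \<le> s \<Longrightarrow> s \<le> t \<Longrightarrow> t \<le> T \<Longrightarrow> \<bar>J t v - J s v - (\<Sum>c\<in>UNIV. J_coeff v c t * (\<gamma> c t - \<gamma> c s))\<bar> \<le> K * (t - s)\<^sup>2"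
    "\<And>s t. 0 \<le> s \<Longrightarrow> s \<le> t \<Longrightarrow> t \<le> T \<Longrightarrow> \<bar>J t v - J s v\<bar> \<le> K * (t - s)"
    using drivenD[OF driven_J[of v]] by blast
  have "\<forall>s t. 0 \<le> s \<longrightarrow> s \<le> t \<longrightarrow> t \<le> T \<longrightarrow> \<bar>J t v - J s v\<bar> \<le> K * (t - s)"
    using K(6) by blast
  then show ?thesis
    using increment_of_product_integral(2)[of "\<lambda>u. J u v" K T T b] T
    by (simp add: Cons J_def \<alpha>_def)
qed simp

text \<open>The signature of the path from time \<open>s\<close> to the end; at \<open>s = 0\<close>
  it contains all iterated integrals in question.\<close>

definition holonomy where "holonomy s = Word_series (J s)"

lemma word_coeff_holonomy [simp]: "word_coeff (holonomy s) = J s"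
  by (simp add: holonomy_def)

lemma holonomy_end: "holonomy T = 1"
  by (rule word_series_eqI) (simp add: J_at_end word_coeff_one)

end

lemma absolutely_continuous_fun_on_subinterval:
  assumes "absolutely_continuous_fun_on p q f" "p \<le> s" "t \<le> q"
  shows "absolutely_continuous_fun_on s t f"
  unfolding absolutely_continuous_fun_on_def
proof (intro allI impI)
  fix e :: real assume "e > 0"
  then obtain d where d: "d > 0" "\<And>I. finite I \<Longrightarrow> (\<forall>(x, y)\<in>I. p \<le> x \<and> x \<le> y \<and> y \<le> q) \<Longrightarrow>
      disjoint_family_on (\<lambda>(x, y). {x<..<y}) I \<Longrightarrow> (\<Sum>(x, y)\<in>I. y - x) < d \<Longrightarrow>
      (\<Sum>(x, y)\<in>I. \<bar>f y - f x\<bar>) < e"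
    using assms(1) unfolding absolutely_continuous_fun_on_def by meson
  show "\<exists>\<delta>>0. \<forall>I. finite I \<longrightarrow> (\<forall>(x, y)\<in>I. s \<le> x \<and> x \<le> y \<and> y \<le> t) \<longrightarrow>
        disjoint_family_on (\<lambda>(x, y). {x<..<y}) I \<longrightarrow> (\<Sum>(x, y)\<in>I. y - x) < \<delta> \<longrightarrow>
        (\<Sum>(x, y)\<in>I. \<bar>f y - f x\<bar>) < e"
    using d assms(2,3) by (intro exI[of _ d]) fastforce
qed

lemma absolutely_continuous_fun_on_imp_continuous_on:
  assumes "absolutely_continuous_fun_on p q f"
  shows "continuous_on {p..q} f"
  unfolding continuous_on_iff
proof (intro ballI allI impI)
  fix x e :: real assume x: "x \<in> {p..q}" and "e > 0"
  obtain d where d: "d > 0" "\<And>I. finite I \<Longrightarrow> (\<forall>(x, y)\<in>I. p \<le> x \<and> x \<le> y \<and> y \<le> q) \<Longrightarrow>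
      disjoint_family_on (\<lambda>(x, y). {x<..<y}) I \<Longrightarrow> (\<Sum>(x, y)\<in>I. y - x) < d \<Longrightarrow>
      (\<Sum>(x, y)\<in>I. \<bar>f y - f x\<bar>) < e"
    using assms \<open>e > 0\<close> unfolding absolutely_continuous_fun_on_def by meson
  have "\<bar>f v - f u\<bar> < e" if "p \<le> u" "u \<le> v" "v \<le> q" "v - u < d" for u v
    using d(2)[of "{(u, v)}"] that by (auto simp: disjoint_family_on_def)
  then have "dist (f y) (f x) < e" if "y \<in> {p..q}" "dist y x < d" for y
    using that x by (cases "x \<le> y") (force simp: dist_real_def abs_minus_commute)+
  then show "\<exists>d>0. \<forall>x'\<in>{p..q}. dist x' x < d \<longrightarrow> dist (f x') (f x) < e"
    using d(1) by blast
qed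

text \<open>Letting \<open>x\<close> tend to 0 kills the constant coefficient; dividing by
  \<open>x\<close> then lowers the degree.\<close>

lemma polynomial_flat_at_0:
  fixes c :: "nat \<Rightarrow> real"
  assumes "r > 0" "\<And>x. 0 < x \<Longrightarrow> x < r \<Longrightarrow> \<bar>\<Sum>d\<le>n. c d * x ^ d\<bar> \<le> M * x ^ Suc n" "d \<le> n"
  shows "c d = 0"
  using assms(2,3)
proof (induction n arbitrary: c d)
  case (0 c d)
  have "((\<lambda>x. M * x ^ Suc 0) \<longlongrightarrow> M * 0 ^ Suc 0) (at_right 0)" by (intro tendsto_intros)
  moreover have "\<forall>\<^sub>F x in at_right 0. \<bar>c 0\<bar> \<le> M * x ^ Suc 0"
    using 0(1) assms(1) by (auto simp: eventually_at_right_field intro!: exI[of _ r])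
  ultimately have "\<bar>c 0\<bar> \<le> M * 0 ^ Suc 0"
    by (intro tendsto_lowerbound[where F = "at_right (0::real)"]) auto
  then show ?case using 0 by simp
next
  case (Suc n c d)
  define P where "P x = (\<Sum>d\<le>n. c (Suc d) * x ^ d)" for x
  have split: "(\<Sum>d\<le>Suc n. c d * x ^ d) = c 0 + x * P x" for x
    by (subst sum.atMost_Suc_shift) (simp add: P_def sum_distrib_left algebra_simps)
  have "((\<lambda>x. M * x ^ Suc (Suc n)) \<longlongrightarrow> M * 0 ^ Suc (Suc n)) (at_right 0)" by (intro tendsto_intros)
  moreover have "((\<lambda>x. \<bar>c 0 + x * P x\<bar>) \<longlongrightarrow> \<bar>c 0 + 0 * P 0\<bar>) (at_right 0)"
    unfolding P_def by (intro tendsto_intros)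
  moreover have "\<forall>\<^sub>F x in at_right 0. \<bar>c 0 + x * P x\<bar> \<le> M * x ^ Suc (Suc n)"
    using Suc(2) assms(1) unfolding split by (auto simp: eventually_at_right_field intro!: exI[of _ r])
  ultimately have "\<bar>c 0 + 0 * P 0\<bar> \<le> M * 0 ^ Suc (Suc n)"
    by (intro tendsto_le[where F = "at_right (0::real)"]) auto
  then have c0: "c 0 = 0" by simp
  have "\<bar>\<Sum>d\<le>n. c (Suc d) * x ^ d\<bar> \<le> M * x ^ Suc n" if "0 < x" "x < r" for x
  proof -
    have "\<bar>x * P x\<bar> \<le> M * x ^ Suc (Suc n)" using Suc(2)[OF that] unfolding split by (simp add: c0)
    then have "x * \<bar>P x\<bar> \<le> x * (M * x ^ Suc n)" using that by (simp add: abs_mult algebra_simps)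
    then show ?thesis using that by (simp add: P_def)
  qed
  from Suc.IH[of "\<lambda>d. c (Suc d)", OF this] show ?case
    using c0 Suc(3) by (cases d) auto
qed

context abel_equation
begin

section \<open>Solutions of the Abel equation and their expansion in the initial value\<close>

context
  fixes v :: "real \<Rightarrow> real"
  assumes v: "abel_solution T a v"
begin

lemma solution_continuous: "continuous_on {0..T} v"
  using v absolutely_continuous_fun_on_imp_continuous_on by (auto simp: abel_solution_def)

lemma solution_has_integral:
  assumes st: "0 \<le> s" "s \<le> t" "t \<le> T"
  shows "((\<lambda>u. \<Sum>b\<in>UNIV. v u ^ (1 + letter_weight b) * \<alpha> b u) has_integral v t - v s) {s..t}"
proof -
  define F where "F u = (\<Sum>b\<in>UNIV. v u ^ (1 + letter_weight b) * \<alpha> b u)" for u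
  have F: "F u = a 1 u * v u ^ 2 + a 2 u * v u ^ 3" for u
    by (simp add: F_def UNIV_bool \<alpha>_def letter_weight_def numeral_eq_Suc)
  have "AE u in lebesgue_on {0..T}. (v has_real_derivative F u) (at u within {0..T})"
    using v by (simp add: abel_solution_def F)
  then have "AE u in lebesgue. u \<in> {0..T} \<longrightarrow> (v has_real_derivative F u) (at u within {0..T})"
    by (subst (asm) AE_restrict_space_iff) auto
  then obtain N where N: "N \<in> null_sets lebesgue"
    "{u. \<not> (u \<in> {0..T} \<longrightarrow> (v has_real_derivative F u) (at u within {0..T}))} \<subseteq> N"
    by (auto simp: eventually_ae_filter)
  have "(F has_integral v t - v s) {s..t}"
  proof (rule fundamental_theorem_absolutely_continuous)
    show "absolutely_continuous_fun_on s t v"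
      using v st absolutely_continuous_fun_on_subinterval by (auto simp: abel_solution_def)
    show "negligible N" using N by (simp add: negligible_iff_null_sets)
    fix u assume "u \<in> {s..t} - N"
    then have "u \<in> {0..T}" "u \<notin> N" using st by auto
    then have "(v has_real_derivative F u) (at u within {0..T})" using N(2) by blast
    then show "(v has_real_derivative F u) (at u within {s..t})"
      by (rule has_field_derivative_subset) (use st in auto)
  qed (use st in auto)
  then show ?thesis by (simp add: F_def[abs_def])
qed

lemma solution_increment_bound:
  assumes st: "0 \<le> s" "s \<le> t" "t \<le> T" and V: "\<And>u. s \<le> u \<Longrightarrow> u \<le> t \<Longrightarrow> \<bar>v u\<bar> \<le> V"
  shows "\<bar>v t - v s\<bar> \<le> C * (V ^ 2 + V ^ 3) * (t - s)"
proof -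
  have V0: "V \<ge> 0" using V[of s] st by force
  have eq: "v t - v s = integral {s..t} (\<lambda>u. \<Sum>b\<in>UNIV. v u ^ (1 + letter_weight b) * \<alpha> b u)"
    using solution_has_integral[OF st] by (simp add: integral_unique)
  show ?thesis
    unfolding eq
  proof (rule abs_integral_le)
    show "(\<lambda>u. \<Sum>b\<in>UNIV. v u ^ (1 + letter_weight b) * \<alpha> b u) integrable_on {s..t}"
      using solution_has_integral[OF st] by blast
    fix u assume u: "s \<le> u" "u \<le> t"
    have "\<bar>v u ^ (1 + letter_weight b) * \<alpha> b u\<bar> \<le> V ^ (1 + letter_weight b) * C" for b
      unfolding abs_mult power_abs using V[OF u] \<alpha>_bound[of u b] u st V0
      by (intro mult_mono power_mono) auto
    then have "\<bar>\<Sum>b\<in>UNIV. v u ^ (1 + letter_weight b) * \<alpha> b u\<bar> \<le> (\<Sum>b\<in>UNIV. V ^ (1 + letter_weight b) * C)"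
      by (intro order.trans[OF sum_abs] sum_mono)
    also have "\<dots> = C * (V ^ 2 + V ^ 3)"
      by (simp add: UNIV_bool letter_weight_def numeral_eq_Suc algebra_simps)
    finally show "\<bar>\<Sum>b\<in>UNIV. v u ^ (1 + letter_weight b) * \<alpha> b u\<bar> \<le> C * (V ^ 2 + V ^ 3)" .
  qed (use st in auto)
qed

text \<open>A solution and hence its powers are Lipschitz, so in the integral form of the equation
  each power may be frozen at the right endpoint.\<close>

lemma solution_driven: "driven 0 T \<gamma> v (\<lambda>b t. v t ^ (1 + letter_weight b))"
proof -
  have "compact (v ` {0..T})" by (intro compact_continuous_image solution_continuous) auto
  then obtain V where "\<forall>x\<in>v ` {0..T}. norm x \<le> V"
    unfolding compact_eq_bounded_closed bounded_iff by blast
  then have V: "\<And>u. 0 \<le> u \<Longrightarrow> u \<le> T \<Longrightarrow> \<bar>v u\<bar> \<le> V" by auto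
  have V0: "V \<ge> 0" using V[of 0] T by force
  define K where "K = C * (V ^ 2 + V ^ 3)"
  have lipv: "\<bar>v t - v s\<bar> \<le> K * (t - s)" if "0 \<le> s" "s \<le> t" "t \<le> T" for s t
    unfolding K_def using that V by (intro solution_increment_bound) auto
  have "\<exists>L. \<forall>s t. 0 \<le> s \<longrightarrow> s \<le> t \<longrightarrow> t \<le> T \<longrightarrow> \<bar>v t ^ n - v s ^ n\<bar> \<le> L * (t - s)" for n
  proof (induction n)
    case (Suc n)
    then obtain L where L: "\<And>s t. 0 \<le> s \<Longrightarrow> s \<le> t \<Longrightarrow> t \<le> T \<Longrightarrow> \<bar>v t ^ n - v s ^ n\<bar> \<le> L * (t - s)" by blast
    have "\<bar>v t ^ Suc n - v s ^ Suc n\<bar> \<le> (V * L + V ^ n * K) * (t - s)" if "0 \<le> s" "s \<le> t" "t \<le> T" for s t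
    proof -
      have "v t ^ Suc n - v s ^ Suc n = v t * (v t ^ n - v s ^ n) + v s ^ n * (v t - v s)"
        by (simp add: algebra_simps)
      moreover have "\<bar>v t * (v t ^ n - v s ^ n)\<bar> \<le> V * (L * (t - s))"
        unfolding abs_mult using V[of t] L[OF that] that V0 by (intro mult_mono) auto
      moreover have "\<bar>v s ^ n * (v t - v s)\<bar> \<le> V ^ n * (K * (t - s))"
        unfolding abs_mult power_abs using V[of s] lipv[OF that] that V0 by (intro mult_mono power_mono) auto
      ultimately show ?thesis by (simp add: algebra_simps)
    qed
    then show ?case by blast
  qed (auto intro!: exI[of _ 0])
  then obtain L where L: "\<And>n. \<forall>s t. 0 \<le> s \<longrightarrow> s \<le> t \<longrightarrow> t \<le> T \<longrightarrow> \<bar>v t ^ n - v s ^ n\<bar> \<le> L n * (t - s)"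
    by metis
  define M where "M = (\<Sum>b\<in>UNIV. \<bar>L (1 + letter_weight b)\<bar> * C)"
  show ?thesis
  proof (rule drivenI[of _ V _ "(1 + V) ^ 3" M])
    fix t assume t: "0 \<le> t" "t \<le> T"
    show "\<bar>v t\<bar> \<le> V" using V[OF t] .
    fix b
    have "\<bar>v t\<bar> ^ (1 + letter_weight b) \<le> (1 + V) ^ (1 + letter_weight b)"
      using V[OF t] by (intro power_mono) auto
    also have "\<dots> \<le> (1 + V) ^ 3"
      using V0 by (intro power_increasing) (auto simp: letter_weight_def)
    finally show "\<bar>v t ^ (1 + letter_weight b)\<bar> \<le> (1 + V) ^ 3" by (simp only: power_abs)
  next
    fix s t assume st: "0 \<le> s" "s \<le> t" "t \<le> T"
    define I where "I b = integral {s..t} (\<lambda>u. v u ^ (1 + letter_weight b) * \<alpha> b u)" for b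
    note int = increment_of_product_integral[OF L st]
    have "v t - v s = integral {s..t} (\<lambda>u. \<Sum>b\<in>UNIV. v u ^ (1 + letter_weight b) * \<alpha> b u)"
      using solution_has_integral[OF st] by (simp add: integral_unique)
    also have "\<dots> = (\<Sum>b\<in>UNIV. I b)"
      unfolding I_def by (rule Henstock_Kurzweil_Integration.integral_sum) (simp, rule int(1))
    finally have "v t - v s - (\<Sum>b\<in>UNIV. v t ^ (1 + letter_weight b) * (\<gamma> b t - \<gamma> b s)) =
        (\<Sum>b\<in>UNIV. I b - v t ^ (1 + letter_weight b) * (\<gamma> b t - \<gamma> b s))"
      by (simp add: sum_subtractf)
    also have "\<bar>\<dots>\<bar> \<le> (\<Sum>b\<in>UNIV. \<bar>L (1 + letter_weight b)\<bar> * C * (t - s)\<^sup>2)"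
      unfolding I_def by (intro order.trans[OF sum_abs] sum_mono int(3))
    also have "\<dots> = M * (t - s)\<^sup>2" by (simp add: M_def sum_distrib_right)
    finally show "\<bar>v t - v s - (\<Sum>b\<in>UNIV. v t ^ (1 + letter_weight b) * (\<gamma> b t - \<gamma> b s))\<bar> \<le> M * (t - s)\<^sup>2" .
  qed
qed

text \<open>Up to the first time \<open>u\<close> at which \<open>\<bar>v\<bar>\<close> reaches
  \<open>2 * v0\<close> the increment is at most \<open>C * ((2 * v0)^2 + (2 * v0)^3) * T\<close>.
  This is \<open>v0\<close> times the quantity assumed to be below 1, so the value
  \<open>2 * v0\<close> is out of reach.\<close>

lemma solution_bound:
  assumes v0: "v 0 = v0" "v0 > 0" and small: "T * C * (4 * v0 + 8 * v0\<^sup>2) < 1"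
    and t: "0 \<le> t" "t \<le> T"
  shows "\<bar>v t\<bar> \<le> 2 * v0"
proof (rule ccontr)
  assume "\<not> \<bar>v t\<bar> \<le> 2 * v0"
  then have big: "\<bar>v t\<bar> > 2 * v0" by simp
  define S where "S = {u \<in> {0..t}. \<bar>v u\<bar> \<in> {2 * v0..}}"
  have contv: "continuous_on {0..t} (\<lambda>u. \<bar>v u\<bar>)"
    using solution_continuous t by (intro continuous_intros) (auto intro: continuous_on_subset)
  then have "closed ({0..t} \<inter> (\<lambda>u. \<bar>v u\<bar>) -` {2 * v0..})"
    by (intro continuous_closed_preimage) auto
  then have "closed S" by (simp add: S_def Int_def vimage_def)
  moreover have "bounded S" by (rule bounded_subset[of "{0..t}"]) (auto simp: S_def)
  ultimately have "compact S" by (simp add: compact_eq_bounded_closed)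
  moreover have "t \<in> S" using big t by (simp add: S_def)
  ultimately obtain u where u: "u \<in> S" "\<And>w. w \<in> S \<Longrightarrow> u \<le> w"
    using compact_attains_inf[of S] by blast
  have u': "0 \<le> u" "u \<le> t" "u \<le> T" "\<bar>v u\<bar> \<ge> 2 * v0" using u(1) t by (auto simp: S_def)
  have below: "\<bar>v w\<bar> < 2 * v0" if "0 \<le> w" "w < u" for w
    using u(2)[of w] that u' by (force simp: S_def)
  have "\<bar>v u\<bar> \<le> 2 * v0"
  proof (rule ccontr)
    assume "\<not> \<bar>v u\<bar> \<le> 2 * v0"
    moreover have "continuous_on {0..u} (\<lambda>u. \<bar>v u\<bar>)"
      using contv u' by (auto intro: continuous_on_subset)
    ultimately obtain w where w: "0 \<le> w" "w \<le> u" "\<bar>v w\<bar> = 2 * v0"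
      using IVT'[of "\<lambda>u. \<bar>v u\<bar>" 0 "2 * v0" u] v0 u' by auto
    then show False using below[of w] \<open>\<not> \<bar>v u\<bar> \<le> 2 * v0\<close> by (cases "w = u") auto
  qed
  then have "\<bar>v w\<bar> \<le> 2 * v0" if "0 \<le> w" "w \<le> u" for w
    using below[of w] that by (cases "w = u") auto
  then have "\<bar>v u - v 0\<bar> \<le> C * ((2 * v0) ^ 2 + (2 * v0) ^ 3) * (u - 0)"
    using u' by (intro solution_increment_bound) auto
  also have "\<dots> \<le> C * ((2 * v0) ^ 2 + (2 * v0) ^ 3) * T"
    using u' C_ge v0 by (intro mult_left_mono) auto
  also have "\<dots> = v0 * (T * C * (4 * v0 + 8 * v0\<^sup>2))"
    by (simp add: power2_eq_square power3_eq_cube algebra_simps)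
  also have "\<dots> < v0" using small v0 by simp
  finally show False using u'(4) v0 by (simp add: abs_if split: if_splits)
qed

end

text \<open>The left side is the \<open>b\<close>-component of the differential of the truncated
  expansion along a solution with value \<open>x\<close>. Differentiating \<open>J\<close> of
  \<open>b # w\<close> strips the letter \<open>b\<close>, differentiating the power belonging to
  \<open>w\<close> prepends it, and the two terms cancel. Only words pushed beyond weight
  \<open>n\<close> survive.\<close>

lemma weighted_sum_driven:
  fixes x :: real
  assumes "k \<ge> 1"
  shows "(\<Sum>w | weight w \<le> n. J_coeff w b t * (field_coeff k w * x ^ (k + weight w)) +
      J t w * (field_coeff k w * (real (k + weight w) * x ^ (k + weight w - 1) * x ^ (1 + letter_weight b)))) =
    (\<Sum>w | weight w \<le> n \<and> n < weight (b # w). J t w * (field_coeff k (b # w) * x ^ (k + weight (b # w))))"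
proof -
  define h where "h w = J t w * (field_coeff k (b # w) * x ^ (k + weight (b # w)))" for w
  have e: "x ^ (k + weight w - 1) * x ^ (1 + letter_weight b) = x ^ (k + weight (b # w))" for w
    unfolding power_add[symmetric] using assms by (intro arg_cong[of _ _ "power x"]) simp
  have second: "J t w * (field_coeff k w * (real (k + weight w) * x ^ (k + weight w - 1) * x ^ (1 + letter_weight b))) = h w" for w
  proof -
    have "J t w * (field_coeff k w * (real (k + weight w) * x ^ (k + weight w - 1) * x ^ (1 + letter_weight b)))
      = J t w * (field_coeff k w * real (k + weight w) * (x ^ (k + weight w - 1) * x ^ (1 + letter_weight b)))"
      by (simp only: mult.assoc)
    then show ?thesis unfolding e h_def by simp
  qed
  have "(\<Sum>w | weight w \<le> n. J_coeff w b t * (field_coeff k w * x ^ (k + weight w))) =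
      (\<Sum>w\<in>(#) b ` {w. weight (b # w) \<le> n}. J_coeff w b t * (field_coeff k w * x ^ (k + weight w)))"
    by (rule sum.mono_neutral_right[OF finite_weight_le])
      (auto simp: J_coeff_def split: list.splits)
  also have "\<dots> = (\<Sum>w | weight (b # w) \<le> n. - h w)"
    by (subst sum.reindex) (auto simp: J_coeff_def h_def)
  finally have first: "(\<Sum>w | weight w \<le> n. J_coeff w b t * (field_coeff k w * x ^ (k + weight w))) =
      - (\<Sum>w | weight (b # w) \<le> n. h w)" by (simp add: sum_negf)
  have "{w. weight w \<le> n} = {w. weight (b # w) \<le> n} \<union> {w. weight w \<le> n \<and> n < weight (b # w)}" by auto
  moreover have "finite {w. weight (b # w) \<le> n}"
    by (rule finite_subset[OF _ finite_weight_le[of n]]) auto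
  moreover have "finite {w. weight w \<le> n \<and> n < weight (b # w)}"
    by (rule finite_subset[OF _ finite_weight_le[of n]]) auto
  ultimately have "(\<Sum>w | weight w \<le> n. h w) =
      (\<Sum>w | weight (b # w) \<le> n. h w) + (\<Sum>w | weight w \<le> n \<and> n < weight (b # w). h w)"
    by (auto intro!: sum.union_disjoint)
  then show ?thesis
    unfolding sum.distrib second first by (simp add: h_def)
qed

lemma J_bound_ex: "\<exists>B. \<forall>t. 0 \<le> t \<longrightarrow> t \<le> T \<longrightarrow> \<bar>J t w\<bar> \<le> B"
  using driven_J[of w] unfolding driven_def by blast

definition J_bound where "J_bound w = (SOME B. \<forall>t. 0 \<le> t \<longrightarrow> t \<le> T \<longrightarrow> \<bar>J t w\<bar> \<le> B)"

lemma J_bound: "0 \<le> t \<Longrightarrow> t \<le> T \<Longrightarrow> \<bar>J t w\<bar> \<le> J_bound w"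
  using someI_ex[OF J_bound_ex[of w]] unfolding J_bound_def by blast

lemma field_coeff_nonneg: "field_coeff k w \<ge> 0"
  by (induction w) auto

text \<open>The truncated sum with \<open>J t w\<close> and \<open>v t\<close> is almost constant in
  \<open>t\<close>: at \<open>T\<close>, where \<open>holonomy\<close> is 1, it is
  \<open>v T ^ k\<close>, and at 0 it is the claimed expansion. By
  \<open>weighted_sum_driven\<close> its differential has order \<open>v0 ^ (k + n + 1)\<close>,
  with a constant independent of the solution.\<close>

lemma solution_expansion:
  assumes k: "k \<ge> 1"
  shows "\<exists>M. \<forall>v v0. abel_solution T a v \<longrightarrow> v 0 = v0 \<longrightarrow> 0 < v0 \<longrightarrow> 2 * v0 \<le> 1 \<longrightarrow>
     T * C * (4 * v0 + 8 * v0\<^sup>2) < 1 \<longrightarrow>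
     \<bar>v T ^ k - (\<Sum>w | weight w \<le> n. J 0 w * (field_coeff k w * v0 ^ (k + weight w)))\<bar> \<le> M * v0 ^ (k + n + 1)"
proof (intro exI allI impI)
  fix v v0
  assume sol: "abel_solution T a v" and v0: "v 0 = v0" "0 < v0" "2 * v0 \<le> 1"
    and small: "T * C * (4 * v0 + 8 * v0\<^sup>2) < 1"
  define A where "A b = {w. weight w \<le> n \<and> n < weight (b # w)}" for b
  define R where "R = (\<Sum>b\<in>UNIV. \<Sum>w\<in>A b. J_bound w * field_coeff k (b # w))"
  have finA: "finite (A b)" for b
    unfolding A_def by (rule finite_subset[OF _ finite_weight_le[of n]]) auto
  have Jb: "J_bound w \<ge> 0" for w using J_bound[of 0 w] T by force
  define F where "F t = (\<Sum>w | weight w \<le> n. J t w * (field_coeff k w * v t ^ (k + weight w)))" for t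
  define G where "G b t = (\<Sum>w | weight w \<le> n. J_coeff w b t * (field_coeff k w * v t ^ (k + weight w)) +
      J t w * (field_coeff k w * (real (k + weight w) * v t ^ (k + weight w - 1) * v t ^ (1 + letter_weight b))))" for b t
  have F_driven: "driven 0 T \<gamma> F G"
    unfolding F_def G_def
  proof (intro driven_sum finite_weight_le)
    fix w
    have "driven 0 T \<gamma> (\<lambda>t. field_coeff k w * v t ^ (k + weight w))
        (\<lambda>b t. field_coeff k w * (real (k + weight w) * v t ^ (k + weight w - 1) * v t ^ (1 + letter_weight b)))"
      using driven_mult[OF driven_const[of "field_coeff k w"] driven_power[OF solution_driven[OF sol], of "k + weight w"]]
      by simp
    from driven_mult[OF driven_J[of w] this]
    show "driven 0 T \<gamma> (\<lambda>t. J t w * (field_coeff k w * v t ^ (k + weight w)))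
        (\<lambda>b t. J_coeff w b t * (field_coeff k w * v t ^ (k + weight w)) +
          J t w * (field_coeff k w * (real (k + weight w) * v t ^ (k + weight w - 1) * v t ^ (1 + letter_weight b))))" .
  qed
  have "\<bar>G b t\<bar> \<le> R * (2 * v0) ^ (k + n + 1)" if t: "0 \<le> t" "t \<le> T" for b t
  proof -
    have vt: "\<bar>v t\<bar> \<le> 2 * v0" using solution_bound[OF sol v0(1,2) small t] .
    have "\<bar>G b t\<bar> = \<bar>\<Sum>w\<in>A b. J t w * (field_coeff k (b # w) * v t ^ (k + weight (b # w)))\<bar>"
      unfolding G_def weighted_sum_driven[OF k] A_def ..
    also have "\<dots> \<le> (\<Sum>w\<in>A b. J_bound w * field_coeff k (b # w) * (2 * v0) ^ (k + n + 1))"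
    proof (rule order.trans[OF sum_abs], rule sum_mono)
      fix w assume w: "w \<in> A b"
      have "\<bar>v t\<bar> ^ (k + weight (b # w)) \<le> (2 * v0) ^ (k + weight (b # w))"
        using vt by (intro power_mono) auto
      also have "\<dots> \<le> (2 * v0) ^ (k + n + 1)"
        using w v0 by (intro power_decreasing) (auto simp: A_def)
      finally have "\<bar>J t w\<bar> * (field_coeff k (b # w) * \<bar>v t\<bar> ^ (k + weight (b # w))) \<le>
          J_bound w * (field_coeff k (b # w) * (2 * v0) ^ (k + n + 1))"
        using J_bound[OF t, of w] Jb field_coeff_nonneg[of k "b # w"] v0
        by (intro mult_mono mult_nonneg_nonneg zero_le_power) auto
      then show "\<bar>J t w * (field_coeff k (b # w) * v t ^ (k + weight (b # w)))\<bar> \<le>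
          J_bound w * field_coeff k (b # w) * (2 * v0) ^ (k + n + 1)"
        using field_coeff_nonneg[of k "b # w"]
        by (simp only: abs_mult power_abs abs_of_nonneg mult.assoc)
    qed
    also have "\<dots> = (\<Sum>w\<in>A b. J_bound w * field_coeff k (b # w)) * (2 * v0) ^ (k + n + 1)"
      by (simp only: sum_distrib_right)
    also have "\<dots> \<le> R * (2 * v0) ^ (k + n + 1)"
      unfolding R_def using v0 Jb field_coeff_nonneg
      by (intro mult_right_mono member_le_sum[of b UNIV "\<lambda>b. \<Sum>w\<in>A b. J_bound w * field_coeff k (b # w)"] sum_nonneg mult_nonneg_nonneg) auto
    finally show ?thesis .
  qed
  from driven_increment[OF F_driven this]
  have 1: "\<bar>F T - F 0\<bar> \<le> 2 * (R * (2 * v0) ^ (k + n + 1)) * C * (T - 0)" by blast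
  have "F T = (\<Sum>w | weight w \<le> n. if w = [] then v T ^ k else 0)"
    unfolding F_def by (intro sum.cong) (auto simp: J_at_end)
  also have "\<dots> = v T ^ k" using sum.delta[OF finite_weight_le[of n], of "[]" "\<lambda>_. v T ^ k"] by simp
  finally have FT: "F T = v T ^ k" .
  have F0: "F 0 = (\<Sum>w | weight w \<le> n. J 0 w * (field_coeff k w * v0 ^ (k + weight w)))"
    using v0 by (simp add: F_def)
  have "2 * (R * (2 * v0) ^ (k + n + 1)) * C * (T - 0) = 2 * R * 2 ^ (k + n + 1) * C * T * v0 ^ (k + n + 1)"
    by (simp only: power_mult_distrib) simp
  then show "\<bar>v T ^ k - (\<Sum>w | weight w \<le> n. J 0 w * (field_coeff k w * v0 ^ (k + weight w)))\<bar> \<le>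
     (2 * (\<Sum>b\<in>UNIV. \<Sum>w\<in>{w. weight w \<le> n \<and> n < weight (b # w)}. J_bound w * field_coeff k (b # w)) * 2 ^ (k + n + 1) * C * T) * v0 ^ (k + n + 1)"
    using 1 by (simp only: FT F0 R_def A_def)
qed

text \<open>A center makes \<open>v T ^ k = v0 ^ k\<close> for all small positive \<open>v0\<close>;
  comparing coefficients with \<open>solution_expansion\<close> determines \<open>transport\<close>.
  For \<open>k = 0\<close> the vector fields annihilate the constant function, whatever the
  path.\<close>

lemma center_imp_inert:
  assumes "has_center T a"
  shows "inert (holonomy 0)"
proof -
  obtain \<epsilon> where \<epsilon>: "\<epsilon> > 0" "\<And>v0. \<bar>v0\<bar> < \<epsilon> \<Longrightarrow> \<exists>v. abel_solution T a v \<and> v 0 = v0 \<and> v T = v0"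
    using assms unfolding has_center_def by blast
  have "((\<lambda>x. T * C * (4 * x + 8 * x\<^sup>2)) \<longlongrightarrow> T * C * (4 * 0 + 8 * 0\<^sup>2)) (at_right 0)"
    by (intro tendsto_intros)
  then have "\<forall>\<^sub>F x in at_right 0. T * C * (4 * x + 8 * x\<^sup>2) < 1" by (simp add: order_tendsto_iff)
  moreover have "\<forall>\<^sub>F x in at_right 0. \<bar>x\<bar> < \<epsilon> \<and> 2 * x \<le> (1::real)"
    using \<epsilon> by (auto simp: eventually_at_right_field intro!: exI[of _ "min \<epsilon> (1/2)"])
  ultimately have "\<forall>\<^sub>F x in at_right 0. T * C * (4 * x + 8 * x\<^sup>2) < 1 \<and> \<bar>x\<bar> < \<epsilon> \<and> 2 * x \<le> 1"
    by eventually_elim auto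
  then obtain r where r: "r > 0" "\<And>x. 0 < x \<Longrightarrow> x < r \<Longrightarrow> T * C * (4 * x + 8 * x\<^sup>2) < 1 \<and> \<bar>x\<bar> < \<epsilon> \<and> 2 * x \<le> 1"
    by (auto simp: eventually_at_right_field)
  have main: "transport (holonomy 0) k d = (if d = 0 then 1 else 0)" if k: "k \<ge> 1" for k d
  proof -
    define c where "c e = transport (holonomy 0) k e - (if e = 0 then 1 else 0)" for e
    obtain M where M: "\<And>v v0. abel_solution T a v \<Longrightarrow> v 0 = v0 \<Longrightarrow> 0 < v0 \<Longrightarrow> 2 * v0 \<le> 1 \<Longrightarrow>
     T * C * (4 * v0 + 8 * v0\<^sup>2) < 1 \<Longrightarrow>
     \<bar>v T ^ k - (\<Sum>w | weight w \<le> d. J 0 w * (field_coeff k w * v0 ^ (k + weight w)))\<bar> \<le> M * v0 ^ (k + d + 1)"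
      using solution_expansion[OF k, of d] by blast
    have "\<bar>\<Sum>e\<le>d. c e * x ^ e\<bar> \<le> M * x ^ Suc d" if x: "0 < x" "x < r" for x
    proof -
      obtain v where v: "abel_solution T a v" "v 0 = x" "v T = x" using \<epsilon>(2)[of x] r(2)[OF x] by blast
      have "(\<Sum>w | weight w \<le> d. J 0 w * (field_coeff k w * x ^ (k + weight w))) =
          (\<Sum>e\<le>d. \<Sum>w | w \<in> {w. weight w \<le> d} \<and> weight w = e. J 0 w * (field_coeff k w * x ^ (k + weight w)))"
        by (rule sum.group[symmetric]) (auto simp: finite_weight_le)
      also have "\<dots> = (\<Sum>e\<le>d. x ^ k * (transport (holonomy 0) k e * x ^ e))"
      proof (rule sum.cong[OF refl])
        fix e assume "e \<in> {..d}"
        then have "{w \<in> {w. weight w \<le> d}. weight w = e} = {w. weight w = e}" by auto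
        then show "(\<Sum>w | w \<in> {w. weight w \<le> d} \<and> weight w = e. J 0 w * (field_coeff k w * x ^ (k + weight w))) =
            x ^ k * (transport (holonomy 0) k e * x ^ e)"
          by (simp add: transport_def sum_distrib_left sum_distrib_right power_add mult_ac)
      qed
      also have "\<dots> - x ^ k = x ^ k * (\<Sum>e\<le>d. c e * x ^ e)"
      proof -
        have "(\<Sum>e\<le>d. (if e = 0 then 1 else 0) * x ^ e) = (\<Sum>e\<le>d. if e = 0 then 1 else 0)"
          by (intro sum.cong) auto
        then have "(\<Sum>e\<le>d. (if e = 0 then 1 else 0) * x ^ e) = 1" by simp
        then show ?thesis
          by (simp add: c_def left_diff_distrib sum_subtractf right_diff_distrib sum_distrib_left)
      qed
      finally have eq: "(\<Sum>w | weight w \<le> d. J 0 w * (field_coeff k w * x ^ (k + weight w))) - x ^ k =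
         x ^ k * (\<Sum>e\<le>d. c e * x ^ e)" .
      have "\<bar>x ^ k * (\<Sum>e\<le>d. c e * x ^ e)\<bar> \<le> M * x ^ (k + d + 1)"
        using M[OF v(1,2) x(1)] r(2)[OF x] v(3) unfolding eq[symmetric] by (simp add: abs_minus_commute)
      then have "x ^ k * \<bar>\<Sum>e\<le>d. c e * x ^ e\<bar> \<le> x ^ k * (M * x ^ Suc d)"
        using x by (simp add: abs_mult power_add algebra_simps)
      then show ?thesis using x by simp
    qed
    from polynomial_flat_at_0[OF r(1) this, of d] show ?thesis by (simp add: c_def)
  qed
  have "transport (holonomy 0) 0 d = (if d = 0 then 1 else 0)" for d
  proof -
    have fc0: "field_coeff 0 w = (if w = [] then 1 else 0)" for w by (induction w) auto
    have "transport (holonomy 0) 0 d = (\<Sum>w | weight w = d. if w = [] then 1 else 0)"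
      unfolding transport_def by (intro sum.cong) (auto simp: fc0)
    also have "\<dots> = (if d = 0 then 1 else 0)"
      using sum.delta[OF finite_weight_eq[of d], of "[]" "\<lambda>_. 1::real"] by simp
    finally show ?thesis .
  qed
  with main have "transport (holonomy 0) k d = transport 1 k d" for k d
    by (cases "k = 0") (simp_all add: transport_one)
  then show ?thesis unfolding inert_def by blast
qed

lemma J_singleton: "J 0 [b] = \<gamma> b T"
  using bounded_measurable_integrable(2)[OF \<alpha>_measurable \<alpha>_bound, of 0 T b]
  by (simp add: J_def \<gamma>_def \<alpha>_def)

text \<open>Closedness of the path puts its final point among the vertices, which is where its
  decomposition into edges begins.\<close>

lemma inert_imp_closed:
  assumes "inert (holonomy 0)"
  shows "\<gamma> b T = 0"
proof -
  have w0: "weight w = 0 \<longleftrightarrow> w = []" for w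
    by (cases w) auto
  have w1: "weight w = Suc 0 \<longleftrightarrow> w = [False]" for w
    by (cases w) (auto simp: letter_weight_def w0)
  have w2: "weight w = Suc (Suc 0) \<longleftrightarrow> w = [True] \<or> w = [False, False]" for w
    by (cases w) (auto simp: letter_weight_def w0 w1)
  have t: "transport (holonomy 0) k (Suc d) = 0" for k d
    using assms by (simp add: inert_def transport_one)
  have "\<gamma> False T = 0"
    using t[of 1 0] by (simp add: transport_def w1 J_singleton)
  moreover have "{w. w = [True] \<or> w = [False, False]} = {[True], [False, False]}" by auto
  \<comment> \<open>In weight 2 the words \<open>[True]\<close> and \<open>[False, False]\<close>
    enter with the factors \<open>k\<close> and \<open>k * (k + 1)\<close>; the cases
    \<open>k = 1\<close> and \<open>k = 2\<close> separate them.\<close>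
  then have "\<gamma> True T = 0"
    using t[of 1 1] t[of 2 1] by (simp add: transport_def w2 J_singleton letter_weight_def)
  ultimately show ?thesis by (cases b) auto
qed

end

section \<open>Signatures of polynomial edges\<close>

definition antideriv :: "real poly \<Rightarrow> real poly" where
  "antideriv p = (\<Sum>i\<le>degree p. monom (coeff p i / real (Suc i)) (Suc i))"

lemma coeff_antideriv: "coeff (antideriv p) n = (if n = 0 then 0 else coeff p (n - 1) / real n)"
proof -
  have "coeff (antideriv p) n = (\<Sum>i\<le>degree p. if Suc i = n then coeff p i / real (Suc i) else 0)"
    by (simp add: antideriv_def coeff_sum del: of_nat_Suc)
  also have "\<dots> = (if n = 0 then 0 else coeff p (n - 1) / real n)"
  proof (cases n)
    case (Suc m)
    then have "(\<Sum>i\<le>degree p. if Suc i = n then coeff p i / real (Suc i) else 0) =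
        (\<Sum>i\<le>degree p. if i = m then coeff p m / real (Suc m) else 0)"
      by (intro sum.cong) auto
    then show ?thesis using Suc by (auto simp: coeff_eq_0)
  qed simp
  finally show ?thesis .
qed

lemma pderiv_antideriv [simp]: "pderiv (antideriv p) = p"
  by (rule poly_eqI) (simp add: coeff_pderiv coeff_antideriv)

lemma poly_antideriv_0 [simp]: "poly (antideriv p) 0 = 0"
  by (simp add: poly_0_coeff_0 coeff_antideriv)

text \<open>Along a polynomial curve iterated integrals are polynomials in the upper limit. Keeping
  them as polynomials makes their algebraic dependence on the coefficients of the curve
  visible.\<close>

primrec edge_poly :: "(bool \<Rightarrow> real poly) \<Rightarrow> bool list \<Rightarrow> real poly" where
  "edge_poly A [] = 1"
| "edge_poly A (b # u) = antideriv (edge_poly A u * pderiv (A b))"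

text \<open>The signature of the curve \<open>A\<close> restricted to \<open>[0, x]\<close>; words are consumed from the end
  because the last letter corresponds to the outermost upper limit.\<close>

definition edge_series :: "(bool \<Rightarrow> real poly) \<Rightarrow> real \<Rightarrow> word_series" where
  "edge_series A x = Word_series (\<lambda>w. poly (edge_poly A (rev w)) x)"

lemma word_coeff_edge_series: "word_coeff (edge_series A x) w = poly (edge_poly A (rev w)) x"
  by (simp add: edge_series_def)

lemma word_coeff_edge_series_Nil [simp]: "word_coeff (edge_series A x) [] = 1"
  by (simp add: word_coeff_edge_series)

lemma edge_series_0: "edge_series A 0 = 1"
proof (rule word_series_eqI)
  fix w
  show "word_coeff (edge_series A 0) w = word_coeff 1 w"
    by (cases w rule: rev_cases) (simp_all add: word_coeff_edge_series word_coeff_one)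
qed

lemma poly_bounded_unit_interval: "\<exists>B. \<forall>x. 0 \<le> x \<longrightarrow> x \<le> 1 \<longrightarrow> \<bar>poly p x\<bar> \<le> (B::real)"
proof -
  have "compact (poly p ` {0..1})" by (intro compact_continuous_image continuous_intros) auto
  then obtain B where "\<forall>x\<in>poly p ` {0..1}. norm x \<le> B"
    unfolding compact_eq_bounded_closed bounded_iff by blast
  then show ?thesis by (intro exI[of _ B]) auto
qed

lemma poly_lipschitz_unit_interval:
  "\<exists>K. \<forall>x y. 0 \<le> x \<longrightarrow> x \<le> 1 \<longrightarrow> 0 \<le> y \<longrightarrow> y \<le> 1 \<longrightarrow> \<bar>poly p x - poly p y\<bar> \<le> K * \<bar>x - (y::real)\<bar>"
proof (induction p)
  case (pCons a p)
  then obtain K where K: "\<And>x y. 0 \<le> x \<Longrightarrow> x \<le> 1 \<Longrightarrow> 0 \<le> y \<Longrightarrow> y \<le> 1 \<Longrightarrow> \<bar>poly p x - poly p y\<bar> \<le> K * \<bar>x - y\<bar>"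
    by blast
  obtain B where B: "\<And>x. 0 \<le> x \<Longrightarrow> x \<le> 1 \<Longrightarrow> \<bar>poly p x\<bar> \<le> B" using poly_bounded_unit_interval by blast
  have "\<bar>poly (pCons a p) x - poly (pCons a p) y\<bar> \<le> (K + B) * \<bar>x - y\<bar>"
    if "0 \<le> x" "x \<le> 1" "0 \<le> y" "y \<le> 1" for x y
  proof -
    have "poly (pCons a p) x - poly (pCons a p) y = x * (poly p x - poly p y) + poly p y * (x - y)"
      by (simp add: algebra_simps)
    moreover have "\<bar>x * (poly p x - poly p y)\<bar> \<le> 1 * (K * \<bar>x - y\<bar>)"
      unfolding abs_mult using K[OF that] that by (intro mult_mono) auto
    moreover have "\<bar>poly p y * (x - y)\<bar> \<le> B * \<bar>x - y\<bar>"
      unfolding abs_mult using B[OF that(3,4)] by (intro mult_right_mono) auto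
    ultimately show ?thesis by (simp add: algebra_simps)
  qed
  then show ?case by blast
qed (auto intro!: exI[of _ 0])

lemma poly_second_order_unit_interval:
  "\<exists>K\<ge>0. \<forall>x y. 0 \<le> x \<longrightarrow> x \<le> 1 \<longrightarrow> 0 \<le> y \<longrightarrow> y \<le> 1 \<longrightarrow>
     \<bar>poly p x - poly p y - poly (pderiv p) x * (x - y)\<bar> \<le> K * (x - (y::real))\<^sup>2"
proof (induction p)
  case 0
  show ?case by (intro exI[of _ 0]) simp
next
  case (pCons a p)
  then obtain K where K: "K \<ge> 0" "\<And>x y. 0 \<le> x \<Longrightarrow> x \<le> 1 \<Longrightarrow> 0 \<le> y \<Longrightarrow> y \<le> 1 \<Longrightarrow>
      \<bar>poly p x - poly p y - poly (pderiv p) x * (x - y)\<bar> \<le> K * (x - y)\<^sup>2"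
    by blast
  obtain L where L: "\<And>x y. 0 \<le> x \<Longrightarrow> x \<le> 1 \<Longrightarrow> 0 \<le> y \<Longrightarrow> y \<le> 1 \<Longrightarrow> \<bar>poly p x - poly p y\<bar> \<le> L * \<bar>x - y\<bar>"
    using poly_lipschitz_unit_interval by blast
  have L0: "L \<ge> 0" using L[of 0 1] by force
  have "\<bar>poly (pCons a p) x - poly (pCons a p) y - poly (pderiv (pCons a p)) x * (x - y)\<bar> \<le> (K + L) * (x - y)\<^sup>2"
    if "0 \<le> x" "x \<le> 1" "0 \<le> y" "y \<le> 1" for x y
  proof -
    have "poly (pCons a p) x - poly (pCons a p) y - poly (pderiv (pCons a p)) x * (x - y) =
        x * (poly p x - poly p y - poly (pderiv p) x * (x - y)) - (x - y) * (poly p x - poly p y)"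
      by (simp add: pderiv_pCons algebra_simps)
    moreover have "\<bar>x * (poly p x - poly p y - poly (pderiv p) x * (x - y))\<bar> \<le> 1 * (K * (x - y)\<^sup>2)"
      unfolding abs_mult using K(2)[OF that] that K(1) by (intro mult_mono) auto
    moreover have "\<bar>(x - y) * (poly p x - poly p y)\<bar> \<le> \<bar>x - y\<bar> * (L * \<bar>x - y\<bar>)"
      unfolding abs_mult using L[OF that] by (intro mult_left_mono) auto
    moreover have "\<bar>x - y\<bar> * (L * \<bar>x - y\<bar>) = L * \<bar>x - y\<bar>\<^sup>2"
      unfolding power2_eq_square by (rule mult.left_commute)
    then have "\<bar>x - y\<bar> * (L * \<bar>x - y\<bar>) = L * (x - y)\<^sup>2" unfolding power2_abs .
    ultimately show ?thesis unfolding distrib_right by linarith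
  qed
  then show ?case using K(1) L0 by (intro exI[of _ "K + L"]) auto
qed

text \<open>Both terms have the derivative \<open>P * Q'\<close> at \<open>x\<close>: the increment
  form of the rule that the differential of the integral of \<open>P dQ\<close> is
  \<open>P dQ\<close>.\<close>

lemma antideriv_increment:
  "\<exists>K\<ge>0. \<forall>x y. 0 \<le> x \<longrightarrow> x \<le> 1 \<longrightarrow> 0 \<le> y \<longrightarrow> y \<le> 1 \<longrightarrow>
     \<bar>poly (antideriv (P * pderiv Q)) x - poly (antideriv (P * pderiv Q)) y - poly P x * (poly Q x - poly Q y)\<bar>
       \<le> K * (x - (y::real))\<^sup>2"
proof -
  obtain K where K: "K \<ge> 0" "\<And>x y. 0 \<le> x \<Longrightarrow> x \<le> 1 \<Longrightarrow> 0 \<le> y \<Longrightarrow> y \<le> 1 \<Longrightarrow>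
      \<bar>poly (antideriv (P * pderiv Q)) x - poly (antideriv (P * pderiv Q)) y -
        poly (P * pderiv Q) x * (x - y)\<bar> \<le> K * (x - y)\<^sup>2"
    using poly_second_order_unit_interval[of "antideriv (P * pderiv Q)"] by auto
  obtain L where L: "L \<ge> 0" "\<And>x y. 0 \<le> x \<Longrightarrow> x \<le> 1 \<Longrightarrow> 0 \<le> y \<Longrightarrow> y \<le> 1 \<Longrightarrow>
      \<bar>poly Q x - poly Q y - poly (pderiv Q) x * (x - y)\<bar> \<le> L * (x - y)\<^sup>2"
    using poly_second_order_unit_interval[of Q] by auto
  obtain B where B: "\<And>x. 0 \<le> x \<Longrightarrow> x \<le> 1 \<Longrightarrow> \<bar>poly P x\<bar> \<le> B" using poly_bounded_unit_interval by blast
  have B0: "B \<ge> 0" using B[of 0] by force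
  have "\<bar>poly (antideriv (P * pderiv Q)) x - poly (antideriv (P * pderiv Q)) y - poly P x * (poly Q x - poly Q y)\<bar>
       \<le> (K + B * L) * (x - y)\<^sup>2" if "0 \<le> x" "x \<le> 1" "0 \<le> y" "y \<le> 1" for x y
  proof -
    have "poly (antideriv (P * pderiv Q)) x - poly (antideriv (P * pderiv Q)) y - poly P x * (poly Q x - poly Q y) =
        (poly (antideriv (P * pderiv Q)) x - poly (antideriv (P * pderiv Q)) y - poly (P * pderiv Q) x * (x - y))
        - poly P x * (poly Q x - poly Q y - poly (pderiv Q) x * (x - y))"
      by (simp add: algebra_simps)
    moreover have "\<bar>poly P x * (poly Q x - poly Q y - poly (pderiv Q) x * (x - y))\<bar> \<le> B * (L * (x - y)\<^sup>2)"
      unfolding abs_mult using B[OF that(1,2)] L(2)[OF that] B0 by (intro mult_mono) auto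
    ultimately show ?thesis using K(2)[OF that] unfolding distrib_right by (simp only: mult.assoc)
  qed
  then show ?thesis using K(1) L(1) B0 by (intro exI[of _ "K + B * L"]) auto
qed

context abel_equation
begin

lemma lipschitz_subpath:
  assumes "0 \<le> p" "p \<le> q" "q \<le> T"
  shows "lipschitz_path p q C \<gamma>"
  by unfold_locales (use assms \<gamma>_lip C_ge in auto)

text \<open>On an edge the path is the curve with a Lipschitz parameter \<open>\<tau>\<close>,
  possibly running back and forth. Increments of \<open>\<gamma>\<close> are increments of the curve
  at \<open>\<tau>\<close>, so expansions in \<open>\<tau>\<close> turn into expansions in
  \<open>\<gamma>\<close>.\<close>

lemma edge_poly_driven:
  assumes pq: "0 \<le> p" "p \<le> q" "q \<le> T"
    and \<tau>: "\<And>t. p \<le> t \<Longrightarrow> t \<le> q \<Longrightarrow> 0 \<le> \<tau> t \<and> \<tau> t \<le> 1"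
    and \<tau>_lip: "\<And>s t. p \<le> s \<Longrightarrow> s \<le> t \<Longrightarrow> t \<le> q \<Longrightarrow> \<bar>\<tau> t - \<tau> s\<bar> \<le> L * (t - s)"
    and on_edge: "\<And>t b. p \<le> t \<Longrightarrow> t \<le> q \<Longrightarrow> \<gamma> b t = x b + poly (A b) (\<tau> t)"
  shows "driven p q \<gamma> (\<lambda>t. poly (edge_poly A u) (\<tau> t))
     (\<lambda>b t. case u of [] \<Rightarrow> 0 | c # v \<Rightarrow> if b = c then poly (edge_poly A v) (\<tau> t) else 0)"
proof -
  interpret sub: lipschitz_path p q C \<gamma> by (rule lipschitz_subpath[OF pq])
  show ?thesis
  proof (cases u)
    case Nil
    then show ?thesis using sub.driven_const[of 1] by simp
  next
    case (Cons c v)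
    obtain K where K: "K \<ge> 0" "\<And>x y. 0 \<le> x \<Longrightarrow> x \<le> 1 \<Longrightarrow> 0 \<le> y \<Longrightarrow> y \<le> 1 \<Longrightarrow>
        \<bar>poly (edge_poly A u) x - poly (edge_poly A u) y - poly (edge_poly A v) x * (poly (A c) x - poly (A c) y)\<bar>
          \<le> K * (x - y)\<^sup>2"
      using antideriv_increment[of "edge_poly A v" "A c"] by (auto simp: Cons)
    obtain B where B: "\<And>x. 0 \<le> x \<Longrightarrow> x \<le> 1 \<Longrightarrow> \<bar>poly (edge_poly A u) x\<bar> \<le> B" using poly_bounded_unit_interval by blast
    obtain B' where B': "\<And>x. 0 \<le> x \<Longrightarrow> x \<le> 1 \<Longrightarrow> \<bar>poly (edge_poly A v) x\<bar> \<le> B'" using poly_bounded_unit_interval by blast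
    have B'0: "B' \<ge> 0" using B'[of 0] by force
    show ?thesis
    proof (rule sub.drivenI[of _ B _ B' "K * L\<^sup>2"])
      show "\<bar>poly (edge_poly A u) (\<tau> t)\<bar> \<le> B" if "p \<le> t" "t \<le> q" for t using B \<tau>[OF that] by blast
      show "\<bar>case u of [] \<Rightarrow> 0 | c # v \<Rightarrow> if b = c then poly (edge_poly A v) (\<tau> t) else 0\<bar> \<le> B'"
        if "p \<le> t" "t \<le> q" for t b using B'[of "\<tau> t"] \<tau>[OF that] B'0 by (simp add: Cons)
      fix s t assume st: "p \<le> s" "s \<le> t" "t \<le> q"
      have r: "0 \<le> \<tau> s" "\<tau> s \<le> 1" "0 \<le> \<tau> t" "\<tau> t \<le> 1" using \<tau>[of s] \<tau>[of t] st by auto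
      have "(\<Sum>b\<in>UNIV. (case u of [] \<Rightarrow> 0 | c # v \<Rightarrow> if b = c then poly (edge_poly A v) (\<tau> t) else 0) * (\<gamma> b t - \<gamma> b s))
         = poly (edge_poly A v) (\<tau> t) * (\<gamma> c t - \<gamma> c s)"
        by (cases c) (simp_all add: UNIV_bool Cons)
      also have "\<gamma> c t - \<gamma> c s = poly (A c) (\<tau> t) - poly (A c) (\<tau> s)"
        using on_edge[of t c] on_edge[of s c] st by simp
      finally have "\<bar>poly (edge_poly A u) (\<tau> t) - poly (edge_poly A u) (\<tau> s) - (\<Sum>b\<in>UNIV. (case u of [] \<Rightarrow> 0 | c # v \<Rightarrow> if b = c then poly (edge_poly A v) (\<tau> t) else 0) * (\<gamma> b t - \<gamma> b s))\<bar>
        \<le> K * (\<tau> t - \<tau> s)\<^sup>2"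
        using K(2)[OF r(3,4,1,2)] by simp
      also have "\<dots> \<le> K * (L * (t - s))\<^sup>2"
        using \<tau>_lip[OF st] K(1) by (intro mult_left_mono) (auto simp: abs_le_square_iff[symmetric])
      finally show "\<bar>poly (edge_poly A u) (\<tau> t) - poly (edge_poly A u) (\<tau> s) - (\<Sum>b\<in>UNIV. (case u of [] \<Rightarrow> 0 | c # v \<Rightarrow> if b = c then poly (edge_poly A v) (\<tau> t) else 0) * (\<gamma> b t - \<gamma> b s))\<bar>
        \<le> K * L\<^sup>2 * (t - s)\<^sup>2" by (simp add: power_mult_distrib mult.assoc)
    qed
  qed
qed

text \<open>The product is the signature of the edge up to the current point followed by that of the
  rest of the path. Motion back and forth on the edge does not change it, as its differential
  vanishes.\<close>

lemma holonomy_along_edge: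
  assumes pq: "0 \<le> p" "p \<le> q" "q \<le> T"
    and \<tau>: "\<And>t. p \<le> t \<Longrightarrow> t \<le> q \<Longrightarrow> 0 \<le> \<tau> t \<and> \<tau> t \<le> 1"
    and \<tau>_lip: "\<And>s t. p \<le> s \<Longrightarrow> s \<le> t \<Longrightarrow> t \<le> q \<Longrightarrow> \<bar>\<tau> t - \<tau> s\<bar> \<le> L * (t - s)"
    and on_edge: "\<And>t b. p \<le> t \<Longrightarrow> t \<le> q \<Longrightarrow> \<gamma> b t = x b + poly (A b) (\<tau> t)"
  shows "edge_series A (\<tau> p) * holonomy p = edge_series A (\<tau> q) * holonomy q"
proof (rule word_series_eqI)
  fix w :: "bool list"
  interpret sub: lipschitz_path p q C \<gamma> by (rule lipschitz_subpath[OF pq])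
  define n where "n = length w"
  define E where "E u t = poly (edge_poly A u) (\<tau> t)" for u t
  define EC where "EC u b t = (case u of [] \<Rightarrow> 0 | c # v \<Rightarrow> if b = c then E v t else 0)" for u b t
  define X where "X b t i = EC (rev (take i w)) b t * J t (drop i w)" for b t i
  define Y where "Y b t i = E (rev (take i w)) t * J_coeff (drop i w) b t" for b t i
  have dE: "driven p q \<gamma> (E u) (EC u)" for u
    unfolding E_def[abs_def] EC_def[abs_def] using edge_poly_driven[OF assms] .
  have dJ: "driven p q \<gamma> (\<lambda>t. J t v) (J_coeff v)" for v
    using driven_subinterval[OF driven_J] pq by simp
  have "driven p q \<gamma> (\<lambda>t. \<Sum>i\<le>n. E (rev (take i w)) t * J t (drop i w)) (\<lambda>b t. \<Sum>i\<le>n. X b t i + Y b t i)"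
    unfolding X_def Y_def by (intro sub.driven_sum sub.driven_mult dE dJ) simp
  moreover have "(\<Sum>i\<le>n. X b t i + Y b t i) = 0" for b t
  proof -
    \<comment> \<open>Differentiating the edge factor for the cut after letter \<open>i\<close>, and
      the path factor for the cut before it, gives the same term with opposite signs.\<close>
    have "X b t (Suc i) + Y b t i = 0" if "i < n" for i
    proof -
      have "rev (take (Suc i) w) = w ! i # rev (take i w)" "drop i w = w ! i # drop (Suc i) w"
        using that by (simp_all add: n_def take_Suc_conv_app_nth Cons_nth_drop_Suc)
      then show ?thesis by (simp add: X_def Y_def EC_def J_coeff_def)
    qed
    then have "(\<Sum>i<n. X b t (Suc i) + Y b t i) = 0" by simp
    moreover have "(\<Sum>i\<le>n. X b t i) = (\<Sum>i<n. X b t (Suc i))"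
      unfolding sum.atMost_shift by (simp add: X_def EC_def)
    moreover have "(\<Sum>i\<le>n. Y b t i) = (\<Sum>i<n. Y b t i)"
      unfolding lessThan_Suc_atMost[symmetric] by (simp add: Y_def J_coeff_def n_def)
    ultimately show ?thesis by (simp add: sum.distrib)
  qed
  ultimately have "driven p q \<gamma> (\<lambda>t. \<Sum>i\<le>n. E (rev (take i w)) t * J t (drop i w)) (\<lambda>_ _. 0)"
    by simp
  from sub.driven_zero_constant[OF this]
  show "word_coeff (edge_series A (\<tau> p) * holonomy p) w = word_coeff (edge_series A (\<tau> q) * holonomy q) w"
    by (simp add: word_coeff_mult conv_sum word_coeff_edge_series E_def n_def)
qed

text \<open>\<open>Z\<close> may be uncountable. Replacing \<open>u\<close> by the last visit
  \<open>l u\<close> up to time \<open>u\<close> skips the gaps, where nothing changes by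
  assumption. Between points of \<open>Z\<close> the path has no increment, so \<open>J\<close>
  changes at most quadratically, and \<open>increments_small\<close> applies with
  \<open>R = 0\<close>.\<close>

lemma holonomy_loops:
  assumes pq: "0 \<le> p" "p \<le> q" "q \<le> T" and Z: "closed Z" "p \<in> Z" "q \<in> Z"
    and same: "\<And>z b. z \<in> Z \<Longrightarrow> p \<le> z \<Longrightarrow> z \<le> q \<Longrightarrow> \<gamma> b z = \<gamma> b p"
    and gap: "\<And>y z. y \<in> Z \<Longrightarrow> z \<in> Z \<Longrightarrow> p \<le> y \<Longrightarrow> y < z \<Longrightarrow> z \<le> q \<Longrightarrow> {y<..<z} \<inter> Z = {} \<Longrightarrow>
       holonomy y = holonomy z"
  shows "holonomy p = holonomy q"
proof (rule word_series_eqI)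
  fix w
  obtain B K where BK: "B \<ge> 0" "K \<ge> 0" "\<And>t. 0 \<le> t \<Longrightarrow> t \<le> T \<Longrightarrow> \<bar>J t w\<bar> \<le> B"
    "\<And>t c. 0 \<le> t \<Longrightarrow> t \<le> T \<Longrightarrow> \<bar>J_coeff w c t\<bar> \<le> B"
    "\<And>s t. 0 \<le> s \<Longrightarrow> s \<le> t \<Longrightarrow> t \<le> T \<Longrightarrow> \<bar>J t w - J s w - (\<Sum>c\<in>UNIV. J_coeff w c t * (\<gamma> c t - \<gamma> c s))\<bar> \<le> K * (t - s)\<^sup>2"
    "\<And>s t. 0 \<le> s \<Longrightarrow> s \<le> t \<Longrightarrow> t \<le> T \<Longrightarrow> \<bar>J t w - J s w\<bar> \<le> K * (t - s)"
    using drivenD[OF driven_J[of w]] by blast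
  have JZ: "\<bar>J t w - J s w\<bar> \<le> K * (t - s)\<^sup>2" if "s \<in> Z" "t \<in> Z" "p \<le> s" "s \<le> t" "t \<le> q" for s t
    using BK(5)[of s t] same[of s] same[of t] that pq by simp
  define l where "l u = Sup (Z \<inter> {p..u})" for u
  have l: "l u \<in> Z" "p \<le> l u" "l u \<le> u" "\<And>z. z \<in> Z \<Longrightarrow> p \<le> z \<Longrightarrow> z \<le> u \<Longrightarrow> z \<le> l u" if "p \<le> u" for u
  proof -
    have ne: "Z \<inter> {p..u} \<noteq> {}" and bdd: "bdd_above (Z \<inter> {p..u})" using Z that by auto
    have "closed (Z \<inter> {p..u})" using Z by auto
    then have "l u \<in> Z \<inter> {p..u}" unfolding l_def by (intro closed_contains_Sup ne bdd)
    then show "l u \<in> Z" "p \<le> l u" "l u \<le> u" by auto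
    show "z \<le> l u" if "z \<in> Z" "p \<le> z" "z \<le> u" for z
      unfolding l_def using that bdd by (intro cSup_upper) auto
  qed
  have "\<bar>J (l q) w - J (l p) w\<bar> \<le> 0 * (q - p)"
  proof (rule increments_small[OF pq(2), of "\<lambda>u. J (l u) w" K])
    fix s t assume st: "p \<le> s" "s \<le> t" "t \<le> q"
    show "\<bar>J (l t) w - J (l s) w\<bar> \<le> K * (t - s)\<^sup>2 + 0 * (t - s)"
    proof (cases "l t \<le> s")
      case True
      then have "l t = l s"
        using l[of s] l[of t] st by (intro antisym) auto
      then show ?thesis using BK(2) by simp
    next
      case False
      \<comment> \<open>The first visit at or after \<open>s\<close>: from \<open>l s\<close> to
        \<open>z\<close> there is at most a gap, and the stretch from \<open>z\<close> to
        \<open>l t\<close> lies within \<open>[s, t]\<close>.\<close>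
      define z where "z = Inf (Z \<inter> {s..q})"
      have lt: "l t \<in> Z \<inter> {s..q}" using False l[of t] st by auto
      have bdd: "bdd_below (Z \<inter> {s..q})" by auto
      have "closed (Z \<inter> {s..q})" using Z by auto
      then have "z \<in> Z \<inter> {s..q}" unfolding z_def using lt bdd by (intro closed_contains_Inf) auto
      then have z: "z \<in> Z" "s \<le> z" "z \<le> q" by auto
      have z_le: "z \<le> y" if "y \<in> Z" "s \<le> y" "y \<le> q" for y
        unfolding z_def using that bdd by (intro cInf_lower) auto
      have "J (l s) w = J z w"
      proof (cases "l s = z")
        case False
        then have "l s < z" using l(3)[of s] z st by simp
        moreover have "{l s<..<z} \<inter> Z = {}"
        proof -
          have False if "y \<in> Z" "l s < y" "y < z" for y
            using l(4)[of s y] l(2)[of s] z_le[of y] z that st by (cases "y \<le> s") auto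
          then show ?thesis by auto
        qed
        ultimately have "holonomy (l s) = holonomy z" using l[of s] z st by (intro gap) auto
        then show ?thesis by (metis word_coeff_holonomy)
      qed simp
      moreover have "\<bar>J (l t) w - J z w\<bar> \<le> K * (l t - z)\<^sup>2"
        using lt z z_le[of "l t"] l[of t] st by (intro JZ) auto
      moreover have "(l t - z)\<^sup>2 \<le> (t - s)\<^sup>2"
        using z z_le[of "l t"] lt l(3)[of t] st by (intro power_mono) auto
      then have "K * (l t - z)\<^sup>2 \<le> K * (t - s)\<^sup>2" using BK(2) by (intro mult_left_mono)
      ultimately show ?thesis by simp
    qed
  qed
  moreover have "l p = p" using l(2,3)[of p] by simp
  moreover have "l q = q" using l(3)[of q] l(4)[of q q] Z(3) pq(2) by simp
  ultimately show "word_coeff (holonomy p) w = word_coeff (holonomy q) w" by simp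
qed

end

section \<open>Paths in a graph of edges\<close>

definition curve :: "(bool \<Rightarrow> real poly) \<Rightarrow> real \<Rightarrow> real \<times> real" where
  "curve A x = (poly (A False) x, poly (A True) x)"

lemma continuous_on_curve: "continuous_on S (curve A)"
  unfolding curve_def by (intro continuous_intros)

definition arc_at :: "(bool \<Rightarrow> real poly) \<Rightarrow> real \<times> real \<Rightarrow> (real \<times> real) set" where
  "arc_at A v = (\<lambda>x. v + curve A x) ` {0..1}"

lemma compact_arc_at: "compact (arc_at A v)"
  unfolding arc_at_def
  by (intro compact_continuous_image continuous_intros continuous_on_curve) auto

context abel_equation
begin

definition pos where "pos t = (\<gamma> False t, \<gamma> True t)"

lemma pos_lipschitz:
  assumes "0 \<le> s" "s \<le> T" "0 \<le> t" "t \<le> T"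
  shows "dist (pos s) (pos t) \<le> 2 * C * \<bar>s - t\<bar>"
proof -
  have "\<bar>\<gamma> b s - \<gamma> b t\<bar> \<le> C * \<bar>s - t\<bar>" for b
    using \<gamma>_lip[of s t b] \<gamma>_lip[of t s b] assms by (cases "s \<le> t") (auto simp: abs_minus_commute)
  from this[of False] this[of True] show ?thesis
    using norm_Pair_le[of "\<gamma> False s - \<gamma> False t" "\<gamma> True s - \<gamma> True t"]
    by (simp add: pos_def dist_norm)
qed

lemma pos_continuous: "continuous_on {0..T} pos"
proof -
  have "(2 * C)-lipschitz_on {0..T} pos"
    using pos_lipschitz C_ge by (intro lipschitz_onI) (auto simp: dist_real_def)
  then show ?thesis by (rule lipschitz_on_continuous_on)
qed

end

text \<open>Edges are listed by their kind \<open>e\<close> and starting point \<open>v\<close>;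
  \<open>S\<close> is the set of vertices. The lower bound \<open>c\<close> makes the parameter on
  an edge a Lipschitz function of the position, hence of time.\<close>

locale abel_path_in_graph = abel_equation T a
  for T a +
  fixes A :: "bool \<Rightarrow> bool \<Rightarrow> real poly" and ED :: "(bool \<times> (real \<times> real)) set"
    and S :: "(real \<times> real) set" and c :: real
  assumes fin: "finite ED"
    and cover: "\<And>t. 0 \<le> t \<Longrightarrow> t \<le> T \<Longrightarrow> \<exists>(e, v)\<in>ED. pos t \<in> arc_at (A e) v"
    and ends: "\<And>e v x. (e, v) \<in> ED \<Longrightarrow> 0 \<le> x \<Longrightarrow> x \<le> 1 \<Longrightarrow> v + curve (A e) x \<in> S \<longleftrightarrow> x = 0 \<or> x = 1"
    and disj: "\<And>e v e' v'. (e, v) \<in> ED \<Longrightarrow> (e', v') \<in> ED \<Longrightarrow> (e, v) \<noteq> (e', v') \<Longrightarrow>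
        arc_at (A e) v \<inter> arc_at (A e') v' \<subseteq> S"
    and c: "c > 0"
    and lower: "\<And>e x y. 0 \<le> x \<Longrightarrow> x \<le> 1 \<Longrightarrow> 0 \<le> y \<Longrightarrow> y \<le> 1 \<Longrightarrow> c * \<bar>x - y\<bar> \<le> dist (curve (A e) x) (curve (A e) y)"
    and closed_path: "pos 0 \<in> S" "pos T \<in> S"
begin

definition V where "V = (\<Union>(e, v)\<in>ED. {v + curve (A e) 0, v + curve (A e) 1})"

definition Z where "Z = {t \<in> {0..T}. pos t \<in> S}"

lemma finite_V: "finite V"
  using fin by (auto simp: V_def)

lemma Z_eq: "Z = {0..T} \<inter> pos -` V"
proof -
  have "pos t \<in> S \<longleftrightarrow> pos t \<in> V" if "t \<in> {0..T}" for t
  proof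
    assume S: "pos t \<in> S"
    have "0 \<le> t" "t \<le> T" using that by auto
    from cover[OF this] obtain e v x where "(e, v) \<in> ED" "pos t = v + curve (A e) x" "0 \<le> x" "x \<le> 1"
      by (auto simp: arc_at_def)
    moreover from this S have "x = 0 \<or> x = 1" using ends by metis
    ultimately show "pos t \<in> V" unfolding V_def by (intro UN_I[of "(e, v)"]) auto
  next
    assume "pos t \<in> V"
    then show "pos t \<in> S" using ends by (auto simp: V_def)
  qed
  then show ?thesis unfolding Z_def vimage_def by blast
qed

lemma closed_Z: "closed Z"
  unfolding Z_eq
  by (intro continuous_closed_preimage pos_continuous finite_imp_closed finite_V closed_atLeastAtMost)

text \<open>Away from \<open>S\<close> the edges are disjoint, so within a gap the times spent on
  one edge form a set that is closed and has closed complement; the gap is connected. Its ends are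
  added by closure.\<close>

lemma gap_in_edge:
  assumes pq: "0 \<le> p" "p < q" "q \<le> T" and gap: "{p<..<q} \<inter> Z = {}"
  obtains e v where "(e, v) \<in> ED" "\<And>t. p \<le> t \<Longrightarrow> t \<le> q \<Longrightarrow> pos t \<in> arc_at (A e) v"
proof -
  define X where "X = (\<lambda>(e, v). {p<..<q} \<inter> pos -` arc_at (A e) v)"
  have cont: "continuous_on {p<..<q} pos"
    by (rule continuous_on_subset[OF pos_continuous]) (use pq in auto)
  have clX: "closedin (top_of_set {p<..<q}) (X i)" for i
    unfolding X_def split_def
    by (intro continuous_closedin_preimage[OF cont] compact_imp_closed compact_arc_at)
  define m where "m = (p + q) / 2"
  have m: "m \<in> {p<..<q}" using pq by (simp add: m_def)
  then obtain e v where ev: "(e, v) \<in> ED" "pos m \<in> arc_at (A e) v"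
    using cover[of m] pq by auto
  have "{p<..<q} - X (e, v) = (\<Union>i\<in>ED - {(e, v)}. X i)"
  proof (rule set_eqI)
    fix t
    show "t \<in> {p<..<q} - X (e, v) \<longleftrightarrow> t \<in> (\<Union>i\<in>ED - {(e, v)}. X i)"
    proof
      assume t: "t \<in> {p<..<q} - X (e, v)"
      then obtain e' v' where "(e', v') \<in> ED" "pos t \<in> arc_at (A e') v'"
        using cover[of t] pq by auto
      moreover have "pos t \<notin> arc_at (A e) v" using t by (auto simp: X_def)
      then have "(e', v') \<noteq> (e, v)" using \<open>pos t \<in> arc_at (A e') v'\<close> by (metis prod.inject)
      moreover have "t \<in> X (e', v')" using t \<open>pos t \<in> arc_at (A e') v'\<close> by (simp add: X_def)
      ultimately show "t \<in> (\<Union>i\<in>ED - {(e, v)}. X i)" by blast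
    next
      assume "t \<in> (\<Union>i\<in>ED - {(e, v)}. X i)"
      then obtain i where i: "i \<in> ED" "i \<noteq> (e, v)" "t \<in> X i" by blast
      obtain e' v' where "i = (e', v')" by (cases i)
      with i have *: "(e', v') \<in> ED" "(e', v') \<noteq> (e, v)" "t \<in> {p<..<q}" "pos t \<in> arc_at (A e') v'"
        by (simp_all add: X_def)
      have "pos t \<notin> S" using gap *(3) pq by (auto simp: Z_def)
      then have "pos t \<notin> arc_at (A e) v" using disj[OF ev(1) *(1)] *(2,4) by blast
      then show "t \<in> {p<..<q} - X (e, v)" using *(3) by (auto simp: X_def)
    qed
  qed
  then have "closedin (top_of_set {p<..<q}) ({p<..<q} - X (e, v))"
    using clX fin by (auto intro!: closedin_Union)
  then have "openin (top_of_set {p<..<q}) (X (e, v))"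
    by (simp add: openin_closedin_eq X_def)
  moreover have "connected {p<..<q}" by simp
  moreover have "X (e, v) \<noteq> {}" using m ev(2) by (auto simp: X_def)
  ultimately have Xall: "X (e, v) = {p<..<q}"
    using clX[of "(e, v)"] unfolding connected_clopen by blast
  have "pos t \<in> arc_at (A e) v" if "p \<le> t" "t \<le> q" for t
  proof -
    have "closed ({0..T} \<inter> pos -` arc_at (A e) v)"
      by (intro continuous_closed_preimage pos_continuous compact_imp_closed compact_arc_at) auto
    moreover have "{p<..<q} \<subseteq> {0..T} \<inter> pos -` arc_at (A e) v"
      using Xall pq by (auto simp: X_def)
    ultimately have "closure {p<..<q} \<subseteq> {0..T} \<inter> pos -` arc_at (A e) v"
      by (rule closure_minimal[rotated])
    then show ?thesis using that pq by auto
  qed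
  then show thesis using that ev(1) by blast
qed

abbreviation E where "E e \<equiv> edge_series (A e) 1"

text \<open>At both ends of a gap the edge parameter is 0 or 1, so the edge factors are the powers 0
  or 1 of the signature of the edge. Equal positions force equal parameters by the lower bound
  \<open>c\<close>, and then the factors cancel.\<close>

lemma gap_holonomy:
  assumes pq: "0 \<le> p" "p < q" "q \<le> T" and Z: "p \<in> Z" "q \<in> Z" and gap: "{p<..<q} \<inter> Z = {}"
  shows "pos p = pos q \<Longrightarrow> holonomy p = holonomy q"
    and "\<exists>L. holonomy p = word_value E L * holonomy q"
proof -
  obtain e v where ev: "(e, v) \<in> ED" and on: "\<And>t. p \<le> t \<Longrightarrow> t \<le> q \<Longrightarrow> pos t \<in> arc_at (A e) v"
    using gap_in_edge[OF pq gap] by blast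
  have "\<exists>x. 0 \<le> x \<and> x \<le> 1 \<and> pos t = v + curve (A e) x" if "p \<le> t" "t \<le> q" for t
    using on[OF that] by (auto simp: arc_at_def)
  then obtain \<tau> where \<tau>: "\<And>t. p \<le> t \<Longrightarrow> t \<le> q \<Longrightarrow> 0 \<le> \<tau> t \<and> \<tau> t \<le> 1 \<and> pos t = v + curve (A e) (\<tau> t)"
    by metis
  have inj: "c * \<bar>\<tau> t - \<tau> s\<bar> \<le> dist (pos s) (pos t)" if "p \<le> s" "s \<le> q" "p \<le> t" "t \<le> q" for s t
    using lower[of "\<tau> t" "\<tau> s" e] \<tau>[of s] \<tau>[of t] that by (simp add: dist_commute)
  define x where "x b = (if b then snd v else fst v)" for b
  have edge: "edge_series (A e) (\<tau> p) * holonomy p = edge_series (A e) (\<tau> q) * holonomy q"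
  proof (rule holonomy_along_edge[where L = "2 * C / c" and x = x])
    show "\<bar>\<tau> t - \<tau> s\<bar> \<le> 2 * C / c * (t - s)" if "p \<le> s" "s \<le> t" "t \<le> q" for s t
    proof -
      have "c * \<bar>\<tau> t - \<tau> s\<bar> \<le> 2 * C * (t - s)"
        using inj[of s t] pos_lipschitz[of s t] that pq by simp
      then show ?thesis using c by (simp add: field_simps)
    qed
    show "\<gamma> b t = x b + poly (A e b) (\<tau> t)" if "p \<le> t" "t \<le> q" for t b
    proof -
      have "pos t = v + curve (A e) (\<tau> t)" using \<tau>[OF that] by simp
      then show ?thesis by (cases b; cases v) (auto simp: pos_def x_def curve_def)
    qed
  qed (use pq \<tau> in auto)
  show "holonomy p = holonomy q" if "pos p = pos q"
  proof -
    have "\<tau> p = \<tau> q" using inj[of p q] that pq c by (simp add: zero_less_mult_iff mult_le_0_iff)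
    then have "series_inverse (edge_series (A e) (\<tau> p)) * (edge_series (A e) (\<tau> p) * holonomy p) =
        series_inverse (edge_series (A e) (\<tau> p)) * (edge_series (A e) (\<tau> p) * holonomy q)"
      using edge by simp
    then show ?thesis by (simp add: series_inverse_left flip: mult.assoc)
  qed
  have end01: "\<tau> t = 0 \<or> \<tau> t = 1" if "t = p \<or> t = q" for t
  proof -
    have "pos t \<in> S" using that Z by (auto simp: Z_def)
    moreover have "0 \<le> \<tau> t \<and> \<tau> t \<le> 1 \<and> pos t = v + curve (A e) (\<tau> t)" using \<tau>[of t] that pq by auto
    ultimately show ?thesis using ends[OF ev, of "\<tau> t"] by auto
  qed
  have "\<exists>i. edge_series (A e) (\<tau> t) = zpower (E e) i" if "t = p \<or> t = q" for t
    using end01[OF that]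
  proof
    assume "\<tau> t = 0"
    then show ?thesis by (intro exI[of _ 0]) (simp add: edge_series_0)
  next
    assume "\<tau> t = 1"
    then show ?thesis by (intro exI[of _ 1]) simp
  qed
  then obtain i j where ij: "edge_series (A e) (\<tau> p) = zpower (E e) i" "edge_series (A e) (\<tau> q) = zpower (E e) j"
    by blast
  note zp = zpower_add[OF word_coeff_edge_series_Nil, of "A e" 1]
  have "zpower (E e) (- i) * (zpower (E e) i * holonomy p) = zpower (E e) (- i) * (zpower (E e) j * holonomy q)"
    using edge ij by simp
  then have "holonomy p = zpower (E e) (- i + j) * holonomy q"
    by (simp flip: mult.assoc zp)
  then show "\<exists>L. holonomy p = word_value E L * holonomy q"
    by (intro exI[of _ "[(e, - i + j)]"]) simp
qed

text \<open>Distinct endpoints have a positive minimal distance, and the path has speed at most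
  \<open>2 * C\<close>.\<close>

lemma window: "\<exists>h>0. \<forall>s\<in>Z. \<forall>t\<in>Z. \<bar>s - t\<bar> \<le> h \<longrightarrow> pos s = pos t"
proof -
  obtain d where d: "d > 0" "\<And>x y. x \<in> V \<Longrightarrow> y \<in> V \<Longrightarrow> x \<noteq> y \<Longrightarrow> d \<le> dist x y"
  proof -
    define D where "D = insert 1 ((\<lambda>(x, y). dist x y) ` {(x, y) \<in> V \<times> V. x \<noteq> y})"
    have "finite {(x, y) \<in> V \<times> V. x \<noteq> y}"
      by (rule finite_subset[of _ "V \<times> V"]) (auto simp: finite_V)
    then have D: "finite D" "D \<noteq> {}" by (auto simp: D_def)
    have "Min D > 0" using D by (auto simp: D_def)
    moreover have "Min D \<le> dist x y" if "x \<in> V" "y \<in> V" "x \<noteq> y" for x y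
      using D that by (intro Min_le) (auto simp: D_def)
    ultimately show thesis using that by blast
  qed
  define h where "h = d / (4 * C)"
  have h: "h > 0" "2 * C * h < d" using d C_ge by (auto simp: h_def)
  have "pos s = pos t" if "s \<in> Z" "t \<in> Z" "\<bar>s - t\<bar> \<le> h" for s t
  proof (rule ccontr)
    assume "pos s \<noteq> pos t"
    then have "d \<le> dist (pos s) (pos t)" using d(2) that by (auto simp: Z_eq)
    also have "\<dots> \<le> 2 * C * \<bar>s - t\<bar>" using that by (intro pos_lipschitz) (auto simp: Z_def)
    also have "\<dots> \<le> 2 * C * h" using that C_ge by (intro mult_left_mono) auto
    finally show False using h by simp
  qed
  then show ?thesis using h by blast
qed

text \<open>Induction backwards in time over windows of length \<open>h\<close>. From a visit
  \<open>u\<close> before the mark \<open>m\<close>, all visits up to \<open>m\<close> are at the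
  same vertex and contribute nothing; the one gap that may reach over \<open>m\<close> contributes a
  single syllable.\<close>

lemma holonomy_is_word_value: "\<exists>L. holonomy 0 = word_value E L"
proof -
  obtain h where h: "h > 0" "\<And>s t. s \<in> Z \<Longrightarrow> t \<in> Z \<Longrightarrow> \<bar>s - t\<bar> \<le> h \<Longrightarrow> pos s = pos t"
    using window by blast
  have TZ: "T \<in> Z" "0 \<in> Z" using closed_path T by (auto simp: Z_def)
  have "\<exists>L. holonomy u = word_value E L" if "u \<in> Z" "T - u \<le> real N * h" for u N
    using that
  proof (induction N arbitrary: u)
    case 0
    then have "u = T" by (auto simp: Z_def)
    then show ?case by (intro exI[of _ "[]"]) (simp add: holonomy_end)
  next
    case (Suc N)
    define m where "m = T - real N * h"
    show ?case
    proof (cases "m \<le> u")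
      case True
      then show ?thesis using Suc by (simp add: m_def)
    next
      case False
      have mT: "m \<le> T" using h by (simp add: m_def)
      have u: "0 \<le> u" "u \<le> T" using Suc.prems by (auto simp: Z_def)
      have um: "u < m" "m - u \<le> h" using False Suc.prems(2) by (auto simp: m_def algebra_simps)
      define z where "z = Sup (Z \<inter> {u..m})"
      define z1 where "z1 = Inf (Z \<inter> {m..T})"
      have ba: "bdd_above (Z \<inter> {u..m})" and bb: "bdd_below (Z \<inter> {m..T})" by auto
      have "z \<in> Z \<inter> {u..m}" unfolding z_def
        using Suc.prems um closed_Z ba by (intro closed_contains_Sup) auto
      then have z: "z \<in> Z" "u \<le> z" "z \<le> m" by auto
      have "z1 \<in> Z \<inter> {m..T}" unfolding z1_def
        using TZ mT closed_Z bb by (intro closed_contains_Inf) auto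
      then have z1: "z1 \<in> Z" "m \<le> z1" "z1 \<le> T" by auto
      have z_ge: "y \<le> z" if "y \<in> Z" "u \<le> y" "y \<le> m" for y
        unfolding z_def using that ba by (intro cSup_upper) auto
      have z1_le: "z1 \<le> y" if "y \<in> Z" "m \<le> y" "y \<le> T" for y
        unfolding z1_def using that bb by (intro cInf_lower) auto
      obtain L where L: "holonomy z1 = word_value E L"
        using Suc.IH[of z1] z1 by (auto simp: m_def)
      have "\<exists>L. holonomy z = word_value E L"
      proof (cases "z = z1")
        case True
        then show ?thesis using L by auto
      next
        case False
        then have "z < z1" using z z1 by simp
        moreover have "{z<..<z1} \<inter> Z = {}"
        proof -
          have False if "y \<in> Z" "z < y" "y < z1" for y
            using z_ge[of y] z1_le[of y] that z z1 by (cases "y \<le> m") auto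
          then show ?thesis by auto
        qed
        ultimately obtain L' where "holonomy z = word_value E L' * holonomy z1"
          using gap_holonomy(2)[of z z1] z z1 u by auto
        then show ?thesis using L by (intro exI[of _ "L' @ L"]) simp
      qed
      moreover have "holonomy u = holonomy z"
      proof (rule holonomy_loops[OF u(1) z(2) _ closed_Z Suc.prems(1) z(1)])
        show "z \<le> T" using z mT by simp
        have same: "pos y = pos u" if "y \<in> Z" "u \<le> y" "y \<le> z" for y
          using that Suc.prems(1) z um by (intro h(2)) auto
        show "\<gamma> b y = \<gamma> b u" if "y \<in> Z" "u \<le> y" "y \<le> z" for y b
          using same[OF that] by (cases b) (auto simp: pos_def)
        show "holonomy y = holonomy y'"
          if "y \<in> Z" "y' \<in> Z" "u \<le> y" "y < y'" "y' \<le> z" "{y<..<y'} \<inter> Z = {}" for y y'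
          using that u z mT same[of y] same[of y'] by (intro gap_holonomy(1)) auto
      qed
      ultimately show ?thesis by simp
    qed
  qed
  moreover obtain N :: nat where "T / h < N" using reals_Archimedean2 by blast
  then have "T - 0 \<le> real N * h" using h by (simp add: field_simps)
  ultimately show ?thesis using TZ by blast
qed

end

section \<open>Algebraic independence\<close>

definition monomial_value :: "('i \<Rightarrow>\<^sub>0 nat) \<Rightarrow> ('i \<Rightarrow> real) \<Rightarrow> real" where
  "monomial_value m x = (\<Prod>i\<in>Poly_Mapping.keys m. x i ^ Poly_Mapping.lookup m i)"

lemma monomial_value_superset:
  assumes "finite K" "Poly_Mapping.keys m \<subseteq> K"
  shows "monomial_value m x = (\<Prod>i\<in>K. x i ^ Poly_Mapping.lookup m i)"
  unfolding monomial_value_def using assms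
  by (intro prod.mono_neutral_left) (auto simp: in_keys_iff)

lemma monomial_value_add: "monomial_value (m + n) x = monomial_value m x * monomial_value n x"
proof -
  define K where "K = Poly_Mapping.keys m \<union> Poly_Mapping.keys n \<union> Poly_Mapping.keys (m + n)"
  have K: "finite K" "Poly_Mapping.keys m \<subseteq> K" "Poly_Mapping.keys n \<subseteq> K" "Poly_Mapping.keys (m + n) \<subseteq> K"
    by (auto simp: K_def)
  show ?thesis
    using K by (simp add: monomial_value_superset[of K] lookup_add power_add prod.distrib)
qed

lemma eval_rat_mpoly_superset:
  assumes "finite K" "Poly_Mapping.keys p \<subseteq> K"
  shows "eval_rat_mpoly p x = (\<Sum>m\<in>K. of_rat (Poly_Mapping.lookup p m) * monomial_value m x)"
  unfolding eval_rat_mpoly_def monomial_value_def[symmetric] using assms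
  by (intro sum.mono_neutral_left) (auto simp: in_keys_iff)

lemma eval_rat_mpoly_0 [simp]: "eval_rat_mpoly 0 x = 0"
  by (simp add: eval_rat_mpoly_def)

lemma eval_rat_mpoly_add: "eval_rat_mpoly (p + q) x = eval_rat_mpoly p x + eval_rat_mpoly q x"
proof -
  define K where "K = Poly_Mapping.keys p \<union> Poly_Mapping.keys q \<union> Poly_Mapping.keys (p + q)"
  have K: "finite K" "Poly_Mapping.keys p \<subseteq> K" "Poly_Mapping.keys q \<subseteq> K" "Poly_Mapping.keys (p + q) \<subseteq> K"
    by (auto simp: K_def)
  show ?thesis
    using K by (simp add: eval_rat_mpoly_superset[of K] lookup_add of_rat_add distrib_right sum.distrib)
qed

lemma eval_rat_mpoly_sum: "eval_rat_mpoly (\<Sum>a\<in>F. P a) x = (\<Sum>a\<in>F. eval_rat_mpoly (P a) x)"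
  by (induction F rule: infinite_finite_induct) (auto simp: eval_rat_mpoly_add)

lemma eval_rat_mpoly_single: "eval_rat_mpoly (Poly_Mapping.single m c) x = of_rat c * monomial_value m x"
  by (subst eval_rat_mpoly_superset[of "{m}"]) auto

lemma poly_mapping_as_sum: "p = (\<Sum>a\<in>Poly_Mapping.keys p. Poly_Mapping.single a (Poly_Mapping.lookup p a))"
proof (rule poly_mapping_eqI)
  fix k
  show "Poly_Mapping.lookup p k = Poly_Mapping.lookup (\<Sum>a\<in>Poly_Mapping.keys p. Poly_Mapping.single a (Poly_Mapping.lookup p a)) k"
    by (cases "k \<in> Poly_Mapping.keys p") (auto simp: lookup_sum lookup_single when_def in_keys_iff)
qed

lemma eval_rat_mpoly_mult: "eval_rat_mpoly (p * q) x = eval_rat_mpoly p x * eval_rat_mpoly q x"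
proof -
  have "p * q = (\<Sum>a\<in>Poly_Mapping.keys p. \<Sum>b\<in>Poly_Mapping.keys q.
      Poly_Mapping.single (a + b) (Poly_Mapping.lookup p a * Poly_Mapping.lookup q b))"
    by (subst poly_mapping_as_sum[of p], subst poly_mapping_as_sum[of q]) (simp add: sum_product mult_single)
  then have "eval_rat_mpoly (p * q) x = (\<Sum>a\<in>Poly_Mapping.keys p. \<Sum>b\<in>Poly_Mapping.keys q.
      of_rat (Poly_Mapping.lookup p a * Poly_Mapping.lookup q b) * monomial_value (a + b) x)"
    by (simp only: eval_rat_mpoly_sum eval_rat_mpoly_single)
  also have "\<dots> = eval_rat_mpoly p x * eval_rat_mpoly q x"
    by (simp add: eval_rat_mpoly_def monomial_value_def[symmetric] sum_product monomial_value_add of_rat_mult mult_ac)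
  finally show ?thesis .
qed

text \<open>Functions of all real assignments \<open>x\<close>, not only of the generic one: this is
  what permits substituting other coefficients into a relation.\<close>

definition rational_polynomial_function :: "'i set \<Rightarrow> (('i \<Rightarrow> real) \<Rightarrow> real) \<Rightarrow> bool" where
  "rational_polynomial_function I F \<longleftrightarrow>
     (\<exists>p. (\<forall>m\<in>Poly_Mapping.keys p. Poly_Mapping.keys m \<subseteq> I) \<and> (\<forall>x. F x = eval_rat_mpoly p x))"

lemma rpf_const [intro]: "rational_polynomial_function I (\<lambda>_. of_rat c)"
  unfolding rational_polynomial_function_def
  by (intro exI[of _ "Poly_Mapping.single 0 c"]) (auto simp: eval_rat_mpoly_single monomial_value_def)

lemma rpf_of_nat [intro]: "rational_polynomial_function I (\<lambda>_. real n)"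
  using rpf_const[of I "of_nat n"] by simp

lemma rpf_inverse_of_nat [intro]: "rational_polynomial_function I (\<lambda>_. inverse (real n))"
  using rpf_const[of I "inverse (of_nat n)"] by (simp add: of_rat_inverse)

lemma rpf_0 [intro]: "rational_polynomial_function I (\<lambda>_. 0)"
  using rpf_of_nat[of I 0] by simp

lemma rpf_1 [intro]: "rational_polynomial_function I (\<lambda>_. 1)"
  using rpf_of_nat[of I 1] by simp

lemma rpf_var [intro]: "i \<in> I \<Longrightarrow> rational_polynomial_function I (\<lambda>x. x i)"
  unfolding rational_polynomial_function_def
  by (intro exI[of _ "Poly_Mapping.single (Poly_Mapping.single i 1) 1"])
    (auto simp: eval_rat_mpoly_single monomial_value_def)

lemma rpf_add [intro]:
  assumes "rational_polynomial_function I F" "rational_polynomial_function I G"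
  shows "rational_polynomial_function I (\<lambda>x. F x + G x)"
proof -
  obtain p q where "\<forall>m\<in>Poly_Mapping.keys p. Poly_Mapping.keys m \<subseteq> I" "\<forall>x. F x = eval_rat_mpoly p x"
    "\<forall>m\<in>Poly_Mapping.keys q. Poly_Mapping.keys m \<subseteq> I" "\<forall>x. G x = eval_rat_mpoly q x"
    using assms unfolding rational_polynomial_function_def by blast
  then show ?thesis
    unfolding rational_polynomial_function_def using Poly_Mapping.keys_add[of p q]
    by (intro exI[of _ "p + q"]) (fastforce simp: eval_rat_mpoly_add)
qed

lemma rpf_mult [intro]:
  assumes "rational_polynomial_function I F" "rational_polynomial_function I G"
  shows "rational_polynomial_function I (\<lambda>x. F x * G x)"
proof -
  obtain p q where p: "\<forall>m\<in>Poly_Mapping.keys p. Poly_Mapping.keys m \<subseteq> I" "\<forall>x. F x = eval_rat_mpoly p x"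
    and q: "\<forall>m\<in>Poly_Mapping.keys q. Poly_Mapping.keys m \<subseteq> I" "\<forall>x. G x = eval_rat_mpoly q x"
    using assms unfolding rational_polynomial_function_def by blast
  have "Poly_Mapping.keys m \<subseteq> I" if m: "m \<in> Poly_Mapping.keys (p * q)" for m
  proof -
    obtain a b where ab: "a \<in> Poly_Mapping.keys p" "b \<in> Poly_Mapping.keys q" "m = a + b"
      using keys_mult[of p q] m by blast
    then show ?thesis using Poly_Mapping.keys_add[of a b] p(1) q(1) by blast
  qed
  then show ?thesis
    unfolding rational_polynomial_function_def using p(2) q(2)
    by (intro exI[of _ "p * q"]) (auto simp: eval_rat_mpoly_mult)
qed

lemma rpf_uminus [intro]:
  assumes "rational_polynomial_function I F"
  shows "rational_polynomial_function I (\<lambda>x. - F x)"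
  using rpf_mult[OF rpf_const[of I "- 1"] assms] by (simp add: of_rat_minus)

lemma rpf_diff [intro]:
  assumes "rational_polynomial_function I F" "rational_polynomial_function I G"
  shows "rational_polynomial_function I (\<lambda>x. F x - G x)"
  using rpf_add[OF assms(1) rpf_uminus[OF assms(2)]] by simp

lemma rpf_sum [intro]:
  "(\<And>a. a \<in> K \<Longrightarrow> rational_polynomial_function I (F a)) \<Longrightarrow>
    rational_polynomial_function I (\<lambda>x. \<Sum>a\<in>K. F a x)"
  by (induction K rule: infinite_finite_induct) auto

lemma rpf_vanishes:
  assumes "algebraically_independent_rat I f" "rational_polynomial_function I F" "F f = 0"
  shows "F x = 0"
proof -
  obtain p where p: "\<forall>m\<in>Poly_Mapping.keys p. Poly_Mapping.keys m \<subseteq> I" "\<forall>x. F x = eval_rat_mpoly p x"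
    using assms(2) unfolding rational_polynomial_function_def by blast
  then have "p = 0" using assms(1,3) unfolding algebraically_independent_rat_def by metis
  then show ?thesis using p by simp
qed

section \<open>Spaces of monomials over the rationals and their dimension\<close>

interpretation rat_real: vector_space "\<lambda>(q :: rat) (x :: real). of_rat q * x"
  by unfold_locales (auto simp: algebra_simps of_rat_add of_rat_mult)

text \<open>Bounding every exponent, rather than the total degree, makes the number of monomials the
  plain power \<open>Suc D ^ card I\<close>.\<close>

definition monomial_box :: "'i set \<Rightarrow> nat \<Rightarrow> ('i \<Rightarrow> nat) set" where
  "monomial_box I D = I \<rightarrow>\<^sub>E {..D}"

lemma finite_monomial_box: "finite I \<Longrightarrow> finite (monomial_box I D)"
  by (simp add: monomial_box_def finite_PiE)

lemma card_monomial_box: "finite I \<Longrightarrow> card (monomial_box I D) = Suc D ^ card I"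
  by (simp add: monomial_box_def card_PiE)

definition box_span :: "'i set \<Rightarrow> ('i \<Rightarrow> real) \<Rightarrow> nat \<Rightarrow> real set" where
  "box_span I z D = rat_real.span ((\<lambda>m. \<Prod>i\<in>I. z i ^ m i) ` monomial_box I D)"

lemma box_span_mono: "D \<le> D' \<Longrightarrow> box_span I z D \<subseteq> box_span I z D'"
  unfolding box_span_def monomial_box_def by (intro rat_real.span_mono image_mono PiE_mono) auto

lemma box_span_mult:
  assumes "x \<in> box_span I z D" "y \<in> box_span I z D'"
  shows "x * y \<in> box_span I z (D + D')"
  using assms(1) unfolding box_span_def
proof (induction rule: rat_real.span_induct_alt)
  case base
  show ?case by (simp add: rat_real.span_zero)
next
  case (step c u v)
  obtain m where m: "u = (\<Prod>i\<in>I. z i ^ m i)" "m \<in> monomial_box I D" using step by auto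
  have "u * y \<in> rat_real.span ((\<lambda>m. \<Prod>i\<in>I. z i ^ m i) ` monomial_box I (D + D'))"
    using assms(2) unfolding box_span_def
  proof (induction rule: rat_real.span_induct_alt)
    case base
    show ?case by (simp add: rat_real.span_zero)
  next
    case (step c' u' v')
    obtain m' where m': "u' = (\<Prod>i\<in>I. z i ^ m' i)" "m' \<in> monomial_box I D'" using step by auto
    define m'' where "m'' = (\<lambda>i\<in>I. m i + m' i)"
    have "u * u' = (\<Prod>i\<in>I. z i ^ m'' i)"
      unfolding m m' prod.distrib[symmetric] by (intro prod.cong) (auto simp: m''_def power_add)
    moreover have "m'' \<in> monomial_box I (D + D')"
      using m(2) m'(2) by (auto simp: monomial_box_def m''_def intro!: add_mono)
    ultimately have "u * u' \<in> rat_real.span ((\<lambda>m. \<Prod>i\<in>I. z i ^ m i) ` monomial_box I (D + D'))"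
      by (auto intro!: rat_real.span_base)
    then have "of_rat c' * (u * u') + u * v' \<in> rat_real.span ((\<lambda>m. \<Prod>i\<in>I. z i ^ m i) ` monomial_box I (D + D'))"
      using step by (intro rat_real.span_add rat_real.span_scale) auto
    then show ?case by (simp add: algebra_simps)
  qed
  then have "of_rat c * (u * y) + v * y \<in> rat_real.span ((\<lambda>m. \<Prod>i\<in>I. z i ^ m i) ` monomial_box I (D + D'))"
    using step by (intro rat_real.span_add rat_real.span_scale) auto
  then show ?case by (simp add: algebra_simps)
qed

lemma box_span_1: "1 \<in> box_span I z D"
proof -
  have "(\<lambda>m. \<Prod>i\<in>I. z i ^ m i) (\<lambda>i\<in>I. 0) \<in> box_span I z D"
    unfolding box_span_def by (intro rat_real.span_base imageI) (auto simp: monomial_box_def)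
  then show ?thesis by simp
qed

lemma box_span_power: "x \<in> box_span I z D \<Longrightarrow> x ^ n \<in> box_span I z (n * D)"
  by (induction n) (auto simp: box_span_1 intro!: box_span_mult)

lemma box_span_prod:
  assumes "finite K" "\<And>a. a \<in> K \<Longrightarrow> F a \<in> box_span I z D"
  shows "(\<Prod>a\<in>K. F a) \<in> box_span I z (card K * D)"
  using assms by (induction K rule: finite_induct) (auto simp: box_span_1 intro!: box_span_mult)

text \<open>The ring generated over the rationals by arbitrary real numbers \<open>z i\<close>. In
  this form, that a solution of an equation belongs to it follows from closure rules alone.\<close>

inductive_set rational_ring :: "'i set \<Rightarrow> ('i \<Rightarrow> real) \<Rightarrow> real set" for I z where
  const [intro]: "of_rat c \<in> rational_ring I z"
| var [intro]: "i \<in> I \<Longrightarrow> z i \<in> rational_ring I z"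
| add [intro]: "x \<in> rational_ring I z \<Longrightarrow> y \<in> rational_ring I z \<Longrightarrow> x + y \<in> rational_ring I z"
| mult [intro]: "x \<in> rational_ring I z \<Longrightarrow> y \<in> rational_ring I z \<Longrightarrow> x * y \<in> rational_ring I z"

lemma rational_ring_of_nat [intro]: "real n \<in> rational_ring I z"
  using rational_ring.const[of "of_nat n"] by simp

lemma rational_ring_of_int [intro]: "real_of_int n \<in> rational_ring I z"
  using rational_ring.const[of "of_int n"] by simp

lemma rational_ring_0 [intro]: "0 \<in> rational_ring I z" and rational_ring_1 [intro]: "1 \<in> rational_ring I z"
  using rational_ring_of_nat[of 0 I z] rational_ring_of_nat[of 1 I z] by simp_all

lemma rational_ring_uminus [intro]:
  assumes "x \<in> rational_ring I z"
  shows "- x \<in> rational_ring I z"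
  using rational_ring.mult[OF rational_ring_of_int[of "- 1"] assms] by simp

lemma rational_ring_diff [intro]:
  "x \<in> rational_ring I z \<Longrightarrow> y \<in> rational_ring I z \<Longrightarrow> x - y \<in> rational_ring I z"
  using rational_ring.add[of x I z "- y"] by auto

lemma rational_ring_power [intro]: "x \<in> rational_ring I z \<Longrightarrow> x ^ n \<in> rational_ring I z"
  by (induction n) auto

lemma rational_ring_sum [intro]:
  "(\<And>a. a \<in> K \<Longrightarrow> F a \<in> rational_ring I z) \<Longrightarrow> (\<Sum>a\<in>K. F a) \<in> rational_ring I z"
  by (induction K rule: infinite_finite_induct) auto

lemma rational_ring_imp_box_span:
  assumes "finite I" "x \<in> rational_ring I z"
  shows "\<exists>D. x \<in> box_span I z D"
  using assms(2)
proof induction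
  case (const c)
  have "of_rat c * 1 \<in> box_span I z 0"
    using box_span_1[of I z 0] unfolding box_span_def by (intro rat_real.span_scale)
  then show ?case by auto
next
  case (var i)
  define m where "m = (\<lambda>j\<in>I. if j = i then 1 else 0 :: nat)"
  have "(\<Prod>j\<in>I. z j ^ m j) = (\<Prod>j\<in>I. if j = i then z i else 1)"
    by (intro prod.cong) (auto simp: m_def)
  also have "\<dots> = z i" using assms(1) var by simp
  finally have "z i = (\<Prod>j\<in>I. z j ^ m j)" by simp
  moreover have "m \<in> monomial_box I 1" by (auto simp: m_def monomial_box_def)
  ultimately have "z i \<in> box_span I z 1" unfolding box_span_def by (auto intro!: rat_real.span_base)
  then show ?case by blast
next
  case (add x y)
  then obtain D D' where "x \<in> box_span I z D" "y \<in> box_span I z D'" by blast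
  then have "x \<in> box_span I z (max D D')" "y \<in> box_span I z (max D D')"
    using box_span_mono[of D "max D D'" I z] box_span_mono[of D' "max D D'" I z] by auto
  then show ?case unfolding box_span_def by (auto intro!: rat_real.span_add)
next
  case (mult x y)
  then show ?case using box_span_mult by blast
qed

text \<open>Exponent functions extensional on \<open>I\<close> correspond injectively to monomials,
  so a vanishing sum is a vanishing polynomial with the \<open>q m\<close> as its
  coefficients.\<close>

lemma independent_monomials:
  assumes ind: "algebraically_independent_rat I f" and I: "finite I" and M: "finite M" "M \<subseteq> monomial_box I D"
    and zero: "(\<Sum>m\<in>M. of_rat (q m) * (\<Prod>i\<in>I. f i ^ m i)) = 0" and m: "m \<in> M"
  shows "q m = 0"
proof -
  define g where "g m = (\<Sum>i\<in>I. Poly_Mapping.single i (m i))" for m :: "'a \<Rightarrow> nat"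
  have lookup_g: "Poly_Mapping.lookup (g m) i = (if i \<in> I then m i else 0)" for m i
    using I by (simp add: g_def lookup_sum lookup_single when_def)
  have keys_g: "Poly_Mapping.keys (g m) \<subseteq> I" for m
    using lookup_g by (auto simp: in_keys_iff split: if_splits)
  have g_inj: "m = m'" if "m \<in> M" "m' \<in> M" "g m = g m'" for m m'
  proof (rule PiE_ext)
    show "m \<in> I \<rightarrow>\<^sub>E {..D}" "m' \<in> I \<rightarrow>\<^sub>E {..D}" using that M by (auto simp: monomial_box_def)
    show "m i = m' i" if "i \<in> I" for i
      using lookup_g[of m i] lookup_g[of m' i] that \<open>g m = g m'\<close> by simp
  qed
  define p where "p = (\<Sum>m\<in>M. Poly_Mapping.single (g m) (q m))"
  have "eval_rat_mpoly p f = (\<Sum>m\<in>M. of_rat (q m) * (\<Prod>i\<in>I. f i ^ m i))"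
    unfolding p_def eval_rat_mpoly_sum eval_rat_mpoly_single
    by (intro sum.cong) (auto simp: monomial_value_superset[OF I keys_g] lookup_g)
  then have "eval_rat_mpoly p f = 0" using zero by simp
  moreover have "Poly_Mapping.keys k \<subseteq> I" if "k \<in> Poly_Mapping.keys p" for k
  proof -
    have "k \<in> (\<Union>m\<in>M. Poly_Mapping.keys (Poly_Mapping.single (g m) (q m)))"
      using that Poly_Mapping.keys_sum[of "\<lambda>m. Poly_Mapping.single (g m) (q m)" M] unfolding p_def by blast
    then show ?thesis using keys_g by (auto split: if_splits)
  qed
  ultimately have "p = 0" using ind unfolding algebraically_independent_rat_def by blast
  then have "Poly_Mapping.lookup p (g m) = 0" by simp
  moreover have "Poly_Mapping.lookup p (g m) = (\<Sum>m'\<in>M. if m' = m then q m else 0)"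
    unfolding p_def lookup_sum lookup_single when_def using g_inj m by (intro sum.cong) auto
  ultimately show ?thesis using M(1) m by simp
qed

text \<open>Transcendence degree by counting: the monomials of bounded degree in the \<open>f i\<close>, multiplied
  by a power of the common denominator \<open>d\<close>, span a space whose dimension is bounded by a
  polynomial in the degree of smaller order than their number.\<close>

lemma not_algebraically_independent:
  assumes ind: "algebraically_independent_rat I f" and I: "finite I" and I': "finite I'" "card I' < card I"
    and d: "d \<noteq> 0" "d \<in> rational_ring I' z" and f: "\<And>i. i \<in> I \<Longrightarrow> d * f i \<in> rational_ring I' z"
  shows False
proof -
  define N where "N = card I"
  define n where "n = card I'"
  have "\<exists>c. d \<in> box_span I' z c \<and> (\<forall>i\<in>I. d * f i \<in> box_span I' z c)"
  proof -
    have "\<forall>i\<in>I. \<exists>c. d * f i \<in> box_span I' z c" using f rational_ring_imp_box_span[OF I'(1)] by blast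
    then obtain c where c: "\<And>i. i \<in> I \<Longrightarrow> d * f i \<in> box_span I' z (c i)" by metis
    obtain c0 where c0: "d \<in> box_span I' z c0" using d rational_ring_imp_box_span[OF I'(1)] by blast
    define c1 where "c1 = c0 + (\<Sum>i\<in>I. c i)"
    have "c i \<le> c1" if "i \<in> I" for i
      using member_le_sum[of i I c] that I by (simp add: c1_def trans_le_add2)
    moreover have "c0 \<le> c1" by (simp add: c1_def)
    ultimately show ?thesis using c c0 box_span_mono by (intro exI[of _ c1]) blast
  qed
  then obtain c where c: "d \<in> box_span I' z c" "\<And>i. i \<in> I \<Longrightarrow> d * f i \<in> box_span I' z c" by blast
  \<comment> \<open>With \<open>D = (N * c + 1) ^ n\<close> the target has dimension at most
    \<open>D * Suc D ^ n\<close>. This is less than \<open>Suc D ^ Suc n\<close>, which is at most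
    the number \<open>Suc D ^ N\<close> of monomials.\<close>
  define D where "D = (N * c + 1) ^ n"
  \<comment> \<open>Each factor \<open>f i ^ m i\<close> with \<open>m i \<le> D\<close> is cleared
    of denominators by \<open>d ^ D\<close>, all \<open>N\<close> of them by
    \<open>d ^ (N * D)\<close>.\<close>
  define g where "g m = d ^ (N * D) * (\<Prod>i\<in>I. f i ^ m i)" for m
  have rep: "\<forall>m\<in>M. q m = 0"
    if "M \<subseteq> monomial_box I D" "(\<Sum>m\<in>M. of_rat (q m) * g m) = 0" for M q
  proof -
    have finM: "finite M" using that(1) finite_monomial_box[OF I] finite_subset by blast
    have "(\<Sum>m\<in>M. of_rat (q m) * g m) = d ^ (N * D) * (\<Sum>m\<in>M. of_rat (q m) * (\<Prod>i\<in>I. f i ^ m i))"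
      by (simp add: g_def sum_distrib_left mult_ac)
    then have "(\<Sum>m\<in>M. of_rat (q m) * (\<Prod>i\<in>I. f i ^ m i)) = 0" using that(2) d by simp
    then show ?thesis using independent_monomials[OF ind I finM that(1)] by blast
  qed
  have inj: "inj_on g (monomial_box I D)"
  proof (rule inj_onI, rule ccontr)
    fix m m' assume m: "m \<in> monomial_box I D" "m' \<in> monomial_box I D" "g m = g m'" "m \<noteq> m'"
    have "(\<Sum>k\<in>{m, m'}. of_rat (if k = m then 1 else - 1) * g k) = 0"
      using m(3,4) by (simp add: of_rat_minus)
    from rep[OF _ this] m show False by auto
  qed
  have "rat_real.independent (g ` monomial_box I D)"
    unfolding rat_real.dependent_finite[OF finite_imageI[OF finite_monomial_box[OF I]]]
  proof (intro notI, elim exE conjE bexE)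
    fix u v assume u: "(\<Sum>v\<in>g ` monomial_box I D. of_rat (u v) * v) = 0" and v: "v \<in> g ` monomial_box I D" "u v \<noteq> 0"
    have "(\<Sum>m\<in>monomial_box I D. of_rat (u (g m)) * g m) = 0"
      using u by (simp add: sum.reindex[OF inj])
    from rep[OF order.refl this] v show False by auto
  qed
  moreover have "g ` monomial_box I D \<subseteq> rat_real.span ((\<lambda>m. \<Prod>i\<in>I'. z i ^ m i) ` monomial_box I' (N * (D * c)))"
  proof
    fix y assume "y \<in> g ` monomial_box I D"
    then obtain m where m: "m \<in> monomial_box I D" "y = g m" by blast
    have "y = (\<Prod>i\<in>I. d ^ D) * (\<Prod>i\<in>I. f i ^ m i)"
      by (simp add: m g_def N_def power_mult[symmetric] mult.commute)
    also have "\<dots> = (\<Prod>i\<in>I. (d * f i) ^ m i * d ^ (D - m i))"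
      unfolding prod.distrib[symmetric]
    proof (rule prod.cong[OF refl])
      fix i assume "i \<in> I"
      then have "m i \<le> D" using m(1) by (auto simp: monomial_box_def)
      then have "d ^ D = d ^ m i * d ^ (D - m i)" by (simp flip: power_add)
      then show "d ^ D * f i ^ m i = (d * f i) ^ m i * d ^ (D - m i)" by (simp add: power_mult_distrib)
    qed
    also have "\<dots> \<in> box_span I' z (card I * (D * c))"
    proof (rule box_span_prod[OF I])
      fix i assume i: "i \<in> I"
      then have "m i \<le> D" using m(1) by (auto simp: monomial_box_def)
      then have "m i * c + (D - m i) * c = D * c" by (simp flip: add_mult_distrib)
      then show "(d * f i) ^ m i * d ^ (D - m i) \<in> box_span I' z (D * c)"
        using box_span_mult[OF box_span_power[OF c(2)[OF i], of "m i"] box_span_power[OF c(1), of "D - m i"]]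
        by simp
    qed
    finally show "y \<in> rat_real.span ((\<lambda>m. \<Prod>i\<in>I'. z i ^ m i) ` monomial_box I' (N * (D * c)))"
      by (simp add: box_span_def N_def)
  qed
  ultimately have "card (g ` monomial_box I D) \<le> card ((\<lambda>m. \<Prod>i\<in>I'. z i ^ m i) ` monomial_box I' (N * (D * c)))"
    using rat_real.independent_span_bound finite_monomial_box[OF I'(1)] by blast
  also have "\<dots> \<le> card (monomial_box I' (N * (D * c)))"
    using finite_monomial_box[OF I'(1)] by (rule card_image_le)
  also have "\<dots> = Suc (N * (D * c)) ^ n" using card_monomial_box[OF I'(1)] by (simp add: n_def)
  also have "\<dots> \<le> ((N * c + 1) * Suc D) ^ n"
    by (intro power_mono) (auto simp: algebra_simps)
  also have "\<dots> = D * Suc D ^ n" unfolding D_def by (rule power_mult_distrib)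
  also have "\<dots> < Suc D ^ Suc n" by simp
  also have "\<dots> \<le> Suc D ^ N"
    using I'(2) by (intro power_increasing) (auto simp: N_def n_def)
  also have "\<dots> = card (g ` monomial_box I D)"
    using card_image[OF inj] card_monomial_box[OF I] by (simp add: N_def)
  finally show False by simp
qed

section \<open>Generic lattices\<close>

lemma poly_in_rational_ring:
  assumes "\<And>i. coeff p i \<in> rational_ring I z" "x \<in> rational_ring I z"
  shows "poly p x \<in> rational_ring I z"
  unfolding poly_altdef using assms by blast

lemma poly_eq_coeff0:
  "\<exists>q. (\<forall>x. poly p x = coeff p 0 + x * poly q x) \<and> (\<forall>i. coeff q i = coeff p (Suc i))"
  by (cases p) (auto simp: coeff_pCons)

text \<open>The position in the list \<open>[P1, P2, Q1, Q2]\<close>, where \<open>e\<close> selects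
  the curve and \<open>b\<close> the coordinate.\<close>

definition component_index :: "bool \<Rightarrow> bool \<Rightarrow> nat" where
  "component_index e b = (if b then 2 else 0) + (if e then 1 else 0)"

lemma component_index_inj [simp]: "component_index e b = component_index e' b' \<longleftrightarrow> e = e' \<and> b = b'"
  by (auto simp: component_index_def split: if_splits)

locale generic_curves =
  fixes P :: "bool \<Rightarrow> bool \<Rightarrow> real poly" and f :: "nat \<times> nat \<Rightarrow> real" and I :: "(nat \<times> nat) set"
  assumes coeff_0: "coeff (P e b) 0 = 0"
    and I_def: "I = {(component_index e b, k) |e b k. 1 \<le> k \<and> k \<le> degree (P e b)}"
    and f: "f (component_index e b, k) = coeff (P e b) k"
    and independent: "algebraically_independent_rat I f"
    and inj: "inj_on (curve (P e)) {0..1}"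
    and meets: "edges_meet_in_endpoints (curve (P False)) (curve (P True))"
begin

lemma finite_I: "finite I"
proof (rule finite_subset)
  define D where "D = (\<Sum>e\<in>UNIV. \<Sum>b\<in>UNIV. degree (P e b))"
  have "degree (P e b) \<le> D" for e b
    by (cases e; cases b) (auto simp: D_def UNIV_bool)
  moreover have "component_index e b \<le> 3" for e b by (simp add: component_index_def)
  ultimately show "I \<subseteq> {..3} \<times> {..D}" by (auto simp: I_def intro: order_trans)
qed auto

lemma in_I [simp]: "(component_index e b, k) \<in> I \<longleftrightarrow> 1 \<le> k \<and> k \<le> degree (P e b)"
  by (auto simp: I_def)

text \<open>There are fewer numbers \<open>z\<close> than coefficients \<open>f\<close>, so the
  latter cannot all be expressed by the former, even up to a common denominator \<open>d\<close>. In
  applications \<open>z\<close> omits the coefficient \<open>i1\<close> and may trade another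
  coefficient for an unknown parameter.\<close>

lemma no_dependence:
  assumes "i1 \<in> I" "d \<noteq> 0" "d \<in> rational_ring (I - {i1}) z"
    and "\<And>i. i \<in> I \<Longrightarrow> d * f i \<in> rational_ring (I - {i1}) z"
  shows False
  using not_algebraically_independent[OF independent finite_I _ card_Diff1_less[OF finite_I assms(1)], of d z]
    assms finite_I by blast

lemma degree_pos: "P e b \<noteq> 0 \<Longrightarrow> 1 \<le> degree (P e b)"
  using coeff_0[of e b] by (cases "degree (P e b)") (auto elim: degree_eq_zeroE)

lemma nonzero_component: "\<exists>b. P e b \<noteq> 0"
proof (rule ccontr)
  assume "\<nexists>b. P e b \<noteq> 0"
  then have "curve (P e) 0 = curve (P e) 1" by (simp add: curve_def)
  then show False using inj_onD[OF inj[of e], of 0 1] by auto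
qed

lemma curve_0 [simp]: "curve (P e) 0 = 0"
  by (simp add: curve_def poly_0_coeff_0 coeff_0 zero_prod_def)

lemma coeff_in_ring:
  assumes "\<And>i. i \<in> I \<Longrightarrow> i \<noteq> i0 \<Longrightarrow> i \<noteq> i1 \<Longrightarrow> z i = f i"
    and "(component_index e b, k) \<noteq> i0" "(component_index e b, k) \<noteq> i1"
  shows "coeff (P e b) k \<in> rational_ring (I - {i1}) z"
proof (cases "1 \<le> k \<and> k \<le> degree (P e b)")
  case True
  then have "z (component_index e b, k) \<in> rational_ring (I - {i1}) z" using assms by (intro rational_ring.var) auto
  then show ?thesis using assms True f by simp
next
  case False
  then have "coeff (P e b) k = 0" using coeff_0 by (cases "k = 0") (auto intro: coeff_eq_0)
  then show ?thesis by auto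
qed

text \<open>Otherwise the equation could be solved for the linear coefficient of
  \<open>P e b\<close> in terms of the other coefficients.\<close>

lemma endpoint_combination_nonzero:
  assumes "P e b \<noteq> 0"
  shows "poly (P e b) 1 + real_of_int q * poly (P (\<not> e) b) 1 \<noteq> 0"
proof
  assume zero: "poly (P e b) 1 + real_of_int q * poly (P (\<not> e) b) 1 = 0"
  define i1 where "i1 = (component_index e b, 1 :: nat)"
  let ?R = "rational_ring (I - {i1}) f"
  have R: "coeff (P e' b') k \<in> ?R" if "(component_index e' b', k) \<noteq> i1" for e' b' k
    using coeff_in_ring[of i1 i1 f e' b' k] that by simp
  obtain p1 where p1: "\<And>x. poly (P e b) x = coeff (P e b) 0 + x * poly p1 x" "\<And>i. coeff p1 i = coeff (P e b) (Suc i)"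
    using poly_eq_coeff0[of "P e b"] by blast
  obtain p2 where p2: "\<And>x. poly p1 x = coeff p1 0 + x * poly p2 x" "\<And>i. coeff p2 i = coeff p1 (Suc i)"
    using poly_eq_coeff0[of "p1"] by blast
  have "poly p2 1 \<in> ?R" using R by (intro poly_in_rational_ring) (auto simp: p1 p2 i1_def)
  moreover have "poly (P (\<not> e) b) 1 \<in> ?R" using R by (intro poly_in_rational_ring) (auto simp: i1_def)
  moreover have "f i1 = - poly p2 1 - real_of_int q * poly (P (\<not> e) b) 1"
    using zero p1 p2 coeff_0 by (simp add: i1_def f)
  ultimately have "f i1 \<in> ?R" by auto
  then have "1 * f i \<in> ?R" if "i \<in> I" for i using that by (cases "i = i1") auto
  then show False
    using degree_pos[OF assms] by (intro no_dependence[of i1 1 f]) (auto simp: i1_def)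
qed

lemma endpoint_nonzero: "P e b \<noteq> 0 \<Longrightarrow> poly (P e b) 1 \<noteq> 0"
  using endpoint_combination_nonzero[of e b 0] by simp

lemma component_strict_mono:
  assumes "P e b = 0"
  shows "strict_mono_on {0..1} (poly (P e (\<not> b))) \<or> strict_antimono_on {0..1} (poly (P e (\<not> b)))"
proof -
  have "inj_on (poly (P e (\<not> b))) {0..1}"
  proof (rule inj_onI)
    fix x y :: real assume "x \<in> {0..1}" "y \<in> {0..1}" "poly (P e (\<not> b)) x = poly (P e (\<not> b)) y"
    moreover from this have "curve (P e) x = curve (P e) y" using assms by (cases b) (simp_all add: curve_def)
    ultimately show "x = y" using inj[of e] by (auto simp: inj_on_def)
  qed
  then show ?thesis
    by (subst injective_eq_monotone_map[symmetric]) (auto intro!: continuous_intros is_interval_cc)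
qed

text \<open>A critical parameter \<open>x\<close> yields one equation per coordinate; together they
  give both linear coefficients at the price of the single new number \<open>x\<close>. If one
  coordinate is zero, the missing equation comes from the second derivative when \<open>x\<close> is
  interior, and for \<open>x = 0\<close> or \<open>x = 1\<close> there is no new number.\<close>

lemma immersed: "\<not> (0 \<le> x \<and> x \<le> 1 \<and> (\<forall>b. poly (pderiv (P e b)) x = 0))"
proof
  assume "0 \<le> x \<and> x \<le> 1 \<and> (\<forall>b. poly (pderiv (P e b)) x = 0)"
  then have x: "0 \<le> x" "x \<le> 1" and dzero: "\<And>b. poly (pderiv (P e b)) x = 0" by auto
  have split: "\<exists>q. poly (pderiv (P e b)) x = coeff (P e b) 1 + x * poly q x \<and>
      (\<forall>i. coeff q i = real (i + 2) * coeff (P e b) (i + 2))" for b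
  proof -
    obtain q where "\<And>x. poly (pderiv (P e b)) x = coeff (pderiv (P e b)) 0 + x * poly q x"
      "\<And>i. coeff q i = coeff (pderiv (P e b)) (Suc i)" using poly_eq_coeff0[of "pderiv (P e b)"] by blast
    then show ?thesis by (intro exI[of _ q]) (simp add: coeff_pderiv)
  qed
  show False
  proof (cases "\<forall>b. P e b \<noteq> 0")
    case True
    define i0 i1 where "i0 = (component_index e False, 1 :: nat)" and "i1 = (component_index e True, 1 :: nat)"
    define z where "z = f(i0 := x)"
    let ?R = "rational_ring (I - {i1}) z"
    have i01: "i0 \<in> I" "i1 \<in> I" "i0 \<noteq> i1"
      using degree_pos True by (auto simp: i0_def i1_def)
    have zx: "x \<in> ?R" using rational_ring.var[of i0 "I - {i1}" z] i01 by (simp add: z_def)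
    have "f (component_index e b, 1) \<in> ?R" for b
    proof -
      obtain q where q: "poly (pderiv (P e b)) x = coeff (P e b) 1 + x * poly q x"
        "\<And>i. coeff q i = real (i + 2) * coeff (P e b) (i + 2)" using split by blast
      have "coeff (P e b) (i + 2) \<in> ?R" for i
        by (rule coeff_in_ring[of i0]) (auto simp: z_def i0_def i1_def)
      then have "coeff q i \<in> ?R" for i
        unfolding q(2) by (intro rational_ring.mult rational_ring_of_nat)
      then have "poly q x \<in> ?R" using zx by (intro poly_in_rational_ring)
      moreover have "f (component_index e b, 1) = - (x * poly q x)" using q(1) dzero[of b] by (simp add: f)
      ultimately show ?thesis using zx by auto
    qed
    then have fi: "f i0 \<in> ?R" "f i1 \<in> ?R" by (simp_all add: i0_def i1_def)
    have "1 * f i \<in> ?R" if "i \<in> I" for i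
    proof (cases "i = i0 \<or> i = i1")
      case False
      then show ?thesis using rational_ring.var[of i "I - {i1}" z] that by (simp add: z_def)
    qed (use fi in auto)
    then show False using i01 by (intro no_dependence[of i1 1 z]) auto
  next
    case False
    then obtain b where b: "P e b = 0" by blast
    define c where "c = (\<not> b)"
    define Q where "Q = P e c"
    have Q0: "Q \<noteq> 0"
    proof
      assume "Q = 0"
      then have "P e b' = 0" for b' using b by (cases "b' = b") (auto simp: Q_def c_def)
      then show False using nonzero_component[of e] by auto
    qed
    define i1 where "i1 = (component_index e c, 1 :: nat)"
    have i1: "i1 \<in> I" using degree_pos Q0 by (auto simp: i1_def Q_def)
    show False
    proof (cases "x = 0 \<or> x = 1")
      case True
      let ?R = "rational_ring (I - {i1}) f"
      have x: "x \<in> ?R" using True by auto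
      obtain q where q: "poly (pderiv Q) x = coeff Q 1 + x * poly q x"
        "\<And>i. coeff q i = real (i + 2) * coeff Q (i + 2)" using split unfolding Q_def by blast
      have "coeff Q (i + 2) \<in> ?R" for i
        unfolding Q_def by (rule coeff_in_ring[of i1]) (auto simp: i1_def)
      then have "coeff q i \<in> ?R" for i
        unfolding q(2) by (intro rational_ring.mult rational_ring_of_nat)
      then have "poly q x \<in> ?R" using x by (intro poly_in_rational_ring)
      moreover have "f i1 = - (x * poly q x)" using q(1) dzero[of c] by (simp add: f i1_def Q_def)
      ultimately have "f i1 \<in> ?R" using x by auto
      then have "1 * f i \<in> ?R" if "i \<in> I" for i using that by (cases "i = i1") auto
      then show False using i1 by (intro no_dependence[of i1 1 f]) auto
    next
      case False
      then have x01: "0 < x" "x < 1" using x by auto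
      define r where "r = min x (1 - x)"
      have r: "r > 0" "\<And>y. \<bar>x - y\<bar> < r \<Longrightarrow> 0 < y \<and> y < 1" using x01 by (auto simp: r_def abs_if split: if_splits)
      \<comment> \<open>The derivative of a monotone component does not change sign, so its zero at
        the interior point \<open>x\<close> is an extremum.\<close>
      have DD: "poly (pderiv (pderiv Q)) x = 0"
      proof -
        have sign: "(\<forall>y. 0 < y \<and> y < 1 \<longrightarrow> 0 \<le> poly (pderiv Q) y) \<or> (\<forall>y. 0 < y \<and> y < 1 \<longrightarrow> poly (pderiv Q) y \<le> 0)"
          using component_strict_mono[OF b]
        proof
          assume sm: "strict_mono_on {0..1} (poly (P e (\<not> b)))"
          have "0 \<le> poly (pderiv Q) y" if y: "0 < y" "y < 1" for y
          proof (rule ccontr)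
            assume "\<not> 0 \<le> poly (pderiv Q) y"
            then obtain d where d: "d > 0" "\<And>h. 0 < h \<Longrightarrow> h < d \<Longrightarrow> poly Q (y + h) < poly Q y"
              using DERIV_neg_dec_right[OF poly_DERIV[of Q y]] by auto
            define h where "h = min d (1 - y) / 2"
            have h: "0 < h" "h < d" "y + h \<le> 1" using d y by (auto simp: h_def min_def field_simps)
            then have "poly Q y < poly Q (y + h)" using sm y unfolding Q_def c_def by (intro strict_mono_onD[OF sm]) auto
            then show False using d(2)[OF h(1,2)] by simp
          qed
          then show ?thesis by blast
        next
          assume sm: "strict_antimono_on {0..1} (poly (P e (\<not> b)))"
          have "poly (pderiv Q) y \<le> 0" if y: "0 < y" "y < 1" for y
          proof (rule ccontr)
            assume "\<not> poly (pderiv Q) y \<le> 0"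
            then obtain d where d: "d > 0" "\<And>h. 0 < h \<Longrightarrow> h < d \<Longrightarrow> poly Q y < poly Q (y + h)"
              using DERIV_pos_inc_right[OF poly_DERIV[of Q y]] by auto
            define h where "h = min d (1 - y) / 2"
            have h: "0 < h" "h < d" "y + h \<le> 1" using d y by (auto simp: h_def min_def field_simps)
            then have "poly Q (y + h) < poly Q y" using sm y unfolding Q_def c_def
              by (intro monotone_onD[OF sm, of y "y + h"]) auto
            then show False using d(2)[OF h(1,2)] by simp
          qed
          then show ?thesis by blast
        qed
        have at_x: "poly (pderiv Q) x = 0" using dzero by (simp add: Q_def)
        show ?thesis
          using sign
        proof
          assume "\<forall>y. 0 < y \<and> y < 1 \<longrightarrow> 0 \<le> poly (pderiv Q) y"
          then show ?thesis using r at_x by (intro DERIV_local_min[OF poly_DERIV r(1)]) auto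
        next
          assume "\<forall>y. 0 < y \<and> y < 1 \<longrightarrow> poly (pderiv Q) y \<le> 0"
          then show ?thesis using r at_x by (intro DERIV_local_max[OF poly_DERIV r(1)]) auto
        qed
      qed
      \<comment> \<open>This puts the quadratic coefficient among the independent numbers, so that
        it can be traded for \<open>x\<close>.\<close>
      have deg2: "2 \<le> degree Q"
      proof (rule ccontr)
        assume "\<not> 2 \<le> degree Q"
        then have d1: "degree Q = 1" using degree_pos[of e c] Q0 by (simp add: Q_def)
        then have "coeff Q (i + 2) = 0" for i by (intro coeff_eq_0) auto
        moreover obtain q where q: "poly (pderiv Q) x = coeff Q 1 + x * poly q x"
          "\<And>i. coeff q i = real (i + 2) * coeff Q (i + 2)" using split unfolding Q_def by blast
        ultimately have "q = 0" by (intro poly_eqI) simp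
        then have "coeff Q 1 = 0" using q(1) dzero[of c] by (simp add: Q_def)
        then show False using d1 Q0 by (metis leading_coeff_0_iff)
      qed
      define i0 where "i0 = (component_index e c, 2 :: nat)"
      define z where "z = f(i0 := x)"
      let ?R = "rational_ring (I - {i1}) z"
      have i01: "i0 \<in> I" "i0 \<noteq> i1" using deg2 by (auto simp: i0_def i1_def Q_def)
      have zx: "x \<in> ?R" using rational_ring.var[of i0 "I - {i1}" z] i01 by (simp add: z_def)
      have c3: "coeff Q (i + 3) \<in> ?R" for i
        unfolding Q_def by (rule coeff_in_ring[of i0]) (auto simp: z_def i0_def i1_def)
      obtain q where q: "\<And>x. poly (pderiv Q) x = coeff (pderiv Q) 0 + x * poly q x"
        "\<And>i. coeff q i = coeff (pderiv Q) (Suc i)" using poly_eq_coeff0[of "pderiv Q"] by blast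
      obtain q' where q': "\<And>x. poly q x = coeff q 0 + x * poly q' x" "\<And>i. coeff q' i = coeff q (Suc i)"
        using poly_eq_coeff0[of "q"] by blast
      obtain h where h: "\<And>x. poly (pderiv (pderiv Q)) x = coeff (pderiv (pderiv Q)) 0 + x * poly h x"
        "\<And>i. coeff h i = coeff (pderiv (pderiv Q)) (Suc i)" using poly_eq_coeff0[of "pderiv (pderiv Q)"] by blast
      have "coeff h i = real ((i + 2) * (i + 3)) * coeff Q (i + 3)" for i
        by (simp add: h(2) coeff_pderiv numeral_eq_Suc algebra_simps)
      then have "coeff h i \<in> ?R" for i
        using c3 by (simp only: rational_ring.mult rational_ring_of_nat)
      then have hR: "poly h x \<in> ?R" using zx by (intro poly_in_rational_ring)
      have "coeff q' i = real (i + 3) * coeff Q (i + 3)" for i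
        by (simp add: q(2) q'(2) coeff_pderiv numeral_eq_Suc)
      then have "coeff q' i \<in> ?R" for i
        using c3 by (simp only: rational_ring.mult rational_ring_of_nat)
      then have q'R: "poly q' x \<in> ?R" using zx by (intro poly_in_rational_ring)
      \<comment> \<open>The vanishing second derivative gives the quadratic coefficient, after which
        the first derivative gives the linear one.\<close>
      have "coeff (pderiv (pderiv Q)) 0 = 2 * coeff Q 2" by (simp add: coeff_pderiv numeral_eq_Suc)
      then have "coeff Q 2 = of_rat (- 1 / 2) * (x * poly h x)" using h(1)[of x] DD by (simp add: of_rat_divide of_rat_minus)
      then have Q2: "coeff Q 2 \<in> ?R" using zx hR by auto
      have "coeff q 0 = 2 * coeff Q 2" by (simp add: q(2) coeff_pderiv numeral_eq_Suc)
      then have "coeff Q 1 = - (x * (real 2 * coeff Q 2 + x * poly q' x))"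
        using q(1)[of x] q'(1)[of x] dzero[of c] by (simp add: Q_def coeff_pderiv)
      also have "\<dots> \<in> ?R" using zx Q2 q'R by blast
      finally have fi: "f i0 \<in> ?R" "f i1 \<in> ?R" using Q2 by (simp_all add: i0_def i1_def f Q_def)
      have "1 * f i \<in> ?R" if "i \<in> I" for i
      proof (cases "i = i0 \<or> i = i1")
        case False
        then show ?thesis using rational_ring.var[of i "I - {i1}" z] that by (simp add: z_def)
      qed (use fi in auto)
      then show False using i1 by (intro no_dependence[of i1 1 z]) auto
    qed
  qed
qed

end

text \<open>The continuous extension to the diagonal lets a single compactness argument treat near
  and distant points together.\<close>

lemma poly_difference_quotient:
  fixes p :: "real poly"
  shows "\<exists>g. continuous_on UNIV g \<and> (\<forall>x y. poly p x - poly p y = (x - y) * g (x, y)) \<and>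
     (\<forall>x. g (x, x) = poly (pderiv p) x)"
proof (induction p)
  case 0
  show ?case by (intro exI[of _ "\<lambda>_. 0"]) auto
next
  case (pCons a p)
  then obtain g where g: "continuous_on UNIV g" "\<And>x y. poly p x - poly p y = (x - y) * g (x, y)"
    "\<And>x. g (x, x) = poly (pderiv p) x" by blast
  have "poly (pCons a p) x - poly (pCons a p) y = (x - y) * (poly p x + y * g (x, y))" for x y
  proof -
    have "poly (pCons a p) x - poly (pCons a p) y = (x - y) * poly p x + y * (poly p x - poly p y)"
      by (simp add: algebra_simps)
    then show ?thesis unfolding g(2) by (simp add: algebra_simps)
  qed
  moreover have "continuous_on UNIV (\<lambda>z :: real \<times> real. poly p (fst z) + snd z * g z)"
    using g(1) by (intro continuous_intros)
  ultimately show ?case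
    using g(3) by (intro exI[of _ "\<lambda>z. poly p (fst z) + snd z * g z"]) (auto simp: pderiv_pCons)
qed

context generic_curves
begin

lemma axis_parallel_component:
  assumes "P e b = 0"
  defines "Q \<equiv> P e (\<not> b)"
  shows "poly Q 1 \<noteq> 0" "\<And>x. 0 < x \<Longrightarrow> x < 1 \<Longrightarrow> 0 < poly Q x / poly Q 1 \<and> poly Q x / poly Q 1 < 1"
    "(\<lambda>x. poly Q x / poly Q 1) ` {0..1} = {0..1}"
proof -
  obtain b' where "P e b' \<noteq> 0" using nonzero_component by blast
  then have "Q \<noteq> 0" using assms by (cases "b' = b") auto
  then show nz: "poly Q 1 \<noteq> 0" using endpoint_nonzero by (simp add: Q_def)
  have Q0: "poly Q 0 = 0" using coeff_0 by (simp add: Q_def poly_0_coeff_0)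
  show inner: "0 < poly Q x / poly Q 1 \<and> poly Q x / poly Q 1 < 1" if x: "0 < x" "x < 1" for x
    using component_strict_mono[OF assms(1)] unfolding Q_def[symmetric]
  proof
    assume "strict_mono_on {0..1} (poly Q)"
    from strict_mono_onD[OF this, of 0 x] strict_mono_onD[OF this, of x 1] show ?thesis
      using x Q0 by auto
  next
    assume "strict_antimono_on {0..1} (poly Q)"
    from monotone_onD[OF this, of 0 x] monotone_onD[OF this, of x 1] show ?thesis
      using x Q0 by (auto simp: zero_less_divide_iff divide_less_eq)
  qed
  show "(\<lambda>x. poly Q x / poly Q 1) ` {0..1} = {0..1}"
  proof (intro equalityI subsetI)
    fix u assume "u \<in> (\<lambda>x. poly Q x / poly Q 1) ` {0..1}"
    then obtain x where x: "0 \<le> x" "x \<le> 1" "u = poly Q x / poly Q 1" by auto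
    show "u \<in> {0..1}"
    proof (cases "x = 0 \<or> x = 1")
      case True
      then show ?thesis using x Q0 nz by auto
    next
      case False
      then show ?thesis using inner[of x] x by auto
    qed
  next
    fix u :: real assume u: "u \<in> {0..1}"
    have "continuous_on {0..1} (\<lambda>x. poly Q x / poly Q 1)" using nz by (intro continuous_intros) auto
    then have "\<exists>x\<ge>0. x \<le> 1 \<and> poly Q x / poly Q 1 = u"
      using u Q0 nz by (intro IVT') auto
    then show "u \<in> (\<lambda>x. poly Q x / poly Q 1) ` {0..1}" by auto
  qed
qed

section \<open>The lattice and the position of its points on the edges\<close>

abbreviation S where "S \<equiv> lattice_points (curve (P False)) (curve (P True))"

lemma lattice_pointI: "of_int \<mu> *\<^sub>R curve (P e) 1 + of_int \<nu> *\<^sub>R curve (P (\<not> e)) 1 \<in> S"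
  by (cases e) (force simp: lattice_points_def add.commute)+

lemma lattice_pointE:
  assumes "p \<in> S"
  obtains \<mu> \<nu> where "p = of_int \<mu> *\<^sub>R curve (P e) 1 + of_int \<nu> *\<^sub>R curve (P (\<not> e)) 1"
proof -
  obtain m n where mn: "p = of_int m *\<^sub>R curve (P False) 1 + of_int n *\<^sub>R curve (P True) 1"
    using assms by (auto simp: lattice_points_def)
  show thesis
  proof (cases e)
    case True
    then show ?thesis using that[of n m] mn by (simp add: add.commute)
  next
    case False
    then show ?thesis using that[of m n] mn by simp
  qed
qed

lemma lattice_diff: "p \<in> S \<Longrightarrow> q \<in> S \<Longrightarrow> p - q \<in> S"
proof -
  assume "p \<in> S" "q \<in> S"
  then obtain m n m' n' where "p = of_int m *\<^sub>R curve (P False) 1 + of_int n *\<^sub>R curve (P True) 1"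
    "q = of_int m' *\<^sub>R curve (P False) 1 + of_int n' *\<^sub>R curve (P True) 1"
    by (auto simp: lattice_points_def)
  then have "p - q = of_int (m - m') *\<^sub>R curve (P False) 1 + of_int (n - n') *\<^sub>R curve (P True) 1"
    by (simp add: algebra_simps)
  then show "p - q \<in> S" unfolding lattice_points_def by blast
qed

lemma lattice_curve_1: "curve (P e) 1 \<in> S" and lattice_0: "0 \<in> S"
  using lattice_pointI[of 1 e 0] lattice_pointI[of 0 e 0] by simp_all

lemma lattice_add: "p \<in> S \<Longrightarrow> q \<in> S \<Longrightarrow> p + q \<in> S"
  using lattice_diff[of p "0 - q"] lattice_diff[OF lattice_0, of q] by simp

lemma is_edge_arc:
  assumes "v \<in> S"
  shows "is_edge (curve (P False)) (curve (P True)) (arc_at (P e) v) v (v + curve (P e) 1)"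
  using assms lattice_add[OF assms lattice_curve_1, of e]
  by (cases e) (auto simp: is_edge_def arc_at_def)

lemma edges_eq: "edges (curve (P False)) (curve (P True)) = {arc_at (P e) v |e v. v \<in> S}"
proof (intro equalityI subsetI)
  fix E assume "E \<in> edges (curve (P False)) (curve (P True))"
  then obtain v w where "is_edge (curve (P False)) (curve (P True)) E v w" by (auto simp: edges_def)
  then have "v \<in> S \<and> (E = arc_at (P False) v \<or> E = arc_at (P True) v)"
    by (auto simp: is_edge_def arc_at_def)
  then show "E \<in> {arc_at (P e) v |e v. v \<in> S}" by blast
next
  fix E assume "E \<in> {arc_at (P e) v |e v. v \<in> S}"
  then show "E \<in> edges (curve (P False)) (curve (P True))"
    using is_edge_arc unfolding edges_def by blast
qed

lemma arcs_meet:
  assumes "v \<in> S" "v' \<in> S" "arc_at (P e) v \<noteq> arc_at (P e') v'" "p \<in> arc_at (P e) v" "p \<in> arc_at (P e') v'"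
  shows "p \<in> S" "\<And>p'. p' \<in> arc_at (P e) v \<Longrightarrow> p' \<in> arc_at (P e') v' \<Longrightarrow> p' = p"
proof -
  obtain r where r: "arc_at (P e) v \<inter> arc_at (P e') v' = {r}"
    "r \<in> {v, v + curve (P e) 1} \<union> {v', v' + curve (P e') 1}"
    using meets is_edge_arc[OF assms(1), of e] is_edge_arc[OF assms(2), of e'] assms(3-5)
    unfolding edges_meet_in_endpoints_def by blast
  then have "p = r" using assms(4,5) by blast
  moreover have "r \<in> S"
    using r(2) assms(1,2) lattice_add[OF assms(1) lattice_curve_1, of e]
      lattice_add[OF assms(2) lattice_curve_1, of e'] by blast
  ultimately show "p \<in> S" by simp
  show "p' = p" if "p' \<in> arc_at (P e) v" "p' \<in> arc_at (P e') v'" for p'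
    using that r(1) \<open>p = r\<close> by blast
qed

text \<open>If both curves lay on one axis, then two edges starting at the origin in the same direction
  would overlap in a segment.\<close>

lemma not_collinear: "P False b \<noteq> 0 \<or> P True b \<noteq> 0"
proof (rule ccontr)
  assume "\<not> (P False b \<noteq> 0 \<or> P True b \<noteq> 0)"
  then have zero: "P e b = 0" for e by (cases e) auto
  define c where "c = (\<not> b)"
  define ax :: "real \<Rightarrow> real \<times> real" where "ax s = (if c then (0, s) else (s, 0))" for s
  define \<alpha> where "\<alpha> e = poly (P e c) 1" for e
  have ax_inj: "ax s = ax t \<longleftrightarrow> s = t" for s t by (auto simp: ax_def)
  have ax_add: "ax s + ax t = ax (s + t)" for s t by (auto simp: ax_def)
  have curve_ax: "curve (P e) x = ax (poly (P e c) x)" for e x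
    using zero[of e] by (cases b) (auto simp: curve_def ax_def c_def)
  have \<alpha>_nz: "\<alpha> e \<noteq> 0" for e using axis_parallel_component(1)[OF zero] by (simp add: \<alpha>_def c_def)
  have range: "(\<lambda>x. poly (P e c) x) ` {0..1} = (\<lambda>u. u * \<alpha> e) ` {0..1}" for e
  proof -
    have "(\<lambda>u. u * \<alpha> e) ` {0..1} = (\<lambda>u. u * \<alpha> e) ` (\<lambda>x. poly (P e c) x / \<alpha> e) ` {0..1}"
      using axis_parallel_component(3)[OF zero, of e] by (simp add: \<alpha>_def c_def)
    also have "\<dots> = (\<lambda>x. poly (P e c) x) ` {0..1}" using \<alpha>_nz by (simp add: image_image)
    finally show ?thesis by simp
  qed
  have arc: "arc_at (P e) (ax s) = (\<lambda>u. ax (s + u * \<alpha> e)) ` {0..1}" for e s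
  proof -
    have "arc_at (P e) (ax s) = (\<lambda>y. ax (s + y)) ` (\<lambda>x. poly (P e c) x) ` {0..1}"
      by (simp add: arc_at_def curve_ax ax_add image_image)
    then show ?thesis unfolding range by (simp add: image_image)
  qed
  have ax0: "ax 0 = 0" by (auto simp: ax_def zero_prod_def)
  \<comment> \<open>\<open>\<alpha> True\<close> with the sign of \<open>\<alpha> False\<close>: the
    second edge is attached at the origin, starting there or, if the directions are opposite, ending
    there.\<close>
  define \<beta> where "\<beta> = (if \<alpha> False * \<alpha> True > 0 then \<alpha> True else - \<alpha> True)"
  have pos: "\<alpha> False * \<beta> > 0" using \<alpha>_nz[of False] \<alpha>_nz[of True]
    by (auto simp: \<beta>_def not_less le_less mult_less_0_iff zero_less_mult_iff)
  have ne: "\<alpha> False \<noteq> \<beta>"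
  proof -
    obtain b' where "P False b' \<noteq> 0" using nonzero_component by blast
    then have "P False c \<noteq> 0" using zero[of False] by (cases "b' = b") (auto simp: c_def)
    then show ?thesis
      using endpoint_combination_nonzero[of False c 1] endpoint_combination_nonzero[of False c "- 1"]
      by (auto simp: \<beta>_def \<alpha>_def)
  qed
  define v where "v = (if \<alpha> False * \<alpha> True > 0 then 0 else - curve (P True) 1)"
  have vS: "v \<in> S" using lattice_0 lattice_diff[OF lattice_0 lattice_curve_1] by (auto simp: v_def)
  have v_ax: "v = ax (if \<alpha> False * \<alpha> True > 0 then 0 else - \<alpha> True)"
    by (auto simp: v_def curve_ax \<alpha>_def ax_def zero_prod_def)
  have arc2: "arc_at (P True) v = (\<lambda>u. ax (u * \<beta>)) ` {0..1}"
  proof (cases "\<alpha> False * \<alpha> True > 0")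
    case True
    then show ?thesis by (simp add: v_ax arc \<beta>_def)
  next
    case False
    have "(\<lambda>u. ax (- \<alpha> True + u * \<alpha> True)) = (\<lambda>u. ax (u * \<beta>)) \<circ> (\<lambda>u. 1 - u)"
      using False by (simp add: fun_eq_iff \<beta>_def algebra_simps)
    then have "(\<lambda>u. ax (- \<alpha> True + u * \<alpha> True)) ` {0..1} = (\<lambda>u. ax (u * \<beta>)) ` ((\<lambda>u. 1 - u) ` {0..1})"
      by (simp only: image_comp)
    also have "(\<lambda>u. 1 - u) ` {0..1} = {0..1::real}" by simp
    finally show ?thesis using False by (simp add: v_ax arc)
  qed
  have arc1: "arc_at (P False) 0 = (\<lambda>u. ax (u * \<alpha> False)) ` {0..1}"
    using arc[of False 0] by (simp add: ax0)
  \<comment> \<open>\<open>r\<close> belongs to the shorter edge. Its tip \<open>ax r\<close> also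
    lies on the longer one, so the two edges share more than the origin.\<close>
  have main: False if A: "\<bar>r\<bar> < \<bar>s\<bar>" "r * s > 0"
    "arc_at (P e) w = (\<lambda>u. ax (u * r)) ` {0..1}" "arc_at (P e') w' = (\<lambda>u. ax (u * s)) ` {0..1}"
    "w \<in> S" "w' \<in> S" for r s e e' w w'
  proof -
    have rs: "r \<noteq> 0" "s \<noteq> 0" using A by auto
    have "r / s = \<bar>r\<bar> / \<bar>s\<bar>" using A(2) by (auto simp: zero_less_mult_iff)
    then have q: "0 \<le> r / s" "r / s \<le> 1" using A(1) by auto
    have "ax s \<in> arc_at (P e') w'" unfolding A(4) by (rule image_eqI[of _ _ 1]) auto
    moreover have "ax s \<notin> arc_at (P e) w"
    proof
      assume "ax s \<in> arc_at (P e) w"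
      then obtain u where "0 \<le> u" "u \<le> 1" "s = u * r" unfolding A(3) by (auto simp: ax_inj)
      then have "\<bar>s\<bar> \<le> 1 * \<bar>r\<bar>" unfolding abs_mult by (metis abs_mult abs_of_nonneg mult_right_mono abs_ge_zero)
      then show False using A(1) by simp
    qed
    ultimately have "arc_at (P e) w \<noteq> arc_at (P e') w'" by blast
    moreover have "0 \<in> arc_at (P e) w" "0 \<in> arc_at (P e') w'"
      unfolding A(3,4) by (rule image_eqI[of _ _ 0]; simp add: ax0)+
    moreover have "ax r \<in> arc_at (P e) w" unfolding A(3) by (rule image_eqI[of _ _ 1]) auto
    moreover have "ax r \<in> arc_at (P e') w'"
      unfolding A(4) using q rs by (intro image_eqI[of _ _ "r / s"]) auto
    ultimately have "ax r = 0" using arcs_meet(2)[OF A(5,6)] by blast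
    then show False using rs ax_inj[of r 0] ax0 by simp
  qed
  show False
  proof (cases "\<bar>\<alpha> False\<bar> < \<bar>\<beta>\<bar>")
    case True
    then show ?thesis using main[OF _ pos arc1 arc2 lattice_0 vS] by blast
  next
    case False
    moreover have "\<bar>\<alpha> False\<bar> \<noteq> \<bar>\<beta>\<bar>" using pos ne by (auto simp: abs_if zero_less_mult_iff split: if_splits)
    ultimately show ?thesis using main[OF _ _ arc2 arc1 vS lattice_0] pos by (simp add: mult.commute)
  qed
qed

text \<open>In the two coordinate equations the linear coefficients occur with the factor
  \<open>d = x - \<mu>\<close>, which is nonzero for \<open>x\<close> strictly between 0 and 1;
  solving for both costs only the new number \<open>x\<close>. If a coordinate of the curve
  vanishes, then \<open>\<nu>\<close> is 0 and an integer would lie strictly between 0 and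
  1.\<close>

lemma no_interior_lattice_point:
  assumes x: "0 < x" "x < 1"
  shows "curve (P e) x \<notin> S"
proof
  assume "curve (P e) x \<in> S"
  then obtain \<mu> \<nu> where \<mu>\<nu>: "curve (P e) x = of_int \<mu> *\<^sub>R curve (P e) 1 + of_int \<nu> *\<^sub>R curve (P (\<not> e)) 1"
    by (rule lattice_pointE)
  then have eq: "poly (P e b) x = of_int \<mu> * poly (P e b) 1 + of_int \<nu> * poly (P (\<not> e) b) 1" for b
    by (cases b) (auto simp: curve_def)
  show False
  proof (cases "\<forall>b. P e b \<noteq> 0")
    case False
    then obtain b where b: "P e b = 0" by blast
    have "P (\<not> e) b \<noteq> 0" using not_collinear[of b] b by (cases e) auto
    then have "\<nu> = 0" using eq[of b] b endpoint_nonzero[of "\<not> e" b] by simp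
    then have "poly (P e (\<not> b)) x / poly (P e (\<not> b)) 1 = of_int \<mu>"
      using eq[of "\<not> b"] axis_parallel_component(1)[OF b] by simp
    then have "0 < real_of_int \<mu>" "real_of_int \<mu> < 1" using axis_parallel_component(2)[OF b x] by simp_all
    then show False by (simp only: of_int_0_less_iff of_int_less_1_iff)
  next
    case True
    define i0 i1 where "i0 = (component_index e False, 1 :: nat)" and "i1 = (component_index e True, 1 :: nat)"
    define z where "z = f(i0 := x)"
    define d where "d = x - of_int \<mu>"
    let ?R = "rational_ring (I - {i1}) z"
    have i01: "i0 \<in> I" "i1 \<in> I" "i0 \<noteq> i1"
      using degree_pos True by (auto simp: i0_def i1_def)
    have zx: "x \<in> ?R" using rational_ring.var[of i0 "I - {i1}" z] i01 by (simp add: z_def)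
    then have dR: "d \<in> ?R" unfolding d_def by auto
    have d0: "d \<noteq> 0"
    proof
      assume "d = 0"
      then have "0 < real_of_int \<mu>" "real_of_int \<mu> < 1" using x by (auto simp: d_def)
      then show False by (simp only: of_int_0_less_iff of_int_less_1_iff)
    qed
    have cR: "coeff (P e' b) k \<in> ?R" if "e' \<noteq> e \<or> k \<noteq> 1" for e' b k
      by (rule coeff_in_ring[of i0]) (use that in \<open>auto simp: z_def i0_def i1_def\<close>)
    have "d * f (component_index e b, 1) \<in> ?R" for b
    proof -
      obtain p1 where p1: "\<And>x. poly (P e b) x = coeff (P e b) 0 + x * poly p1 x" "\<And>i. coeff p1 i = coeff (P e b) (Suc i)"
        using poly_eq_coeff0[of "P e b"] by blast
      obtain p2 where p2: "\<And>x. poly p1 x = coeff p1 0 + x * poly p2 x" "\<And>i. coeff p2 i = coeff p1 (Suc i)"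
        using poly_eq_coeff0[of p1] by blast
      have "poly p2 y \<in> ?R" if "y \<in> ?R" for y
        using that by (intro poly_in_rational_ring) (auto simp: p1 p2 cR)
      then have p2R: "poly p2 x \<in> ?R" "poly p2 1 \<in> ?R" using zx by auto
      have oR: "poly (P (\<not> e) b) 1 \<in> ?R" by (intro poly_in_rational_ring) (auto simp: cR)
      have "d * coeff (P e b) 1 = of_int \<mu> * poly p2 1 + of_int \<nu> * poly (P (\<not> e) b) 1 - x * x * poly p2 x"
        using eq[of b] coeff_0 by (simp add: p1 p2 d_def algebra_simps)
      also have "\<dots> \<in> ?R" using p2R oR zx by blast
      finally show ?thesis by (simp add: f)
    qed
    then have fi: "d * f i0 \<in> ?R" "d * f i1 \<in> ?R" by (simp_all add: i0_def i1_def)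
    have "d * f i \<in> ?R" if "i \<in> I" for i
    proof (cases "i = i0 \<or> i = i1")
      case False
      then show ?thesis using rational_ring.var[of i "I - {i1}" z] that dR by (auto simp: z_def)
    qed (use fi in auto)
    then show False using no_dependence[OF i01(2) d0 dR] by blast
  qed
qed

lemma lattice_point_on_arc:
  assumes "v \<in> S" "0 \<le> x" "x \<le> 1"
  shows "v + curve (P e) x \<in> S \<longleftrightarrow> x = 0 \<or> x = 1"
proof
  assume "v + curve (P e) x \<in> S"
  then have "curve (P e) x \<in> S" using lattice_diff[of "v + curve (P e) x" v] assms(1) by simp
  then show "x = 0 \<or> x = 1" using no_interior_lattice_point[of x e] assms(2,3) by force
next
  assume "x = 0 \<or> x = 1"
  then show "v + curve (P e) x \<in> S" using assms(1) lattice_add[OF assms(1) lattice_curve_1, of e] by auto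
qed

text \<open>The norm of the continuous difference quotient has a positive minimum on the square: it
  is nonzero off the diagonal by injectivity and on the diagonal by \<open>immersed\<close>.\<close>

lemma curve_bilipschitz:
  "\<exists>c>0. \<forall>e x y. 0 \<le> x \<longrightarrow> x \<le> 1 \<longrightarrow> 0 \<le> y \<longrightarrow> y \<le> 1 \<longrightarrow>
     c * \<bar>x - y\<bar> \<le> dist (curve (P e) x) (curve (P e) y)"
proof -
  have "\<exists>c>0. \<forall>x y. 0 \<le> x \<longrightarrow> x \<le> 1 \<longrightarrow> 0 \<le> y \<longrightarrow> y \<le> 1 \<longrightarrow>
     c * \<bar>x - y\<bar> \<le> dist (curve (P e) x) (curve (P e) y)" for e
  proof -
    have "\<exists>g. continuous_on UNIV g \<and> (\<forall>x y. poly (P e b) x - poly (P e b) y = (x - y) * g (x, y)) \<and>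
       (\<forall>x. g (x, x) = poly (pderiv (P e b)) x)" for b by (rule poly_difference_quotient)
    then obtain g where g: "\<And>b. continuous_on UNIV (g b)"
      "\<And>b x y. poly (P e b) x - poly (P e b) y = (x - y) * g b (x, y)"
      "\<And>b x. g b (x, x) = poly (pderiv (P e b)) x" by metis
    define h where "h z = norm (g False z, g True z)" for z
    have dist_h: "dist (curve (P e) x) (curve (P e) y) = \<bar>x - y\<bar> * h (x, y)" for x y
    proof -
      have "curve (P e) x - curve (P e) y = (x - y) *\<^sub>R (g False (x, y), g True (x, y))"
        by (simp add: curve_def g(2))
      then show ?thesis by (simp only: dist_norm h_def norm_scaleR)
    qed
    have "continuous_on ({0..1} \<times> {0..1}) h"
      unfolding h_def by (intro continuous_intros continuous_on_subset[OF g(1)]) auto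
    moreover have "compact ({0..1::real} \<times> {0..1::real})" by (intro compact_Times) auto
    ultimately obtain z where z: "z \<in> {0..1} \<times> {0..1}" "\<And>w. w \<in> {0..1} \<times> {0..1} \<Longrightarrow> h z \<le> h w"
      using continuous_attains_inf[of "{0..1::real} \<times> {0..1::real}" h] by auto
    obtain x y where xy: "z = (x, y)" "0 \<le> x" "x \<le> 1" "0 \<le> y" "y \<le> 1" using z(1) by (cases z) auto
    have "h z \<noteq> 0"
    proof (cases "x = y")
      case True
      have "\<not> (g False z = 0 \<and> g True z = 0)"
      proof
        assume "g False z = 0 \<and> g True z = 0"
        then have "poly (pderiv (P e b)) x = 0" for b using g(3)[of b x] xy True by (cases b) auto
        then show False using immersed[of x e] xy by blast
      qed
      then show ?thesis by (auto simp: h_def norm_eq_zero prod_eq_iff)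
    next
      case False
      then have "dist (curve (P e) x) (curve (P e) y) \<noteq> 0" using inj_onD[OF inj[of e], of x y] xy by auto
      then show ?thesis using dist_h xy by auto
    qed
    then have "h z > 0" by (auto simp: h_def)
    moreover have "h z * \<bar>x - y\<bar> \<le> dist (curve (P e) x) (curve (P e) y)"
      if "0 \<le> x" "x \<le> 1" "0 \<le> y" "y \<le> 1" for x y
      unfolding dist_h using z(2)[of "(x, y)"] that by (simp add: mult.commute[of "h z"] mult_left_mono)
    ultimately show ?thesis by blast
  qed
  then obtain c where c: "\<And>e. c e > 0" "\<And>e x y. 0 \<le> x \<Longrightarrow> x \<le> 1 \<Longrightarrow> 0 \<le> y \<Longrightarrow> y \<le> 1 \<Longrightarrow>
     c e * \<bar>x - y\<bar> \<le> dist (curve (P e) x) (curve (P e) y)" by metis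
  define c0 where "c0 = min (c False) (c True)"
  have "c0 \<le> c e" for e by (cases e) (auto simp: c0_def)
  then have "c0 * \<bar>x - y\<bar> \<le> c e * \<bar>x - y\<bar>" for e x y by (intro mult_right_mono) auto
  moreover have "c0 > 0" using c(1) by (simp add: c0_def)
  ultimately show ?thesis using c(2) order_trans by blast
qed

end

section \<open>Specialisation of the coefficients\<close>

text \<open>The degree bound is uniform in \<open>x\<close>, so the value at 1 is a sum over a fixed
  finite range.\<close>

definition rational_polynomial_family :: "'i set \<Rightarrow> (('i \<Rightarrow> real) \<Rightarrow> real poly) \<Rightarrow> bool" where
  "rational_polynomial_family I p \<longleftrightarrow>
     (\<exists>D. \<forall>x. degree (p x) \<le> D) \<and> (\<forall>n. rational_polynomial_function I (\<lambda>x. coeff (p x) n))"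

lemma rational_polynomial_family_poly_1:
  assumes "rational_polynomial_family I p"
  shows "rational_polynomial_function I (\<lambda>x. poly (p x) 1)"
proof -
  obtain D where D: "\<And>x. degree (p x) \<le> D" using assms by (auto simp: rational_polynomial_family_def)
  have "poly (p x) 1 = (\<Sum>i\<le>D. coeff (p x) i)" for x
    unfolding poly_altdef using D[of x]
    by (simp, intro sum.mono_neutral_left) (auto simp: coeff_eq_0)
  moreover have "rational_polynomial_function I (\<lambda>x. \<Sum>i\<le>D. coeff (p x) i)"
    using assms by (intro rpf_sum) (auto simp: rational_polynomial_family_def)
  ultimately show ?thesis by simp
qed

lemma rational_polynomial_family_1: "rational_polynomial_family I (\<lambda>x. 1)"
  unfolding rational_polynomial_family_def by (auto simp: coeff_1 intro!: exI[of _ 0])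

lemma rational_polynomial_family_mult:
  assumes "rational_polynomial_family I p" "rational_polynomial_family I q"
  shows "rational_polynomial_family I (\<lambda>x. p x * q x)"
proof -
  obtain D D' where "\<And>x. degree (p x) \<le> D" "\<And>x. degree (q x) \<le> D'"
    using assms by (auto simp: rational_polynomial_family_def)
  then have "degree (p x * q x) \<le> D + D'" for x
    using degree_mult_le[of "p x" "q x"] add_mono order_trans by blast
  then show ?thesis
    using assms unfolding rational_polynomial_family_def coeff_mult by (auto intro!: rpf_sum rpf_mult)
qed

lemma rational_polynomial_family_pderiv:
  assumes "rational_polynomial_family I p"
  shows "rational_polynomial_family I (\<lambda>x. pderiv (p x))"
proof -
  obtain D where "\<And>x. degree (p x) \<le> D" using assms by (auto simp: rational_polynomial_family_def)
  then have "degree (pderiv (p x)) \<le> D" for x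
    using diff_le_self[of "degree (p x)" 1] order_trans unfolding degree_pderiv by blast
  then show ?thesis
    using assms unfolding rational_polynomial_family_def coeff_pderiv by (auto intro!: rpf_mult simp del: of_nat_Suc)
qed

lemma rational_polynomial_family_antideriv:
  assumes "rational_polynomial_family I p"
  shows "rational_polynomial_family I (\<lambda>x. antideriv (p x))"
proof -
  obtain D where D: "\<And>x. degree (p x) \<le> D" using assms by (auto simp: rational_polynomial_family_def)
  have "degree (antideriv (p x)) \<le> Suc D" for x
    by (intro degree_le) (use D[of x] in \<open>auto simp: coeff_antideriv intro!: coeff_eq_0\<close>)
  moreover have "rational_polynomial_function I (\<lambda>x. coeff (antideriv (p x)) n)" for n
    using assms by (cases "n = 0")
      (auto simp: rational_polynomial_family_def coeff_antideriv divide_inverse intro!: rpf_mult simp del: of_nat_Suc)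
  ultimately show ?thesis unfolding rational_polynomial_family_def by blast
qed

lemma rational_polynomial_family_edge_poly:
  assumes "\<And>b. rational_polynomial_family I (\<lambda>x. A x b)"
  shows "rational_polynomial_family I (\<lambda>x. edge_poly (A x) w)"
  by (induction w)
    (auto intro!: assms rational_polynomial_family_1 rational_polynomial_family_antideriv
      rational_polynomial_family_mult rational_polynomial_family_pderiv)

definition rational_series :: "'i set \<Rightarrow> (('i \<Rightarrow> real) \<Rightarrow> word_series) \<Rightarrow> bool" where
  "rational_series I R \<longleftrightarrow> (\<forall>w. rational_polynomial_function I (\<lambda>x. word_coeff (R x) w))"

lemma rational_series_1: "rational_series I (\<lambda>x. 1)"
  by (auto simp: rational_series_def word_coeff_one)

lemma rational_series_mult: "rational_series I R \<Longrightarrow> rational_series I Q \<Longrightarrow> rational_series I (\<lambda>x. R x * Q x)"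
  by (auto simp: rational_series_def word_coeff_mult conv_sum intro!: rpf_sum rpf_mult)

lemma rational_series_power: "rational_series I R \<Longrightarrow> rational_series I (\<lambda>x. R x ^ n)"
  by (induction n) (auto intro: rational_series_1 rational_series_mult)

lemma rational_series_inverse:
  assumes "rational_series I R"
  shows "rational_series I (\<lambda>x. series_inverse (R x))"
proof -
  have "rational_polynomial_function I (\<lambda>x. conv_inverse (word_coeff (R x)) w)" for w
  proof (induction w rule: length_induct)
    case (1 w)
    show ?case
    proof (cases w)
      case (Cons b u)
      have "rational_polynomial_function I
          (\<lambda>x. \<Sum>i\<le>length u. word_coeff (R x) (b # take i u) * conv_inverse (word_coeff (R x)) (drop i u))"
        using assms 1 Cons by (intro rpf_sum rpf_mult) (auto simp: rational_series_def)
      then show ?thesis using Cons by (auto intro: rpf_uminus)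
    qed auto
  qed
  then show ?thesis by (simp add: rational_series_def series_inverse_def)
qed

lemma rational_series_word_value:
  assumes "\<And>e. rational_series I (\<lambda>x. E x e)"
  shows "rational_series I (\<lambda>x. word_value (E x) L)"
proof (induction L)
  case (Cons p L)
  obtain b e where p: "p = (b, e)" by (cases p)
  have "rational_series I (\<lambda>x. zpower (E x b) e)"
    unfolding zpower_def using rational_series_power[OF assms, of b "nat e"]
      rational_series_power[OF rational_series_inverse[OF assms], of b "nat (- e)"]
    by (cases "0 \<le> e") simp_all
  then show ?case using Cons by (simp add: p rational_series_mult)
qed (simp add: rational_series_1)

text \<open>Each \<open>transport\<close> coefficient is a finite sum, hence a rational polynomial
  in the coefficients of the curves. Inertness prescribes the value 0 or 1 for it, and by
  independence it keeps that value everywhere.\<close>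

lemma rational_series_inert:
  assumes "algebraically_independent_rat I f" "rational_series I R" "inert (R f)"
  shows "inert (R x)"
proof -
  have "transport (R x) k d = transport 1 k d" for k d
  proof -
    have "rational_polynomial_function I (\<lambda>x. word_coeff (R x) w * field_coeff k w)" for w
    proof (intro rpf_mult)
      have "field_coeff k w = real (\<Prod>i<length w. k + weight (drop (Suc i) w))" for w
        by (induction w) (simp_all add: prod.lessThan_Suc_shift del: prod.lessThan_Suc)
      then show "rational_polynomial_function I (\<lambda>x. field_coeff k w)"
        using rpf_of_nat by metis
    qed (use assms(2) in \<open>auto simp: rational_series_def\<close>)
    then have "rational_polynomial_function I (\<lambda>x. transport (R x) k d - transport 1 k d)"
      unfolding transport_def[of "R _"] transport_one by (intro rpf_diff rpf_sum) (cases "d = 0"; simp add: rpf_0 rpf_1)+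
    moreover have "transport (R f) k d - transport 1 k d = 0" using assms(3) by (simp add: inert_def)
    ultimately show ?thesis using rpf_vanishes[OF assms(1), of "\<lambda>x. transport (R x) k d - transport 1 k d" x] by simp
  qed
  then show ?thesis by (auto simp: inert_def)
qed

lemma edge_poly_straight:
  "edge_poly (\<lambda>b. if b = c then monom s 1 else 0) w =
     (if set w \<subseteq> {c} then monom (s ^ length w / fact (length w)) (length w) else 0)"
proof (induction w)
  case (Cons b w)
  have "antideriv (monom r n) = monom (r / real (Suc n)) (Suc n)" for r n
    by (rule poly_eqI) (auto simp: coeff_antideriv)
  moreover have "antideriv 0 = 0" by (rule poly_eqI) (simp add: coeff_antideriv)
  ultimately show ?case using Cons
    by (auto simp: pderiv_monom mult_monom field_simps)
qed (simp add: monom_0 one_pCons)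

lemma edge_series_straight: "edge_series (\<lambda>b. if b = c then monom s 1 else 0) 1 = exp_series c s"
  by (rule word_series_eqI) (simp add: word_coeff_edge_series word_coeff_exp_series edge_poly_straight poly_monom)

context generic_curves
begin

definition specialize :: "(nat \<times> nat \<Rightarrow> real) \<Rightarrow> bool \<Rightarrow> bool \<Rightarrow> real poly" where
  "specialize x e b = (\<Sum>k = 1..degree (P e b). monom (x (component_index e b, k)) k)"

lemma coeff_specialize:
  "coeff (specialize x e b) n = (if 1 \<le> n \<and> n \<le> degree (P e b) then x (component_index e b, n) else 0)"
  by (auto simp: specialize_def coeff_sum)

lemma specialize_generic: "specialize f e = P e"
proof (intro ext poly_eqI)
  fix b n
  show "coeff (specialize f e b) n = coeff (P e b) n"
    using coeff_0[of e b] by (cases "n = 0") (auto simp: coeff_specialize f not_le coeff_eq_0)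
qed

lemma rational_polynomial_family_specialize: "rational_polynomial_family I (\<lambda>x. specialize x e b)"
proof -
  have "degree (specialize x e b) \<le> degree (P e b)" for x
    by (rule degree_le) (simp add: coeff_specialize)
  moreover have "rational_polynomial_function I (\<lambda>x. coeff (specialize x e b) n)" for n
    unfolding coeff_specialize by (cases "1 \<le> n \<and> n \<le> degree (P e b)") (simp_all only: rpf_var rpf_0 in_I simp_thms if_True if_False)
  ultimately show ?thesis unfolding rational_polynomial_family_def by blast
qed

lemma inert_specialize:
  assumes "inert (word_value (\<lambda>e. edge_series (P e) 1) L)"
  shows "inert (word_value (\<lambda>e. edge_series (specialize x e) 1) L)"
proof (rule rational_series_inert[OF independent, where R = "\<lambda>x. word_value (\<lambda>e. edge_series (specialize x e) 1) L"])
  show "rational_series I (\<lambda>x. word_value (\<lambda>e. edge_series (specialize x e) 1) L)"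
    by (intro rational_series_word_value)
      (auto simp: rational_series_def word_coeff_edge_series
        intro!: rational_polynomial_family_poly_1 rational_polynomial_family_edge_poly
          rational_polynomial_family_specialize)
  show "inert (word_value (\<lambda>e. edge_series (specialize f e) 1) L)"
    using assms by (simp add: specialize_generic)
qed

text \<open>Keeping one linear coefficient and setting the others to 0 straightens the edge into an
  axis-parallel segment; \<open>P e c \<noteq> 0\<close> guarantees that this coefficient is
  available.\<close>

lemma edge_series_specialize:
  assumes "\<And>k. 2 \<le> k \<Longrightarrow> x (component_index e c, k) = 0" "\<And>k. x (component_index e (\<not> c), k) = 0" "P e c \<noteq> 0"
  shows "edge_series (specialize x e) 1 = exp_series c (x (component_index e c, 1))"
proof -
  have "specialize x e = (\<lambda>b. if b = c then monom (x (component_index e c, 1)) 1 else 0)"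
  proof (intro ext poly_eqI)
    fix b n
    have "b \<noteq> c \<Longrightarrow> b = (\<not> c)" by auto
    then show "coeff (specialize x e b) n = coeff (if b = c then monom (x (component_index e c, 1)) 1 else 0) n"
      using assms degree_pos[OF assms(3)] by (cases "n \<le> 1") (auto simp: coeff_specialize le_Suc_eq)
  qed
  then show ?thesis using edge_series_straight by simp
qed

text \<open>Decides which edge becomes horizontal and which vertical. In the 2 by 2 pattern of
  components no row and no column vanishes, so one of the two diagonals has no zero.\<close>

lemma transverse_components: "\<exists>e. P e False \<noteq> 0 \<and> P (\<not> e) True \<noteq> 0"
proof -
  have "P e False \<noteq> 0 \<or> P e True \<noteq> 0" for e using nonzero_component[of e] by (metis (full_types))
  then show ?thesis using not_collinear[of False] not_collinear[of True] by (metis (full_types))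
qed

theorem inert_edge_word_trivial:
  assumes "inert (word_value (\<lambda>e. edge_series (P e) 1) L)"
  shows "word_value (\<lambda>e. edge_series (P e) 1) L = 1"
proof -
  obtain e0 where e0: "P e0 False \<noteq> 0" "P (\<not> e0) True \<noteq> 0" using transverse_components by blast
  show ?thesis
  proof (rule inert_word_trivial[of "\<lambda>e. edge_series (P e) 1" e0])
    fix e :: bool and n :: int assume n: "n \<noteq> 0"
    obtain c where c: "P e c \<noteq> 0" using nonzero_component by blast
    define x where "x i = (if i = (component_index e c, 1 :: nat) then 1 else 0 :: real)" for i
    show "\<not> inert (zpower (edge_series (P e) 1) n)"
    proof
      assume "inert (zpower (edge_series (P e) 1) n)"
      then have "inert (word_value (\<lambda>e. edge_series (P e) 1) [(e, n)])" by simp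
      then have "inert (word_value (\<lambda>e. edge_series (specialize x e) 1) [(e, n)])" by (rule inert_specialize)
      then have "inert (zpower (edge_series (specialize x e) 1) n)" by simp
      also have "edge_series (specialize x e) 1 = exp_series c 1"
        using edge_series_specialize[OF _ _ c, of x] by (simp add: x_def)
      \<comment> \<open>The lowest nonconstant coefficient already tells a flow at nonzero time from
        the identity.\<close>
      finally have "transport (exp_series c (of_int n)) 1 (letter_weight c) = 0"
        by (simp add: exp_series_zpower inert_def transport_one)
      then show False using n by (simp add: transport_exp_series letter_weight_def split: if_splits)
    qed
  next
    fix ps :: "(int \<times> int) list" assume ps: "ps \<noteq> []" "\<forall>(m, n)\<in>set ps. m \<noteq> 0 \<and> n \<noteq> 0"
    show "\<not> inert (word_value (\<lambda>e. edge_series (P e) 1) (interleave e0 ps))"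
    proof
      assume inert: "inert (word_value (\<lambda>e. edge_series (P e) 1) (interleave e0 ps))"
      show False
      proof (rule free_flows[OF ps])
        fix s t :: real
        define x where "x i = (if i = (component_index e0 False, 1 :: nat) then s
          else if i = (component_index (\<not> e0) True, 1) then t else 0)" for i
        have "edge_series (specialize x e0) 1 = exp_series False s"
          using edge_series_specialize[OF _ _ e0(1), of x] by (simp add: x_def)
        moreover have "edge_series (specialize x (\<not> e0)) 1 = exp_series True t"
          using edge_series_specialize[OF _ _ e0(2), of x] by (simp add: x_def)
        ultimately have "(\<lambda>e. edge_series (specialize x e) 1) = (\<lambda>b. if b = e0 then exp_series False s else exp_series True t)"
          by (intro ext) (metis (full_types))
        then show "inert (word_value (\<lambda>b. if b = e0 then exp_series False s else exp_series True t) (interleave e0 ps))"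
          using inert_specialize[OF inert, of x] by simp
      qed
    qed
  qed (use assms in auto)
qed

end

section \<open>Edge families\<close>

text \<open>The lower bound makes the inverse Lipschitz with constant \<open>1 / c\<close>, hence
  continuous on the image.\<close>

lemma bilipschitz_imp_open_arc:
  assumes c: "c > 0" and lower: "\<And>x y. x \<in> {0<..<1} \<Longrightarrow> y \<in> {0<..<1} \<Longrightarrow> c * dist x y \<le> dist (h x) (h y)"
    and upper: "\<And>x y. x \<in> {0<..<1} \<Longrightarrow> y \<in> {0<..<1} \<Longrightarrow> dist (h x) (h y) \<le> K * dist x y"
  shows "lipschitz_open_arc h"
proof -
  let ?U = "{0<..<1} :: real set"
  have "c * dist (1/3) (2/3::real) \<le> K * dist (1/3) (2/3::real)"
    using order_trans[OF lower[of "1/3" "2/3"] upper[of "1/3" "2/3"]] by simp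
  then have "c \<le> K" by (simp add: dist_real_def)
  then have K: "K > 0" using c by linarith
  have inj: "inj_on h ?U"
  proof (rule inj_onI)
    fix x y assume "x \<in> ?U" "y \<in> ?U" "h x = h y"
    then have "c * dist x y \<le> 0" using lower[of x y] by simp
    then show "x = y" using c by (simp add: mult_le_0_iff)
  qed
  have lip: "K-lipschitz_on ?U h" using upper K by (intro lipschitz_onI) auto
  define g where "g = the_inv_into ?U h"
  have g: "g (h x) = x" if "x \<in> ?U" for x using inj that by (simp add: g_def the_inv_into_f_f)
  have "(1 / c)-lipschitz_on (h ` ?U) g"
  proof (rule lipschitz_onI)
    fix p q assume "p \<in> h ` ?U" "q \<in> h ` ?U"
    then obtain x y where xy: "x \<in> ?U" "y \<in> ?U" "p = h x" "q = h y" by blast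
    then show "dist (g p) (g q) \<le> 1 / c * dist p q"
      using lower[OF xy(1,2)] c by (simp add: g field_simps)
  qed (use c in auto)
  then have "homeomorphic_maps (top_of_set ?U) (top_of_set (h ` ?U)) h g"
    unfolding homeomorphic_maps_def
    using lipschitz_on_continuous_on[OF lip] lipschitz_on_continuous_on[of "1 / c" "h ` ?U" g] g
    by (auto simp: continuous_map_in_subtopology)
  then have "embedding_map (top_of_set ?U) euclidean h"
    unfolding embedding_map_def homeomorphic_map_maps by auto
  moreover have "locally_bilipschitz_on ?U h"
    unfolding locally_bilipschitz_on_def using c K lower upper by (intro ballI exI[of _ 1] conjI exI[of _ c] exI[of _ K]) auto
  ultimately show ?thesis unfolding lipschitz_open_arc_def using lip by blast
qed

context generic_curves
begin

lemma lipschitz_open_arc_edge: "lipschitz_open_arc (\<lambda>x. v + curve (P e) x)"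
proof -
  obtain c where c: "c > 0" "\<And>e x y. 0 \<le> x \<Longrightarrow> x \<le> 1 \<Longrightarrow> 0 \<le> y \<Longrightarrow> y \<le> 1 \<Longrightarrow>
     c * \<bar>x - y\<bar> \<le> dist (curve (P e) x) (curve (P e) y)" using curve_bilipschitz by metis
  have "\<exists>K. \<forall>x y. 0 \<le> x \<longrightarrow> x \<le> 1 \<longrightarrow> 0 \<le> y \<longrightarrow> y \<le> 1 \<longrightarrow> \<bar>poly (P e b) x - poly (P e b) y\<bar> \<le> K * \<bar>x - y\<bar>" for b
    by (rule poly_lipschitz_unit_interval)
  then obtain K where K: "\<And>b x y. 0 \<le> x \<Longrightarrow> x \<le> 1 \<Longrightarrow> 0 \<le> y \<Longrightarrow> y \<le> 1 \<Longrightarrow>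
      \<bar>poly (P e b) x - poly (P e b) y\<bar> \<le> K b * \<bar>x - y\<bar>" by metis
  show ?thesis
  proof (rule bilipschitz_imp_open_arc[OF c(1), where K = "K False + K True"])
    fix x y :: real assume xy: "x \<in> {0<..<1}" "y \<in> {0<..<1}"
    then show "c * dist x y \<le> dist (v + curve (P e) x) (v + curve (P e) y)"
      using c(2) by (simp add: dist_real_def)
    have "dist (curve (P e) x) (curve (P e) y) \<le> \<bar>poly (P e False) x - poly (P e False) y\<bar> + \<bar>poly (P e True) x - poly (P e True) y\<bar>"
      using norm_Pair_le[of "poly (P e False) x - poly (P e False) y" "poly (P e True) x - poly (P e True) y"]
      by (simp add: curve_def dist_norm)
    also have "\<dots> \<le> (K False + K True) * \<bar>x - y\<bar>"
      using K[of x y False] K[of x y True] xy by (simp add: distrib_right)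
    finally show "dist (v + curve (P e) x) (v + curve (P e) y) \<le> (K False + K True) * dist x y"
      by (simp add: dist_real_def)
  qed
qed

text \<open>Injectivity makes different indices denote different edges, the only ones whose
  intersections are controlled by \<open>edges_meet_in_endpoints\<close>.\<close>

definition edge_family :: "(bool \<times> real \<times> real) set \<Rightarrow> (real \<times> real) set \<Rightarrow> bool" where
  "edge_family ED \<Gamma> \<longleftrightarrow> finite ED \<and> (\<forall>(e, v)\<in>ED. v \<in> S) \<and>
     inj_on (\<lambda>(e, v). arc_at (P e) v) ED \<and> \<Gamma> = (\<Union>(e, v)\<in>ED. arc_at (P e) v)"

lemma edge_family_exists:
  assumes "finite \<E>" "\<E> \<subseteq> edges (curve (P False)) (curve (P True))"
  shows "\<exists>ED. edge_family ED (\<Union>\<E>)"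
proof -
  have "\<forall>E\<in>\<E>. \<exists>p. snd p \<in> S \<and> E = arc_at (P (fst p)) (snd p)"
    using assms(2) unfolding edges_eq by (auto; blast)
  then obtain g where g: "\<And>E. E \<in> \<E> \<Longrightarrow> snd (g E) \<in> S \<and> E = arc_at (P (fst (g E))) (snd (g E))" by metis
  have "inj_on (\<lambda>(e, v). arc_at (P e) v) (g ` \<E>)"
    using g by (auto simp: inj_on_def split_def)
  moreover have "\<Union>\<E> = (\<Union>(e, v)\<in>g ` \<E>. arc_at (P e) v)"
    using g by (auto simp: split_def)
  moreover have "\<forall>(e, v)\<in>g ` \<E>. v \<in> S" using g by (auto simp: split_def)
  ultimately show ?thesis using assms(1) unfolding edge_family_def by (intro exI[of _ "g ` \<E>"]) simp
qed

lemma edge_family_meet: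
  assumes "edge_family ED \<Gamma>" "(e, v) \<in> ED" "(e', v') \<in> ED" "(e, v) \<noteq> (e', v')"
  shows "arc_at (P e) v \<inter> arc_at (P e') v' \<subseteq> S"
proof -
  have "arc_at (P e) v \<noteq> arc_at (P e') v'" "v \<in> S" "v' \<in> S"
    using assms by (auto simp: edge_family_def inj_on_def)
  then show ?thesis using arcs_meet(1) by blast
qed

text \<open>Removing the endpoints leaves the open edges. They are disjoint, because different edges
  meet only in lattice points and no lattice point lies inside an edge.\<close>

lemma triangulable_edge_family:
  assumes ED: "edge_family ED \<Gamma>" and nonempty: "\<Gamma> \<noteq> {}"
  shows "lipschitz_triangulable \<Gamma>"
proof -
  have fin: "finite ED" and vS: "\<And>e v. (e, v) \<in> ED \<Longrightarrow> v \<in> S" and \<Gamma>: "\<Gamma> = (\<Union>(e, v)\<in>ED. arc_at (P e) v)"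
    using ED by (auto simp: edge_family_def)
  define arc where "arc p x = snd p + curve (P (fst p)) x" for p :: "bool \<times> real \<times> real" and x
  obtain idx where idx: "bij_betw idx {1..card ED} ED" using ex_bij_betw_nat_finite_1[OF fin] by blast
  define F where "F = (\<lambda>(p, x). arc p x) ` (ED \<times> {0, 1})"
  have arc_at: "arc_at (P (fst p)) (snd p) = arc p ` {0..1}" for p by (simp add: arc_at_def arc_def[abs_def])
  have \<Gamma>_arc: "\<Gamma> = (\<Union>p\<in>ED. arc p ` {0..1})" unfolding \<Gamma> split_def arc_at ..
  have arc_S: "arc p x \<in> S \<longleftrightarrow> x = 0 \<or> x = 1" if "p \<in> ED" "0 \<le> x" "x \<le> 1" for p x
    using lattice_point_on_arc[OF vS that(2,3), of "fst p" "snd p" "fst p"] that(1) by (simp add: arc_def)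
  have disj: "arc p ` {0<..<1} \<inter> arc q ` {0<..<1} = {}" if "p \<in> ED" "q \<in> ED" "p \<noteq> q" for p q
  proof (rule ccontr)
    assume "arc p ` {0<..<1} \<inter> arc q ` {0<..<1} \<noteq> {}"
    then obtain z where "z \<in> arc p ` {0<..<1}" "z \<in> arc q ` {0<..<1}" by blast
    then obtain x y where xy: "0 < x" "x < 1" "0 < y" "y < 1" "z = arc p x" "z = arc q y" by (auto simp: image_iff)
    have "arc p x \<in> arc p ` {0..1}" using xy(1,2) by simp
    moreover have "arc p x \<in> arc q ` {0..1}" using xy(3-6) by (intro image_eqI[of _ _ y]) auto
    ultimately have "arc p x \<in> S"
      using edge_family_meet[OF ED, of "fst p" "snd p" "fst q" "snd q"] that by (auto simp: arc_at)
    then show False using arc_S[OF that(1), of x] xy by simp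
  qed
  have "compact \<Gamma>" unfolding \<Gamma> using fin by (auto intro!: compact_UN compact_arc_at)
  moreover have "finite F" using fin by (simp add: F_def)
  moreover have "F \<subseteq> \<Gamma>" by (auto simp: F_def \<Gamma>_arc)
  moreover have "1 \<le> card ED" using nonempty fin by (auto simp: \<Gamma> Suc_le_eq card_gt_0_iff)
  moreover have "\<forall>i\<in>{1..card ED}. lipschitz_open_arc (arc (idx i))"
    unfolding arc_def[abs_def] by (intro ballI lipschitz_open_arc_edge)
  moreover have "disjoint_family_on (\<lambda>i. arc (idx i) ` {0<..<1}) {1..card ED}"
  proof (unfold disjoint_family_on_def, intro ballI impI)
    fix i j assume ij: "i \<in> {1..card ED}" "j \<in> {1..card ED}" "i \<noteq> j"
    then have "idx i \<in> ED" "idx j \<in> ED" "idx i \<noteq> idx j"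
      using bij_betwE[OF idx] inj_onD[OF bij_betw_imp_inj_on[OF idx]] by blast+
    then show "arc (idx i) ` {0<..<1} \<inter> arc (idx j) ` {0<..<1} = {}" by (rule disj)
  qed
  moreover have "\<Gamma> - F = (\<Union>i\<in>{1..card ED}. arc (idx i) ` {0<..<1})"
  proof -
    have "\<Gamma> - F = (\<Union>p\<in>ED. arc p ` {0<..<1})"
    proof (intro equalityI subsetI)
      fix z assume z: "z \<in> \<Gamma> - F"
      then obtain p x where p: "p \<in> ED" "0 \<le> x" "x \<le> 1" "z = arc p x" by (auto simp: \<Gamma>_arc)
      moreover have "x \<noteq> 0 \<and> x \<noteq> 1"
      proof (rule ccontr)
        assume "\<not> (x \<noteq> 0 \<and> x \<noteq> 1)"
        then have "z \<in> F" using p unfolding F_def by (intro image_eqI[of _ _ "(p, x)"]) auto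
        then show False using z by simp
      qed
      ultimately show "z \<in> (\<Union>p\<in>ED. arc p ` {0<..<1})" by (intro UN_I[of p] image_eqI[of _ _ x]) auto
    next
      fix z assume "z \<in> (\<Union>p\<in>ED. arc p ` {0<..<1})"
      then obtain p x where p: "p \<in> ED" "0 < x" "x < 1" "z = arc p x" by auto
      moreover have "z \<notin> S" using arc_S[OF p(1), of x] p by simp
      moreover have "F \<subseteq> S" using arc_S by (auto simp: F_def)
      moreover have "z \<in> \<Gamma>" unfolding \<Gamma>_arc using p by (intro UN_I[of p] image_eqI[of _ _ x]) auto
      ultimately show "z \<in> \<Gamma> - F" by blast
    qed
    also have "\<dots> = (\<Union>p\<in>idx ` {1..card ED}. arc p ` {0<..<1})" using idx by (simp add: bij_betw_def)
    finally show ?thesis by simp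
  qed
  ultimately show ?thesis
    unfolding lipschitz_triangulable_def by (intro conjI exI[of _ F] exI[of _ "card ED"] exI[of _ "\<lambda>i. arc (idx i)"])
qed

lemma center_in_edge_family_universal:
  assumes ED: "edge_family ED \<Gamma>" and T: "T > 0"
    and meas: "bounded_lebesgue_measurable_on {0..T} (a 1)" "bounded_lebesgue_measurable_on {0..T} (a 2)"
    and path: "abel_path a ` {0..T} \<subseteq> \<Gamma>" and center: "has_center T a"
  shows "all_iterated_integrals_vanish T a"
proof -
  interpret abel_equation T a by unfold_locales (use T meas in auto)
  have inert: "inert (holonomy 0)" by (rule center_imp_inert[OF center])
  obtain c where c: "c > 0" "\<And>e x y. 0 \<le> x \<Longrightarrow> x \<le> 1 \<Longrightarrow> 0 \<le> y \<Longrightarrow> y \<le> 1 \<Longrightarrow>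
     c * \<bar>x - y\<bar> \<le> dist (curve (P e) x) (curve (P e) y)" using curve_bilipschitz by metis
  have vS: "v \<in> S" if "(e, v) \<in> ED" for e v using ED that by (auto simp: edge_family_def)
  interpret abel_path_in_graph T a P ED S c
  proof
    show "\<exists>(e, v)\<in>ED. pos t \<in> arc_at (P e) v" if "0 \<le> t" "t \<le> T" for t
    proof -
      have "abel_path a t \<in> \<Gamma>" using path that by auto
      then have "pos t \<in> \<Gamma>" using abel_path_eq[OF that] by (simp add: pos_def)
      then show ?thesis using ED by (auto simp: edge_family_def split_def)
    qed
    show "pos 0 \<in> S" "pos T \<in> S"
      using lattice_0 inert_imp_closed[OF inert] by (simp_all add: pos_def zero_prod_def)
    show "finite ED" using ED by (simp add: edge_family_def)
    show "v + curve (P e) x \<in> S \<longleftrightarrow> x = 0 \<or> x = 1" if "(e, v) \<in> ED" "0 \<le> x" "x \<le> 1" for e v x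
      using lattice_point_on_arc[OF vS[OF that(1)] that(2,3)] .
    show "arc_at (P e) v \<inter> arc_at (P e') v' \<subseteq> S"
      if "(e, v) \<in> ED" "(e', v') \<in> ED" "(e, v) \<noteq> (e', v')" for e v e' v'
      using edge_family_meet[OF ED that] .
  qed (use c in auto)
  obtain L where "holonomy 0 = word_value (\<lambda>e. edge_series (P e) 1) L" using holonomy_is_word_value by blast
  then have "holonomy 0 = 1" using inert_edge_word_trivial[of L] inert by simp
  then have J: "J 0 w = word_coeff 1 w" for w using word_coeff_holonomy[of 0] by metis
  show ?thesis
    unfolding all_iterated_integrals_vanish_def
  proof (intro allI impI)
    fix ks :: "nat list" assume ks: "ks \<noteq> [] \<and> set ks \<subseteq> {1, 2}"
    \<comment> \<open>A word over \<open>{1, 2}\<close> is recovered as the list of weights of the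
      boolean word that marks its 2s.\<close>
    then have "map letter_weight (map (\<lambda>k. k = 2) ks) = ks"
      by (intro map_idI[THEN trans[OF map_map]]) (auto simp: letter_weight_def)
    then show "iterated_integral T a 0 ks = 0"
      using J[of "map (\<lambda>k. k = 2) ks"] ks by (simp add: J_def word_coeff_one)
  qed
qed

end

theorem proposition2p3:
  fixes P1 P2 Q1 Q2 :: "real poly"
    and A1 A2 :: "real \<Rightarrow> real \<times> real"
    and T :: real
    and \<Gamma> :: "(real \<times> real) set"
  assumes "T > 0"
    and "coeff P1 0 = 0" and "coeff P2 0 = 0" and "coeff Q1 0 = 0" and "coeff Q2 0 = 0"
    and "generic_coefficients [P1, P2, Q1, Q2]"
    and "A1 = poly_curve P1 Q1" and "A2 = poly_curve P2 Q2"
    and "embedding_map (top_of_set {0..1}) euclidean A1"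
    and "embedding_map (top_of_set {0..1}) euclidean A2"
    and "edges_meet_in_endpoints A1 A2"
    and "\<Gamma> \<subseteq> \<Union>(edges A1 A2)"
    and "\<exists>\<E>. finite \<E> \<and> \<E> \<subseteq> edges A1 A2 \<and> \<Gamma> = \<Union>\<E>"
    and "connected \<Gamma>"
    and "(0, 0) \<in> \<Gamma>"
  shows "universal_curve T \<Gamma>"
proof -
  define P where "P e b = (if b then if e then Q2 else Q1 else if e then P2 else P1)" for e b
  define f where "f = (\<lambda>(j, k). coeff ([P1, P2, Q1, Q2] ! j) k)"
  define I where "I = {(j, k). j < length [P1, P2, Q1, Q2] \<and> 1 \<le> k \<and> k \<le> degree ([P1, P2, Q1, Q2] ! j)}"
  have nth: "[P1, P2, Q1, Q2] ! component_index e b = P e b" for e b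
    by (cases e; cases b) (simp_all add: P_def component_index_def numeral_eq_Suc)
  have curves: "curve (P False) = A1" "curve (P True) = A2"
    using assms(7,8) by (auto simp: curve_def[abs_def] P_def poly_curve_def[abs_def])
  have embedded: "embedding_map (top_of_set {0..1}) euclidean (curve (P e))" for e
    using assms(9,10) curves by (cases e) auto
  interpret generic_curves P f I
  proof
    show "coeff (P e b) 0 = 0" for e b using assms(2-5) by (simp add: P_def)
    show "I = {(component_index e b, k) |e b k. 1 \<le> k \<and> k \<le> degree (P e b)}"
    proof (intro equalityI subsetI)
      fix i assume "i \<in> I"
      then obtain j k where i: "i = (j, k)" "j < 4" "1 \<le> k" "k \<le> degree ([P1, P2, Q1, Q2] ! j)" by (auto simp: I_def)
      have "j = component_index (odd j) (2 \<le> j)"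
      proof -
        have "j = 0 \<or> j = 1 \<or> j = 2 \<or> j = 3" using i(2) by linarith
        then show ?thesis by (elim disjE) (simp_all add: component_index_def)
      qed
      then show "i \<in> {(component_index e b, k) |e b k. 1 \<le> k \<and> k \<le> degree (P e b)}"
        using i nth[of "odd j" "2 \<le> j"] by auto
    next
      fix i assume "i \<in> {(component_index e b, k) |e b k. 1 \<le> k \<and> k \<le> degree (P e b)}"
      then show "i \<in> I" by (auto simp: I_def nth) (simp add: component_index_def)
    qed
    show "f (component_index e b, k) = coeff (P e b) k" for e b k by (simp add: f_def nth)
    show "algebraically_independent_rat I f" using assms(6) by (simp only: I_def f_def generic_coefficients_def)
    show "inj_on (curve (P e)) {0..1}" for e
      using embedded[of e] by (auto simp: embedding_map_def homeomorphic_eq_everything_map)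
    show "edges_meet_in_endpoints (curve (P False)) (curve (P True))" using assms(11) curves by simp
  qed
  obtain \<E> where "finite \<E>" "\<E> \<subseteq> edges A1 A2" "\<Gamma> = \<Union>\<E>" using assms(13) by blast
  then obtain ED where ED: "edge_family ED \<Gamma>" using edge_family_exists[of \<E>] curves by auto
  show ?thesis
    unfolding universal_curve_def
    using triangulable_edge_family[OF ED] center_in_edge_family_universal[OF ED assms(1)] assms(14,15) by blast
qed

end
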